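(* Let $p$ be a prime and let $G$ be a nonabelian metacyclic $p$-group generated by two elements $\sigma,\tau$ with defining relations $\sigma^{p^a}=1$, $\tau^{p^b}=\sigma^{p^c}$, $\tau^{-1}\sigma\tau=\sigma^{k}$, where $k=\varepsilon+p^r$, $1\leq c\leq a$, $r\leq\min\{b,c\}$, and $\varepsilon=1$ if $p$ is odd, $\varepsilon=\pm1$ if $p=2$. Let $t\ge 0$ be an integer and let $$1\longrightarrow C_{p^t}\longrightarrow\widetilde G\longrightarrow G\longrightarrow 1$$ be a central extension of $G$ by the cyclic group $C_{p^t}$, i.e. $C_{p^t}\leq Z(\widetilde G)$. Assume $t\leq r$, and assume that the pre-image of $\sigma^{-(k-1)}[\sigma,\tau]=\sigma^{-k}\tau^{-1}\sigma\tau$ in $\widetilde G$, that is, the element $\tilde\sigma^{-k}\tilde\tau^{-1}\tilde\sigma\tilde\tau\in C_{p^t}$ where $\tilde\sigma,\tilde\tau\in\widetilde G$ are pre-images of $\sigma,\tau$, has order $p^t$. Let $p^m=\exp(\widetilde G)$ be the exponent of $\widetilde G$. Let $K$ be a field such that either (i) $\operatorname{char}K=p$, or (ii) $\operatorname{char}K\neq p$, $K$ is infinite, and $K$ contains a primitive $p^m$-th root of unity. Then $K(\widetilde G)$ is rational over $K$.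
   Context: For a field $K$ and a finite group $H$, let $H$ act on the rational function field $K(x(g):g\in H)$ (in $|H|$ independent variables) by $K$-automorphisms via $h\cdot x(g)=x(hg)$ for $h,g\in H$; $K(H)$ denotes the fixed field $K(x(g):g\in H)^H$. A field extension $L/K$ is called rational if $L$ is purely transcendental over $K$. A group is metacyclic if it can be generated by two elements one of which generates a normal subgroup. $C_n$ denotes the cyclic group of order $n$, $Z(\cdot)$ the center, and $[\sigma,\tau]=\sigma^{-1}\tau^{-1}\sigma\tau$. The parameters $a,b,c,r$ are non-negative integers, subject to the usual restrictions from the classification of metacyclic $p$-groups; in particular the presentation is consistent: $\sigma$ has order exactly $p^a$ and $|G|=p^{a+b}$. *)

theory Defs
  imports "HOL-Algebra.Algebra" "HOL-Algebra.Algebraic_Closure_Type" "HOL-Library.Poly_Mapping"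
begin

text \<open>
  Groups are HOL-Algebra records. Fields are subfields of an ambient field \<open>L\<close> which is a type
  \<open>'l :: field\<close>; the library record \<open>ring_of_type_algebra\<close> makes \<open>subfield\<close> and
  \<open>generate_field\<close> available for such a type.
\<close>

section \<open>Groups\<close>

definition metacyclic :: "('a, 'b) monoid_scheme \<Rightarrow> bool" where
  "metacyclic G \<longleftrightarrow> group G \<and>
     (\<exists>u\<in>carrier G. \<exists>v\<in>carrier G. generate G {u, v} = carrier G \<and> generate G {u} \<lhd> G)"

definition group_center :: "('a, 'b) monoid_scheme \<Rightarrow> 'a set" where
  "group_center G = {z \<in> carrier G. \<forall>g\<in>carrier G. z \<otimes>\<^bsub>G\<^esub> g = g \<otimes>\<^bsub>G\<^esub> z}"

text \<open>Meaningful for groups of finite exponent, in particular for finite groups.\<close>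

definition group_exponent :: "('a, 'b) monoid_scheme \<Rightarrow> nat" where
  "group_exponent G = (LEAST n. 0 < n \<and> (\<forall>g\<in>carrier G. g [^]\<^bsub>G\<^esub> n = \<one>\<^bsub>G\<^esub>))"

text \<open>
  A central extension \<open>1 \<longrightarrow> C \<longrightarrow> E \<longrightarrow> G \<longrightarrow> 1\<close> with maps \<open>\<iota>\<close> and \<open>\<pi>\<close>. The library's
  \<open>short_exact_sequence\<close> is not used because it forces all groups to have the same element type.
\<close>

definition central_extension ::
  "('c, 'd) monoid_scheme \<Rightarrow> ('e, 'f) monoid_scheme \<Rightarrow> ('a, 'b) monoid_scheme
     \<Rightarrow> ('c \<Rightarrow> 'e) \<Rightarrow> ('e \<Rightarrow> 'a) \<Rightarrow> bool" where
  "central_extension C E G \<iota> \<pi> \<longleftrightarrow>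
     group C \<and> group E \<and> group G \<and> \<iota> \<in> mon C E \<and> \<pi> \<in> epi E G \<and>
     kernel E G \<pi> = \<iota> ` carrier C \<and> \<iota> ` carrier C \<subseteq> group_center E"

section \<open>Fields\<close>

definition field_adjoin :: "'l::field set \<Rightarrow> 'l set \<Rightarrow> 'l set" where
  "field_adjoin K S = generate_field (ring_of_type_algebra :: 'l ring) (K \<union> S)"

definition primitive_root_of_unity :: "nat \<Rightarrow> 'l::field \<Rightarrow> bool" where
  "primitive_root_of_unity n z \<longleftrightarrow> z ^ n = 1 \<and> (\<forall>j. 0 < j \<and> j < n \<longrightarrow> z ^ j \<noteq> 1)"

text \<open>
  A polynomial in variables indexed by \<open>'i\<close> is a finitely supported map from exponent vectors
  \<open>'i \<Rightarrow>\<^sub>0 nat\<close> to coefficients; \<open>poly_at x P\<close> is its value at the family \<open>x\<close>.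
\<close>

definition poly_at :: "('i \<Rightarrow> 'l) \<Rightarrow> (('i \<Rightarrow>\<^sub>0 nat) \<Rightarrow>\<^sub>0 'l) \<Rightarrow> 'l::field" where
  "poly_at x P = (\<Sum>e\<in>Poly_Mapping.keys P. Poly_Mapping.lookup P e * (\<Prod>i\<in>Poly_Mapping.keys e. x i ^ Poly_Mapping.lookup e i))"

definition algebraically_independent :: "'l::field set \<Rightarrow> 'i set \<Rightarrow> ('i \<Rightarrow> 'l) \<Rightarrow> bool" where
  "algebraically_independent K I x \<longleftrightarrow>
     (\<forall>P. (\<forall>e. Poly_Mapping.lookup P e \<in> K) \<and> (\<forall>e\<in>Poly_Mapping.keys P. Poly_Mapping.keys e \<subseteq> I) \<and> poly_at x P = 0 \<longrightarrow> P = 0)"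

definition rational_over :: "'l::field set \<Rightarrow> 'l set \<Rightarrow> bool" where
  "rational_over K F \<longleftrightarrow>
     (\<exists>S. algebraically_independent K S (\<lambda>s. s) \<and> field_adjoin K S = F)"

section \<open>The rational function field with the regular action\<close>

text \<open>
  The type \<open>'l\<close> is the rational function field over its subfield \<open>K\<close> in the independent
  variables \<open>x g\<close>, \<open>g \<in> carrier H\<close>. This determines \<open>'l\<close> up to a \<open>K\<close>-isomorphism
  matching the variables.
\<close>

definition rational_function_field ::
  "'l::field set \<Rightarrow> ('a, 'b) monoid_scheme \<Rightarrow> ('a \<Rightarrow> 'l) \<Rightarrow> bool" where
  "rational_function_field K H x \<longleftrightarrow>
     subfield K (ring_of_type_algebra :: 'l ring) \<and>
     algebraically_independent K (carrier H) x \<and>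
     field_adjoin K (x ` carrier H) = UNIV"

definition automorphism_over :: "'l::field set \<Rightarrow> ('l \<Rightarrow> 'l) \<Rightarrow> bool" where
  "automorphism_over K f \<longleftrightarrow>
     bij f \<and> f 1 = 1 \<and> (\<forall>u v. f (u + v) = f u + f v) \<and> (\<forall>u v. f (u * v) = f u * f v) \<and>
     (\<forall>u\<in>K. f u = u)"

text \<open>Given \<open>rational_function_field K H x\<close>, these conditions determine \<open>\<rho> h\<close> for \<open>h \<in> carrier H\<close>.\<close>

definition regular_action ::
  "'l::field set \<Rightarrow> ('a, 'b) monoid_scheme \<Rightarrow> ('a \<Rightarrow> 'l) \<Rightarrow> ('a \<Rightarrow> 'l \<Rightarrow> 'l) \<Rightarrow> bool" where
  "regular_action K H x \<rho> \<longleftrightarrow>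
     group_action H UNIV \<rho> \<and>
     (\<forall>h\<in>carrier H. automorphism_over K (\<rho> h)) \<and>
     (\<forall>h\<in>carrier H. \<forall>g\<in>carrier H. \<rho> h (x g) = x (h \<otimes>\<^bsub>H\<^esub> g))"

definition fixed_field :: "('a, 'b) monoid_scheme \<Rightarrow> ('a \<Rightarrow> 'l \<Rightarrow> 'l) \<Rightarrow> 'l set" where
  "fixed_field H \<rho> = {u. \<forall>h\<in>carrier H. \<rho> h u = u}"

end

(*
A field of transcendence degree d that is generated by d elements is purely transcendental, so it is
enough to generate the fixed field by |E| elements.

The preimage A of the cyclic normal subgroup generated by sigma is central-by-cyclic, hence abelian,
and E is the union of the cosets A tau^l, 0 <= l < N = p^n.

In characteristic p the group acts unipotently on the span V of the variables. This gives a basis y_i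
of V such that h y_i - y_i always lies in the span of the earlier y_j, and in each such step an
invariant polynomial of minimal degree in y_i generates the fixed field over the previous one.

In characteristic different from p, joint eigenvectors of A and tau generate the field of A-invariants
by a Kummer generator v (tau v = zeta v, zeta a primitive N-th root of unity), elements permuted by
tau, and the monomials with exponents in a sublattice M of a permutation lattice P, where tau acts on
these monomials up to constants. The elements permuted by tau can be replaced by tau-invariant ones
with the help of v. A vector of P whose image under tau^(p^j) - 1 lies in M can be changed by a unit
vector so as to lie in M. This vanishing of cohomology makes the image of tau^(p^(j-1)) - 1 on M
generated, over that of tau^(p^j) - 1, by as many elements as P has orbits of length at least p^j. By
Hilbert 90 in the explicit form given by v, the monomials in these images are generated level by level
by p^j invariants for each such orbit, which absorb p^(j-1) of the invariants found before. The counts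
add up to |E|.
*)
theory Submission
  imports Defs "HOL-Library.Function_Algebras" "HOL-Combinatorics.Permutations"
begin

section \<open>Subfields of a field type\<close>

text \<open>The invariant monomials form the function field of a torus whose character lattice
  \<open>M\<close> need not have a basis permuted by tau. What is available is the vanishing of
  cohomology. It bounds numbers of generators, and such bounds are all that the transcendence degree
  argument asks for. The quotient of (g^(p^(j-1)) - 1) P by (g^(p^j) - 1) P is a module over
  Z[zeta], zeta a root of unity of order p^j. Localized at p this ring is a discrete valuation ring,
  so a submodule needs no more generators than the module. One generator accounts for rank p^j -
  p^(j-1), but Hilbert 90 expresses it by p^j invariants. This excess is the obstacle. It is met by
  multiplying the monomial by a combination of p^(j-1) known invariants that is fixed by
  tau^(p^(j-1)): the factor cancels in the quotients that matter, and its coefficients can be solved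
  for once the monomial itself is known. There are enough invariants for this because N is at least
  2: every character of A that occurs belongs to at least two eigenvectors, and the monomials use
  only one of them.\<close>

definition is_subfield :: "'l::field set \<Rightarrow> bool" where
  "is_subfield F \<longleftrightarrow> 1 \<in> F \<and> (\<forall>a\<in>F. \<forall>b\<in>F. a - b \<in> F \<and> a * b \<in> F) \<and> (\<forall>a\<in>F. inverse a \<in> F)"

context
  fixes F :: "'l::field set"
  assumes F: "is_subfield F"
begin

lemma is_subfield_one: "1 \<in> F" and is_subfield_diff: "a \<in> F \<Longrightarrow> b \<in> F \<Longrightarrow> a - b \<in> F"
  and is_subfield_mult: "a \<in> F \<Longrightarrow> b \<in> F \<Longrightarrow> a * b \<in> F" and is_subfield_inverse: "a \<in> F \<Longrightarrow> inverse a \<in> F"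
  using F by (auto simp: is_subfield_def)

lemma is_subfield_zero: "0 \<in> F"
  using is_subfield_diff[OF is_subfield_one is_subfield_one] by simp

lemma is_subfield_uminus: "a \<in> F \<Longrightarrow> - a \<in> F"
  using is_subfield_diff[OF is_subfield_zero] by fastforce

lemma is_subfield_add: "a \<in> F \<Longrightarrow> b \<in> F \<Longrightarrow> a + b \<in> F"
  using is_subfield_diff[of a "- b"] is_subfield_uminus by fastforce

lemma is_subfield_divide: "a \<in> F \<Longrightarrow> b \<in> F \<Longrightarrow> a / b \<in> F"
  by (simp add: divide_inverse is_subfield_inverse is_subfield_mult)

lemma is_subfield_power: "a \<in> F \<Longrightarrow> a ^ n \<in> F"
  by (induction n) (auto intro: is_subfield_one is_subfield_mult)

lemma is_subfield_power_int: "a \<in> F \<Longrightarrow> a powi k \<in> F"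
  by (simp add: power_int_def is_subfield_power is_subfield_inverse)

lemma is_subfield_sum: "(\<And>i. i \<in> I \<Longrightarrow> f i \<in> F) \<Longrightarrow> sum f I \<in> F"
  by (induction I rule: infinite_finite_induct) (auto intro: is_subfield_zero is_subfield_add)

lemma is_subfield_prod: "(\<And>i. i \<in> I \<Longrightarrow> f i \<in> F) \<Longrightarrow> prod f I \<in> F"
  by (induction I rule: infinite_finite_induct) (auto intro: is_subfield_one is_subfield_mult)

lemma is_subfield_of_nat: "of_nat n \<in> F"
  by (induction n) (auto intro: is_subfield_zero is_subfield_one is_subfield_add)

lemma is_subfield_cancel_right: "a * b \<in> F \<Longrightarrow> b \<in> F \<Longrightarrow> b \<noteq> 0 \<Longrightarrow> a \<in> F"
  using is_subfield_divide[of "a * b" b] by simp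

lemmas is_subfield_closed = is_subfield_one is_subfield_zero is_subfield_diff is_subfield_add
  is_subfield_uminus is_subfield_mult is_subfield_inverse is_subfield_divide is_subfield_power
  is_subfield_power_int is_subfield_sum is_subfield_prod is_subfield_of_nat

end

lemma ring_of_type_algebra_simps:
  "carrier (ring_of_type_algebra :: 'l::field ring) = UNIV"
  "x \<otimes>\<^bsub>ring_of_type_algebra\<^esub> y = x * (y::'l)" "x \<oplus>\<^bsub>ring_of_type_algebra\<^esub> y = x + (y::'l)"
  "\<one>\<^bsub>ring_of_type_algebra\<^esub> = (1::'l)" "\<zero>\<^bsub>ring_of_type_algebra\<^esub> = (0::'l)"
  by (auto simp: ring_of_type_algebra_def)

lemma ring_of_type_algebra_field: "field (ring_of_type_algebra :: 'l::field ring)"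
  by (rule field_from_type_algebra)

lemma ring_of_type_algebra_uminus: "\<ominus>\<^bsub>ring_of_type_algebra\<^esub> (x::'l::field) = - x"
proof -
  interpret R: Ring.field "ring_of_type_algebra :: 'l ring" by (rule ring_of_type_algebra_field)
  show ?thesis
    by (rule R.minus_equality) (simp_all add: ring_of_type_algebra_simps)
qed

lemma ring_of_type_algebra_inverse:
  assumes "(x::'l::field) \<noteq> 0" shows "inv\<^bsub>ring_of_type_algebra\<^esub> x = inverse x"
proof -
  interpret R: Ring.field "ring_of_type_algebra :: 'l ring" by (rule ring_of_type_algebra_field)
  show ?thesis
    by (rule R.comm_inv_char) (simp_all add: ring_of_type_algebra_simps assms)
qed

lemma subfield_iff_is_subfield:
  "subfield F (ring_of_type_algebra :: 'l::field ring) \<longleftrightarrow> is_subfield F"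
proof -
  interpret R: Ring.field "ring_of_type_algebra :: 'l ring" by (rule ring_of_type_algebra_field)
  show ?thesis
  proof
    assume F: "subfield F (ring_of_type_algebra :: 'l ring)"
    interpret F: Ring.field "(ring_of_type_algebra :: 'l ring)\<lparr>carrier := F\<rparr>"
      using F by (rule R.subfield_iff(2))
    have sr: "subring F (ring_of_type_algebra :: 'l ring)"
      using F by (rule subfieldE)
    have inv: "inverse a \<in> F" if "a \<in> F" for a
    proof (cases "a = 0")
      case False
      then have "inv\<^bsub>ring_of_type_algebra\<^esub> a \<in> F"
        using R.subfield_m_inv(1)[OF F, of a] that by (simp add: ring_of_type_algebra_simps)
      with False show ?thesis by (simp add: ring_of_type_algebra_inverse)
    qed (use that in simp)
    have "a - b \<in> F" if "a \<in> F" "b \<in> F" for a b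
      using subringE(7)[OF sr that(1) subringE(5)[OF sr that(2)]]
      by (simp add: ring_of_type_algebra_simps ring_of_type_algebra_uminus)
    moreover have "a * b \<in> F" if "a \<in> F" "b \<in> F" for a b
      using subringE(6)[OF sr that] by (simp add: ring_of_type_algebra_simps)
    moreover have "1 \<in> F"
      using subringE(3)[OF sr] by (simp add: ring_of_type_algebra_simps)
    ultimately show "is_subfield F"
      using inv by (auto simp: is_subfield_def)
  next
    assume F: "is_subfield F"
    note c = is_subfield_closed[OF F]
    show "subfield F (ring_of_type_algebra :: 'l ring)"
    proof (rule R.subfieldI')
      show "subring F (ring_of_type_algebra :: 'l ring)"
        by (rule R.subringI)
          (auto simp: ring_of_type_algebra_simps ring_of_type_algebra_uminus c)
      show "inv\<^bsub>ring_of_type_algebra\<^esub> k \<in> F"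
        if "k \<in> F - {\<zero>\<^bsub>(ring_of_type_algebra :: 'l ring)\<^esub>}" for k
        using that by (simp add: ring_of_type_algebra_simps ring_of_type_algebra_inverse c)
    qed
  qed
qed

lemma field_adjoin_subfield: "is_subfield (field_adjoin K S)"
proof -
  interpret R: Ring.field "ring_of_type_algebra :: 'a ring" by (rule ring_of_type_algebra_field)
  show ?thesis
    unfolding field_adjoin_def
    by (subst subfield_iff_is_subfield[symmetric], rule R.generate_field_is_subfield)
      (simp add: ring_of_type_algebra_simps)
qed

lemma field_adjoin_base: "a \<in> K \<Longrightarrow> a \<in> field_adjoin K S"
  and field_adjoin_gen: "a \<in> S \<Longrightarrow> a \<in> field_adjoin K S"
  unfolding field_adjoin_def by (auto intro: generate_field.incl)

lemma field_adjoin_least: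
  assumes "is_subfield F" "K \<subseteq> F" "S \<subseteq> F" shows "field_adjoin K S \<subseteq> F"
proof -
  interpret R: Ring.field "ring_of_type_algebra :: 'a ring" by (rule ring_of_type_algebra_field)
  show ?thesis
    unfolding field_adjoin_def
    by (rule R.generate_field_min_subfield1)
      (use assms in \<open>auto simp: ring_of_type_algebra_simps subfield_iff_is_subfield\<close>)
qed

lemma field_adjoin_mono: "K \<subseteq> K' \<Longrightarrow> S \<subseteq> S' \<Longrightarrow> field_adjoin K S \<subseteq> field_adjoin K' S'"
  by (intro field_adjoin_least field_adjoin_subfield) (auto intro: field_adjoin_base field_adjoin_gen)

lemma field_adjoin_Un: "field_adjoin K (S \<union> T) = field_adjoin (field_adjoin K S) T"
proof
  show "field_adjoin K (S \<union> T) \<subseteq> field_adjoin (field_adjoin K S) T"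
    by (intro field_adjoin_least field_adjoin_subfield) (auto intro: field_adjoin_base field_adjoin_gen)
  show "field_adjoin (field_adjoin K S) T \<subseteq> field_adjoin K (S \<union> T)"
    by (intro field_adjoin_least field_adjoin_subfield field_adjoin_mono)
      (auto intro: field_adjoin_gen)
qed

section \<open>Endomorphisms of a field\<close>

definition field_hom :: "('l::field \<Rightarrow> 'l) \<Rightarrow> bool" where
  "field_hom f \<longleftrightarrow> f 1 = 1 \<and> (\<forall>u v. f (u + v) = f u + f v) \<and> (\<forall>u v. f (u * v) = f u * f v)"

context
  fixes f :: "'l::field \<Rightarrow> 'l"
  assumes f: "field_hom f"
begin

lemma field_hom_one: "f 1 = 1" and field_hom_add: "f (u + v) = f u + f v"
  and field_hom_mult: "f (u * v) = f u * f v"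
  using f by (auto simp: field_hom_def)

lemma field_hom_zero: "f 0 = 0"
  using field_hom_add[of 0 0] by (metis add_cancel_left_right add_0)

lemma field_hom_uminus: "f (- u) = - f u"
  using field_hom_add[of u "- u"] by (simp add: field_hom_zero eq_neg_iff_add_eq_0 add.commute)

lemma field_hom_diff: "f (u - v) = f u - f v"
  using field_hom_add[of u "- v"] by (simp add: field_hom_uminus)

lemma field_hom_eq_0: "f u = 0 \<longleftrightarrow> u = 0"
proof
  assume "f u = 0"
  show "u = 0"
  proof (rule ccontr)
    assume "u \<noteq> 0"
    then have "f 1 = f u * f (inverse u)" by (simp flip: field_hom_mult)
    then show False using \<open>f u = 0\<close> by (simp add: field_hom_one)
  qed
qed (simp add: field_hom_zero)

lemma field_hom_inverse: "f (inverse u) = inverse (f u)"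
proof (cases "u = 0")
  case False
  then have "f u * f (inverse u) = 1" by (simp flip: field_hom_mult add: field_hom_one)
  then show ?thesis by (simp add: inverse_unique)
qed (simp add: field_hom_zero)

lemma field_hom_divide: "f (u / v) = f u / f v"
  by (simp add: divide_inverse field_hom_mult field_hom_inverse)

lemma field_hom_power: "f (u ^ n) = f u ^ n"
  by (induction n) (auto simp: field_hom_one field_hom_mult)

lemma field_hom_power_int: "f (u powi k) = f u powi k"
  by (simp add: power_int_def field_hom_power field_hom_inverse)

lemma field_hom_sum: "f (sum g I) = (\<Sum>i\<in>I. f (g i))"
  by (induction I rule: infinite_finite_induct) (auto simp: field_hom_zero field_hom_add)

lemma field_hom_prod: "f (prod g I) = (\<Prod>i\<in>I. f (g i))"
  by (induction I rule: infinite_finite_induct) (auto simp: field_hom_one field_hom_mult)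

lemma field_hom_of_nat: "f (of_nat n) = of_nat n"
  by (induction n) (auto simp: field_hom_zero field_hom_one field_hom_add)

lemma is_subfield_vimage: "is_subfield F \<Longrightarrow> is_subfield {u. f u \<in> F}"
  by (auto simp: is_subfield_def field_hom_one field_hom_diff field_hom_mult field_hom_inverse)

lemma is_subfield_fixed: "is_subfield {u. f u = u}"
  by (auto simp: is_subfield_def field_hom_one field_hom_diff field_hom_mult field_hom_inverse)

lemma field_hom_field_adjoin:
  assumes "is_subfield F" "\<And>u. u \<in> K \<Longrightarrow> f u \<in> F" "\<And>u. u \<in> S \<Longrightarrow> f u \<in> F" "u \<in> field_adjoin K S"
  shows "f u \<in> F"
  using field_adjoin_least[OF is_subfield_vimage[OF assms(1)], of K S] assms by auto

lemmas field_hom_simps = field_hom_one field_hom_zero field_hom_add field_hom_diff field_hom_mult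
  field_hom_uminus field_hom_inverse field_hom_divide field_hom_power field_hom_power_int
  field_hom_sum field_hom_prod field_hom_of_nat

end

lemma field_hom_funpow: "field_hom f \<Longrightarrow> field_hom (f ^^ n)"
  by (induction n) (auto simp: field_hom_def)

lemma is_subfield_Inter: "(\<And>F. F \<in> \<F> \<Longrightarrow> is_subfield F) \<Longrightarrow> is_subfield (\<Inter>\<F>)"
  by (auto simp: is_subfield_def)

section \<open>Transcendence degree\<close>

text \<open>Gaussian elimination, one equation at a time. The solution is demanded in
  \<open>F\<close>, because the coefficients are coordinates over \<open>F\<close> of elements of a
  larger field.\<close>

lemma homogeneous_system_nontrivial:
  fixes a :: "'i \<Rightarrow> 'j \<Rightarrow> 'l::field"
  assumes F: "is_subfield F" and "finite J" "finite I" "card J < card I"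
    and "\<And>i j. i \<in> I \<Longrightarrow> j \<in> J \<Longrightarrow> a i j \<in> F"
  shows "\<exists>c. (\<forall>i\<in>I. c i \<in> F) \<and> (\<exists>i\<in>I. c i \<noteq> 0) \<and> (\<forall>j\<in>J. (\<Sum>i\<in>I. c i * a i j) = 0)"
  using assms(2-)
proof (induction J arbitrary: I a rule: finite_induct)
  case empty
  then obtain i where "i \<in> I" by fastforce
  then show ?case
    by (intro exI[of _ "\<lambda>_. 1"]) (auto simp: is_subfield_closed[OF F])
next
  case (insert j0 J)
  show ?case
  proof (cases "\<forall>i\<in>I. a i j0 = 0")
    case True
    have "card J < card I" using insert.prems insert.hyps by simp
    from insert.IH[OF insert.prems(1) this, of a] insert.prems(3) obtain c where
      "\<forall>i\<in>I. c i \<in> F" "\<exists>i\<in>I. c i \<noteq> 0" "\<forall>j\<in>J. (\<Sum>i\<in>I. c i * a i j) = 0" by auto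
    with True show ?thesis by (intro exI[of _ c]) auto
  next
    case False
    then obtain i0 where i0: "i0 \<in> I" "a i0 j0 \<noteq> 0" by auto
    define I' where "I' = I - {i0}"
    have I: "I = insert i0 I'" "i0 \<notin> I'" "finite I'" using i0 insert.prems by (auto simp: I'_def)
    \<comment> \<open>The pivot \<open>a i0 j0\<close> eliminates the unknown \<open>i0\<close>; its
      value \<open>- d\<close> is the one that equation \<open>j0\<close> then forces.\<close>
    define a' where "a' i j = a i j - a i0 j * (a i j0 / a i0 j0)" for i j
    have "card J < card I'" using insert.prems insert.hyps I by simp
    from insert.IH[OF I(3) this, of a'] obtain c where
      c: "\<forall>i\<in>I'. c i \<in> F" "\<exists>i\<in>I'. c i \<noteq> 0" "\<forall>j\<in>J. (\<Sum>i\<in>I'. c i * a' i j) = 0"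
      using insert.prems(3) I by (auto simp: a'_def intro!: is_subfield_closed[OF F])
    define d where "d = (\<Sum>i\<in>I'. c i * (a i j0 / a i0 j0))"
    define c' where "c' = c(i0 := - d)"
    have s: "(\<Sum>i\<in>I. c' i * a i j) = (\<Sum>i\<in>I'. c i * a i j) - d * a i0 j" for j
    proof -
      have "(\<Sum>i\<in>I'. c' i * a i j) = (\<Sum>i\<in>I'. c i * a i j)"
        by (rule sum.cong) (use I in \<open>auto simp: c'_def\<close>)
      then show ?thesis using I by (simp add: c'_def)
    qed
    have "(\<Sum>i\<in>I. c' i * a i j) = 0" if "j \<in> insert j0 J" for j
    proof (cases "j = j0")
      case True
      have "d * a i0 j0 = (\<Sum>i\<in>I'. c i * a i j0)"
        unfolding d_def sum_distrib_right by (rule sum.cong) (use i0 in auto)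
      then show ?thesis by (simp add: s True)
    next
      case False
      with that c have "(\<Sum>i\<in>I'. c i * a' i j) = 0" by auto
      moreover have "(\<Sum>i\<in>I'. c i * a' i j) = (\<Sum>i\<in>I'. c i * a i j) - d * a i0 j"
        unfolding d_def sum_distrib_right a'_def right_diff_distrib sum_subtractf
        by (simp add: mult_ac)
      ultimately show ?thesis by (simp add: s)
    qed
    moreover have "\<forall>i\<in>I. c' i \<in> F"
      using c(1) I insert.prems(3) by (auto simp: c'_def d_def intro!: is_subfield_closed[OF F])
    moreover have "\<exists>i\<in>I. c' i \<noteq> 0"
      using c(2) I by (auto simp: c'_def)
    ultimately show ?thesis by blast
  qed
qed

lemma linear_dependence:
  fixes v :: "'i \<Rightarrow> 'l::field"
  assumes F: "is_subfield F" and "finite J" "finite I" "card J < card I"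
    and v: "\<And>i. i \<in> I \<Longrightarrow> \<exists>a. (\<forall>j\<in>J. a j \<in> F) \<and> v i = (\<Sum>j\<in>J. a j * w j)"
  shows "\<exists>c. (\<forall>i\<in>I. c i \<in> F) \<and> (\<exists>i\<in>I. c i \<noteq> 0) \<and> (\<Sum>i\<in>I. c i * v i) = 0"
proof -
  have "\<forall>i\<in>I. \<exists>a. (\<forall>j\<in>J. a j \<in> F) \<and> v i = (\<Sum>j\<in>J. a j * w j)"
    using v by blast
  then obtain a where a: "\<And>i j. i \<in> I \<Longrightarrow> j \<in> J \<Longrightarrow> a i j \<in> F"
    "\<And>i. i \<in> I \<Longrightarrow> v i = (\<Sum>j\<in>J. a i j * w j)" by metis
  from homogeneous_system_nontrivial[OF assms(1-4), of a] a(1) obtain c where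
    c: "\<forall>i\<in>I. c i \<in> F" "\<exists>i\<in>I. c i \<noteq> 0" "\<And>j. j \<in> J \<Longrightarrow> (\<Sum>i\<in>I. c i * a i j) = 0" by blast
  have "(\<Sum>i\<in>I. c i * v i) = (\<Sum>i\<in>I. \<Sum>j\<in>J. c i * a i j * w j)"
    by (rule sum.cong) (auto simp: a(2) sum_distrib_left mult_ac)
  also have "\<dots> = (\<Sum>j\<in>J. (\<Sum>i\<in>I. c i * a i j) * w j)"
    by (subst sum.swap) (simp add: sum_distrib_right)
  also have "\<dots> = 0" using c(3) by simp
  finally show ?thesis using c by blast
qed

section \<open>Elements algebraic over a subfield\<close>

definition algebraic_over :: "'l::field set \<Rightarrow> 'l \<Rightarrow> bool" where
  "algebraic_over F u \<longleftrightarrow>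
     (\<exists>p. p \<noteq> 0 \<and> (\<forall>i. Polynomial.coeff p i \<in> F) \<and> poly p u = 0)"

lemma algebraic_over_mono: "algebraic_over F u \<Longrightarrow> F \<subseteq> F' \<Longrightarrow> algebraic_over F' u"
  unfolding algebraic_over_def by blast

lemma algebraic_over_self:
  assumes F: "is_subfield F" and "u \<in> F" shows "algebraic_over F u"
  unfolding algebraic_over_def
  by (rule exI[of _ "[:-u, 1:]"])
    (auto simp: coeff_pCons assms is_subfield_closed[OF F] split: nat.splits)

lemma algebraic_overI:
  assumes F: "is_subfield F" and "finite I" "\<And>i. i \<in> I \<Longrightarrow> c i \<in> F" "i0 \<in> I" "c i0 \<noteq> 0"
    "(\<Sum>i\<in>I. c i * u ^ i) = 0"
  shows "algebraic_over F u"
proof -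
  define p where "p = (\<Sum>i\<in>I. Polynomial.monom (c i) i)"
  have co: "Polynomial.coeff p k = (if k \<in> I then c k else 0)" for k
    using assms(2) by (auto simp: p_def coeff_sum)
  have "p \<noteq> 0" using co[of i0] assms by auto
  moreover have "poly p u = 0" using assms(6) by (simp add: p_def poly_sum poly_monom)
  moreover have "Polynomial.coeff p k \<in> F" for k
    using assms by (auto simp: co is_subfield_closed[OF F])
  ultimately show ?thesis unfolding algebraic_over_def by blast
qed

text \<open>One power more than there are spanning elements gives a linear relation. With the
  converse \<open>algebraic_over_powers_span\<close> this replaces algebraicity by finite spans, so
  that degrees of extensions never have to be defined.\<close>

lemma algebraic_over_if_powers_span:
  assumes F: "is_subfield F" and J: "finite J"
    and v: "\<And>k. \<exists>a. (\<forall>j\<in>J. a j \<in> F) \<and> u ^ k = (\<Sum>j\<in>J. a j * w j)"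
  shows "algebraic_over F u"
proof -
  obtain c where "\<forall>i\<in>{..card J}. c i \<in> F" "\<exists>i\<in>{..card J}. c i \<noteq> 0" "(\<Sum>i\<in>{..card J}. c i * u ^ i) = 0"
    using linear_dependence[OF F J, of "{..card J}" "\<lambda>k. u ^ k" w] v by auto
  then show ?thesis using algebraic_overI[OF F, of "{..card J}" c] by auto
qed

lemma algebraic_over_powers_span:
  assumes F: "is_subfield F" and u: "algebraic_over F u"
  shows "\<exists>e. \<forall>k. \<exists>b. (\<forall>j<e. b j \<in> F) \<and> u ^ k = (\<Sum>j<e. b j * u ^ j)"
proof -
  note c = is_subfield_closed[OF F]
  obtain p where p: "p \<noteq> 0" "\<And>i. Polynomial.coeff p i \<in> F" "poly p u = 0"
    using u by (auto simp: algebraic_over_def)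
  define e where "e = Polynomial.degree p"
  define g where "g j = - Polynomial.coeff p j / lead_coeff p" for j
  have lc: "lead_coeff p \<noteq> 0" using p by simp
  have top: "u ^ e = (\<Sum>j<e. g j * u ^ j)"
  proof -
    have "0 = (\<Sum>j\<le>e. Polynomial.coeff p j * u ^ j)" using p(3) by (simp add: poly_altdef e_def)
    also have "\<dots> = (\<Sum>j<e. Polynomial.coeff p j * u ^ j) + lead_coeff p * u ^ e"
      by (simp add: e_def flip: lessThan_Suc_atMost)
    finally have "lead_coeff p * u ^ e = - (\<Sum>j<e. Polynomial.coeff p j * u ^ j)"
      by (simp add: eq_neg_iff_add_eq_0 add.commute)
    then have "u ^ e = - (\<Sum>j<e. Polynomial.coeff p j * u ^ j) / lead_coeff p"
      using lc by (simp add: field_simps)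
    also have "\<dots> = (\<Sum>j<e. g j * u ^ j)"
      by (simp add: g_def sum_divide_distrib sum_negf flip: minus_divide_left)
    finally show ?thesis .
  qed
  have gF: "g j \<in> F" for j using p by (auto simp: g_def intro!: c)
  have "\<exists>b. (\<forall>j<e. b j \<in> F) \<and> u ^ k = (\<Sum>j<e. b j * u ^ j)" for k
  proof (induction k)
    case 0
    show ?case
    proof (cases "e = 0")
      case True
      then show ?thesis using top by simp
    next
      case False
      then have "{..<e} \<inter> {0} = {0}" by auto
      then show ?thesis
        by (intro exI[of _ "\<lambda>j. if j = 0 then 1 else 0"]) (auto simp: c sum.If_cases if_distrib if_distribR cong: if_cong)
    qed
  next
    case (Suc k)
    then obtain b where b: "\<forall>j<e. b j \<in> F" "u ^ k = (\<Sum>j<e. b j * u ^ j)" by blast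
    show ?case
    proof (cases e)
      case 0
      then show ?thesis using top by simp
    next
      case (Suc d)
      \<comment> \<open>Multiplication by \<open>u\<close> shifts the coefficients; the term that
        reaches \<open>u ^ e\<close> is rewritten by \<open>top\<close>.\<close>
      define b' where "b' j = (if j = 0 then 0 else b (j - 1)) + b d * g j" for j
      have "u ^ Suc k = (\<Sum>j<e. b j * u ^ Suc j)"
        using b(2) by (simp add: sum_distrib_left mult_ac)
      also have "\<dots> = (\<Sum>j<d. b j * u ^ Suc j) + b d * u ^ e"
        by (simp add: Suc)
      also have "(\<Sum>j<d. b j * u ^ Suc j) = (\<Sum>j<e. (if j = 0 then 0 else b (j - 1)) * u ^ j)"
        unfolding Suc sum.lessThan_Suc_shift by simp
      also have "\<dots> + b d * u ^ e = (\<Sum>j<e. b' j * u ^ j)"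
        unfolding top b'_def by (simp add: sum_distrib_left sum.distrib algebra_simps)
      finally have "u ^ Suc k = (\<Sum>j<e. b' j * u ^ j)" .
      moreover have "\<forall>j<e. b' j \<in> F"
        using b(1) Suc by (auto simp: b'_def intro!: c gF)
      ultimately show ?thesis by blast
    qed
  qed
  then show ?thesis by blast
qed

definition is_subring :: "'l::field set \<Rightarrow> bool" where
  "is_subring R \<longleftrightarrow> 1 \<in> R \<and> (\<forall>a\<in>R. \<forall>b\<in>R. a - b \<in> R \<and> a * b \<in> R)"

context
  fixes R :: "'l::field set"
  assumes R: "is_subring R"
begin

lemma is_subring_one: "1 \<in> R" and is_subring_diff: "a \<in> R \<Longrightarrow> b \<in> R \<Longrightarrow> a - b \<in> R"
  and is_subring_mult: "a \<in> R \<Longrightarrow> b \<in> R \<Longrightarrow> a * b \<in> R"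
  using R by (auto simp: is_subring_def)

lemma is_subring_zero: "0 \<in> R"
  using is_subring_diff[OF is_subring_one is_subring_one] by simp

lemma is_subring_uminus: "a \<in> R \<Longrightarrow> - a \<in> R"
  using is_subring_diff[OF is_subring_zero] by fastforce

lemma is_subring_add: "a \<in> R \<Longrightarrow> b \<in> R \<Longrightarrow> a + b \<in> R"
  using is_subring_diff[of a "- b"] is_subring_uminus by fastforce

lemma is_subring_sum: "(\<And>i. i \<in> I \<Longrightarrow> f i \<in> R) \<Longrightarrow> sum f I \<in> R"
  by (induction I rule: infinite_finite_induct) (auto intro: is_subring_zero is_subring_add)

lemma is_subring_prod: "(\<And>i. i \<in> I \<Longrightarrow> f i \<in> R) \<Longrightarrow> prod f I \<in> R"
  by (induction I rule: infinite_finite_induct) (auto intro: is_subring_one is_subring_mult)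

lemma is_subring_power: "a \<in> R \<Longrightarrow> a ^ n \<in> R"
  by (induction n) (auto intro: is_subring_one is_subring_mult)

lemmas is_subring_closed = is_subring_one is_subring_diff is_subring_mult is_subring_zero
  is_subring_uminus is_subring_add is_subring_sum is_subring_prod is_subring_power

text \<open>Denominators may be 0, because a / 0 = 0. This adds no new element and saves a side
  condition, at the price of a case distinction for differences.\<close>

lemma is_subfield_fractions: "is_subfield {a / b |a b. a \<in> R \<and> b \<in> R}"
  unfolding is_subfield_def
proof (intro conjI ballI)
  show "1 \<in> {a / b |a b. a \<in> R \<and> b \<in> R}"
    by (rule CollectI, rule exI[of _ 1], rule exI[of _ 1]) (simp add: is_subring_one)
  fix u w assume "u \<in> {a / b |a b. a \<in> R \<and> b \<in> R}" "w \<in> {a / b |a b. a \<in> R \<and> b \<in> R}"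
  then obtain a b c d where u: "u = a / b" "a \<in> R" "b \<in> R" and w: "w = c / d" "c \<in> R" "d \<in> R"
    by blast
  have "u * w = (a * c) / (b * d)" by (simp add: u w)
  moreover have "a * c \<in> R" "b * d \<in> R" using u w is_subring_mult by auto
  ultimately show "u * w \<in> {a / b |a b. a \<in> R \<and> b \<in> R}" by blast
  consider "b = 0" | "d = 0" | "b \<noteq> 0" "d \<noteq> 0" by blast
  then have "\<exists>a' b'. u - w = a' / b' \<and> a' \<in> R \<and> b' \<in> R"
  proof cases
    case 1
    then have "u - w = (- c) / d" by (simp add: u w)
    with w is_subring_uminus show ?thesis by - (rule exI[of _ "- c"], rule exI[of _ d], simp)
  next
    case 2
    then have "u - w = a / b" by (simp add: u w)
    with u show ?thesis by - (rule exI[of _ a], rule exI[of _ b], simp)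
  next
    case 3
    then have "u - w = (a * d - c * b) / (b * d)" by (simp add: u w field_simps)
    with u w is_subring_mult is_subring_diff show ?thesis
      by - (rule exI[of _ "a * d - c * b"], rule exI[of _ "b * d"], simp)
  qed
  then show "u - w \<in> {a / b |a b. a \<in> R \<and> b \<in> R}" by blast
next
  fix u assume "u \<in> {a / b |a b. a \<in> R \<and> b \<in> R}"
  then obtain a b where u: "u = a / b" "a \<in> R" "b \<in> R" by blast
  then have "inverse u = b / a" by simp
  then show "inverse u \<in> {a / b |a b. a \<in> R \<and> b \<in> R}" using u by blast
qed

lemma field_adjoin_fractions:
  assumes "K \<subseteq> R" "S \<subseteq> R"
  shows "field_adjoin K S \<subseteq> {a / b |a b. a \<in> R \<and> b \<in> R}"
proof (rule field_adjoin_least[OF is_subfield_fractions])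
  have "R \<subseteq> {a / b |a b. a \<in> R \<and> b \<in> R}"
  proof
    fix a assume "a \<in> R"
    then have "a = a / 1 \<and> a \<in> R \<and> 1 \<in> R" by (simp add: is_subring_one)
    then show "a \<in> {a / b |a b. a \<in> R \<and> b \<in> R}" by blast
  qed
  then show "K \<subseteq> {a / b |a b. a \<in> R \<and> b \<in> R}" "S \<subseteq> {a / b |a b. a \<in> R \<and> b \<in> R}"
    by (rule order_trans[OF assms(1)], rule order_trans[OF assms(2)])
qed

lemma common_denominator:
  assumes "finite C" "C \<subseteq> {a / b |a b. a \<in> R \<and> b \<in> R}"
  shows "\<exists>d\<in>R. d \<noteq> 0 \<and> (\<forall>c\<in>C. d * c \<in> R)"
  using assms
proof (induction C rule: finite_induct)
  case empty
  then show ?case by (intro bexI[of _ 1]) (auto simp: is_subring_one)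
next
  case (insert c C)
  then obtain d where d: "d \<in> R" "d \<noteq> 0" "\<forall>c\<in>C. d * c \<in> R" by auto
  from insert.prems obtain a b where c: "c = a / b" "a \<in> R" "b \<in> R" by blast
  show ?case
  proof (cases "b = 0")
    case True
    then show ?thesis using d c is_subring_zero by (intro bexI[of _ d]) auto
  next
    case False
    then have "b * d * c = d * a" by (simp add: c)
    then have "b * d * c \<in> R" using is_subring_mult[OF d(1) c(2)] by metis
    moreover have "b * d * c' \<in> R" if "c' \<in> C" for c'
      using is_subring_mult[OF c(3), of "d * c'"] d(3) that by (simp add: mult.assoc)
    ultimately show ?thesis using d c False is_subring_mult[OF c(3) d(1)]
      by (intro bexI[of _ "b * d"]) auto
  qed
qed

end

lemma is_subring_poly_values:
  assumes F: "is_subfield F"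
  shows "is_subring {poly P y |P. \<forall>i. Polynomial.coeff P i \<in> F}"
  unfolding is_subring_def
proof (intro conjI ballI)
  note c = is_subfield_closed[OF F]
  show "1 \<in> {poly P y |P. \<forall>i. Polynomial.coeff P i \<in> F}"
    by (intro CollectI exI[of _ 1]) (auto intro: c)
  fix u w assume "u \<in> {poly P y |P. \<forall>i. Polynomial.coeff P i \<in> F}" "w \<in> {poly P y |P. \<forall>i. Polynomial.coeff P i \<in> F}"
  then obtain P Q where "u = poly P y" "\<forall>i. Polynomial.coeff P i \<in> F"
    "w = poly Q y" "\<forall>i. Polynomial.coeff Q i \<in> F" by blast
  then have "u - w = poly (P - Q) y \<and> (\<forall>i. Polynomial.coeff (P - Q) i \<in> F)"
    "u * w = poly (P * Q) y \<and> (\<forall>i. Polynomial.coeff (P * Q) i \<in> F)"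
    by (auto simp: Polynomial.coeff_mult intro!: c)
  then show "u - w \<in> {poly P y |P. \<forall>i. Polynomial.coeff P i \<in> F}"
    "u * w \<in> {poly P y |P. \<forall>i. Polynomial.coeff P i \<in> F}"
    by blast+
qed

lemma sum_lessThan_add: "(\<Sum>i<k + n. f i) = (\<Sum>i<k. f i) + (\<Sum>i<n. f (k + i) :: 'a::comm_monoid_add)"
  for k n :: nat
  by (induction n) (auto simp: add_ac)

lemma poly_eq_sum_atMost: "Polynomial.degree p \<le> m \<Longrightarrow> poly p y = (\<Sum>j\<le>m. Polynomial.coeff p j * y ^ j)"
  for p :: "'a::comm_semiring_1 poly"
  unfolding poly_altdef by (rule sum.mono_neutral_left) (auto simp: coeff_eq_0)

text \<open>After division by the lowest power of \<open>e\<close> that occurs, the relation has a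
  nonzero constant term. Solving for this term and dividing by \<open>e\<close> expresses the
  inverse as a polynomial in \<open>e\<close>.\<close>

lemma inverse_algebraic:
  assumes F: "is_subfield F" and e: "algebraic_over F e"
  shows "\<exists>n b. (\<forall>i<n. b i \<in> F) \<and> inverse e = (\<Sum>i<n. b i * e ^ i)"
proof (cases "e = 0")
  case True
  then show ?thesis by (intro exI[of _ 0]) auto
next
  case False
  obtain p where p: "p \<noteq> 0" "\<And>i. Polynomial.coeff p i \<in> F" "poly p e = 0"
    using e by (auto simp: algebraic_over_def)
  define k where "k = (LEAST k. Polynomial.coeff p k \<noteq> 0)"
  have "\<exists>k. Polynomial.coeff p k \<noteq> 0" using p(1) by (auto simp: poly_eq_iff)
  then have k: "Polynomial.coeff p k \<noteq> 0" and low: "\<And>i. i < k \<Longrightarrow> Polynomial.coeff p i = 0"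
    unfolding k_def by (rule LeastI_ex) (use not_less_Least in blast)
  obtain n where n: "Polynomial.degree p = k + n"
    using le_degree[OF k] le_Suc_ex by blast
  have "0 = (\<Sum>i\<le>k + n. Polynomial.coeff p i * e ^ i)" using p(3) by (simp add: poly_altdef n)
  also have "\<dots> = (\<Sum>i<k. Polynomial.coeff p i * e ^ i) + (\<Sum>i<Suc n. Polynomial.coeff p (k + i) * e ^ (k + i))"
    unfolding lessThan_Suc_atMost[symmetric] add_Suc_right[symmetric] by (rule sum_lessThan_add)
  also have "\<dots> = e ^ k * (\<Sum>i<Suc n. Polynomial.coeff p (k + i) * e ^ i)"
    by (simp add: low power_add sum_distrib_left algebra_simps)
  finally have "0 = (\<Sum>i<Suc n. Polynomial.coeff p (k + i) * e ^ i)" using False by simp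
  also have "\<dots> = Polynomial.coeff p k + e * (\<Sum>i<n. Polynomial.coeff p (Suc (k + i)) * e ^ i)"
    by (simp only: sum.lessThan_Suc_shift) (simp add: sum_distrib_left mult_ac)
  finally have "e * (\<Sum>i<n. Polynomial.coeff p (Suc (k + i)) * e ^ i) = - Polynomial.coeff p k"
    by (simp add: eq_neg_iff_add_eq_0 add.commute)
  then have "inverse e = (\<Sum>i<n. Polynomial.coeff p (Suc (k + i)) * e ^ i) / (- Polynomial.coeff p k)"
    using False k by (simp add: field_simps)
  also have "\<dots> = (\<Sum>i<n. (- Polynomial.coeff p (Suc (k + i)) / Polynomial.coeff p k) * e ^ i)"
    by (simp add: sum_divide_distrib sum_negf)
  finally show ?thesis
    using p(2) by (intro exI[of _ n] exI[of _ "\<lambda>i. - Polynomial.coeff p (Suc (k + i)) / Polynomial.coeff p k"])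
      (auto intro!: is_subfield_closed[OF F])
qed

lemma is_subfield_algebraic_ring:
  assumes F: "is_subfield F" and R: "is_subring R" "F \<subseteq> R" and alg: "\<And>e. e \<in> R \<Longrightarrow> algebraic_over F e"
  shows "is_subfield R"
proof -
  have "inverse e \<in> R" if "e \<in> R" for e
  proof -
    from inverse_algebraic[OF F alg[OF that]] obtain n b where
      "\<forall>i<n. b i \<in> F" "inverse e = (\<Sum>i<n. b i * e ^ i)" by blast
    then show ?thesis using R(2) that by (auto intro!: is_subring_closed[OF R(1)])
  qed
  then show ?thesis using R(1) by (auto simp: is_subfield_def is_subring_def)
qed

text \<open>The span of the first powers of \<open>y\<close> is a ring. All powers of one of its
  elements lie in this finite span, so its elements are algebraic and the ring is already a
  field.\<close>

lemma field_adjoin_algebraic_span: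
  assumes F: "is_subfield F" and y: "algebraic_over F y"
  shows "\<exists>d. \<forall>e\<in>field_adjoin F {y}. \<exists>a. (\<forall>j<d. a j \<in> F) \<and> e = (\<Sum>j<d. a j * y ^ j)"
proof -
  note c = is_subfield_closed[OF F]
  from algebraic_over_powers_span[OF F y] obtain d where
    d: "\<And>k. \<exists>b. (\<forall>j<d. b j \<in> F) \<and> y ^ k = (\<Sum>j<d. b j * y ^ j)" by blast
  define D where "D = {e. \<exists>a. (\<forall>j<d. a j \<in> F) \<and> e = (\<Sum>j<d. a j * y ^ j)}"
  have pow: "y ^ k \<in> D" for k using d by (simp add: D_def)
  have diff: "u - w \<in> D" if "u \<in> D" "w \<in> D" for u w
  proof -
    from that obtain a b where "\<forall>j<d. a j \<in> F" "u = (\<Sum>j<d. a j * y ^ j)"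
      "\<forall>j<d. b j \<in> F" "w = (\<Sum>j<d. b j * y ^ j)" by (auto simp: D_def)
    then show ?thesis unfolding D_def
      by (intro CollectI exI[of _ "\<lambda>j. a j - b j"]) (auto simp: c sum_subtractf algebra_simps)
  qed
  have zero: "0 \<in> D" using diff[OF pow pow, of 0 0] by simp
  have add: "u + w \<in> D" if "u \<in> D" "w \<in> D" for u w
    using diff[OF that(1) diff[OF zero that(2)]] by simp
  have sum: "sum f I \<in> D" if "\<And>i. i \<in> I \<Longrightarrow> f i \<in> D" for f :: "nat \<Rightarrow> _" and I
    using that by (induction I rule: infinite_finite_induct) (auto intro: zero add)
  have scal: "s * u \<in> D" if "s \<in> F" "u \<in> D" for s u
  proof -
    from that obtain a where "\<forall>j<d. a j \<in> F" "u = (\<Sum>j<d. a j * y ^ j)" by (auto simp: D_def)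
    then show ?thesis using that unfolding D_def
      by (intro CollectI exI[of _ "\<lambda>j. s * a j"]) (auto simp: c sum_distrib_left mult_ac)
  qed
  have mult: "u * w \<in> D" if u: "u \<in> D" and w: "w \<in> D" for u w
  proof -
    from u obtain a where a: "\<forall>j<d. a j \<in> F" "u = (\<Sum>j<d. a j * y ^ j)" by (auto simp: D_def)
    from w obtain b where b: "\<forall>j<d. b j \<in> F" "w = (\<Sum>j<d. b j * y ^ j)" by (auto simp: D_def)
    have "u * w = (\<Sum>i<d. \<Sum>j<d. (a i * b j) * y ^ (i + j))"
      by (simp add: a b sum_product power_add mult_ac)
    then show ?thesis using a b by (auto intro!: sum scal pow c)
  qed
  have R: "is_subring D"
    using pow[of 0] diff mult by (auto simp: is_subring_def)
  have FD: "F \<subseteq> D" using scal[OF _ pow[of 0]] by auto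
  have "is_subfield D"
  proof (rule is_subfield_algebraic_ring[OF F R FD])
    fix e assume "e \<in> D"
    then have "e ^ k \<in> D" for k by (rule is_subring_power[OF R])
    then show "algebraic_over F e"
      by (intro algebraic_over_if_powers_span[OF F, of "{..<d}" e "\<lambda>j. y ^ j"]) (simp_all add: D_def Ball_def)
  qed
  from field_adjoin_least[OF this FD, of "{y}"] pow[of 1] have "field_adjoin F {y} \<subseteq> D" by simp
  then show ?thesis by (intro exI[of _ d]) (auto simp: D_def)
qed

lemma algebraic_over_trans:
  assumes F: "is_subfield F" and y: "algebraic_over F y" and u: "algebraic_over (field_adjoin F {y}) u"
  shows "algebraic_over F u"
proof -
  from field_adjoin_algebraic_span[OF F y] obtain d where
    d: "\<And>e. e \<in> field_adjoin F {y} \<Longrightarrow> \<exists>a. (\<forall>j<d. a j \<in> F) \<and> e = (\<Sum>j<d. a j * y ^ j)" by blast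
  from algebraic_over_powers_span[OF field_adjoin_subfield u] obtain e where
    e: "\<And>k. \<exists>b. (\<forall>j<e. b j \<in> field_adjoin F {y}) \<and> u ^ k = (\<Sum>j<e. b j * u ^ j)" by blast
  show ?thesis
  proof (rule algebraic_over_if_powers_span[OF F, of "{..<e} \<times> {..<d}" _ "\<lambda>(j, i). u ^ j * y ^ i"])
    fix k
    from e obtain b where b: "\<forall>j<e. b j \<in> field_adjoin F {y}" "u ^ k = (\<Sum>j<e. b j * u ^ j)" by blast
    then have "\<forall>j\<in>{..<e}. \<exists>a. (\<forall>i<d. a i \<in> F) \<and> b j = (\<Sum>i<d. a i * y ^ i)" using d by blast
    then obtain a where a: "\<And>j i. j < e \<Longrightarrow> i < d \<Longrightarrow> a j i \<in> F"
      "\<And>j. j < e \<Longrightarrow> b j = (\<Sum>i<d. a j i * y ^ i)" by (metis lessThan_iff)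
    have "u ^ k = (\<Sum>j<e. \<Sum>i<d. a j i * (u ^ j * y ^ i))"
      by (simp add: b(2) a(2) sum_distrib_left sum_distrib_right mult_ac)
    also have "\<dots> = (\<Sum>(j, i)\<in>{..<e} \<times> {..<d}. a j i * (u ^ j * y ^ i))"
      by (simp add: sum.cartesian_product)
    finally show "\<exists>a. (\<forall>j\<in>{..<e} \<times> {..<d}. a j \<in> F) \<and>
        u ^ k = (\<Sum>j\<in>{..<e} \<times> {..<d}. a j * (case j of (j, i) \<Rightarrow> u ^ j * y ^ i))"
      using a(1) by (intro exI[of _ "\<lambda>(j, i). a j i"]) (auto simp: split_def)
  qed simp
qed

text \<open>Steinitz exchange: once the denominators in \<open>y\<close> are cleared, the relation
  for \<open>x\<close> is a polynomial relation between \<open>x\<close> and \<open>y\<close>, which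
  is then sorted by powers of \<open>y\<close>.\<close>

lemma algebraic_over_exchange:
  assumes F: "is_subfield F" and x: "algebraic_over (field_adjoin F {y}) x" "\<not> algebraic_over F x"
  shows "algebraic_over (field_adjoin F {x}) y"
proof -
  define R where "R = {poly P y |P. \<forall>i. Polynomial.coeff P i \<in> F}"
  have R: "is_subring R" unfolding R_def by (rule is_subring_poly_values[OF F])
  have FR: "F \<subseteq> R"
  proof
    fix a assume "a \<in> F"
    then show "a \<in> R" unfolding R_def
      by (intro CollectI exI[of _ "[:a:]"]) (auto simp: coeff_pCons is_subfield_closed[OF F] split: nat.splits)
  qed
  have yR: "{y} \<subseteq> R" unfolding R_def
    by (auto intro!: exI[of _ "[:0, 1:]"] simp: coeff_pCons is_subfield_closed[OF F] split: nat.splits)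
  from x(1) obtain p where p: "p \<noteq> 0" "\<And>i. Polynomial.coeff p i \<in> field_adjoin F {y}" "poly p x = 0"
    by (auto simp: algebraic_over_def)
  define n where "n = Polynomial.degree p"
  have "Polynomial.coeff p ` {..n} \<subseteq> {a / b |a b. a \<in> R \<and> b \<in> R}"
    using p(2) field_adjoin_fractions[OF R FR yR] by blast
  from common_denominator[OF R _ this] obtain d where
    d: "d \<noteq> 0" "\<And>i. i \<le> n \<Longrightarrow> d * Polynomial.coeff p i \<in> R" by auto
  then have "\<forall>i\<in>{..n}. \<exists>P. (\<forall>j. Polynomial.coeff P j \<in> F) \<and> d * Polynomial.coeff p i = poly P y"
    unfolding R_def by blast
  then obtain P where P: "\<And>i j. i \<le> n \<Longrightarrow> Polynomial.coeff (P i) j \<in> F"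
    "\<And>i. i \<le> n \<Longrightarrow> d * Polynomial.coeff p i = poly (P i) y" by (metis atMost_iff)
  have "d * Polynomial.coeff p n \<noteq> 0" using p(1) d by (simp add: n_def)
  then have "P n \<noteq> 0" using P(2)[of n] by auto
  then obtain j0 where j0: "Polynomial.coeff (P n) j0 \<noteq> 0" by (auto simp: poly_eq_iff)
  define m where "m = Max ((\<lambda>i. Polynomial.degree (P i)) ` {..n})"
  have m: "Polynomial.degree (P i) \<le> m" if "i \<le> n" for i
    unfolding m_def using that by (intro Max_ge) auto
  define c where "c j = (\<Sum>i\<le>n. Polynomial.coeff (P i) j * x ^ i)" for j
  have "(\<Sum>j\<le>m. c j * y ^ j) = (\<Sum>i\<le>n. (\<Sum>j\<le>m. Polynomial.coeff (P i) j * y ^ j) * x ^ i)"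
    unfolding c_def sum_distrib_right by (subst sum.swap) (simp add: mult_ac)
  also have "\<dots> = (\<Sum>i\<le>n. poly (P i) y * x ^ i)"
    by (intro sum.cong refl) (simp add: poly_eq_sum_atMost[OF m])
  also have "\<dots> = d * poly p x"
    unfolding poly_altdef[of p] sum_distrib_left n_def[symmetric]
    by (intro sum.cong refl) (simp add: P(2)[symmetric])
  finally have sum0: "(\<Sum>j\<le>m. c j * y ^ j) = 0" by (simp add: p)
  \<comment> \<open>\<open>c j0\<close> is a polynomial in \<open>x\<close> over \<open>F\<close>
    with a nonzero coefficient at \<open>x ^ n\<close>, and \<open>x\<close> is not algebraic over
    \<open>F\<close>.\<close>
  have "c j0 \<noteq> 0"
    unfolding c_def using algebraic_overI[OF F, of "{..n}" "\<lambda>i. Polynomial.coeff (P i) j0" n x] P(1) j0 x(2)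
    by auto
  moreover have "j0 \<le> m" using le_degree[OF j0] m[of n] by simp
  ultimately show ?thesis
    by (intro algebraic_overI[OF field_adjoin_subfield, where I = "{..m}" and c = c and ?i0.0 = j0])
      (use P(1) sum0 in \<open>auto simp: c_def intro!: is_subfield_closed[OF field_adjoin_subfield]
         intro: field_adjoin_base field_adjoin_gen\<close>)
qed

section \<open>Polynomials in several variables and the exchange argument\<close>

definition monomial_at :: "('i \<Rightarrow> 'l) \<Rightarrow> ('i \<Rightarrow>\<^sub>0 nat) \<Rightarrow> 'l::field" where
  "monomial_at x e = (\<Prod>i\<in>Poly_Mapping.keys e. x i ^ Poly_Mapping.lookup e i)"

lemma monomial_at_superset:
  assumes "finite A" "Poly_Mapping.keys e \<subseteq> A"
  shows "monomial_at x e = (\<Prod>i\<in>A. x i ^ Poly_Mapping.lookup e i)"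
  unfolding monomial_at_def using assms by (intro prod.mono_neutral_left) (auto simp: in_keys_iff)

lemma monomial_at_zero: "monomial_at x 0 = 1"
  by (simp add: monomial_at_def)

lemma monomial_at_add: "monomial_at x (e + f) = monomial_at x e * monomial_at x f"
proof -
  define A where "A = Poly_Mapping.keys e \<union> Poly_Mapping.keys f"
  have A: "finite A" "Poly_Mapping.keys e \<subseteq> A" "Poly_Mapping.keys f \<subseteq> A" by (auto simp: A_def)
  then have "Poly_Mapping.keys (e + f) \<subseteq> A" using keys_add[of e f] by (simp add: A_def)
  with A show ?thesis
    by (simp add: monomial_at_superset[of A] lookup_add power_add prod.distrib)
qed

lemma monomial_at_single: "monomial_at x (Poly_Mapping.single i k) = x i ^ k"
  by (simp add: monomial_at_def)

lemma poly_at_superset: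
  assumes "finite A" "Poly_Mapping.keys P \<subseteq> A"
  shows "poly_at x P = (\<Sum>e\<in>A. Poly_Mapping.lookup P e * monomial_at x e)"
  unfolding poly_at_def monomial_at_def[symmetric] using assms
  by (intro sum.mono_neutral_left) (auto simp: in_keys_iff)

lemma poly_at_zero: "poly_at x 0 = 0"
  by (simp add: poly_at_def)

lemma poly_at_add: "poly_at x (P + Q) = poly_at x P + poly_at x Q"
proof -
  define A where "A = Poly_Mapping.keys P \<union> Poly_Mapping.keys Q"
  have A: "finite A" "Poly_Mapping.keys P \<subseteq> A" "Poly_Mapping.keys Q \<subseteq> A" by (auto simp: A_def)
  then have "Poly_Mapping.keys (P + Q) \<subseteq> A" using keys_add[of P Q] by (simp add: A_def)
  with A show ?thesis
    by (simp add: poly_at_superset[of A] lookup_add sum.distrib algebra_simps)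
qed

lemma poly_at_sum: "poly_at x (sum f I) = (\<Sum>i\<in>I. poly_at x (f i))"
  by (induction I rule: infinite_finite_induct) (auto simp: poly_at_zero poly_at_add)

lemma poly_at_single: "poly_at x (Poly_Mapping.single e c) = c * monomial_at x e"
  by (cases "c = 0") (auto simp: poly_at_def monomial_at_def)

definition mpoly_over :: "'l::field set \<Rightarrow> 'i set \<Rightarrow> (('i \<Rightarrow>\<^sub>0 nat) \<Rightarrow>\<^sub>0 'l) \<Rightarrow> bool" where
  "mpoly_over K I P \<longleftrightarrow> (\<forall>e. Poly_Mapping.lookup P e \<in> K) \<and>
     (\<forall>e\<in>Poly_Mapping.keys P. Poly_Mapping.keys e \<subseteq> I)"

lemma is_subring_poly_at:
  fixes x :: "'i \<Rightarrow> 'l::field"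
  assumes K: "is_subfield K"
  shows "is_subring {poly_at x P |P. mpoly_over K I P}" (is "is_subring ?R")
proof -
  note c = is_subfield_closed[OF K]
  have mono: "c * monomial_at x e \<in> ?R" if "c \<in> K" "Poly_Mapping.keys e \<subseteq> I" for c e
    using that by (intro CollectI exI[of _ "Poly_Mapping.single e c"])
      (auto simp: poly_at_single mpoly_over_def lookup_single when_def c)
  have add: "u + w \<in> ?R" if "u \<in> ?R" "w \<in> ?R" for u w
  proof -
    from that obtain P Q where "u = poly_at x P" "mpoly_over K I P" "w = poly_at x Q" "mpoly_over K I Q"
      by blast
    then have "u + w = poly_at x (P + Q) \<and> mpoly_over K I (P + Q)"
      using keys_add[of P Q]
      unfolding mpoly_over_def poly_at_add lookup_add by (blast intro: c)
    then show ?thesis by blast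
  qed
  have zero: "0 \<in> ?R" using mono[of 0 0] by (simp add: c)
  have sum: "sum f J \<in> ?R" if "\<And>j. j \<in> J \<Longrightarrow> f j \<in> ?R" for f :: "('i \<Rightarrow>\<^sub>0 nat) \<Rightarrow> 'l" and J
    using that
  proof (induction J rule: infinite_finite_induct)
    case (insert j J)
    have "f j + sum f J \<in> ?R"
      by (intro add insert.IH insert.prems) auto
    then show ?case unfolding sum.insert[OF insert.hyps] .
  next
    case (infinite J)
    show ?case unfolding sum.infinite[OF infinite.hyps] by (rule zero)
  next
    case empty
    show ?case unfolding sum.empty by (rule zero)
  qed
  have mult: "u * w \<in> ?R" if "u \<in> ?R" "w \<in> ?R" for u w
  proof -
    from that obtain P Q where P: "u = poly_at x P" "mpoly_over K I P"
      and Q: "w = poly_at x Q" "mpoly_over K I Q" by blast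
    have "u * w = (\<Sum>e\<in>Poly_Mapping.keys P. \<Sum>f\<in>Poly_Mapping.keys Q.
        (Poly_Mapping.lookup P e * Poly_Mapping.lookup Q f) * monomial_at x (e + f))"
      by (simp add: P Q poly_at_superset[OF finite_keys order_refl] sum_product monomial_at_add mult_ac)
    also have "\<dots> \<in> ?R"
    proof (intro sum mono)
      fix e f assume e: "e \<in> Poly_Mapping.keys P" "f \<in> Poly_Mapping.keys Q"
      show "Poly_Mapping.lookup P e * Poly_Mapping.lookup Q f \<in> K"
        using P Q by (auto simp: mpoly_over_def intro!: c)
      show "Poly_Mapping.keys (e + f) \<subseteq> I"
        using keys_add[of e f] e P(2) Q(2) unfolding mpoly_over_def by blast
    qed
    finally show ?thesis .
  qed
  have um: "- w \<in> ?R" if "w \<in> ?R" for w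
    using mult[OF mono[of "-1" 0] that] by (simp add: c monomial_at_zero)
  show ?thesis
    unfolding is_subring_def using mono[of 1 0] add[OF _ um] mult by (auto simp: c monomial_at_zero)
qed

lemma mpoly_over_generators:
  assumes K: "is_subfield K"
  shows "K \<subseteq> {poly_at x P |P. mpoly_over K I P}" "x ` I \<subseteq> {poly_at x P |P. mpoly_over K I P}"
proof -
  have "a = poly_at x (Poly_Mapping.single 0 a) \<and> mpoly_over K I (Poly_Mapping.single 0 a)" if "a \<in> K" for a
    using that by (auto simp: poly_at_single mpoly_over_def monomial_at_zero lookup_single when_def
        is_subfield_closed[OF K])
  then show "K \<subseteq> {poly_at x P |P. mpoly_over K I P}" by blast
  define s where "s i = Poly_Mapping.single (Poly_Mapping.single i (1::nat)) (1::'a)" for i :: 'b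
  have "x i = poly_at x (s i) \<and> mpoly_over K I (s i)" if "i \<in> I" for i
    using that by (auto simp: s_def poly_at_single mpoly_over_def monomial_at_single lookup_single when_def
        is_subfield_closed[OF K])
  then show "x ` I \<subseteq> {poly_at x P |P. mpoly_over K I P}" by blast
qed

text \<open>A relation for \<open>x i\<close> over the other variables becomes, with denominators
  cleared, a polynomial \<open>P\<close> in all variables that vanishes at \<open>x\<close>. The
  work lies in checking that \<open>P\<close> itself is not 0.\<close>

lemma transcendental_if_algebraically_independent:
  assumes K: "is_subfield K" and ind: "algebraically_independent K I x"
    and J: "J \<subseteq> I" "i \<in> I" "i \<notin> J"
  shows "\<not> algebraic_over (field_adjoin K (x ` J)) (x i)"
proof
  assume "algebraic_over (field_adjoin K (x ` J)) (x i)"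
  then obtain p where p: "p \<noteq> 0" "\<And>k. Polynomial.coeff p k \<in> field_adjoin K (x ` J)" "poly p (x i) = 0"
    by (auto simp: algebraic_over_def)
  define n where "n = Polynomial.degree p"
  define R where "R = {poly_at x P |P. mpoly_over K J P}"
  have R: "is_subring R" unfolding R_def by (rule is_subring_poly_at[OF K])
  have "Polynomial.coeff p ` {..n} \<subseteq> {a / b |a b. a \<in> R \<and> b \<in> R}"
    using p(2) field_adjoin_fractions[OF R, of K "x ` J"] mpoly_over_generators[OF K, of x J]
    unfolding R_def by blast
  from common_denominator[OF R _ this] obtain d where
    d: "d \<noteq> 0" "\<And>k. k \<le> n \<Longrightarrow> d * Polynomial.coeff p k \<in> R" by auto
  then have "\<forall>k\<in>{..n}. \<exists>P. mpoly_over K J P \<and> d * Polynomial.coeff p k = poly_at x P"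
    unfolding R_def by blast
  then obtain Q where Q: "\<And>k. k \<le> n \<Longrightarrow> mpoly_over K J (Q k)"
    "\<And>k. k \<le> n \<Longrightarrow> d * Polynomial.coeff p k = poly_at x (Q k)" by (metis atMost_iff)
  \<comment> \<open>The variable \<open>i\<close> does not occur in the coefficients
    \<open>Q k\<close>, so different pairs give different exponents \<open>s e k\<close> and nothing
    cancels in \<open>P\<close>.\<close>
  define s where "s e k = e + Poly_Mapping.single i (k::nat)" for e k
  define P where "P = (\<Sum>k\<le>n. \<Sum>e\<in>Poly_Mapping.keys (Q k).
    Poly_Mapping.single (s e k) (Poly_Mapping.lookup (Q k) e))"
  have key_i: "Poly_Mapping.lookup e i = 0" if "k \<le> n" "e \<in> Poly_Mapping.keys (Q k)" for k e
  proof -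
    have "Poly_Mapping.keys e \<subseteq> J" using Q(1)[OF that(1)] that(2) by (simp add: mpoly_over_def)
    with J show ?thesis by (auto simp flip: not_in_keys_iff_lookup_eq_zero)
  qed
  have s_inj: "k = k' \<and> e = e'" if "s e k = s e' k'" "Poly_Mapping.lookup e i = 0" "Poly_Mapping.lookup e' i = 0"
    for e e' k k'
  proof -
    have "Poly_Mapping.lookup (s e k) i = Poly_Mapping.lookup (s e' k') i" using that by simp
    then have "k = k'" using that(2,3) by (simp add: s_def lookup_add)
    with that show ?thesis by (simp add: s_def)
  qed
  have look: "Poly_Mapping.lookup P (s e k) = Poly_Mapping.lookup (Q k) e"
    if "k \<le> n" "e \<in> Poly_Mapping.keys (Q k)" for e k
  proof -
    have "Poly_Mapping.lookup P (s e k) = (\<Sum>k'\<le>n. \<Sum>e'\<in>Poly_Mapping.keys (Q k').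
        (if k' = k then if e' = e then Poly_Mapping.lookup (Q k) e else 0 else 0))"
      unfolding P_def lookup_sum lookup_single when_def
    proof (intro sum.cong refl)
      fix k' e' assume "k' \<in> {..n}" "e' \<in> Poly_Mapping.keys (Q k')"
      then have "s e' k' = s e k \<longleftrightarrow> k' = k \<and> e' = e"
        using s_inj[of e' k' e k] key_i that by auto
      then show "(if s e' k' = s e k then Poly_Mapping.lookup (Q k') e' else 0) =
          (if k' = k then if e' = e then Poly_Mapping.lookup (Q k) e else 0 else 0)"
        by simp
    qed
    also have "\<dots> = (\<Sum>k'\<le>n. if k' = k then Poly_Mapping.lookup (Q k) e else 0)"
      using that by (intro sum.cong refl) auto
    finally show ?thesis using that by simp
  qed
  have "poly_at x P = (\<Sum>k\<le>n. poly_at x (Q k) * x i ^ k)"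
    unfolding P_def poly_at_sum poly_at_single s_def monomial_at_add monomial_at_single
    by (simp add: poly_at_superset[OF finite_keys order_refl] sum_distrib_right sum_distrib_left mult_ac)
  also have "\<dots> = d * poly p (x i)"
    unfolding poly_altdef[of p] sum_distrib_left n_def[symmetric]
    by (intro sum.cong refl) (simp add: Q(2)[symmetric])
  finally have P0: "poly_at x P = 0" by (simp add: p)
  have keysP: "e \<in> (\<Union>k\<le>n. (\<lambda>e. s e k) ` Poly_Mapping.keys (Q k))" if "e \<in> Poly_Mapping.keys P" for e
  proof (rule ccontr)
    assume "e \<notin> (\<Union>k\<le>n. (\<lambda>e. s e k) ` Poly_Mapping.keys (Q k))"
    then have "Poly_Mapping.lookup P e = 0"
      unfolding P_def lookup_sum lookup_single by (intro sum.neutral ballI) (auto simp: when_def)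
    with that show False by (simp add: in_keys_iff)
  qed
  have "Poly_Mapping.lookup P e \<in> K" for e
    unfolding P_def lookup_sum lookup_single when_def
    using Q(1) by (auto simp: mpoly_over_def intro!: is_subfield_closed[OF K])
  moreover have "Poly_Mapping.keys e \<subseteq> I" if "e \<in> Poly_Mapping.keys P" for e
  proof -
    from keysP[OF that] obtain k e' where e': "k \<le> n" "e' \<in> Poly_Mapping.keys (Q k)" "e = s e' k" by auto
    then have "Poly_Mapping.keys e' \<subseteq> J" using Q(1) by (auto simp: mpoly_over_def)
    then show ?thesis using e'(3) keys_add[of e' "Poly_Mapping.single i k"] J
      by (auto simp: s_def split: if_splits)
  qed
  ultimately have "P = 0" using ind P0 by (auto simp: algebraically_independent_def)
  have "d * Polynomial.coeff p n \<noteq> 0" using p(1) d by (simp add: n_def)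
  then have "poly_at x (Q n) \<noteq> 0" using Q(2)[of n] by simp
  then have "Q n \<noteq> 0" by (auto simp: poly_at_zero)
  then obtain e where "e \<in> Poly_Mapping.keys (Q n)" by fastforce
  with look[of n e] \<open>P = 0\<close> show False by (simp add: in_keys_iff)
qed

text \<open>The relation is sorted by powers of one variable \<open>y\<close>. If some coefficient
  has a nonzero value, \<open>y\<close> is algebraic over the rest; otherwise a nonzero coefficient
  is itself a relation in fewer variables.\<close>

lemma dependent_imp_algebraic_over_rest:
  fixes Y :: "'l::field set"
  assumes K: "is_subfield K" and "finite Y" "mpoly_over K Y P" "poly_at (\<lambda>s. s) P = 0" "P \<noteq> 0"
  shows "\<exists>y\<in>Y. algebraic_over (field_adjoin K (Y - {y})) y"
  using assms(2-)
proof (induction Y arbitrary: P rule: finite_induct)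
  case empty
  then have "Poly_Mapping.keys P \<subseteq> {0}" by (auto simp: mpoly_over_def)
  then have "poly_at (\<lambda>s. s) P = Poly_Mapping.lookup P 0"
    by (subst poly_at_superset[of "{0}"]) (auto simp: monomial_at_zero)
  with empty.prems have "Poly_Mapping.lookup P 0 = 0" by simp
  with \<open>Poly_Mapping.keys P \<subseteq> {0}\<close> have "Poly_Mapping.keys P = {}"
    by (metis in_keys_iff subset_singletonD singletonI)
  with empty.prems show ?case by simp
next
  case (insert y Y)
  define n where "n = Max (insert 0 ((\<lambda>e. Poly_Mapping.lookup e y) ` Poly_Mapping.keys P))"
  define D where "D j = {e \<in> Poly_Mapping.keys P. Poly_Mapping.lookup e y = j}" for j
  \<comment> \<open>Divides the monomial by \<open>y ^ j\<close>. The truncated subtraction of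
    exponents is exact on \<open>D j\<close>.\<close>
  define s where "s j e = e - Poly_Mapping.single y (j::nat)" for j e
  define Q where "Q j = (\<Sum>e\<in>D j. Poly_Mapping.single (s j e) (Poly_Mapping.lookup P e))" for j
  have se: "e = s j e + Poly_Mapping.single y j" if "e \<in> D j" for j e
    using that by (auto intro!: poly_mapping_eqI simp: s_def D_def lookup_add lookup_minus lookup_single when_def)
  have fD: "finite (D j)" for j by (auto simp: D_def)
  have keysP: "Poly_Mapping.keys P = (\<Union>j\<le>n. D j)"
    by (auto simp: D_def n_def intro!: Max_ge)
  have "poly_at (\<lambda>s. s) P = (\<Sum>j\<le>n. \<Sum>e\<in>D j. Poly_Mapping.lookup P e * monomial_at (\<lambda>s. s) e)"
    unfolding poly_at_superset[OF finite_keys order_refl] keysP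
    by (rule sum.UNION_disjoint) (auto simp: D_def)
  also have "\<dots> = (\<Sum>j\<le>n. poly_at (\<lambda>s. s) (Q j) * y ^ j)"
  proof (intro sum.cong refl)
    fix j
    have "Poly_Mapping.lookup P e * monomial_at (\<lambda>s. s) e =
        Poly_Mapping.lookup P e * monomial_at (\<lambda>s. s) (s j e) * y ^ j" if "e \<in> D j" for e
      by (subst se[OF that]) (simp add: monomial_at_add monomial_at_single)
    then show "(\<Sum>e\<in>D j. Poly_Mapping.lookup P e * monomial_at (\<lambda>s. s) e) = poly_at (\<lambda>s. s) (Q j) * y ^ j"
      unfolding Q_def poly_at_sum poly_at_single sum_distrib_right by (intro sum.cong refl) simp
  qed
  finally have sum0: "(\<Sum>j\<le>n. poly_at (\<lambda>s. s) (Q j) * y ^ j) = 0" using insert.prems by simp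
  have Qover: "mpoly_over K Y (Q j)" for j
    unfolding mpoly_over_def
  proof (intro conjI allI ballI)
    show "Poly_Mapping.lookup (Q j) e \<in> K" for e
      using insert.prems(1) unfolding Q_def lookup_sum lookup_single when_def
      by (auto simp: mpoly_over_def intro!: is_subfield_closed[OF K])
    fix e assume e: "e \<in> Poly_Mapping.keys (Q j)"
    have "\<exists>e'\<in>D j. e = s j e'"
    proof (rule ccontr)
      assume "\<not> (\<exists>e'\<in>D j. e = s j e')"
      then have "Poly_Mapping.lookup (Q j) e = 0"
        unfolding Q_def lookup_sum lookup_single by (intro sum.neutral ballI) (auto simp: when_def)
      with e show False by (simp add: in_keys_iff)
    qed
    then obtain e' where e': "e' \<in> D j" "e = s j e'" by blast
    then have "Poly_Mapping.keys e' \<subseteq> insert y Y" using insert.prems(1) by (auto simp: mpoly_over_def D_def)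
    moreover have "Poly_Mapping.lookup e y = 0"
      using e' by (simp add: s_def D_def lookup_minus)
    moreover have "Poly_Mapping.lookup e i \<le> Poly_Mapping.lookup e' i" for i
      using e' by (simp add: s_def lookup_minus)
    ultimately show "Poly_Mapping.keys e \<subseteq> Y"
      by (metis (no_types, lifting) in_keys_iff insert_iff le_zero_eq subset_iff)
  qed
  show ?case
  proof (cases "\<forall>j\<le>n. poly_at (\<lambda>s. s) (Q j) = 0")
    case True
    obtain e0 where e0: "e0 \<in> Poly_Mapping.keys P" using insert.prems by fastforce
    with keysP obtain j where j: "j \<le> n" "e0 \<in> D j" by auto
    have "Poly_Mapping.lookup (Q j) (s j e0) = (\<Sum>e\<in>D j. if e = e0 then Poly_Mapping.lookup P e else 0)"
      unfolding Q_def lookup_sum lookup_single when_def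
      by (intro sum.cong refl) (use se j in metis)
    also have "\<dots> \<noteq> 0" using j e0 fD by (simp add: in_keys_iff)
    finally have "Q j \<noteq> 0" by auto
    with insert.IH[OF Qover[of j]] True j obtain y' where
      y': "y' \<in> Y" "algebraic_over (field_adjoin K (Y - {y'})) y'" by auto
    have "algebraic_over (field_adjoin K (insert y Y - {y'})) y'"
      by (rule algebraic_over_mono[OF y'(2)], rule field_adjoin_mono) auto
    with y' show ?thesis by blast
  next
    case False
    then obtain j where j: "j \<le> n" "poly_at (\<lambda>s. s) (Q j) \<noteq> 0" by auto
    have "poly_at (\<lambda>s. s) (Q j) \<in> field_adjoin K Y" for j
      unfolding poly_at_def
      using Qover[of j] by (auto simp: mpoly_over_def intro!: is_subfield_closed[OF field_adjoin_subfield]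
          intro: field_adjoin_base field_adjoin_gen)
    then have "algebraic_over (field_adjoin K Y) y"
      using algebraic_overI[OF field_adjoin_subfield, where I = "{..n}" and c = "\<lambda>j. poly_at (\<lambda>s. s) (Q j)" and ?i0.0 = j] j sum0
      by auto
    then show ?thesis using insert.hyps by (intro bexI[of _ y]) auto
  qed
qed

text \<open>Members of \<open>Y\<close> are exchanged for variables \<open>x j\<close> one by one,
  and all variables stay algebraic over the mixed set.\<close>

lemma transcendence_degree_le:
  assumes K: "is_subfield K" and I: "finite I" and ind: "algebraically_independent K I x"
    and Y: "finite Y" and alg: "\<And>i. i \<in> I \<Longrightarrow> algebraic_over (field_adjoin K Y) (x i)"
  shows "card I \<le> card Y"
proof -
  have "\<exists>Y'\<subseteq>Y. card Y' + card J = card Y \<and> (\<forall>i\<in>I. algebraic_over (field_adjoin K (x ` J \<union> Y')) (x i))"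
    if "finite J" "J \<subseteq> I" for J
    using that
  proof (induction J rule: finite_induct)
    case empty
    then show ?case using alg by (intro exI[of _ Y]) auto
  next
    case (insert j J)
    then obtain Y' where Y': "Y' \<subseteq> Y" "card Y' + card J = card Y"
      "\<And>i. i \<in> I \<Longrightarrow> algebraic_over (field_adjoin K (x ` J \<union> Y')) (x i)" by auto
    have fY': "finite Y'" using Y' Y finite_subset by blast
    \<comment> \<open>A minimal \<open>Z\<close> is not empty, because \<open>x j\<close> is
      transcendental over the other variables. By minimality the exchange lemma can remove any
      \<open>y\<close> in \<open>Z\<close>.\<close>
    define P where "P Z \<longleftrightarrow> Z \<subseteq> Y' \<and> algebraic_over (field_adjoin K (x ` J \<union> Z)) (x j)" for Z
    have "P Y'" using Y' insert.prems by (auto simp: P_def)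
    then obtain Z where Z: "P Z" "\<And>Z'. card Z' < card Z \<Longrightarrow> \<not> P Z'"
      using ex_has_least_nat[of P Y' card] by (metis not_le)
    have "\<not> algebraic_over (field_adjoin K (x ` J)) (x j)"
      by (rule transcendental_if_algebraically_independent[OF K ind]) (use insert in auto)
    then obtain y where y: "y \<in> Z" using Z(1) by (fastforce simp: P_def)
    have fZ: "finite Z" using Z(1) fY' finite_subset by (auto simp: P_def)
    have "\<not> P (Z - {y})" using Z(2)[of "Z - {y}"] card_Diff1_less[OF fZ y] by blast
    then have na: "\<not> algebraic_over (field_adjoin K (x ` J \<union> (Z - {y}))) (x j)"
      using Z(1) by (auto simp: P_def)
    have "algebraic_over (field_adjoin (field_adjoin K (x ` J \<union> (Z - {y}))) {y}) (x j)"
    proof -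
      have "x ` J \<union> Z = (x ` J \<union> (Z - {y})) \<union> {y}" using y by auto
      then show ?thesis using Z(1) field_adjoin_Un[of K "x ` J \<union> (Z - {y})" "{y}"] by (auto simp: P_def)
    qed
    from algebraic_over_exchange[OF field_adjoin_subfield this na]
    have "algebraic_over (field_adjoin K ((x ` J \<union> (Z - {y})) \<union> {x j})) y"
      by (simp only: field_adjoin_Un)
    then have y_alg: "algebraic_over (field_adjoin K (x ` insert j J \<union> (Y' - {y}))) y"
      by (rule algebraic_over_mono, intro field_adjoin_mono) (use Z(1) in \<open>auto simp: P_def\<close>)
    have "algebraic_over (field_adjoin K (x ` insert j J \<union> (Y' - {y}))) (x i)" if "i \<in> I" for i
    proof (rule algebraic_over_trans[OF field_adjoin_subfield y_alg])
      show "algebraic_over (field_adjoin (field_adjoin K (x ` insert j J \<union> (Y' - {y}))) {y}) (x i)"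
        unfolding field_adjoin_Un[symmetric]
        by (rule algebraic_over_mono[OF Y'(3)[OF that]], intro field_adjoin_mono) auto
    qed
    moreover have "Y' - {y} \<subseteq> Y" using Y'(1) by blast
    moreover have "card (Y' - {y}) + card (insert j J) = card Y"
    proof -
      have "y \<in> Y'" using y Z(1) by (auto simp: P_def)
      then have "Suc (card (Y' - {y})) = card Y'" by (rule card_Suc_Diff1[OF fY'])
      then show ?thesis using Y'(2) insert.hyps by simp
    qed
    ultimately show ?case by blast
  qed
  from this[OF I order_refl] show ?thesis by (metis le_add2)
qed

lemma transcendental_if_generated_by_few:
  assumes K: "is_subfield K" and I: "finite I" and ind: "algebraically_independent K I x"
    and Y: "finite Y" "card Y \<le> card I" and alg: "\<And>u. algebraic_over (field_adjoin K Y) u" and y: "y \<in> Y"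
  shows "\<not> algebraic_over (field_adjoin K (Y - {y})) y"
proof
  assume y_alg: "algebraic_over (field_adjoin K (Y - {y})) y"
  have "algebraic_over (field_adjoin K (Y - {y})) u" for u
  proof (rule algebraic_over_trans[OF field_adjoin_subfield y_alg])
    show "algebraic_over (field_adjoin (field_adjoin K (Y - {y})) {y}) u"
      unfolding field_adjoin_Un[symmetric]
      by (rule algebraic_over_mono[OF alg], rule field_adjoin_mono) auto
  qed
  from transcendence_degree_le[OF K I ind, of "Y - {y}", OF _ this]
  have "card I \<le> card (Y - {y})" using Y(1) by simp
  moreover have "card (Y - {y}) < card Y" using Y(1) y by (rule card_Diff1_less)
  ultimately show False using Y(2) by simp
qed

text \<open>A member of \<open>Y\<close> algebraic over the others could be dropped, and
  \<open>Y\<close> would be too small for the transcendence degree. This is why only numbers of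
  generators are counted below and independence is never checked directly.\<close>

lemma rational_if_generated_by_few:
  assumes K: "is_subfield K" and I: "finite I" and ind: "algebraically_independent K I x"
    and Y: "finite Y" "card Y \<le> card I" and alg: "\<And>u. algebraic_over (field_adjoin K Y) u"
  shows "rational_over K (field_adjoin K Y)"
  unfolding rational_over_def
proof (intro exI conjI)
  show "algebraically_independent K Y (\<lambda>s. s)"
    unfolding algebraically_independent_def
  proof (intro allI impI)
    fix P :: "('a \<Rightarrow>\<^sub>0 nat) \<Rightarrow>\<^sub>0 'a"
    assume P: "(\<forall>e. Poly_Mapping.lookup P e \<in> K) \<and> (\<forall>e\<in>Poly_Mapping.keys P. Poly_Mapping.keys e \<subseteq> Y) \<and> poly_at (\<lambda>s. s) P = 0"
    then have "mpoly_over K Y P" by (auto simp: mpoly_over_def)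
    with dependent_imp_algebraic_over_rest[OF K Y(1), of P] P
      transcendental_if_generated_by_few[OF K I ind Y alg]
    show "P = 0" by auto
  qed
qed simp

section \<open>Permutation lattices of cyclic \<open>p\<close>-groups\<close>

text \<open>An abelian group regarded as a module over Z[\<open>lam\<close>]. The operator is a
  parameter because the bound on generators is used with g - 1 for \<open>lam\<close> and also with
  multiplication by \<open>p\<close>.\<close>

locale lattice_operator = Modules.module scale
  for scale :: "int \<Rightarrow> 'a::ab_group_add \<Rightarrow> 'a" (infixr "*s" 75) +
  fixes lam :: "'a \<Rightarrow> 'a"
  assumes lam_diff: "lam (f - h) = lam f - lam h"
begin

lemmas scale_simps = scale_left_distrib scale_right_distrib scale_left_diff_distrib scale_right_diff_distrib
  scale_zero_left scale_zero_right scale_one scale_scale[symmetric]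

lemma lam_0: "lam 0 = 0"
  using lam_diff[of 0 0] by simp

lemma lam_add: "lam (f + h) = lam f + lam h"
  using lam_diff[of f "0 - h"] lam_diff[of 0 h] by (simp add: lam_0)

lemma lam_pow_diff: "(lam ^^ k) (f - h) = (lam ^^ k) f - (lam ^^ k) h"
  by (induction k) (auto simp: lam_diff)

lemma lam_pow_add: "(lam ^^ k) (f + h) = (lam ^^ k) f + (lam ^^ k) h"
  by (induction k) (auto simp: lam_add)

definition submodule :: "'a set \<Rightarrow> bool" where
  "submodule S \<longleftrightarrow> 0 \<in> S \<and> (\<forall>f\<in>S. \<forall>h\<in>S. f - h \<in> S) \<and> (\<forall>f\<in>S. lam f \<in> S)"

definition lspan :: "'a set \<Rightarrow> 'a set" where
  "lspan B = \<Inter>{S. submodule S \<and> B \<subseteq> S}"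

lemma lspan_least: "submodule S \<Longrightarrow> B \<subseteq> S \<Longrightarrow> lspan B \<subseteq> S"
  by (auto simp: lspan_def)

lemma lspan_incl: "B \<subseteq> lspan B"
  by (auto simp: lspan_def)

lemma submodule_lspan: "submodule (lspan B)"
  by (auto simp: lspan_def submodule_def)

lemma lspan_mono: "B \<subseteq> C \<Longrightarrow> lspan B \<subseteq> lspan C"
  by (rule lspan_least[OF submodule_lspan]) (use lspan_incl[of C] in blast)

lemma lam_scale: "lam (u *s f) = u *s lam f"
proof -
  have n: "lam (int n *s f) = int n *s lam f" for n
    by (induction n) (auto simp: lam_0 lam_add scale_left_distrib)
  show ?thesis
  proof (cases u)
    case (neg k)
    then show ?thesis using lam_diff[of 0 "int (Suc k) *s f"] n[of "Suc k"] by (simp add: lam_0 scale_minus_left del: of_nat_Suc)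
  qed (use n in simp)
qed

lemma lam_pow_scale: "(lam ^^ k) (u *s f) = u *s (lam ^^ k) f"
  by (induction k) (auto simp: lam_scale)

context
  fixes S
  assumes S: "submodule S"
begin

lemma submodule_zero: "0 \<in> S" and submodule_diff: "f \<in> S \<Longrightarrow> h \<in> S \<Longrightarrow> f - h \<in> S"
  and submodule_lam: "f \<in> S \<Longrightarrow> lam f \<in> S"
  using S by (auto simp: submodule_def)

lemma submodule_uminus: "f \<in> S \<Longrightarrow> - f \<in> S"
  using submodule_diff[OF submodule_zero, of f] by simp

lemma submodule_add: "f \<in> S \<Longrightarrow> h \<in> S \<Longrightarrow> f + h \<in> S"
  using submodule_diff[OF _ submodule_uminus, of f h] by simp

lemma submodule_lam_pow: "f \<in> S \<Longrightarrow> (lam ^^ k) f \<in> S"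
  by (induction k) (auto intro: submodule_lam)

lemma submodule_sum: "(\<And>j. j \<in> J \<Longrightarrow> F j \<in> S) \<Longrightarrow> sum F J \<in> S"
  by (induction J rule: infinite_finite_induct) (auto intro: submodule_zero submodule_add)

lemma submodule_scale:
  assumes "f \<in> S" shows "u *s f \<in> S"
proof -
  have n: "int n *s f \<in> S" for n
    by (induction n) (auto simp: scale_simps submodule_zero assms intro: submodule_add)
  show ?thesis
  proof (cases u)
    case (neg k)
    then have "u *s f = - (int (Suc k) *s f)" by (simp only: scale_minus_left)
    then show ?thesis using submodule_uminus[OF n] by metis
  qed (use n in simp)
qed

end

lemma submodule_plus:
  assumes V: "submodule V" and W: "submodule W"
  shows "submodule {v + w |v w. v \<in> V \<and> w \<in> W}"
proof -
  let ?S = "{v + w |v w. v \<in> V \<and> w \<in> W}"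
  have I: "v + w \<in> ?S" if "v \<in> V" "w \<in> W" for v w using that by blast
  have "0 \<in> ?S" using I[OF submodule_zero[OF V] submodule_zero[OF W]] by simp
  moreover have "f - h \<in> ?S" if fh: "f \<in> ?S" "h \<in> ?S" for f h
  proof -
    from fh obtain v w v' w' where *: "f = v + w" "v \<in> V" "w \<in> W" "h = v' + w'" "v' \<in> V" "w' \<in> W" by blast
    have "f - h = (v - v') + (w - w')" by (simp add: *)
    then show ?thesis using I[OF submodule_diff[OF V *(2,5)] submodule_diff[OF W *(3,6)]] by simp
  qed
  moreover have "lam f \<in> ?S" if f: "f \<in> ?S" for f
  proof -
    from f obtain v w where *: "f = v + w" "v \<in> V" "w \<in> W" by blast
    then show ?thesis using I[OF submodule_lam[OF V *(2)] submodule_lam[OF W *(3)]] by (simp add: lam_add)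
  qed
  ultimately show ?thesis unfolding submodule_def by blast
qed

lemma lspan_Un_subset:
  assumes W: "submodule W"
  shows "lspan (W \<union> B) \<subseteq> {w + z |w z. w \<in> W \<and> z \<in> lspan B}"
proof (rule lspan_least[OF submodule_plus[OF W submodule_lspan]])
  have "w = w + 0" "z = 0 + z" for w z :: "'a" by simp_all
  then show "W \<union> B \<subseteq> {w + z |w z. w \<in> W \<and> z \<in> lspan B}"
    using submodule_zero[OF W] submodule_zero[OF submodule_lspan] lspan_incl[of B] by blast
qed

text \<open>A polynomial in \<open>lam\<close> is a constant plus a multiple of
  \<open>lam\<close>.\<close>

lemma lspan_singleton_decomp:
  assumes "z \<in> lspan {y}" shows "\<exists>u. \<exists>z'\<in>lspan {y}. z = u *s y + lam z'"
proof -
  let ?S = "{u *s y + lam z' |u z'. z' \<in> lspan {y}}"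
  note sp = submodule_lspan[of "{y}"]
  have y: "y \<in> lspan {y}" using lspan_incl by blast
  have I: "u *s y + lam z' \<in> ?S" if "z' \<in> lspan {y}" for u z' using that by blast
  have S_sub: "f \<in> lspan {y}" if f: "f \<in> ?S" for f
    using f submodule_add[OF sp] submodule_scale[OF sp y] submodule_lam[OF sp] by blast
  have "submodule ?S"
    unfolding submodule_def
  proof (intro conjI ballI)
    show "0 \<in> ?S" using I[OF submodule_zero[OF sp], of 0] by (simp add: scale_simps lam_0)
    fix f h assume "f \<in> ?S" "h \<in> ?S"
    then obtain u z' w z'' where *: "f = u *s y + lam z'" "z' \<in> lspan {y}"
      "h = w *s y + lam z''" "z'' \<in> lspan {y}" by blast
    have "f - h = (u - w) *s y + lam (z' - z'')"
      by (simp add: * scale_simps lam_diff)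
    then show "f - h \<in> ?S" using I[OF submodule_diff[OF sp *(2,4)]] by simp
  next
    fix f assume "f \<in> ?S"
    then have "f \<in> lspan {y}" by (rule S_sub)
    then show "lam f \<in> ?S" using I[of f 0] by (simp add: scale_simps)
  qed
  moreover have "{y} \<subseteq> ?S"
    using I[OF submodule_zero[OF sp], of 1] by (simp add: scale_simps lam_0)
  ultimately have "lspan {y} \<subseteq> ?S" by (rule lspan_least)
  with assms show ?thesis by blast
qed

lemma lam_lspan_singleton:
  assumes "z \<in> lspan {y}" shows "(lam ^^ k) z \<in> lspan {(lam ^^ k) y}"
proof -
  note sp = submodule_lspan[of "{(lam ^^ k) y}"]
  have "lspan {y} \<subseteq> {z. (lam ^^ k) z \<in> lspan {(lam ^^ k) y}}"
  proof (rule lspan_least)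
    have "(lam ^^ k) 0 = 0" by (induction k) (auto simp: lam_0)
    moreover have "(lam ^^ k) (lam f) = lam ((lam ^^ k) f)" for f
      by (simp add: funpow_swap1)
    ultimately show "submodule {z. (lam ^^ k) z \<in> lspan {(lam ^^ k) y}}"
      using submodule_zero[OF sp] submodule_diff[OF sp] submodule_lam[OF sp]
      by (auto simp: submodule_def lam_pow_diff)
  qed (use lspan_incl in auto)
  with assms show ?thesis by blast
qed

text \<open>
  Modulo \<open>P0\<close> each generator spans a module whose submodules form a chain, as over a discrete
  valuation ring with uniformizer \<open>lam\<close> and residue field of order \<open>p\<close>. A submodule containing
  a power of \<open>lam\<close> times each generator therefore needs no more generators than the whole module.
\<close>

lemma submodule_generators:
  fixes p :: nat
  assumes p: "Factorial_Ring.prime p" and P0: "submodule P0" and "submodule M" and "finite G"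
    and "M \<subseteq> lspan (P0 \<union> G)"
    and "\<And>y. y \<in> lspan (P0 \<union> G) \<Longrightarrow> \<exists>w\<in>lspan {y}. \<exists>z\<in>P0. int p *s y = lam w + z"
    and "\<And>g. g \<in> G \<Longrightarrow> \<exists>k. \<exists>m\<in>M. \<exists>z\<in>P0. (lam ^^ k) g = m + z"
  shows "\<exists>B\<subseteq>M. finite B \<and> card B \<le> card G \<and> M \<subseteq> lspan (P0 \<union> B)"
  using assms(4,3,5-)
proof (induction G arbitrary: M rule: finite_induct)
  case empty
  then show ?case by (intro exI[of _ "{}"]) auto
next
  case (insert g G)
  note M = insert.prems(1)
  define W where "W = lspan (P0 \<union> G)"
  have W: "submodule W" unfolding W_def by (rule submodule_lspan)
  have P0W: "P0 \<subseteq> W" "G \<subseteq> W" unfolding W_def using lspan_incl[of "P0 \<union> G"] by auto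
  have Wg: "W \<subseteq> lspan (P0 \<union> insert g G)" unfolding W_def by (rule lspan_mono) auto
  have "\<exists>B\<subseteq>M \<inter> W. finite B \<and> card B \<le> card G \<and> M \<inter> W \<subseteq> lspan (P0 \<union> B)"
  proof (rule insert.IH)
    show "submodule (M \<inter> W)" using M W by (auto simp: submodule_def)
    show "M \<inter> W \<subseteq> lspan (P0 \<union> G)" by (auto simp: W_def)
    show "\<exists>w\<in>lspan {y}. \<exists>z\<in>P0. int p *s y = lam w + z" if "y \<in> lspan (P0 \<union> G)" for y
      using insert.prems(3)[of y] that Wg by (auto simp: W_def)
    show "\<exists>k. \<exists>m\<in>M \<inter> W. \<exists>z\<in>P0. (lam ^^ k) g' = m + z" if g': "g' \<in> G" for g'
    proof -
      from insert.prems(4)[of g'] g' obtain k m z where *: "m \<in> M" "z \<in> P0" "(lam ^^ k) g' = m + z" by auto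
      have "m = (lam ^^ k) g' - z" by (simp add: *)
      also have "\<dots> \<in> W" using submodule_diff[OF W submodule_lam_pow[OF W]] g' * P0W by blast
      finally show ?thesis using * by blast
    qed
  qed
  then obtain B where B: "B \<subseteq> M \<inter> W" "finite B" "card B \<le> card G" "M \<inter> W \<subseteq> lspan (P0 \<union> B)" by blast
  \<comment> \<open>Modulo \<open>W\<close> the whole module is generated by \<open>g\<close> alone.
    The aim is that \<open>M\<close> becomes there the multiples of \<open>lam ^^ k\<close> applied
    to \<open>g\<close>, with the least \<open>k\<close> for which this vector lies in
    \<open>MW\<close>.\<close>
  define MW where "MW = {m + w |m w. m \<in> M \<and> w \<in> W}"
  have MW: "submodule MW" unfolding MW_def by (rule submodule_plus[OF M W])
  have MMW: "M \<subseteq> MW" "W \<subseteq> MW"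
  proof -
    have "m + 0 \<in> MW" if "m \<in> M" for m unfolding MW_def using that submodule_zero[OF W] by blast
    then show "M \<subseteq> MW" by auto
    have "0 + w \<in> MW" if "w \<in> W" for w unfolding MW_def using that submodule_zero[OF M] by blast
    then show "W \<subseteq> MW" by auto
  qed
  define k where "k = (LEAST k. (lam ^^ k) g \<in> MW)"
  have "\<exists>k. (lam ^^ k) g \<in> MW"
    using insert.prems(4)[of g] P0W unfolding MW_def by blast
  then have k: "(lam ^^ k) g \<in> MW" and kmin: "\<And>i. i < k \<Longrightarrow> (lam ^^ i) g \<notin> MW"
    unfolding k_def by (rule LeastI_ex) (use not_less_Least in blast)
  define C where "C i = {w + z |w z. w \<in> W \<and> z \<in> lspan {(lam ^^ i) g}}" for i
  have CI: "w + z \<in> C i" if "w \<in> W" "z \<in> lspan {(lam ^^ i) g}" for w z i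
    unfolding C_def using that by blast
  have gspan: "(lam ^^ i) g \<in> lspan (P0 \<union> insert g G)" for i
    by (rule submodule_lam_pow[OF submodule_lspan]) (use lspan_incl in fastforce)
  have spMW: "lspan {(lam ^^ k) g} \<subseteq> MW" by (rule lspan_least[OF MW]) (use k in auto)
  \<comment> \<open>\<open>M\<close> is pushed down the chain \<open>C i\<close>. The part of an
    element that is not yet divisible by \<open>lam\<close> is an integer multiple of
    \<open>(lam ^^ i) g\<close>; a multiple of \<open>p\<close> counts as divisible.\<close>
  have chain: "M \<subseteq> C i" if "i \<le> k" for i
    using that
  proof (induction i)
    case 0
    have "P0 \<union> insert g G \<subseteq> W \<union> {g}" using P0W by auto
    then have "lspan (P0 \<union> insert g G) \<subseteq> lspan (W \<union> {g})" by (rule lspan_mono)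
    also have "\<dots> \<subseteq> C 0" using lspan_Un_subset[OF W, of "{g}"] by (simp add: C_def)
    finally show ?case using insert.prems(2) by blast
  next
    case (Suc i)
    show ?case
    proof
      fix m assume m: "m \<in> M"
      with Suc have "m \<in> C i" by auto
      then obtain w z where wz: "m = w + z" "w \<in> W" "z \<in> lspan {(lam ^^ i) g}" unfolding C_def by blast
      from lspan_singleton_decomp[OF wz(3)] obtain u z' where
        z': "z' \<in> lspan {(lam ^^ i) g}" "z = u *s ((lam ^^ i) g) + lam z'" by blast
      have lz': "lam z' \<in> lspan {(lam ^^ Suc i) g}" using lam_lspan_singleton[OF z'(1), of 1] by simp
      show "m \<in> C (Suc i)"
      proof (cases "int p dvd u")
        case True
        then obtain u' where u': "u = u' * int p" by (metis dvdE mult.commute)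
        from insert.prems(3)[OF gspan[of i]] obtain v y where
          v: "v \<in> lspan {(lam ^^ i) g}" "y \<in> P0" "int p *s ((lam ^^ i) g) = lam v + y" by blast
        have tau_exp: "lam v \<in> lspan {(lam ^^ Suc i) g}" using lam_lspan_singleton[OF v(1), of 1] by simp
        have "m = (w + u' *s y) + (u' *s (lam v) + lam z')"
          by (simp add: wz(1) z'(2) u' scale_simps v(3))
        moreover have "w + u' *s y \<in> W"
          using submodule_add[OF W wz(2)] submodule_scale[OF W] v(2) P0W by blast
        moreover have "u' *s (lam v) + lam z' \<in> lspan {(lam ^^ Suc i) g}"
          using submodule_add[OF submodule_lspan _ lz'] submodule_scale[OF submodule_lspan tau_exp] by blast
        ultimately show ?thesis using CI by metis
      next
        case False
        \<comment> \<open>Now \<open>u\<close> is prime to \<open>p\<close>. Applying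
          \<open>lam ^^ r\<close> puts \<open>u\<close> times \<open>y\<close> into
          \<open>MW\<close>, and \<open>p\<close> times \<open>y\<close> lies there anyway. By
          Bezout \<open>y\<close> would lie there too, against the minimality of
          \<open>k\<close>.\<close>
        define r where "r = k - Suc i"
        have r: "r + i = k - 1" "k \<noteq> 0" "Suc (r + i) = k" using Suc.prems by (auto simp: r_def)
        define y where "y = (lam ^^ (k - 1)) g"
        have y: "(lam ^^ r) ((lam ^^ i) g) = y" "lam y = (lam ^^ k) g"
          using r by (simp_all add: y_def flip: funpow_add[THEN fun_cong, unfolded comp_apply])
            (metis comp_apply funpow.simps(2))
        have e1: "u *s y \<in> MW"
        proof -
          have "u *s y = (lam ^^ r) m - (lam ^^ r) w - (lam ^^ r) (lam z')"
            by (simp add: wz(1) z'(2) lam_pow_add lam_pow_scale y)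
          moreover have "(lam ^^ r) m \<in> MW" using submodule_lam_pow[OF MW] m MMW by blast
          moreover have "(lam ^^ r) w \<in> MW" using submodule_lam_pow[OF MW] wz(2) MMW by blast
          moreover have "(lam ^^ r) ((lam ^^ Suc i) g) = (lam ^^ k) g"
            by (metis add_Suc_right comp_apply funpow_add r(3))
          then have "(lam ^^ r) (lam z') \<in> MW"
            using lam_lspan_singleton[OF lz', of r] spMW by auto
          ultimately show ?thesis using submodule_diff[OF MW] by auto
        qed
        have e2: "int p *s y \<in> MW"
        proof -
          from insert.prems(3)[OF gspan[of "k - 1"]] obtain v x where
            v: "v \<in> lspan {y}" "x \<in> P0" "int p *s y = lam v + x" unfolding y_def by blast
          have "lam v \<in> lspan {(lam ^^ k) g}" using lam_lspan_singleton[OF v(1), of 1] y(2) by simp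
          then have "lam v \<in> MW" "x \<in> MW" using v(2) spMW MMW P0W by blast+
          then show ?thesis unfolding v(3) by (rule submodule_add[OF MW])
        qed
        have "coprime u (int p)"
          using False p by (metis coprime_commute prime_imp_coprime prime_nat_int_transfer)
        then obtain s t where st: "s * u + t * int p = 1"
          using bezout_int[of u "int p"] by auto
        have "y = (s * u + t * int p) *s y" by (simp add: st scale_simps)
        also have "\<dots> = s *s (u *s y) + t *s (int p *s y)"
          by (simp only: scale_simps)
        also have "\<dots> \<in> MW"
          using submodule_add[OF MW submodule_scale[OF MW e1] submodule_scale[OF MW e2]] .
        finally show ?thesis using kmin[of "k - 1"] r by (auto simp: y_def)
      qed
    qed
  qed
  \<comment> \<open>The one additional generator: an element \<open>x\<close> of \<open>M\<close>
    that agrees with \<open>(lam ^^ k) g\<close> modulo \<open>W\<close>.\<close>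
  from k obtain x w where xw: "(lam ^^ k) g = x + w" "x \<in> M" "w \<in> W" unfolding MW_def by blast
  have "M \<subseteq> lspan (P0 \<union> insert x B)"
  proof
    fix m assume m: "m \<in> M"
    with chain[of k] obtain w' z where wz: "m = w' + z" "w' \<in> W" "z \<in> lspan {(lam ^^ k) g}"
      unfolding C_def by blast
    have "lspan {(lam ^^ k) g} \<subseteq> {v + y |v y. v \<in> W \<and> y \<in> lspan {x}}"
    proof (rule lspan_least[OF submodule_plus[OF W submodule_lspan]])
      have "(lam ^^ k) g = w + x" by (simp add: xw)
      then show "{(lam ^^ k) g} \<subseteq> {v + y |v y. v \<in> W \<and> y \<in> lspan {x}}"
        using xw(3) lspan_incl[of "{x}"] by blast
    qed
    with wz(3) obtain v y where vy: "z = v + y" "v \<in> W" "y \<in> lspan {x}" by blast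
    have "y \<in> M" using lspan_least[OF M, of "{x}"] vy xw by blast
    have "m - y = w' + v" by (simp add: wz vy)
    then have "m - y \<in> M \<inter> W"
      using submodule_diff[OF M m \<open>y \<in> M\<close>] submodule_add[OF W wz(2) vy(2)] by auto
    then have "m - y \<in> lspan (P0 \<union> insert x B)" using B(4) lspan_mono[of "P0 \<union> B" "P0 \<union> insert x B"] by blast
    moreover have "y \<in> lspan (P0 \<union> insert x B)" using vy(3) lspan_mono[of "{x}" "P0 \<union> insert x B"] by blast
    ultimately have "(m - y) + y \<in> lspan (P0 \<union> insert x B)" by (rule submodule_add[OF submodule_lspan])
    then show "m \<in> lspan (P0 \<union> insert x B)" by simp
  qed
  moreover have "card (insert x B) \<le> card (insert g G)"
    using B(3) insert.hyps card_insert_le_m1[of "Suc (card G)" B x] by simp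
  ultimately show ?case using B xw by (intro exI[of _ "insert x B"]) auto
qed

text \<open>The modular law: what an element of \<open>M\<close> has in \<open>P0\<close> is a
  difference of two elements of \<open>M\<close>, hence lies in \<open>M\<close>.\<close>

lemma lspan_relative:
  assumes M: "submodule M" and P0: "submodule P0" and "B \<subseteq> M" "M \<subseteq> lspan (P0 \<union> B)"
  shows "M \<subseteq> lspan (M \<inter> P0 \<union> B)"
proof
  fix m assume m: "m \<in> M"
  with assms(4) lspan_Un_subset[OF P0, of B] obtain z b where zb: "m = z + b" "z \<in> P0" "b \<in> lspan B"
    by blast
  have "b \<in> M" using lspan_least[OF M assms(3)] zb by blast
  then have "m - b \<in> M" by (rule submodule_diff[OF M m])
  then have "z \<in> M" unfolding zb(1) by simp
  then have "z \<in> M \<inter> P0" using zb(2) by blast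
  then have "z \<in> lspan (M \<inter> P0 \<union> B)" using lspan_incl[of "M \<inter> P0 \<union> B"] by blast
  moreover have "b \<in> lspan (M \<inter> P0 \<union> B)" using zb lspan_mono[of B "M \<inter> P0 \<union> B"] by blast
  ultimately show "m \<in> lspan (M \<inter> P0 \<union> B)" unfolding zb by (rule submodule_add[OF submodule_lspan])
qed

end

lemma prime_dvd_choose_prime_power:
  fixes p :: nat
  assumes p: "Factorial_Ring.prime p" and i: "0 < i" "i < p ^ j"
  shows "p dvd (p ^ j choose i)"
proof (rule ccontr)
  assume np: "\<not> p dvd (p ^ j choose i)"
  have "i * (p ^ j choose i) = p ^ j * ((p ^ j - 1) choose (i - 1))"
    using i times_binomial_minus1_eq[of i "p ^ j"] by simp
  then have "p ^ j dvd i * (p ^ j choose i)" by simp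
  moreover have "coprime (p ^ j) (p ^ j choose i)"
    using p np by (simp add: prime_imp_coprime)
  ultimately have "p ^ j dvd i" by (simp add: coprime_dvd_mult_left_iff)
  with i show False by (auto dest: dvd_imp_le)
qed

section \<open>Differences along a map and their behaviour modulo \<open>p\<close>\<close>

definition shift_diff :: "('i \<Rightarrow> 'i) \<Rightarrow> nat \<Rightarrow> ('i \<Rightarrow> 'r::comm_ring_1) \<Rightarrow> 'i \<Rightarrow> 'r" where
  "shift_diff g k f = (\<lambda>i. f ((g ^^ k) i) - f i)"

lemma shift_diff_apply: "shift_diff g k f i = f ((g ^^ k) i) - f i"
  by (simp add: shift_diff_def)

text \<open>This is g - 1, whereas \<open>shift_diff g k\<close> is g^k - 1. It has its own name
  because it is iterated and takes the place of \<open>lam\<close>.\<close>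

definition coboundary :: "('i \<Rightarrow> 'i) \<Rightarrow> ('i \<Rightarrow> 'r::comm_ring_1) \<Rightarrow> 'i \<Rightarrow> 'r" where
  "coboundary g f = (\<lambda>i. f (g i) - f i)"

lemma coboundary_apply: "coboundary g f i = f (g i) - f i"
  by (simp add: coboundary_def)

lemma lattice_operator_coboundary: "lattice_operator (\<lambda>u f i. u * f i) (coboundary g)"
  by unfold_locales (auto simp: coboundary_def fun_eq_iff algebra_simps)

lemma lattice_operator_scale: "lattice_operator (\<lambda>u f i. u * f i) (\<lambda>f i :: 'i. c * f i)"
  by unfold_locales (auto simp: fun_eq_iff algebra_simps)

lemma shift_diff_pow:
  fixes f :: "'i \<Rightarrow> 'r::comm_ring_1"
  shows
  "(coboundary g ^^ k) f x = (\<Sum>i\<le>k. (-1) ^ (k + i) * of_nat (k choose i) * f ((g ^^ i) x))"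
proof (induction k arbitrary: x)
  case (Suc k)
  define c :: "nat \<Rightarrow> nat \<Rightarrow> 'r" where "c k i = (-1) ^ (k + i) * of_nat (k choose i)" for k i
  have c1: "c (Suc k) (Suc i) = c k i - c k (Suc i)" for i by (simp add: c_def algebra_simps)
  have c0: "c (Suc k) 0 = - c k 0" by (simp add: c_def)
  have "(coboundary g ^^ Suc k) f x = (\<Sum>i\<le>k. c k i * f ((g ^^ Suc i) x)) - (\<Sum>i\<le>k. c k i * f ((g ^^ i) x))"
  proof -
    have "(coboundary g ^^ Suc k) f x = (coboundary g ^^ k) f (g x) - (coboundary g ^^ k) f x"
      by (simp add: coboundary_apply)
    then show ?thesis unfolding Suc.IH by (simp add: c_def funpow_swap1)
  qed
  also have "(\<Sum>i\<le>k. c k i * f ((g ^^ i) x)) = (\<Sum>i\<le>Suc k. c k i * f ((g ^^ i) x))"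
    by (simp add: c_def binomial_eq_0)
  also have "\<dots> = c k 0 * f x + (\<Sum>i\<le>k. c k (Suc i) * f ((g ^^ Suc i) x))"
    by (subst sum.atMost_Suc_shift) simp
  also have "(\<Sum>i\<le>k. c k i * f ((g ^^ Suc i) x)) - (c k 0 * f x + (\<Sum>i\<le>k. c k (Suc i) * f ((g ^^ Suc i) x))) =
      c (Suc k) 0 * f x + (\<Sum>i\<le>k. c (Suc k) (Suc i) * f ((g ^^ Suc i) x))"
    by (simp only: c1 c0 left_diff_distrib sum_subtractf) (simp add: algebra_simps del: funpow.simps)
  also have "\<dots> = (\<Sum>i\<le>Suc k. c (Suc k) i * f ((g ^^ i) x))"
    by (subst sum.atMost_Suc_shift) simp
  finally show ?case unfolding c_def .
qed simp

text \<open>The inner binomial coefficients of a power of \<open>p\<close> are divisible by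
  \<open>p\<close>. The ring is arbitrary: the congruence is needed over the integers for exponent
  vectors, and in characteristic \<open>p\<close>, where it is an equation, for unipotent
  operators.\<close>

lemma shift_diff_prime_power_cong:
  assumes p: "Factorial_Ring.prime p"
  shows "(of_nat p :: 'r::comm_ring_1) dvd (coboundary g ^^ (p ^ j)) f x - shift_diff g (p ^ j) f x"
proof -
  define N where "N = p ^ j"
  have N: "N > 0" using p by (simp add: N_def prime_gt_0_nat)
  define t where "t i = (-1) ^ (N + i) * of_nat (N choose i) * f ((g ^^ i) x)" for i
  have "{..N} = insert 0 (insert N {0<..<N})" using N by auto
  then have "(\<Sum>i\<le>N. t i) = t 0 + (t N + (\<Sum>i\<in>{0<..<N}. t i))" using N by simp
  then have "(coboundary g ^^ N) f x - shift_diff g N f x = (t 0 + f x) + (t N - f ((g ^^ N) x)) + (\<Sum>i\<in>{0<..<N}. t i)"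
    unfolding shift_diff_pow t_def[symmetric] by (simp add: shift_diff_def)
  moreover have "of_nat p dvd t 0 + f x"
  \<comment> \<open>The term at 0 has the wrong sign only for even \<open>N\<close>. Then
    \<open>p = 2\<close>, and the error is twice \<open>f x\<close>.\<close>
  proof (cases "even N")
    case True
    then have "p = 2"
      using p by (metis N_def prime_dvd_power primes_dvd_imp_eq two_is_prime_nat)
    then have "t 0 + f x = of_nat p * f x" using True by (simp add: t_def)
    then show ?thesis by simp
  next
    case False
    then show ?thesis by (simp add: t_def)
  qed
  moreover have "t N - f ((g ^^ N) x) = 0" by (simp add: t_def power_add flip: power_mult_distrib)
  moreover have "of_nat p dvd (\<Sum>i\<in>{0<..<N}. t i)"
  proof (rule dvd_sum)
    fix i assume "i \<in> {0<..<N}"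
    then have "p dvd (N choose i)" unfolding N_def by (intro prime_dvd_choose_prime_power[OF p]) auto
    then have "(of_nat p :: 'r) dvd of_nat (N choose i)" by (elim dvdE) simp
    then show "of_nat p dvd t i" unfolding t_def by (intro dvd_mult dvd_mult2)
  qed
  ultimately show ?thesis by (simp add: N_def)
qed

section \<open>Orbits and the permutation lattice\<close>

locale perm_lattice =
  fixes I :: "'i set" and g :: "'i \<Rightarrow> 'i" and p n :: nat
  assumes finite_I: "finite I" and g_permutes: "g permutes I" and p: "Factorial_Ring.prime p"
    and g_order: "\<And>i. i \<in> I \<Longrightarrow> (g ^^ (p ^ n)) i = i"
begin

sublocale L: lattice_operator "\<lambda>u f i. u * f i" "coboundary g"
  by (rule lattice_operator_coboundary)

lemma p_pos: "0 < p"
  using p by (simp add: prime_gt_0_nat)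

lemma funpow_permutes: "(g ^^ k) permutes I"
proof (induction k)
  case (Suc k)
  then show ?case unfolding funpow.simps(2) by (rule permutes_compose[OF _ g_permutes])
qed (metis funpow_0 eq_id_iff permutes_id)

lemma funpow_in: "i \<in> I \<Longrightarrow> (g ^^ k) i \<in> I"
  using funpow_permutes[of k] by (simp add: permutes_in_image)

lemma funpow_stable_mult: "(g ^^ a) i = i \<Longrightarrow> (g ^^ (a * b)) i = i"
  by (induction b) (auto simp: funpow_add)

definition orb :: "'i \<Rightarrow> 'i set" where
  "orb x = range (\<lambda>l. (g ^^ l) x)"

lemma orb_self: "x \<in> orb x"
  unfolding orb_def by (rule range_eqI[of _ _ 0]) simp

lemma orb_subset: "x \<in> I \<Longrightarrow> orb x \<subseteq> I"
  by (auto simp: orb_def funpow_in)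

lemma orb_trans: "y \<in> orb x \<Longrightarrow> orb y \<subseteq> orb x"
  by (auto simp: orb_def simp flip: funpow_add[THEN fun_cong, unfolded comp_apply])

lemma orb_eq:
  assumes "x \<in> I" "y \<in> orb x" shows "orb y = orb x"
proof
  show "orb y \<subseteq> orb x" using assms(2) by (rule orb_trans)
  from assms obtain l where l: "y = (g ^^ l) x" by (auto simp: orb_def)
  have "(g ^^ (p ^ n * l)) x = x" by (intro funpow_stable_mult g_order assms)
  moreover have "p ^ n * l = (p ^ n * l - l) + l" using p_pos by simp
  ultimately have "(g ^^ (p ^ n * l - l)) y = x" unfolding l by (metis comp_apply funpow_add)
  then have "x \<in> orb y" by (auto simp: orb_def)
  then show "orb x \<subseteq> orb y" by (rule orb_trans)
qed

definition reps :: "'i set" where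
  "reps = (\<lambda>x. SOME y. y \<in> orb x) ` I"

lemma rep_in_orb: "(SOME y. y \<in> orb x) \<in> orb x"
  by (rule someI[of "\<lambda>y. y \<in> orb x"], rule orb_self)

lemma reps_subset: "reps \<subseteq> I"
  using rep_in_orb orb_subset by (auto simp: reps_def)

lemma finite_reps: "finite reps"
  unfolding reps_def using finite_I by blast

lemma reps_meet: "x \<in> I \<Longrightarrow> \<exists>i\<in>reps. \<exists>l. (g ^^ l) x = i"
proof -
  assume x: "x \<in> I"
  obtain l where "(SOME y. y \<in> orb x) = (g ^^ l) x" using rep_in_orb[of x] unfolding orb_def by blast
  then have "(g ^^ l) x \<in> reps" using x unfolding reps_def by (metis imageI)
  then show ?thesis by blast
qed

lemma reps_unique:
  assumes "i \<in> reps" "i' \<in> reps" "orb i = orb i'" shows "i = i'"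
proof -
  have "(SOME y. y \<in> orb r) = r" if "r \<in> reps" for r
  proof -
    from that obtain x where x: "x \<in> I" "r = (SOME y. y \<in> orb x)" by (auto simp: reps_def)
    have "orb r = orb x" using orb_eq[OF x(1)] rep_in_orb[of x] x(2) by simp
    then show ?thesis using x by simp
  qed
  with assms show ?thesis by metis
qed

text \<open>A return time below \<open>p ^ J\<close> would, by Bezout, make a smaller power of
  \<open>p\<close> a return time as well.\<close>

lemma card_orb_prime_power:
  assumes i: "i \<in> I"
  shows "\<exists>J\<le>n. card (orb i) = p ^ J \<and> (g ^^ (p ^ J)) i = i \<and> (\<forall>J'<J. (g ^^ (p ^ J')) i \<noteq> i)"
proof -
  define J where "J = (LEAST J. (g ^^ (p ^ J)) i = i)"
  have J: "(g ^^ (p ^ J)) i = i" unfolding J_def by (rule LeastI) (rule g_order[OF i])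
  have Jn: "J \<le> n" unfolding J_def by (rule Least_le) (rule g_order[OF i])
  have Jmin: "(g ^^ (p ^ J')) i \<noteq> i" if "J' < J" for J' using that not_less_Least unfolding J_def by blast
  have inj_pow: "inj (g ^^ a)" for a using funpow_permutes permutes_inj by blast
  have mod: "(g ^^ l) i = (g ^^ (l mod p ^ J)) i" for l
  proof -
    have "(g ^^ l) i = (g ^^ (l mod p ^ J + p ^ J * (l div p ^ J))) i" by simp
    also have "\<dots> = (g ^^ (l mod p ^ J)) i"
      unfolding funpow_add comp_apply by (simp add: funpow_stable_mult[OF J])
    finally show ?thesis .
  qed
  have "orb i = (\<lambda>l. (g ^^ l) i) ` {..<p ^ J}"
  proof
    show "orb i \<subseteq> (\<lambda>l. (g ^^ l) i) ` {..<p ^ J}"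
    proof
      fix y assume "y \<in> orb i"
      then obtain l where "y = (g ^^ l) i" by (auto simp: orb_def)
      then show "y \<in> (\<lambda>l. (g ^^ l) i) ` {..<p ^ J}"
        using mod[of l] p_pos by (intro image_eqI[of _ _ "l mod p ^ J"]) auto
    qed
  qed (auto simp: orb_def)
  moreover have "inj_on (\<lambda>l. (g ^^ l) i) {..<p ^ J}"
  proof (rule linorder_inj_onI')
    fix a b assume ab: "a \<in> {..<p ^ J}" "b \<in> {..<p ^ J}" "a < b"
    show "(g ^^ a) i \<noteq> (g ^^ b) i"
    proof
      assume eq: "(g ^^ a) i = (g ^^ b) i"
      define c where "c = b - a"
      have "(g ^^ b) i = (g ^^ a) ((g ^^ c) i)" using ab by (simp add: c_def flip: funpow_add[THEN fun_cong, unfolded comp_apply])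
      with eq inj_pow[of a] have c: "(g ^^ c) i = i" by (metis injD)
      have c0: "c \<noteq> 0" "c < p ^ J" using ab by (auto simp: c_def)
      obtain J' where J': "J' \<le> J" "gcd c (p ^ J) = p ^ J'"
        using divides_primepow_nat[OF p, of "gcd c (p ^ J)" J] by auto
      have "gcd c (p ^ J) \<le> c" using c0 by (intro dvd_imp_le) auto
      with c0 J' have "J' < J" using p by (metis le_neq_implies_less linorder_not_less)
      obtain x y where xy: "c * x = p ^ J * y + gcd c (p ^ J)"
        using bezout_nat[OF c0(1)] by blast
      have "i = (g ^^ (c * x)) i" by (simp add: funpow_stable_mult[OF c])
      also have "\<dots> = (g ^^ (p ^ J')) ((g ^^ (p ^ J * y)) i)"
        unfolding xy J'(2)[symmetric] by (metis add.commute comp_apply funpow_add)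
      also have "\<dots> = (g ^^ (p ^ J')) i" by (simp add: funpow_stable_mult[OF J])
      finally show False using Jmin[OF \<open>J' < J\<close>] by simp
    qed
  qed
  ultimately have "card (orb i) = p ^ J" by (simp add: card_image)
  with J Jn Jmin show ?thesis by blast
qed

text \<open>A power of \<open>p\<close> as a telescoping sum, with one summand for each level
  \<open>j\<close> that the orbit reaches. The summand is the net number of generators that this
  orbit contributes at level \<open>j\<close> of the tower of monomials.\<close>

lemma card_orb:
  assumes i: "i \<in> I"
  shows "card (orb i) = 1 + (\<Sum>j\<in>{1..n}. if (g ^^ (p ^ (j - 1))) i \<noteq> i then p ^ j - p ^ (j - 1) else 0)"
proof -
  from card_orb_prime_power[OF i] obtain J where Jn: "J \<le> n" and co: "card (orb i) = p ^ J"
    and J: "(g ^^ (p ^ J)) i = i" and Jmin: "\<And>J'. J' < J \<Longrightarrow> (g ^^ (p ^ J')) i \<noteq> i" by blast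
  have "card (orb i) = p ^ J" by (rule co)
  also have "p ^ J = 1 + (\<Sum>j\<in>{1..J}. p ^ j - p ^ (j - 1))"
  proof (induction J)
    case (Suc k)
    have "p ^ k \<le> p ^ Suc k" using p_pos by simp
    moreover have "{1..Suc k} = insert (Suc k) {1..k}" by auto
    ultimately show ?case using Suc by simp
  qed simp
  also have "(\<Sum>j\<in>{1..J}. p ^ j - p ^ (j - 1)) = (\<Sum>j\<in>{1..n}. if j \<le> J then p ^ j - p ^ (j - 1) else 0)"
    using Jn by (simp add: sum.If_cases) (rule sum.cong; auto)
  also have "\<dots> = (\<Sum>j\<in>{1..n}. if (g ^^ (p ^ (j - 1))) i \<noteq> i then p ^ j - p ^ (j - 1) else 0)"
  proof (rule sum.cong[OF refl])
    fix j assume j: "j \<in> {1..n}"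
    have "(g ^^ (p ^ (j - 1))) i = i" if "\<not> j \<le> J"
    proof -
      have "p ^ (j - 1) = p ^ J * p ^ (j - 1 - J)" using that by (simp flip: power_add)
      then show ?thesis by (simp add: funpow_stable_mult[OF J])
    qed
    moreover have "(g ^^ (p ^ (j - 1))) i \<noteq> i" if "j \<le> J"
      using Jmin[of "j - 1"] that j by (metis Suc_le_eq Suc_pred' atLeastAtMost_iff less_eq_Suc_le One_nat_def)
    ultimately show "(if j \<le> J then p ^ j - p ^ (j - 1) else 0) =
      (if (g ^^ (p ^ (j - 1))) i \<noteq> i then p ^ j - p ^ (j - 1) else 0)" by auto
  qed
  finally show ?thesis .
qed

text \<open>One representative for each orbit of length at least \<open>p ^ j\<close>.\<close>

definition moved :: "nat \<Rightarrow> 'i set" where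
  "moved j = {i \<in> reps. (g ^^ (p ^ (j - 1))) i \<noteq> i}"

lemma I_eq_orbs: "I = (\<Union>i\<in>reps. orb i)"
proof
  show "I \<subseteq> (\<Union>i\<in>reps. orb i)"
  proof
    fix x assume x: "x \<in> I"
    define r where "r = (SOME y. y \<in> orb x)"
    have "r \<in> reps" using x by (auto simp: reps_def r_def)
    moreover have "orb r = orb x" using orb_eq[OF x] rep_in_orb[of x] by (simp add: r_def)
    ultimately show "x \<in> (\<Union>i\<in>reps. orb i)" using orb_self[of x] by auto
  qed
qed (use reps_subset orb_subset in blast)

lemma card_I_eq_orbs: "card I = (\<Sum>i\<in>reps. card (orb i))"
proof -
  have "card (\<Union>i\<in>reps. orb i) = (\<Sum>i\<in>reps. card (orb i))"
  proof (rule card_UN_disjoint[OF finite_reps])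
    show "\<forall>i\<in>reps. finite (orb i)" using reps_subset orb_subset finite_I finite_subset by blast
    show "\<forall>i\<in>reps. \<forall>j\<in>reps. i \<noteq> j \<longrightarrow> orb i \<inter> orb j = {}"
    proof (intro ballI impI)
      fix i j assume ij: "i \<in> reps" "j \<in> reps" "i \<noteq> j"
      show "orb i \<inter> orb j = {}"
      proof (rule ccontr)
        assume "orb i \<inter> orb j \<noteq> {}"
        then obtain y where "y \<in> orb i" "y \<in> orb j" by blast
        then have "orb i = orb j" using orb_eq ij reps_subset by blast
        with reps_unique ij show False by blast
      qed
    qed
  qed
  then show ?thesis by (simp flip: I_eq_orbs)
qed

lemma card_moved_sum: "card I = card reps + (\<Sum>j\<in>{1..n}. card (moved j) * (p ^ j - p ^ (j - 1)))"
proof -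
  have "card I = (\<Sum>i\<in>reps. card (orb i))" by (rule card_I_eq_orbs)
  also have "\<dots> = (\<Sum>i\<in>reps. 1 + (\<Sum>j\<in>{1..n}. if (g ^^ (p ^ (j - 1))) i \<noteq> i then p ^ j - p ^ (j - 1) else 0))"
    using card_orb reps_subset by (intro sum.cong refl) auto
  also have "\<dots> = card reps + (\<Sum>j\<in>{1..n}. \<Sum>i\<in>reps. if (g ^^ (p ^ (j - 1))) i \<noteq> i then p ^ j - p ^ (j - 1) else 0)"
    unfolding sum.distrib by (subst sum.swap) simp
  also have "(\<Sum>j\<in>{1..n}. \<Sum>i\<in>reps. if (g ^^ (p ^ (j - 1))) i \<noteq> i then p ^ j - p ^ (j - 1) else 0) =
      (\<Sum>j\<in>{1..n}. card (moved j) * (p ^ j - p ^ (j - 1)))"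
    using finite_reps by (intro sum.cong refl) (simp add: sum.If_cases moved_def Int_def)
  finally show ?thesis .
qed

definition lattice :: "('i \<Rightarrow> int) set" where
  "lattice = {f. \<forall>i. i \<notin> I \<longrightarrow> f i = 0}"

definition unit_vector :: "'i \<Rightarrow> 'i \<Rightarrow> int" where
  "unit_vector i = (\<lambda>x. if x = i then 1 else 0)"

lemma shift_diff_diff: "shift_diff g k (f - h) = shift_diff g k f - shift_diff g k h"
  and shift_diff_commute: "shift_diff g k (shift_diff g l f) = shift_diff g l (shift_diff g k f)"
  by (auto simp: shift_diff_def fun_eq_iff simp flip: funpow_add[THEN fun_cong, unfolded comp_apply] add.commute)

lemma coboundary_commute: "coboundary g (shift_diff g k f) = shift_diff g k (coboundary g f)"
  by (auto simp: shift_diff_def coboundary_def fun_eq_iff funpow_swap1)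

lemma shift_diff_0: "shift_diff g k 0 = 0"
  by (simp add: shift_diff_def fun_eq_iff)

lemma shift_diff_pow_commute:
  "(coboundary g ^^ r) (shift_diff g k f) = shift_diff g k ((coboundary g ^^ r) f)"
  by (induction r) (auto simp: coboundary_commute)

lemma submodule_lattice: "L.submodule lattice"
proof -
  have "i \<notin> I \<Longrightarrow> g i \<notin> I" for i using g_permutes by (simp add: permutes_in_image)
  then show ?thesis by (auto simp: L.submodule_def lattice_def coboundary_def)
qed

lemma submodule_shift_image:
  assumes M: "L.submodule M" shows "L.submodule (shift_diff g k ` M)"
  unfolding L.submodule_def
proof (intro conjI ballI)
  show "0 \<in> shift_diff g k ` M"
    by (rule image_eqI[of _ _ 0], rule shift_diff_0[symmetric], rule L.submodule_zero[OF M])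
  fix f h assume "f \<in> shift_diff g k ` M" "h \<in> shift_diff g k ` M"
  then obtain f' h' where "f' \<in> M" "h' \<in> M" "f = shift_diff g k f'" "h = shift_diff g k h'" by blast
  then show "f - h \<in> shift_diff g k ` M"
    by (intro image_eqI[of _ _ "f' - h'"] L.submodule_diff[OF M]) (simp_all only: shift_diff_diff)
next
  fix f assume "f \<in> shift_diff g k ` M"
  then obtain f' where f': "f' \<in> M" "f = shift_diff g k f'" by blast
  show "coboundary g f \<in> shift_diff g k ` M"
    unfolding f'(2) coboundary_commute by (intro imageI L.submodule_lam[OF M] f'(1))
qed

lemma shift_diff_mem:
  assumes M: "L.submodule M" "f \<in> M" shows "shift_diff g k f \<in> M"
proof (induction k)
  case 0
  have "shift_diff g 0 f = 0" by (simp add: shift_diff_def fun_eq_iff)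
  show ?case unfolding \<open>shift_diff g 0 f = 0\<close> by (rule L.submodule_zero[OF M(1)])
next
  case (Suc k)
  have "shift_diff g (Suc k) f = coboundary g (shift_diff g k f) + (coboundary g f + shift_diff g k f)"
    by (auto simp: shift_diff_def coboundary_def fun_eq_iff funpow_swap1)
  moreover have "coboundary g h \<in> M" if "h \<in> M" for h
    using that by (rule L.submodule_lam[OF M(1)])
  ultimately show ?case
    using Suc M(2) by (simp only: L.submodule_add[OF M(1)])
qed

lemma sum_fun_apply: "(\<Sum>j\<in>J. F j) x = (\<Sum>j\<in>J. F j x)" for F :: "'j \<Rightarrow> 'k \<Rightarrow> int"
  by (induction J rule: infinite_finite_induct) auto

text \<open>Moving a unit vector along its orbit changes it by a \<open>shift_diff\<close>, so one
  unit vector for each orbit is enough.\<close>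

lemma lattice_span: "lattice \<subseteq> L.lspan (unit_vector ` reps)"
proof
  note sp = L.submodule_lspan[of "unit_vector ` reps"]
  have ev: "unit_vector x \<in> L.lspan (unit_vector ` reps)" if x: "x \<in> I" for x
  proof -
    from reps_meet[OF x] obtain i l where i: "i \<in> reps" "(g ^^ l) x = i" by blast
    have "(g ^^ l) y = i \<longleftrightarrow> y = x" for y
      using i(2) permutes_inj[OF funpow_permutes[of l]] by (auto dest: injD)
    then have "unit_vector x = unit_vector i + shift_diff g l (unit_vector i)"
      by (auto simp: unit_vector_def shift_diff_def fun_eq_iff)
    moreover have u: "unit_vector i \<in> L.lspan (unit_vector ` reps)" using L.lspan_incl i by blast
    ultimately show ?thesis
      using L.submodule_add[OF sp u shift_diff_mem[OF sp u]] by simp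
  qed
  fix f assume f: "f \<in> lattice"
  have "f = (\<Sum>x\<in>I. (\<lambda>i. f x * unit_vector x i))"
    using f finite_I by (auto simp: fun_eq_iff sum_fun_apply unit_vector_def lattice_def if_distrib cong: if_cong)
  moreover have "(\<Sum>x\<in>I. (\<lambda>i. f x * unit_vector x i)) \<in> L.lspan (unit_vector ` reps)"
    by (rule L.submodule_sum[OF sp], rule L.submodule_scale[OF sp], rule ev)
  ultimately show "f \<in> L.lspan (unit_vector ` reps)" by metis
qed

end

text \<open>The last hypothesis says that every subgroup of the cyclic group generated by \<open>g\<close> has
  vanishing first cohomology with values in \<open>M\<close>.\<close>

locale coflasque_sublattice = perm_lattice +
  fixes M :: "('a \<Rightarrow> int) set" and e :: nat
  assumes submodule_M: "L.submodule M" and M_lattice: "M \<subseteq> lattice"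
    and index: "\<And>f. f \<in> lattice \<Longrightarrow> (\<lambda>i. int (p ^ e) * f i) \<in> M"
    and coflasque: "\<And>k f. f \<in> lattice \<Longrightarrow> shift_diff g (p ^ k) f \<in> M \<Longrightarrow>
      \<exists>m\<in>M. shift_diff g (p ^ k) m = shift_diff g (p ^ k) f"
begin

text \<open>The cohomological hypothesis in the form of an intersection, as
  \<open>lspan_relative\<close> wants it.\<close>

lemma M_shift_lattice: "M \<inter> shift_diff g (p ^ k) ` lattice \<subseteq> shift_diff g (p ^ k) ` M"
proof
  fix h assume h: "h \<in> M \<inter> shift_diff g (p ^ k) ` lattice"
  then obtain f where f: "f \<in> lattice" "h = shift_diff g (p ^ k) f" by blast
  have "shift_diff g (p ^ k) f \<in> M" using h f by simp
  from coflasque[OF f(1) this] obtain m where m: "m \<in> M" "shift_diff g (p ^ k) m = h"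
    unfolding f(2) by blast
  show "h \<in> shift_diff g (p ^ k) ` M" unfolding m(2)[symmetric] by (rule imageI[OF m(1)])
qed

text \<open>Let q = p^(j-1). The operator \<open>D'\<close> is \<open>D\<close> times 1 + g^q + ...
  + g^((p-1)q), the cyclotomic polynomial of order p^j at g. So the images of the lattice under
  \<open>D\<close> and \<open>D'\<close> have as quotient a module over Z[zeta], generated by the
  unit vectors of \<open>moved j\<close>, on which g - 1 acts as the uniformizer zeta - 1 above
  \<open>p\<close>.\<close>

lemma level_generators:
  assumes j: "1 \<le> j"
  shows "\<exists>B\<subseteq>M. finite B \<and> card B \<le> card (moved j) \<and>
    shift_diff g (p ^ (j - 1)) ` M \<subseteq>
      L.lspan (shift_diff g (p ^ j) ` M \<union> shift_diff g (p ^ (j - 1)) ` B)"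
proof -
  define D :: "('a \<Rightarrow> int) \<Rightarrow> 'a \<Rightarrow> int" where "D = shift_diff g (p ^ (j - 1))"
  define D' :: "('a \<Rightarrow> int) \<Rightarrow> 'a \<Rightarrow> int" where "D' = shift_diff g (p ^ j)"
  define P0 where "P0 = D' ` lattice"
  define G where "G = (\<lambda>i. D (unit_vector i)) ` moved j"
  have P0: "L.submodule P0" unfolding P0_def D'_def by (rule submodule_shift_image[OF submodule_lattice])
  have DM: "L.submodule (D ` M)" unfolding D_def by (rule submodule_shift_image[OF submodule_M])
  have fin: "finite (moved j)" unfolding moved_def using finite_reps by simp
  then have finG: "finite G" by (simp add: G_def)
  have pj: "p ^ j = p * p ^ (j - 1)" using j by (cases j) auto
  have Dlat: "D ` lattice \<subseteq> L.lspan G"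
  proof -
    have "lattice \<subseteq> {f. D f \<in> L.lspan G}"
    proof (rule order_trans[OF lattice_span], rule L.lspan_least)
      note sp = L.submodule_lspan[of G]
      show "L.submodule {f. D f \<in> L.lspan G}"
        using L.submodule_zero[OF sp] L.submodule_diff[OF sp] L.submodule_lam[OF sp]
        by (auto simp: L.submodule_def D_def shift_diff_0 shift_diff_diff coboundary_commute[symmetric])
      have "D (unit_vector i) \<in> L.lspan G" if "i \<in> reps" for i
      proof (cases "i \<in> moved j")
        case True
        then show ?thesis using L.lspan_incl[of G] by (auto simp: G_def)
      next
        case False
        with that have fixed: "(g ^^ (p ^ (j - 1))) i = i" by (simp add: moved_def)
        have "(g ^^ (p ^ (j - 1))) y = i \<longleftrightarrow> y = i" for y
          using fixed permutes_inj[OF funpow_permutes[of "p ^ (j - 1)"]] by (metis injD)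
        then have "D (unit_vector i) = 0"
          by (auto simp: D_def shift_diff_def unit_vector_def fun_eq_iff)
        then show ?thesis using L.submodule_zero[OF sp] by simp
      qed
      then show "unit_vector ` reps \<subseteq> {f. D f \<in> L.lspan G}" by auto
    qed
    then show ?thesis by auto
  qed
  \<comment> \<open>The factorization of \<open>D'\<close> through \<open>D\<close>, written as a
    telescoping sum.\<close>
  have P0D: "P0 \<subseteq> D ` lattice"
  proof
    fix f assume "f \<in> P0"
    then obtain q where q: "q \<in> lattice" "f = D' q" by (auto simp: P0_def)
    have "D' q = D (\<Sum>i<p. (\<lambda>x. q ((g ^^ (i * p ^ (j - 1))) x)))"
    proof
      fix x
      have "D' q x = (\<Sum>i<p. q ((g ^^ (Suc i * p ^ (j - 1))) x) - q ((g ^^ (i * p ^ (j - 1))) x))"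
        by (subst sum_lessThan_telescope) (simp add: D'_def shift_diff_def pj)
      also have "\<dots> = D (\<Sum>i<p. (\<lambda>x. q ((g ^^ (i * p ^ (j - 1))) x))) x"
        by (simp add: D_def shift_diff_def sum_fun_apply sum_subtractf add.commute
            flip: funpow_add[THEN fun_cong, unfolded comp_apply])
      finally show "D' q x = D (\<Sum>i<p. (\<lambda>x. q ((g ^^ (i * p ^ (j - 1))) x))) x" .
    qed
    moreover have "(\<Sum>i<p. (\<lambda>x. q ((g ^^ (i * p ^ (j - 1))) x))) \<in> lattice"
    proof (rule L.submodule_sum[OF submodule_lattice])
      fix i
      have "(\<lambda>x. q ((g ^^ (i * p ^ (j - 1))) x)) = q + shift_diff g (i * p ^ (j - 1)) q"
        by (auto simp: shift_diff_def fun_eq_iff)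
      then show "(\<lambda>x. q ((g ^^ (i * p ^ (j - 1))) x)) \<in> lattice"
        using L.submodule_add[OF submodule_lattice q(1) shift_diff_mem[OF submodule_lattice q(1)]] by simp
    qed
    ultimately show "f \<in> D ` lattice" using q by blast
  qed
  have "G \<subseteq> D ` lattice"
    using reps_subset by (auto simp: G_def moved_def lattice_def unit_vector_def)
  with P0D have spD: "L.lspan (P0 \<union> G) \<subseteq> D ` lattice"
    unfolding D_def by (intro L.lspan_least submodule_shift_image[OF submodule_lattice]) auto
  have "\<exists>B\<subseteq>D ` M. finite B \<and> card B \<le> card G \<and> D ` M \<subseteq> L.lspan (P0 \<union> B)"
  proof (rule L.submodule_generators[OF p P0 DM finG])
    show "D ` M \<subseteq> L.lspan (P0 \<union> G)"
      using Dlat M_lattice L.lspan_mono[of G "P0 \<union> G"] by blast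
    show "\<exists>w\<in>L.lspan {y}. \<exists>z\<in>P0. (\<lambda>i. int p * y i) = coboundary g w + z" if y: "y \<in> L.lspan (P0 \<union> G)" for y
    proof -
      from y spD obtain q where q: "q \<in> lattice" "y = D q" by auto
      \<comment> \<open>The cyclotomic polynomial has the value \<open>p\<close> at 1, so
        \<open>p\<close> minus its value at g is a multiple of g - 1. Applied to \<open>y\<close>
        this multiple is \<open>coboundary g w\<close>, and the cyclotomic polynomial sends
        \<open>y = D q\<close> to \<open>D' q\<close>.\<close>
      define w where "w = (\<Sum>i<p. \<Sum>l<i * p ^ (j - 1). (\<lambda>x. - y ((g ^^ l) x)))"
      have "(\<lambda>i. int p * y i) = coboundary g w + D' q"
      proof
        fix x
        have "coboundary g w x = (\<Sum>i<p. \<Sum>l<i * p ^ (j - 1). y ((g ^^ l) x) - y ((g ^^ Suc l) x))"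
          by (simp add: w_def coboundary_def sum_fun_apply sum_subtractf sum_negf funpow_swap1)
        also have "\<dots> = (\<Sum>i<p. y x - y ((g ^^ (i * p ^ (j - 1))) x))"
          by (intro sum.cong refl) (subst sum_lessThan_telescope', simp)
        also have "\<dots> = int p * y x - (\<Sum>i<p. y ((g ^^ (i * p ^ (j - 1))) x))"
          by (simp add: sum_subtractf)
        also have "(\<Sum>i<p. y ((g ^^ (i * p ^ (j - 1))) x)) =
            (\<Sum>i<p. q ((g ^^ (Suc i * p ^ (j - 1))) x) - q ((g ^^ (i * p ^ (j - 1))) x))"
          by (simp add: q D_def shift_diff_def add.commute flip: funpow_add[THEN fun_cong, unfolded comp_apply])
        also have "\<dots> = D' q x"
          by (subst sum_lessThan_telescope) (simp add: D'_def shift_diff_def pj)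
        finally show "int p * y x = (coboundary g w + D' q) x" by simp
      qed
      moreover have "w \<in> L.lspan {y}"
        unfolding w_def
      proof (intro L.submodule_sum[OF L.submodule_lspan])
        fix l
        have yy: "y \<in> L.lspan {y}" using L.lspan_incl by blast
        have "(\<lambda>x. - y ((g ^^ l) x)) = - (y + shift_diff g l y)"
          by (auto simp: shift_diff_def fun_eq_iff)
        also have "\<dots> \<in> L.lspan {y}"
          by (intro L.submodule_uminus[OF L.submodule_lspan] L.submodule_add[OF L.submodule_lspan]
              yy shift_diff_mem[OF L.submodule_lspan])
        finally show "(\<lambda>x. - y ((g ^^ l) x)) \<in> L.lspan {y}" .
      qed
      ultimately show ?thesis using q by (auto simp: P0_def)
    qed
    show "\<exists>k. \<exists>m\<in>D ` M. \<exists>z\<in>P0. (coboundary g ^^ k) y = m + z" if y: "y \<in> G" for y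
    proof -
      from y \<open>G \<subseteq> D ` lattice\<close> obtain q where q: "q \<in> lattice" "y = D q" by auto
      \<comment> \<open>Modulo \<open>p\<close>, (g - 1)^(p^j) agrees with \<open>D'\<close>. Each
        round of \<open>p ^ j\<close> coboundaries therefore gains a factor \<open>p\<close> modulo
        the image of \<open>D'\<close>, and after \<open>e\<close> rounds \<open>index\<close>
        applies.\<close>
      have "\<exists>h\<in>lattice. \<exists>q'\<in>lattice. (coboundary g ^^ (p ^ j * s)) q = (\<lambda>i. int (p ^ s) * h i) + D' q'" for s
      proof (induction s)
        case 0
        have "D' (\<lambda>_. 0) = (\<lambda>_. 0)" by (simp add: D'_def shift_diff_def)
        then show ?case
          using q L.submodule_zero[OF submodule_lattice]
          by (intro bexI[of _ q] bexI[of _ 0]) (simp_all add: fun_eq_iff zero_fun_def)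
      next
        case (Suc s)
        then obtain h q' where h: "h \<in> lattice" "q' \<in> lattice"
          "(coboundary g ^^ (p ^ j * s)) q = (\<lambda>i. int (p ^ s) * h i) + D' q'" by blast
        define u where "u = (\<lambda>x. ((coboundary g ^^ (p ^ j)) h x - D' h x) div int p)"
        have u: "(coboundary g ^^ (p ^ j)) h = (\<lambda>i. int p * u i) + D' h"
          using shift_diff_prime_power_cong[OF p, where j = j and g = g and f = h]
          by (auto simp: u_def D'_def fun_eq_iff)
        have ulat: "u \<in> lattice"
          using L.submodule_lam_pow[OF submodule_lattice h(1), of "p ^ j"]
            shift_diff_mem[OF submodule_lattice h(1), of "p ^ j"]
          by (auto simp: u_def lattice_def D'_def)
        define q'' where "q'' = (\<lambda>i. int (p ^ s) * h i) + (coboundary g ^^ (p ^ j)) q'"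
        have "q'' \<in> lattice"
          unfolding q''_def using L.submodule_add[OF submodule_lattice L.submodule_scale[OF submodule_lattice h(1)]
              L.submodule_lam_pow[OF submodule_lattice h(2)]] .
        moreover have "(coboundary g ^^ (p ^ j * Suc s)) q = (\<lambda>i. int (p ^ Suc s) * u i) + D' q''"
        proof -
          have "(coboundary g ^^ (p ^ j * Suc s)) q = (coboundary g ^^ (p ^ j)) ((\<lambda>i. int (p ^ s) * h i) + D' q')"
            unfolding mult_Suc_right funpow_add comp_apply h(3) ..
          also have "\<dots> = (\<lambda>i. int (p ^ s) * (coboundary g ^^ (p ^ j)) h i) + D' ((coboundary g ^^ (p ^ j)) q')"
            unfolding L.lam_pow_add L.lam_pow_scale D'_def shift_diff_pow_commute ..
          also have "\<dots> = (\<lambda>i. int (p ^ Suc s) * u i) + D' q''"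
            unfolding u q''_def by (auto simp: fun_eq_iff D'_def shift_diff_def algebra_simps)
          finally show ?thesis .
        qed
        ultimately show ?case using ulat by blast
      qed
      from this[of e] obtain h q' where h: "h \<in> lattice" "q' \<in> lattice"
        "(coboundary g ^^ (p ^ j * e)) q = (\<lambda>i. int (p ^ e) * h i) + D' q'" by blast
      have "(coboundary g ^^ (p ^ j * e)) y = D ((coboundary g ^^ (p ^ j * e)) q)"
        by (simp add: q D_def shift_diff_pow_commute)
      also have "\<dots> = D (\<lambda>i. int (p ^ e) * h i) + D' (D q')"
        unfolding h(3) by (auto simp: D_def D'_def shift_diff_def fun_eq_iff add.commute simp flip: funpow_add[THEN fun_cong, unfolded comp_apply])
      finally have "(coboundary g ^^ (p ^ j * e)) y = D (\<lambda>i. int (p ^ e) * h i) + D' (D q')" .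
      moreover have "D (\<lambda>i. int (p ^ e) * h i) \<in> D ` M" using index[OF h(1)] by blast
      moreover have "D' (D q') \<in> P0"
        using shift_diff_mem[OF submodule_lattice h(2)] by (auto simp: P0_def D_def)
      ultimately show ?thesis by blast
    qed
  qed
  then obtain C where C: "C \<subseteq> D ` M" "finite C" "card C \<le> card G" "D ` M \<subseteq> L.lspan (P0 \<union> C)" by blast
  have "D ` M \<subseteq> M" using shift_diff_mem[OF submodule_M] by (auto simp: D_def)
  \<comment> \<open>Vanishing of cohomology enters here: what \<open>M\<close> has in common with
    \<open>D'\<close> of the lattice already comes from \<open>D'\<close> of
    \<open>M\<close>.\<close>
  then have "D ` M \<inter> P0 \<subseteq> D' ` M"
    unfolding P0_def D'_def using M_shift_lattice[of j] by blast
  moreover have "D ` M \<subseteq> L.lspan (D ` M \<inter> P0 \<union> C)" by (rule L.lspan_relative[OF DM P0 C(1,4)])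
  ultimately have 1: "D ` M \<subseteq> L.lspan (D' ` M \<union> C)"
    using L.lspan_mono[of "D ` M \<inter> P0 \<union> C" "D' ` M \<union> C"] by blast
  from C(1,2) obtain B where B: "B \<subseteq> M" "finite B" "C = D ` B" "card B = card C"
    by (metis subset_image_inj finite_imageD card_image)
  have "card G \<le> card (moved j)" unfolding G_def by (rule card_image_le[OF fin])
  then show ?thesis using B C(3) 1 unfolding D_def D'_def by (intro exI[of _ B]) auto
qed

text \<open>Modulo the image of g - 1 the permutation acts trivially and the lattice becomes free
  over the integers, with one generator for each orbit. The role of the uniformizer passes to
  \<open>p\<close>, so the general bound is used with multiplication by \<open>p\<close> as its
  operator.\<close>

lemma bottom_generators:
  "\<exists>B\<subseteq>M. finite B \<and> card B \<le> card reps \<and> M \<subseteq> L.lspan (coboundary g ` M \<union> B)"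
proof -
  interpret S: lattice_operator "\<lambda>u f i. u * f i" "\<lambda>f i. int p * f i"
    by (rule lattice_operator_scale)
  have conv: "S.submodule V" if "L.submodule V" for V
    using that L.submodule_scale[OF that] by (auto simp: S.submodule_def L.submodule_def)
  define P0 where "P0 = coboundary g ` lattice"
  have cob: "coboundary g = shift_diff g 1" by (auto simp: fun_eq_iff coboundary_def shift_diff_def)
  have P0: "L.submodule P0"
    using submodule_shift_image[OF submodule_lattice, of 1] unfolding P0_def cob[symmetric] .
  define G where "G = unit_vector ` reps"
  have pow: "((\<lambda>f i. int p * f i) ^^ k) f = (\<lambda>i. int (p ^ k) * f i)" for k and f :: "'a \<Rightarrow> int"
    by (induction k) (auto simp: fun_eq_iff)
  have lat: "lattice \<subseteq> S.lspan (P0 \<union> G)"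
  proof (rule order_trans[OF lattice_span], rule L.lspan_least)
    note sp = S.submodule_lspan[of "P0 \<union> G"]
    have in_lat: "S.lspan (P0 \<union> G) \<subseteq> lattice"
    proof (rule S.lspan_least[OF conv[OF submodule_lattice]])
      show "P0 \<union> G \<subseteq> lattice"
        using L.submodule_lam[OF submodule_lattice] reps_subset
        by (auto simp: P0_def G_def lattice_def unit_vector_def)
    qed
    show "L.submodule (S.lspan (P0 \<union> G))"
      unfolding L.submodule_def
    proof (intro conjI ballI)
      fix f assume "f \<in> S.lspan (P0 \<union> G)"
      then have "coboundary g f \<in> P0" using in_lat by (auto simp: P0_def)
      then show "coboundary g f \<in> S.lspan (P0 \<union> G)" using S.lspan_incl[of "P0 \<union> G"] by blast
    qed (use S.submodule_zero[OF sp] S.submodule_diff[OF sp] in auto)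
    show "unit_vector ` reps \<subseteq> S.lspan (P0 \<union> G)" using S.lspan_incl[of "P0 \<union> G"] by (auto simp: G_def)
  qed
  have "\<exists>B\<subseteq>M. finite B \<and> card B \<le> card G \<and> M \<subseteq> S.lspan (P0 \<union> B)"
  proof (rule S.submodule_generators[OF p conv[OF P0] conv[OF submodule_M]])
    show "finite G" unfolding G_def using finite_reps by simp
    show "M \<subseteq> S.lspan (P0 \<union> G)" using lat M_lattice by blast
    show "\<exists>w\<in>S.lspan {y}. \<exists>z\<in>P0. (\<lambda>i. int p * y i) = (\<lambda>i. int p * w i) + z" for y
      using S.lspan_incl[of "{y}"] L.submodule_zero[OF P0] by (intro bexI[of _ y] bexI[of _ 0]) auto
    show "\<exists>k. \<exists>m\<in>M. \<exists>z\<in>P0. ((\<lambda>f i. int p * f i) ^^ k) y = m + z" if "y \<in> G" for y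
    proof -
      have "y \<in> lattice" using that reps_subset by (auto simp: G_def lattice_def unit_vector_def)
      from index[OF this] show ?thesis
        unfolding pow using L.submodule_zero[OF P0] by (intro exI[of _ e] bexI[of _ "\<lambda>i. int (p ^ e) * y i"] bexI[of _ 0]) auto
    qed
  qed
  then obtain B where B: "B \<subseteq> M" "finite B" "card B \<le> card G" "M \<subseteq> S.lspan (P0 \<union> B)" by blast
  have "M \<subseteq> S.lspan (M \<inter> P0 \<union> B)" by (rule S.lspan_relative[OF conv[OF submodule_M] conv[OF P0] B(1,4)])
  also have "\<dots> \<subseteq> L.lspan (M \<inter> P0 \<union> B)"
    by (rule S.lspan_least[OF conv[OF L.submodule_lspan] L.lspan_incl])
  also have "\<dots> \<subseteq> L.lspan (coboundary g ` M \<union> B)"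
    using M_shift_lattice[of 0] by (intro L.lspan_mono) (auto simp: P0_def shift_diff_def coboundary_def)
  finally have "M \<subseteq> L.lspan (coboundary g ` M \<union> B)" .
  moreover have "card G \<le> card reps" unfolding G_def by (rule card_image_le[OF finite_reps])
  ultimately show ?thesis using B by (intro exI[of _ B]) auto
qed

end

section \<open>Kummer descent\<close>

lemma sum_powers_root_of_unity:
  fixes x :: "'l::field"
  assumes "x ^ M = 1" "x \<noteq> 1" shows "(\<Sum>r<M. x ^ r) = 0"
  using assms by (simp add: geometric_sum)

lemma sum_lessThan_rotate:
  fixes f :: "nat \<Rightarrow> 'b::ab_group_add"
  assumes "f M = f 0" shows "(\<Sum>l<M. f (Suc l)) = (\<Sum>l<M. f l)"
proof -
  have "(\<Sum>l<M. f (Suc l)) + f 0 = (\<Sum>l<Suc M. f l)"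
    by (simp only: sum.lessThan_Suc_shift add.commute)
  with assms show ?thesis by simp
qed

context
  fixes S :: "'l::field \<Rightarrow> 'l" and w \<omega> :: 'l and M :: nat
  assumes S: "field_hom S" and w: "w \<noteq> 0" "S w = \<omega> * w" and \<omega>: "S \<omega> = \<omega>" "\<omega> ^ M = 1"
    and prim: "\<And>l. 0 < l \<Longrightarrow> l < M \<Longrightarrow> \<omega> ^ l \<noteq> 1"
begin

lemma root_pow_M: "(\<omega> ^ l) ^ M = 1"
  by (metis \<omega>(2) mult.commute power_mult power_one)

lemma eigen_funpow: "(S ^^ l) w = \<omega> ^ l * w"
proof (induction l)
  case (Suc l)
  have "(S ^^ Suc l) w = S (\<omega> ^ l * w)" using Suc by simp
  also have "\<dots> = \<omega> ^ Suc l * w"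
    unfolding field_hom_mult[OF S] field_hom_power[OF S] by (simp add: w \<omega>)
  finally show ?case .
qed simp

lemma eigen_funpow_mult: "(S ^^ l) (w ^ k * z) = \<omega> ^ (l * k) * (w ^ k * (S ^^ l) z)"
  unfolding field_hom_mult[OF field_hom_funpow[OF S]] field_hom_power[OF field_hom_funpow[OF S]] eigen_funpow
  by (simp add: power_mult_distrib power_mult mult.assoc)

text \<open>A Lagrange resolvent: \<open>w ^ k * z\<close> also returns after \<open>M\<close>
  steps, so \<open>S\<close> only rotates the summands.\<close>

lemma fourier_fixed:
  assumes "(S ^^ M) z = z"
  shows "S (\<Sum>l<M. (S ^^ l) (w ^ k * z)) = (\<Sum>l<M. (S ^^ l) (w ^ k * z))"
proof -
  have "(S ^^ M) (w ^ k * z) = w ^ k * z"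
    unfolding eigen_funpow_mult using assms by (simp add: power_mult \<omega>)
  then have "(\<Sum>l<M. (S ^^ Suc l) (w ^ k * z)) = (\<Sum>l<M. (S ^^ l) (w ^ k * z))"
    by (intro sum_lessThan_rotate) simp
  then show ?thesis by (simp add: field_hom_sum[OF S])
qed

text \<open>Orthogonality of the powers of \<open>\<omega>\<close> leaves only the summand at
  \<open>l = 0\<close>.\<close>

lemma fourier_inversion:
  "of_nat M * z = (\<Sum>k<M. (\<Sum>l<M. (S ^^ l) (w ^ k * z)) / w ^ k)"
proof (cases "M = 0")
  case False
  have "(\<Sum>k<M. (\<Sum>l<M. (S ^^ l) (w ^ k * z)) / w ^ k) = (\<Sum>l<M. \<Sum>k<M. (\<omega> ^ l) ^ k * (S ^^ l) z)"
    unfolding eigen_funpow_mult sum_divide_distrib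
    by (subst sum.swap) (simp add: w power_mult)
  also have "\<dots> = (\<Sum>l<M. if l = 0 then of_nat M * z else 0)"
  proof (intro sum.cong refl)
    fix l assume "l \<in> {..<M}"
    then have "(\<Sum>k<M. (\<omega> ^ l) ^ k) = 0" if "l \<noteq> 0"
      using that prim[of l] by (intro sum_powers_root_of_unity) (auto simp: root_pow_M)
    then show "(\<Sum>k<M. (\<omega> ^ l) ^ k * (S ^^ l) z) = (if l = 0 then of_nat M * z else 0)"
      by (auto simp flip: sum_distrib_right)
  qed
  finally show ?thesis using False by simp
qed simp

text \<open>The transform in the other direction: \<open>M\<close> invariants can be packed into one
  element as coefficients of powers of \<open>w\<close>, and unpacked from its conjugates. The tower
  of monomials depends on this.\<close>

lemma fourier_coefficient:
  assumes t: "\<And>k. k < M \<Longrightarrow> S (t k) = t k" and k: "k < M"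
  shows "of_nat M * t k = (\<Sum>l<M. (S ^^ l) (\<Sum>i<M. w ^ i * t i) / \<omega> ^ (l * k)) / w ^ k"
proof -
  have \<omega>0: "\<omega> \<noteq> 0" using \<omega>(2) k by (auto simp: power_0_left split: if_splits)
  have St: "(S ^^ l) (t i) = t i" if "i < M" for l i
    using that by (induction l) (auto simp: t)
  have "(\<Sum>l<M. (S ^^ l) (\<Sum>i<M. w ^ i * t i) / \<omega> ^ (l * k)) =
      (\<Sum>l<M. \<Sum>i<M. (\<omega> ^ i / \<omega> ^ k) ^ l * (w ^ i * t i))"
    unfolding field_hom_sum[OF field_hom_funpow[OF S]] eigen_funpow_mult sum_divide_distrib
    by (intro sum.cong refl) (simp add: St power_divide power_mult mult.commute[of _ k] flip: power_mult, simp add: mult.commute)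
  also have "\<dots> = (\<Sum>i<M. (\<Sum>l<M. (\<omega> ^ i / \<omega> ^ k) ^ l) * (w ^ i * t i))"
    by (subst sum.swap) (simp add: sum_distrib_right)
  also have "\<dots> = (\<Sum>i<M. if i = k then of_nat M * (w ^ k * t k) else 0)"
  proof (intro sum.cong refl)
    fix i assume i: "i \<in> {..<M}"
    have "(\<Sum>l<M. (\<omega> ^ i / \<omega> ^ k) ^ l) = 0" if "i \<noteq> k"
    proof (rule sum_powers_root_of_unity)
      show "(\<omega> ^ i / \<omega> ^ k) ^ M = 1"
        by (simp only: power_divide root_pow_M div_by_1)
      show "\<omega> ^ i / \<omega> ^ k \<noteq> 1"
      proof
        assume "\<omega> ^ i / \<omega> ^ k = 1"
        then have eq: "\<omega> ^ i = \<omega> ^ k" using \<omega>0 by (simp add: field_simps)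
        have False if "a < b" "b < M" "\<omega> ^ a = \<omega> ^ b" for a b
        proof -
          have "\<omega> ^ b = \<omega> ^ a * \<omega> ^ (b - a)" using that(1) by (simp flip: power_add)
          with that \<omega>0 have "\<omega> ^ (b - a) = 1" by simp
          moreover have "b - a < M" using that by simp
          ultimately show False using prim[of "b - a"] that by simp
        qed
        from this[of i k] this[of k i] eq that i k show False by (auto simp: neq_iff)
      qed
    qed
    then show "(\<Sum>l<M. (\<omega> ^ i / \<omega> ^ k) ^ l) * (w ^ i * t i) = (if i = k then of_nat M * (w ^ k * t k) else 0)"
      using \<omega>0 by auto
  qed
  also have "\<dots> = of_nat M * (w ^ k * t k)" using k by simp
  finally show ?thesis using w by simp
qed

end

section \<open>Generation by invariants in the presence of a Kummer generator\<close>

locale kummer_setup =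
  fixes K E :: "'l::field set" and T :: "'l \<Rightarrow> 'l" and p n :: nat and \<zeta> v :: 'l
  assumes K: "is_subfield K" and E: "is_subfield E" and KE: "K \<subseteq> E"
    and T: "field_hom T" and T_K: "\<And>u. u \<in> K \<Longrightarrow> T u = u" and T_E: "\<And>u. u \<in> E \<Longrightarrow> T u \<in> E"
    and T_order: "\<And>u. u \<in> E \<Longrightarrow> (T ^^ (p ^ n)) u = u"
    and p: "Factorial_Ring.prime p" and p_nz: "of_nat p \<noteq> (0::'l)"
    and \<zeta>: "\<zeta> \<in> K" "\<zeta> ^ (p ^ n) = 1" "\<And>l. 0 < l \<Longrightarrow> l < p ^ n \<Longrightarrow> \<zeta> ^ l \<noteq> 1"
    and v: "v \<in> E" "v \<noteq> 0" "T v = \<zeta> * v"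
begin

lemma p_pos': "0 < p"
  using p by (simp add: prime_gt_0_nat)

lemma T_pow_K: "u \<in> K \<Longrightarrow> (T ^^ l) u = u"
  by (induction l) (auto simp: T_K)

lemma T_pow_v: "(T ^^ l) v = \<zeta> ^ l * v"
proof (induction l)
  case (Suc l)
  have "(T ^^ Suc l) v = T (\<zeta> ^ l * v)" using Suc by simp
  also have "\<dots> = \<zeta> ^ Suc l * v"
    unfolding field_hom_mult[OF T] field_hom_power[OF T] by (simp add: v T_K \<zeta>)
  finally show ?case .
qed simp

lemma \<zeta>_pow_primitive:
  assumes "a * b = p ^ n"
  shows "(\<zeta> ^ a) ^ b = 1" "0 < l \<Longrightarrow> l < b \<Longrightarrow> (\<zeta> ^ a) ^ l \<noteq> 1"
proof -
  show "(\<zeta> ^ a) ^ b = 1" using assms \<zeta>(2) by (simp flip: power_mult)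
  have "a > 0" using assms p_pos' by (cases a) auto
  then show "(\<zeta> ^ a) ^ l \<noteq> 1" if "0 < l" "l < b"
    using \<zeta>(3)[of "a * l"] that mult_strict_left_mono[of l b a] by (simp add: assms flip: power_mult)
qed

definition T_stable :: "'l set \<Rightarrow> bool" where
  "T_stable F \<longleftrightarrow> is_subfield F \<and> K \<subseteq> F \<and> v \<in> F \<and> F \<subseteq> E \<and> (\<forall>u\<in>F. T u \<in> F)"

definition T_fixed :: "'l set" where
  "T_fixed = {u \<in> E. T u = u}"

lemma T_stable_pow: "T_stable F \<Longrightarrow> u \<in> F \<Longrightarrow> (T ^^ l) u \<in> F"
  by (induction l) (auto simp: T_stable_def)

lemma T_fixed_pow: "u \<in> T_fixed \<Longrightarrow> (T ^^ l) u = u"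
  by (induction l) (auto simp: T_fixed_def)

lemma T_pow_E: "u \<in> E \<Longrightarrow> (T ^^ l) u \<in> E"
  by (induction l) (auto simp: T_E)

lemma T_stable_adjoin:
  assumes F: "T_stable F" and Y: "Y \<subseteq> T_fixed"
  shows "T_stable (field_adjoin F Y)"
  unfolding T_stable_def
proof (intro conjI ballI)
  show "field_adjoin F Y \<subseteq> E"
    using F Y by (intro field_adjoin_least E) (auto simp: T_stable_def T_fixed_def)
  show "T u \<in> field_adjoin F Y" if "u \<in> field_adjoin F Y" for u
  proof (rule field_hom_field_adjoin[OF T field_adjoin_subfield _ _ that])
    show "T u \<in> field_adjoin F Y" if "u \<in> Y" for u
      using that Y field_adjoin_gen[of u Y F] by (auto simp: T_fixed_def subset_iff)
  qed (use F in \<open>auto simp: T_stable_def intro: field_adjoin_base\<close>)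
qed (use F in \<open>auto simp: T_stable_def field_adjoin_subfield intro: field_adjoin_base\<close>)

lemma T_stable_base: "T_stable (field_adjoin K {v})"
  unfolding T_stable_def
proof (intro conjI ballI)
  show "field_adjoin K {v} \<subseteq> E" using KE v by (intro field_adjoin_least E) auto
  show "T u \<in> field_adjoin K {v}" if "u \<in> field_adjoin K {v}" for u
  proof (rule field_hom_field_adjoin[OF T field_adjoin_subfield _ _ that])
    show "T u \<in> field_adjoin K {v}" if "u \<in> K" for u
      using that by (simp add: T_K field_adjoin_base)
    show "T u \<in> field_adjoin K {v}" if "u \<in> {v}" for u
      using that v(3) is_subfield_mult[OF field_adjoin_subfield field_adjoin_base[OF \<zeta>(1)] field_adjoin_gen[of v "{v}"]]
      by simp
  qed
qed (auto simp: field_adjoin_subfield intro: field_adjoin_base field_adjoin_gen)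

lemma of_nat_p_pow_nz: "of_nat (p ^ j) \<noteq> (0::'l)"
  using p_nz by simp

text \<open>Twice Hilbert 90, made explicit by the Kummer generator \<open>v\<close>.\<close>

lemma invariant_generators:
  assumes F: "T_stable F" and j: "j \<le> n" and z: "z \<in> E" "z \<noteq> 0" and c: "(T ^^ (p ^ j)) z / z \<in> F"
  shows "\<exists>Y. finite Y \<and> card Y \<le> p ^ j \<and> Y \<subseteq> T_fixed \<and> z \<in> field_adjoin F Y"
proof -
  define q M where "q = p ^ j" and "M = p ^ (n - j)"
  have qM: "q * M = p ^ n" using j by (simp add: q_def M_def flip: power_add)
  have F_sub: "is_subfield F" "K \<subseteq> F" "v \<in> F" "F \<subseteq> E" using F by (auto simp: T_stable_def)
  note cF = is_subfield_closed[OF F_sub(1)]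
  \<comment> \<open>First descent, along \<open>T ^^ q\<close>, whose \<open>M\<close>-th power is
    the identity on \<open>E\<close>. Its Kummer generator is \<open>v\<close> with root
    \<open>\<zeta> ^ q\<close>. A factor \<open>d\<close> from \<open>F\<close> will make
    \<open>z\<close> invariant under it.\<close>
  define S where "S = T ^^ q"
  have S: "field_hom S" unfolding S_def by (rule field_hom_funpow[OF T])
  have S_pow: "S ^^ l = T ^^ (q * l)" for l by (simp add: S_def funpow_mult mult.commute)
  have Sv: "S v = \<zeta> ^ q * v" by (simp add: S_def T_pow_v)
  have S\<zeta>: "S (\<zeta> ^ q) = \<zeta> ^ q" unfolding S_def by (rule T_pow_K) (simp add: \<zeta> is_subfield_power[OF K])
  note four = S v(2) Sv S\<zeta> \<zeta>_pow_primitive[OF qM]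
  have SM: "(S ^^ M) z = z" unfolding S_pow qM by (rule T_order[OF z(1)])
  define y where "y k = (\<Sum>l<M. (S ^^ l) (v ^ k * z))" for k
  have y_fixed: "S (y k) = y k" for k
    unfolding y_def by (rule fourier_fixed[OF four SM])
  have "of_nat M * z = (\<Sum>k<M. y k / v ^ k)"
    unfolding y_def by (rule fourier_inversion[OF four])
  moreover have "of_nat M * z \<noteq> 0" using z of_nat_p_pow_nz[of "n - j"] by (simp add: M_def del: of_nat_power)
  \<comment> \<open>The resolvents together recover a nonzero multiple of \<open>z\<close>, so one
    of them is nonzero.\<close>
  ultimately obtain k where k: "y k \<noteq> 0" by (metis (no_types, lifting) div_0 sum.neutral)
  have Sz: "(S ^^ l) z / z \<in> F" for l
  proof (induction l)
    case (Suc l)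
    have "(S ^^ Suc l) z / z = S ((S ^^ l) z / z) * (S z / z)"
      using z(2) field_hom_eq_0[OF S] by (simp add: field_hom_divide[OF S])
    moreover have "S ((S ^^ l) z / z) \<in> F" using T_stable_pow[OF F Suc, of q] by (simp only: S_def)
    moreover have "S z / z \<in> F" using c by (simp add: S_def q_def)
    ultimately show ?case using cF(6) by metis
  qed (use z in \<open>auto intro: cF\<close>)
  define d where "d = y k / z"
  have dF: "d \<in> F"
  proof -
    have "d = (\<Sum>l<M. (\<zeta> ^ q) ^ (l * k) * (v ^ k * ((S ^^ l) z / z)))"
      unfolding d_def y_def sum_divide_distrib
    proof (intro sum.cong refl)
      fix l
      show "(S ^^ l) (v ^ k * z) / z = (\<zeta> ^ q) ^ (l * k) * (v ^ k * ((S ^^ l) z / z))"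
        using eigen_funpow_mult[OF four, of l k z] by simp
    qed
    also have "\<dots> \<in> F" using F_sub \<zeta>(1) by (intro cF(6,9,11) Sz) auto
    finally show ?thesis .
  qed
  have d: "y k = d * z" "d \<noteq> 0" using z k by (auto simp: d_def)
  define z' where "z' = d * z"
  have z'E: "z' \<in> E" using dF F_sub z is_subfield_mult[OF E] by (auto simp: z'_def)
  have Tz': "(T ^^ q) z' = z'" using y_fixed[of k] by (simp add: z'_def d S_def)
  have Mq: "M * q = p ^ n" using qM by (simp add: mult.commute)
  have Tb: "T (v ^ M) = \<zeta> ^ M * v ^ M" by (simp add: field_hom_power[OF T] v power_mult_distrib)
  have T\<zeta>: "T (\<zeta> ^ M) = \<zeta> ^ M" by (rule T_K) (simp add: \<zeta> is_subfield_power[OF K])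
  have b0: "v ^ M \<noteq> 0" using v by simp
  note four' = T b0 Tb T\<zeta> \<zeta>_pow_primitive[OF Mq]
  \<comment> \<open>Second descent: on elements fixed by \<open>T ^^ q\<close> the map
    \<open>T\<close> has order dividing \<open>q\<close>, and \<open>v ^ M\<close> is a Kummer
    generator. The \<open>q\<close> resolvents of \<open>z'\<close> are the invariants that are
    counted.\<close>
  define x where "x k = (\<Sum>l<q. (T ^^ l) ((v ^ M) ^ k * z'))" for k
  define Y where "Y = x ` {..<q}"
  have xE: "x k \<in> E" for k
    unfolding x_def using z'E v
    by (intro is_subfield_sum[OF E] T_pow_E is_subfield_mult[OF E] is_subfield_power[OF E])
  have "Y \<subseteq> T_fixed"
    using xE fourier_fixed[OF four' Tz'] by (auto simp: Y_def T_fixed_def x_def)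
  moreover have "z \<in> field_adjoin F Y"
  proof -
    note cY = is_subfield_closed[OF field_adjoin_subfield]
    have "of_nat q * z' = (\<Sum>k<q. x k / (v ^ M) ^ k)"
      unfolding x_def by (rule fourier_inversion[OF four'])
    then have "z = (\<Sum>k<q. x k / (v ^ M) ^ k) / of_nat q / d"
      using d of_nat_p_pow_nz[of j] by (simp add: z'_def q_def field_simps)
    also have "\<dots> \<in> field_adjoin F Y"
      using F_sub dF by (auto intro!: cY simp: Y_def intro: field_adjoin_base field_adjoin_gen)
    finally show ?thesis .
  qed
  moreover have "finite Y" "card Y \<le> p ^ j"
    using card_image_le[of "{..<q}" x] by (auto simp: Y_def q_def)
  ultimately show ?thesis by blast
qed

text \<open>A representative of an orbit of length \<open>p ^ J\<close> is fixed by
  \<open>T ^^ (p ^ J)\<close>, so the quotient in \<open>invariant_generators\<close> is 1 and the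
  orbit costs as many invariants as it has elements. The other elements are images under
  \<open>T\<close>.\<close>

lemma permuted_set_invariant_generators:
  assumes F: "T_stable F" and S: "finite S" "S \<subseteq> E" "T ` S \<subseteq> S"
  shows "\<exists>Y. finite Y \<and> card Y \<le> card S \<and> Y \<subseteq> T_fixed \<and> S \<subseteq> field_adjoin F Y"
proof -
  define g where "g x = (if x \<in> S then T x else x)" for x
  have inj: "inj_on T S"
    using field_hom_diff[OF T] field_hom_eq_0[OF T] by (intro inj_onI) (metis eq_iff_diff_eq_0)
  have "T ` S = S" using S inj by (metis endo_inj_surj)
  then have "bij_betw T S S" using inj by (simp add: bij_betw_def)
  then have g: "g permutes S"
    by (intro bij_imp_permutes) (auto simp: g_def cong: bij_betw_cong)
  have gT: "(g ^^ l) x = (T ^^ l) x" "(T ^^ l) x \<in> S" if "x \<in> S" for l x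
    using that by (induction l) (use S(3) in \<open>auto simp: g_def\<close>)
  interpret perm_lattice S g p n
    by unfold_locales (use S g p gT T_order in auto)
  have "\<exists>Y. finite Y \<and> card Y \<le> card (orb r) \<and> Y \<subseteq> T_fixed \<and> r \<in> field_adjoin F Y" if r: "r \<in> reps" for r
  proof (cases "r = 0")
    case True
    then show ?thesis by (intro exI[of _ "{}"]) (auto intro: is_subfield_zero[OF field_adjoin_subfield])
  next
    case False
    have rS: "r \<in> S" using r reps_subset by auto
    from card_orb_prime_power[OF rS] obtain J where
      J: "J \<le> n" "card (orb r) = p ^ J" "(g ^^ (p ^ J)) r = r" by blast
    have "(T ^^ (p ^ J)) r / r \<in> F"
      using J(3) gT(1)[OF rS] False F by (simp add: T_stable_def is_subfield_one)
    from invariant_generators[OF F J(1) _ False this] rS S J(2) show ?thesis by auto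
  qed
  then obtain Y where Y: "\<And>r. r \<in> reps \<Longrightarrow> finite (Y r) \<and> card (Y r) \<le> card (orb r) \<and> Y r \<subseteq> T_fixed \<and>
      r \<in> field_adjoin F (Y r)" by metis
  define Z where "Z = (\<Union>r\<in>reps. Y r)"
  have "card Z \<le> (\<Sum>r\<in>reps. card (Y r))" unfolding Z_def by (rule card_UN_le[OF finite_reps])
  also have "\<dots> \<le> (\<Sum>r\<in>reps. card (orb r))" using Y by (intro sum_mono) auto
  finally have "card Z \<le> card S" by (simp add: card_I_eq_orbs)
  moreover have Zf: "Z \<subseteq> T_fixed" using Y by (auto simp: Z_def)
  moreover have "finite Z" using Y finite_reps by (auto simp: Z_def)
  moreover have "S \<subseteq> field_adjoin F Z"
  proof
    fix s assume s: "s \<in> S"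
    then obtain r where r: "r \<in> reps" "s \<in> orb r" using I_eq_orbs by auto
    then obtain l where "s = (g ^^ l) r" by (auto simp: orb_def)
    then have "s = (T ^^ l) r" using gT(1) r reps_subset by auto
    moreover have "r \<in> field_adjoin F Z"
      using Y[OF r(1)] field_adjoin_mono[of F F "Y r" Z] r by (auto simp: Z_def)
    ultimately show "s \<in> field_adjoin F Z" using T_stable_pow[OF T_stable_adjoin[OF F Zf]] by simp
  qed
  ultimately show ?thesis by blast
qed

end

section \<open>Monomials with exponents in a coflasque lattice\<close>

locale monomial_tower = kummer_setup K E T p n \<zeta> v + L: coflasque_sublattice I g p n M e
  for K E :: "'l::field set" and T p n \<zeta> v and I :: "'i set" and g M e +
  fixes \<xi> c :: "'i \<Rightarrow> 'l" and J :: "'j set" and t :: "'j \<Rightarrow> 'l"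
  assumes \<xi>_nz: "\<And>i. i \<in> I \<Longrightarrow> \<xi> i \<noteq> 0" and c: "\<And>i. i \<in> I \<Longrightarrow> c i \<in> K" "\<And>i. i \<in> I \<Longrightarrow> c i \<noteq> 0"
    and T_\<xi>: "\<And>i. i \<in> I \<Longrightarrow> T (\<xi> (g i)) = c i * \<xi> i"
    and monomial_E: "\<And>f. f \<in> M \<Longrightarrow> (\<Prod>i\<in>I. \<xi> i powi f i) \<in> E"
    and J: "finite J" and t: "\<And>j. j \<in> J \<Longrightarrow> t j \<in> T_fixed" "\<And>j. j \<in> J \<Longrightarrow> t j \<noteq> 0"
begin

definition mon :: "('i \<Rightarrow> int) \<Rightarrow> 'l" where
  "mon f = (\<Prod>i\<in>I. \<xi> i powi f i)"

lemma mon_nz: "mon f \<noteq> 0"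
  unfolding mon_def using \<xi>_nz L.finite_I by (simp add: power_int_not_zero)

lemma mon_diff: "mon (f - h) = mon f / mon h"
  unfolding mon_def prod_dividef[symmetric] using \<xi>_nz by (intro prod.cong refl) (simp add: power_int_diff)

lemma mon_E: "f \<in> M \<Longrightarrow> mon f \<in> E"
  by (simp add: mon_def monomial_E)

text \<open>The indices in \<open>T_\<xi>\<close> are chosen so that \<open>T\<close> acts on
  exponent vectors by composition with \<open>g\<close>. Thus \<open>T (mon f) / mon f\<close>
  corresponds to \<open>coboundary g f\<close>, up to a constant.\<close>

lemma T_mon: "\<exists>k\<in>K. k \<noteq> 0 \<and> T (mon f) = k * mon (\<lambda>i. f (g i))"
proof -
  have "mon f = (\<Prod>i\<in>I. \<xi> (g i) powi f (g i))"
    unfolding mon_def by (rule prod.reindex_bij_betw[OF permutes_imp_bij[OF L.g_permutes], symmetric])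
  then have "T (mon f) = (\<Prod>i\<in>I. (c i * \<xi> i) powi f (g i))"
    by (simp add: field_hom_prod[OF T] field_hom_power_int[OF T] T_\<xi>)
  also have "\<dots> = (\<Prod>i\<in>I. c i powi f (g i)) * mon (\<lambda>i. f (g i))"
    by (simp add: mon_def power_int_mult_distrib prod.distrib)
  finally have "T (mon f) = (\<Prod>i\<in>I. c i powi f (g i)) * mon (\<lambda>i. f (g i))" .
  moreover have "(\<Prod>i\<in>I. c i powi f (g i)) \<in> K"
    by (intro is_subfield_prod[OF K] is_subfield_power_int[OF K] c)
  moreover have "(\<Prod>i\<in>I. c i powi f (g i)) \<noteq> 0"
    using L.finite_I c by (simp add: power_int_not_zero)
  ultimately show ?thesis by blast
qed

lemma T_pow_mon: "\<exists>k\<in>K. k \<noteq> 0 \<and> (T ^^ l) (mon f) = k * mon (\<lambda>i. f ((g ^^ l) i))"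
proof (induction l)
  case 0
  then show ?case using is_subfield_one[OF K] by (intro bexI[of _ 1]) auto
next
  case (Suc l)
  then obtain k where k: "k \<in> K" "k \<noteq> 0" "(T ^^ l) (mon f) = k * mon (\<lambda>i. f ((g ^^ l) i))" by blast
  obtain k' where k': "k' \<in> K" "k' \<noteq> 0"
    "T (mon (\<lambda>i. f ((g ^^ l) i))) = k' * mon (\<lambda>i. f ((g ^^ l) (g i)))" using T_mon by blast
  have "(T ^^ Suc l) (mon f) = (k * k') * mon (\<lambda>i. f ((g ^^ Suc l) i))"
    using k k' by (simp add: field_hom_mult[OF T] T_K funpow_swap1)
  then show ?case using k k' is_subfield_mult[OF K] by (intro bexI[of _ "k * k'"]) auto
qed

lemma T_pow_mon_ratio: "\<exists>k\<in>K. k \<noteq> 0 \<and> (T ^^ l) (mon f) / mon f = k * mon (shift_diff g l f)"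
proof -
  have "mon (shift_diff g l f) = mon (\<lambda>i. f ((g ^^ l) i)) / mon f"
    using mon_diff[of "\<lambda>i. f ((g ^^ l) i)" f] by (simp add: shift_diff_def fun_diff_def)
  with T_pow_mon[of l f] show ?thesis by auto
qed

text \<open>A stable field contains the constants and is closed under quotients and under
  \<open>T\<close>. Hence module generators of a set of exponents suffice to place all its monomials
  in \<open>F\<close>.\<close>

lemma submodule_mon_preimage:
  assumes F: "T_stable F" shows "L.L.submodule {f. mon f \<in> F}"
proof -
  have sF: "is_subfield F" "K \<subseteq> F" using F by (auto simp: T_stable_def)
  have "mon 0 = 1" by (simp add: mon_def)
  moreover have "mon (coboundary g f) \<in> F" if f: "mon f \<in> F" for f
  proof -
    have "shift_diff g 1 f = coboundary g f" by (simp add: shift_diff_def coboundary_def)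
    with T_pow_mon_ratio[of 1 f] obtain k where k: "k \<in> K" "k \<noteq> 0"
      "T (mon f) / mon f = k * mon (coboundary g f)" by auto
    then have "mon (coboundary g f) = T (mon f) / mon f / k" by simp
    also have "\<dots> \<in> F" using F f k sF by (intro is_subfield_divide[OF sF(1)]) (auto simp: T_stable_def)
    finally show ?thesis .
  qed
  ultimately show ?thesis
    unfolding L.L.submodule_def using sF is_subfield_one[OF sF(1)] is_subfield_divide[OF sF(1)]
    by (simp add: mon_diff)
qed

text \<open>A generator at level \<open>i\<close> costs \<open>p ^ i\<close> new invariants and
  frees \<open>p ^ (i - 1)\<close> old ones.\<close>

definition weight :: "nat \<Rightarrow> nat" where
  "weight j = (\<Sum>i\<in>{j<..n}. card (L.moved i) * (p ^ i - p ^ (i - 1)))"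

definition budget :: "nat \<Rightarrow> nat" where
  "budget j = (\<Sum>i\<in>{j<..n}. card (L.moved i) * p ^ (i - 1))"

lemma weight_step: "1 \<le> j \<Longrightarrow> j \<le> n \<Longrightarrow> weight (j - 1) = weight j + card (L.moved j) * (p ^ j - p ^ (j - 1))"
  and budget_step: "1 \<le> j \<Longrightarrow> j \<le> n \<Longrightarrow> budget (j - 1) = budget j + card (L.moved j) * p ^ (j - 1)"
proof -
  assume "1 \<le> j" "j \<le> n"
  then have *: "{j - 1<..n} = insert j {j<..n}" by auto
  show "weight (j - 1) = weight j + card (L.moved j) * (p ^ j - p ^ (j - 1))"
    "budget (j - 1) = budget j + card (L.moved j) * p ^ (j - 1)"
    unfolding weight_def budget_def * by simp_all
qed

text \<open>The members of \<open>Y\<close> absorb the invariants \<open>t i\<close> with \<open>i \<in> U\<close>: these need not be kept as generators,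
  since they can be recovered from \<open>Y\<close> and the monomials. \<open>weight\<close> counts the net number of new
  generators down to level \<open>j\<close>, and \<open>budget\<close> the invariants absorbed.\<close>

definition level_done :: "nat \<Rightarrow> 'l set \<Rightarrow> 'j set \<Rightarrow> bool" where
  "level_done j Y U \<longleftrightarrow> finite Y \<and> Y \<subseteq> T_fixed \<and> U \<subseteq> J \<and> card U \<le> budget j \<and> card Y \<le> card U + weight j \<and>
     mon ` (shift_diff g (p ^ j) ` M) \<subseteq> field_adjoin (field_adjoin K {v}) Y \<and>
     (\<forall>L. T_stable L \<and> Y \<subseteq> L \<and> mon ` M \<subseteq> L \<longrightarrow> t ` U \<subseteq> L)"

lemma level_done_step:
  assumes j: "1 \<le> j" "j \<le> n" and YU: "level_done j Y U" and enough: "budget 0 \<le> card J"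
  shows "\<exists>Y' U'. level_done (j - 1) Y' U'"
proof -
  define F where "F = field_adjoin (field_adjoin K {v}) Y"
  have Y: "finite Y" "Y \<subseteq> T_fixed" "U \<subseteq> J" "card U \<le> budget j" "card Y \<le> card U + weight j"
    "mon ` (shift_diff g (p ^ j) ` M) \<subseteq> F" "\<And>L. T_stable L \<Longrightarrow> Y \<subseteq> L \<Longrightarrow> mon ` M \<subseteq> L \<Longrightarrow> t ` U \<subseteq> L"
    using YU by (auto simp: level_done_def F_def)
  have F: "T_stable F" unfolding F_def by (rule T_stable_adjoin[OF T_stable_base Y(2)])
  have sF: "is_subfield F" "K \<subseteq> F" "v \<in> F" "F \<subseteq> E" using F by (auto simp: T_stable_def)
  define q where "q = p ^ (j - 1)"
  have pj: "p ^ j = q * p" using j by (cases j) (auto simp: q_def)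
  from L.level_generators[OF j(1)] obtain B where B: "B \<subseteq> M" "finite B" "card B \<le> card (L.moved j)"
    "shift_diff g q ` M \<subseteq> L.L.lspan (shift_diff g (p ^ j) ` M \<union> shift_diff g q ` B)"
    unfolding q_def by blast
  have "budget (j - 1) \<le> budget 0"
    unfolding budget_def by (intro sum_mono2) auto
  then have "budget j + card (L.moved j) * q \<le> card J"
    using budget_step[OF j] enough by (simp add: q_def)
  moreover have "card B * q \<le> card (L.moved j) * q" using B(3) by simp
  ultimately have "card B * q \<le> card J - card U" using Y(4) by linarith
  then have "card (B \<times> {..<q}) \<le> card (J - U)"
    using Y(3) J by (simp add: card_cartesian_product card_Diff_subset finite_subset)
  \<comment> \<open>\<open>\<phi>\<close> reserves \<open>q\<close> fresh indices for each
    generator; the budget ensures that so many are left.\<close>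
  with card_le_inj[of "B \<times> {..<q}" "J - U"] B(2) J obtain \<phi> where
    \<phi>: "\<phi> ` (B \<times> {..<q}) \<subseteq> J - U" "inj_on \<phi> (B \<times> {..<q})" by auto
  \<comment> \<open>The least positive power of \<open>v\<close> fixed by \<open>T ^^ q\<close>.
    \<open>T\<close> multiplies it by a primitive \<open>q\<close>-th root of unity, so its powers
    below \<open>q\<close> keep \<open>q\<close> coefficients apart.\<close>
  define b where "b = v ^ (p ^ (n - (j - 1)))"
  define \<omega> where "\<omega> = \<zeta> ^ (p ^ (n - (j - 1)))"
  have Nq: "p ^ (n - (j - 1)) * q = p ^ n" using j by (simp add: q_def flip: power_add)
  have Tb: "T b = \<omega> * b" by (simp add: b_def \<omega>_def field_hom_power[OF T] v power_mult_distrib)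
  have T\<omega>: "T \<omega> = \<omega>" unfolding \<omega>_def by (rule T_K) (simp add: \<zeta> is_subfield_power[OF K])
  have b0: "b \<noteq> 0" using v by (simp add: b_def)
  note four = T b0 Tb T\<omega> \<zeta>_pow_primitive[OF Nq, folded \<omega>_def]
  have bF: "b \<in> F" using sF by (simp add: b_def is_subfield_power)
  have \<omega>K: "\<omega> \<in> K" by (simp add: \<omega>_def \<zeta> is_subfield_power[OF K])
  define w where "w m = (\<Sum>k<q. b ^ k * t (\<phi> (m, k)))" for m
  have t\<phi>: "t (\<phi> (m, k)) \<in> T_fixed" "t (\<phi> (m, k)) \<noteq> 0" if "m \<in> B" "k < q" for m k
    using \<phi>(1) that t by auto
  have coef: "of_nat q * t (\<phi> (m, k)) = (\<Sum>l<q. (T ^^ l) (w m) / \<omega> ^ (l * k)) / b ^ k"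
    if "m \<in> B" "k < q" for m k
    unfolding w_def by (rule fourier_coefficient[OF four _ that(2), of "\<lambda>k. t (\<phi> (m, k))"])
      (use t\<phi> that in \<open>auto simp: T_fixed_def\<close>)
  have q_nz: "of_nat q \<noteq> (0::'l)" unfolding q_def by (rule of_nat_p_pow_nz)
  have q0: "0 < q" by (simp add: q_def p_pos')
  \<comment> \<open>If \<open>w m\<close> vanished, so would all its conjugates, and with them its
    coefficients, which are nonzero.\<close>
  have w_nz: "w m \<noteq> 0" if "m \<in> B" for m
  proof
    assume "w m = 0"
    then have "(T ^^ l) (w m) = 0" for l using field_hom_zero[OF field_hom_funpow[OF T]] by simp
    with coef[OF that q0] t\<phi>(2)[OF that q0] q_nz show False by simp
  qed
  have w_E: "w m \<in> E" if "m \<in> B" for m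
    unfolding w_def using t\<phi> that bF sF by (auto simp: T_fixed_def intro!: is_subfield_closed[OF E])
  have b_q: "(T ^^ q) b = b"
    using eigen_funpow[OF four, of q] \<zeta>_pow_primitive(1)[OF Nq] by (simp add: \<omega>_def)
  have w_q: "(T ^^ q) (w m) = w m" if "m \<in> B" for m
    unfolding w_def field_hom_sum[OF field_hom_funpow[OF T]] field_hom_mult[OF field_hom_funpow[OF T]]
      field_hom_power[OF field_hom_funpow[OF T]] b_q
    using t\<phi> that T_fixed_pow by (intro sum.cong refl) auto
  have w_pj: "(T ^^ (p ^ j)) (w m) = w m" if "m \<in> B" for m
  proof -
    have "((T ^^ q) ^^ p) (w m) = w m" by (induction p) (auto simp: w_q that)
    then show ?thesis by (simp add: pj funpow_mult)
  qed
  define Z where "Z m = w m * mon m" for m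
  have mE: "mon m \<in> E" if "m \<in> B" for m using mon_E B(1) that by auto
  have "\<exists>Y. finite Y \<and> card Y \<le> p ^ j \<and> Y \<subseteq> T_fixed \<and> Z m \<in> field_adjoin F Y" if m: "m \<in> B" for m
  proof (rule invariant_generators[OF F j(2)])
    show "Z m \<in> E" unfolding Z_def by (rule is_subfield_mult[OF E w_E[OF m] mE[OF m]])
    show "Z m \<noteq> 0" using w_nz[OF m] mon_nz by (simp add: Z_def)
    obtain k where k: "k \<in> K" "(T ^^ (p ^ j)) (mon m) / mon m = k * mon (shift_diff g (p ^ j) m)"
      using T_pow_mon_ratio by blast
    have "(T ^^ (p ^ j)) (Z m) / Z m = k * mon (shift_diff g (p ^ j) m)"
      using k(2) w_nz[OF m] by (simp add: Z_def field_hom_mult[OF field_hom_funpow[OF T]] w_pj[OF m])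
    moreover have "mon (shift_diff g (p ^ j) m) \<in> F" using Y(6) m B(1) by blast
    then have "k * mon (shift_diff g (p ^ j) m) \<in> F"
      using k(1) sF by (intro is_subfield_mult[OF sF(1)]) auto
    ultimately show "(T ^^ (p ^ j)) (Z m) / Z m \<in> F" by simp
  qed
  then obtain V where V: "\<And>m. m \<in> B \<Longrightarrow> finite (V m) \<and> card (V m) \<le> p ^ j \<and> V m \<subseteq> T_fixed \<and>
      Z m \<in> field_adjoin F (V m)" by metis
  define Y' where "Y' = Y \<union> (\<Union>m\<in>B. V m)"
  define U' where "U' = U \<union> \<phi> ` (B \<times> {..<q})"
  define F' where "F' = field_adjoin (field_adjoin K {v}) Y'"
  have Y'_fixed: "Y' \<subseteq> T_fixed" using Y(2) V by (auto simp: Y'_def)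
  have F': "T_stable F'" unfolding F'_def by (rule T_stable_adjoin[OF T_stable_base Y'_fixed])
  have sF': "is_subfield F'" "K \<subseteq> F'" using F' by (auto simp: T_stable_def)
  have FF': "F \<subseteq> F'" unfolding F_def F'_def by (intro field_adjoin_mono) (auto simp: Y'_def)
  have ZF': "Z m \<in> F'" if m: "m \<in> B" for m
  proof -
    have "field_adjoin F (V m) \<subseteq> F'"
      using FF' m by (intro field_adjoin_least sF') (auto simp: F'_def Y'_def intro: field_adjoin_gen)
    with V[OF m] show ?thesis by auto
  qed
  have "card (\<Union>m\<in>B. V m) \<le> (\<Sum>m\<in>B. card (V m))" by (rule card_UN_le[OF B(2)])
  also have "\<dots> \<le> card B * p ^ j" using V sum_bounded_above[of B "\<lambda>m. card (V m)" "p ^ j"] by simp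
  finally have cardV: "card (\<Union>m\<in>B. V m) \<le> card B * p ^ j" .
  have cU': "card U' = card U + card B * q"
  proof -
    have "finite U" "U \<inter> \<phi> ` (B \<times> {..<q}) = {}" using Y(3) J finite_subset \<phi>(1) by blast+
    then show ?thesis
      using \<phi>(2) B(2) by (simp add: U'_def card_Un_disjoint card_image card_cartesian_product)
  qed
  have "level_done (j - 1) Y' U'"
    unfolding level_done_def
  proof (intro conjI allI impI)
    show "finite Y'" using Y(1) B(2) V by (auto simp: Y'_def)
    show "Y' \<subseteq> T_fixed" by (rule Y'_fixed)
    show "U' \<subseteq> J" using Y(3) \<phi>(1) by (auto simp: U'_def)
    show "card U' \<le> budget (j - 1)"
      using cU' Y(4) B(3) budget_step[OF j] by (simp add: q_def add_mono)
    show "card Y' \<le> card U' + weight (j - 1)"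
    proof -
      have "card Y' \<le> card Y + card B * p ^ j"
        using card_Un_le[of Y "\<Union>m\<in>B. V m"] cardV by (simp add: Y'_def)
      \<comment> \<open>Of the \<open>p ^ j\<close> new invariants, \<open>q\<close> are compensated
        by the growth of \<open>U\<close>, and only the rest adds to \<open>weight\<close>.\<close>
      also have "p ^ j = q + (p ^ j - q)" using pj p_pos' by simp
      then have "card B * p ^ j = card B * q + card B * (p ^ j - q)"
        by (metis distrib_left)
      also have "card B * (p ^ j - q) \<le> card (L.moved j) * (p ^ j - q)" using B(3) by simp
      finally show ?thesis using Y(5) cU' weight_step[OF j] by (simp add: q_def)
    qed
    show "mon ` (shift_diff g (p ^ (j - 1)) ` M) \<subseteq> field_adjoin (field_adjoin K {v}) Y'"
    proof -
      have "shift_diff g q ` B \<subseteq> {f. mon f \<in> F'}"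
      proof safe
        fix m assume m: "m \<in> B"
        obtain k where k: "k \<in> K" "k \<noteq> 0" "(T ^^ q) (mon m) / mon m = k * mon (shift_diff g q m)"
          using T_pow_mon_ratio by blast
        have "(T ^^ q) (Z m) / Z m = k * mon (shift_diff g q m)"
          using k(3) w_nz[OF m] by (simp add: Z_def field_hom_mult[OF field_hom_funpow[OF T]] w_q[OF m])
        then have "mon (shift_diff g q m) = (T ^^ q) (Z m) / Z m / k" using k(2) by simp
        also have "\<dots> \<in> F'"
          using k(1) sF'(2)
          by (intro is_subfield_divide[OF sF'(1)] T_stable_pow[OF F'] ZF'[OF m]) auto
        finally show "mon (shift_diff g q m) \<in> F'" .
      qed
      moreover have "shift_diff g (p ^ j) ` M \<subseteq> {f. mon f \<in> F'}" using Y(6) FF' by auto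
      ultimately have "L.L.lspan (shift_diff g (p ^ j) ` M \<union> shift_diff g q ` B) \<subseteq> {f. mon f \<in> F'}"
        by (intro L.L.lspan_least submodule_mon_preimage[OF F']) auto
      with B(4) show ?thesis unfolding F'_def q_def by auto
    qed
    fix L assume L: "T_stable L \<and> Y' \<subseteq> L \<and> mon ` M \<subseteq> L"
    then have sL: "is_subfield L" "K \<subseteq> L" "v \<in> L" by (auto simp: T_stable_def)
    have F'L: "F' \<subseteq> L" unfolding F'_def using L sL
      by (intro field_adjoin_least) auto
    have "t ` U \<subseteq> L" using Y(7)[of L] L by (auto simp: Y'_def)
    moreover have "t (\<phi> (m, k)) \<in> L" if mk: "m \<in> B" "k < q" for m k
    proof -
      have "Z m \<in> L" "mon m \<in> L" using ZF'[OF mk(1)] F'L L B(1) mk(1) by blast+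
      then have "Z m / mon m \<in> L" by (rule is_subfield_divide[OF sL(1)])
      then have "w m \<in> L" using mon_nz by (simp add: Z_def)
      then have Tw: "(T ^^ l) (w m) \<in> L" for l using T_stable_pow[of L] L by blast
      have "t (\<phi> (m, k)) = (\<Sum>l<q. (T ^^ l) (w m) / \<omega> ^ (l * k)) / b ^ k / of_nat q"
        unfolding coef[OF mk, symmetric] using q_nz by simp
      also have "\<dots> \<in> L"
        using Tw \<omega>K sL bF FF' F'L by (auto intro!: is_subfield_closed[OF sL(1)])
      finally show ?thesis .
    qed
    ultimately show "t ` U' \<subseteq> L" by (auto simp: U'_def)
  qed
  then show ?thesis by blast
qed

text \<open>Level \<open>n\<close> is empty, because g^(p^n) = 1 on \<open>I\<close>. The descent
  ends at the image of g - 1, where one invariant for each orbit completes the monomials. Only then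
  do the absorbed \<open>t i\<close> become available again.\<close>

theorem monomial_tower_generators:
  assumes enough: "budget 0 \<le> card J"
  shows "\<exists>Y. finite Y \<and> Y \<subseteq> T_fixed \<and> card Y \<le> card I + card J \<and>
    mon ` M \<union> t ` J \<subseteq> field_adjoin (field_adjoin K {v}) Y"
proof -
  have "\<exists>Y U. level_done (n - i) Y U" if "i \<le> n" for i
    using that
  proof (induction i)
    case 0
    have "mon (shift_diff g (p ^ n) m) = 1" if m: "m \<in> M" for m
    proof -
      have "shift_diff g (p ^ n) m i = 0" if "i \<in> I" for i
        using L.g_order[OF that] by (simp add: shift_diff_def)
      then show ?thesis by (simp add: mon_def)
    qed
    then have "level_done n {} {}"
      by (auto simp: level_done_def weight_def budget_def intro: is_subfield_one[OF field_adjoin_subfield])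
    then show ?case by auto
  next
    case (Suc i)
    then obtain Y U where "level_done (n - i) Y U" by auto
    moreover have "n - Suc i = n - i - 1" "1 \<le> n - i" using Suc.prems by auto
    ultimately show ?case using level_done_step[of "n - i"] enough by auto
  qed
  from this[of n] obtain Y U where YU: "level_done 0 Y U" by auto
  define F where "F = field_adjoin (field_adjoin K {v}) Y"
  have Y: "finite Y" "Y \<subseteq> T_fixed" "U \<subseteq> J" "card Y \<le> card U + weight 0"
    "mon ` (shift_diff g (p ^ 0) ` M) \<subseteq> F" "\<And>L. T_stable L \<Longrightarrow> Y \<subseteq> L \<Longrightarrow> mon ` M \<subseteq> L \<Longrightarrow> t ` U \<subseteq> L"
    using YU by (auto simp: level_done_def F_def)
  have F: "T_stable F" unfolding F_def by (rule T_stable_adjoin[OF T_stable_base Y(2)])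
  have sF: "is_subfield F" "K \<subseteq> F" "v \<in> F" "F \<subseteq> E" using F by (auto simp: T_stable_def)
  have cob: "coboundary g f = shift_diff g (p ^ 0) f" for f by (simp add: shift_diff_def coboundary_def)
  from L.bottom_generators obtain B where B: "B \<subseteq> M" "finite B" "card B \<le> card L.reps"
    "M \<subseteq> L.L.lspan (coboundary g ` M \<union> B)" by blast
  have "\<exists>Y. finite Y \<and> card Y \<le> p ^ 0 \<and> Y \<subseteq> T_fixed \<and> mon m \<in> field_adjoin F Y" if m: "m \<in> B" for m
  proof (rule invariant_generators[OF F])
    show "mon m \<in> E" using mon_E B(1) m by auto
    obtain k where k: "k \<in> K" "(T ^^ (p ^ 0)) (mon m) / mon m = k * mon (shift_diff g (p ^ 0) m)"
      using T_pow_mon_ratio by blast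
    moreover have "mon (shift_diff g (p ^ 0) m) \<in> F" using Y(5) m B(1) by blast
    then have "k * mon (shift_diff g (p ^ 0) m) \<in> F"
      using k(1) sF by (intro is_subfield_mult[OF sF(1)]) auto
    ultimately show "(T ^^ (p ^ 0)) (mon m) / mon m \<in> F" by simp
  qed (simp_all add: mon_nz)
  then obtain V where V: "\<And>m. m \<in> B \<Longrightarrow> finite (V m) \<and> card (V m) \<le> 1 \<and> V m \<subseteq> T_fixed \<and>
      mon m \<in> field_adjoin F (V m)" by (metis power_0)
  define Y' where "Y' = Y \<union> (\<Union>m\<in>B. V m)"
  define F' where "F' = field_adjoin (field_adjoin K {v}) Y'"
  have Y'_fixed: "Y' \<subseteq> T_fixed" using Y(2) V by (auto simp: Y'_def)
  have F': "T_stable F'" unfolding F'_def by (rule T_stable_adjoin[OF T_stable_base Y'_fixed])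
  have sF': "is_subfield F'" using F' by (auto simp: T_stable_def)
  have FF': "F \<subseteq> F'" unfolding F_def F'_def by (intro field_adjoin_mono) (auto simp: Y'_def)
  have "B \<subseteq> {f. mon f \<in> F'}"
  proof safe
    fix m assume m: "m \<in> B"
    have "field_adjoin F (V m) \<subseteq> F'"
      using FF' m by (intro field_adjoin_least sF') (auto simp: F'_def Y'_def intro: field_adjoin_gen)
    with V[OF m] show "mon m \<in> F'" by auto
  qed
  moreover have "coboundary g ` M \<subseteq> {f. mon f \<in> F'}" using Y(5) FF' by (auto simp: cob)
  ultimately have "L.L.lspan (coboundary g ` M \<union> B) \<subseteq> {f. mon f \<in> F'}"
    by (intro L.L.lspan_least submodule_mon_preimage[OF F']) auto
  with B(4) have monF': "mon ` M \<subseteq> F'" by auto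
  have YF': "Y' \<subseteq> F'" by (auto simp: F'_def intro: field_adjoin_gen)
  have tU: "t ` U \<subseteq> F'" using Y(6)[OF F' _ monF'] YF' by (auto simp: Y'_def)
  \<comment> \<open>Invariants that were not absorbed remain generators.\<close>
  define Y'' where "Y'' = Y' \<union> t ` (J - U)"
  have F'': "F' \<subseteq> field_adjoin (field_adjoin K {v}) Y''"
    unfolding F'_def by (intro field_adjoin_mono) (auto simp: Y''_def)
  have "finite Y''" using Y(1) B(2) V J by (auto simp: Y''_def Y'_def)
  moreover have "Y'' \<subseteq> T_fixed" using Y'_fixed t(1) by (auto simp: Y''_def)
  moreover have "card Y'' \<le> card I + card J"
  proof -
    have "card (\<Union>m\<in>B. V m) \<le> (\<Sum>m\<in>B. card (V m))" by (rule card_UN_le[OF B(2)])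
    also have "\<dots> \<le> card B" using V sum_bounded_above[of B "\<lambda>m. card (V m)" 1] by simp
    finally have "card (\<Union>m\<in>B. V m) \<le> card L.reps" using B(3) by simp
    moreover have "card (t ` (J - U)) \<le> card (J - U)" using J by (intro card_image_le) auto
    moreover have "card (J - U) + card U = card J"
      using Y(3) J by (metis card_Diff_subset card_mono finite_subset le_add_diff_inverse2)
    moreover have "weight 0 + card L.reps = card I"
      using L.card_moved_sum by (simp add: weight_def atLeastSucAtMost_greaterThanAtMost[symmetric])
    moreover have "card Y'' \<le> card Y' + card (t ` (J - U))" unfolding Y''_def by (rule card_Un_le)
    moreover have "card Y' \<le> card Y + card (\<Union>m\<in>B. V m)" unfolding Y'_def by (rule card_Un_le)
    ultimately show ?thesis using Y(4) by linarith
  qed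
  moreover have "t ` J \<subseteq> field_adjoin (field_adjoin K {v}) Y''"
  proof
    fix x assume "x \<in> t ` J"
    then obtain j where j: "j \<in> J" "x = t j" by blast
    show "x \<in> field_adjoin (field_adjoin K {v}) Y''"
    proof (cases "j \<in> U")
      case True
      then show ?thesis using j tU F'' by auto
    next
      case False
      then show ?thesis using j by (auto simp: Y''_def intro: field_adjoin_gen)
    qed
  qed
  moreover have "mon ` M \<subseteq> field_adjoin (field_adjoin K {v}) Y''" using monF' F'' by (rule order_trans)
  ultimately show ?thesis by (intro exI[of _ Y''] conjI Un_least)
qed

end

section \<open>The regular action\<close>

locale regular_field = group H for H :: "('h, 'm) monoid_scheme" (structure) +
  fixes K :: "'l::field set" and x :: "'h \<Rightarrow> 'l" and \<rho> :: "'h \<Rightarrow> 'l \<Rightarrow> 'l"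
  assumes finite_H: "finite (carrier H)" and K: "is_subfield K"
    and x_indep: "algebraically_independent K (carrier H) x"
    and x_gen: "field_adjoin K (x ` carrier H) = UNIV"
    and \<rho>_hom: "\<And>h. h \<in> carrier H \<Longrightarrow> field_hom (\<rho> h)"
    and \<rho>_K: "\<And>h u. h \<in> carrier H \<Longrightarrow> u \<in> K \<Longrightarrow> \<rho> h u = u"
    and \<rho>_one: "\<rho> \<one> u = u"
    and \<rho>_mult: "\<And>h k u. h \<in> carrier H \<Longrightarrow> k \<in> carrier H \<Longrightarrow> \<rho> (h \<otimes> k) u = \<rho> h (\<rho> k u)"
    and \<rho>_x: "\<And>h k. h \<in> carrier H \<Longrightarrow> k \<in> carrier H \<Longrightarrow> \<rho> h (x k) = x (h \<otimes> k)"
begin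

text \<open>Algebraic independence, applied to the polynomial of degree one with the coefficients
  \<open>c g\<close>.\<close>

lemma x_linear_independent:
  assumes c: "\<And>g. g \<in> carrier H \<Longrightarrow> c g \<in> K" and 0: "(\<Sum>g\<in>carrier H. c g * x g) = 0" and h: "h \<in> carrier H"
  shows "c h = 0"
proof -
  define P where "P = (\<Sum>g\<in>carrier H. Poly_Mapping.single (Poly_Mapping.single g (1::nat)) (c g))"
  have look: "Poly_Mapping.lookup P e = (\<Sum>g\<in>carrier H. if Poly_Mapping.single g 1 = e then c g else 0)" for e
    unfolding P_def lookup_sum lookup_single when_def ..
  have "poly_at x P = 0"
    unfolding P_def poly_at_sum poly_at_single monomial_at_single using 0 by simp
  moreover have "Poly_Mapping.lookup P e \<in> K" for e
    unfolding look by (auto intro!: is_subfield_closed[OF K] c)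
  moreover have "Poly_Mapping.keys e \<subseteq> carrier H" if "e \<in> Poly_Mapping.keys P" for e
  proof -
    have "\<exists>g\<in>carrier H. Poly_Mapping.single g (1::nat) = e"
    proof (rule ccontr)
      assume "\<not> ?thesis"
      then have "Poly_Mapping.lookup P e = 0" unfolding look by (intro sum.neutral) auto
      with that show False by (simp add: in_keys_iff)
    qed
    then show ?thesis by auto
  qed
  ultimately have "P = 0" using x_indep by (auto simp: algebraically_independent_def)
  moreover have "Poly_Mapping.lookup P (Poly_Mapping.single h 1) = c h"
  proof -
    have "Poly_Mapping.single g (1::nat) = Poly_Mapping.single h 1 \<longleftrightarrow> g = h" for g
      by (metis lookup_single_eq lookup_single_not_eq zero_neq_one)
    then show ?thesis unfolding look using finite_H h by simp
  qed
  ultimately show ?thesis by simp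
qed

lemma subgroup_sum_translate:
  assumes "subgroup B H" "k \<in> B"
  shows "(\<Sum>h\<in>B. f (k \<otimes> h)) = (\<Sum>h\<in>B. f h)" "(\<Prod>h\<in>B. f' (k \<otimes> h)) = (\<Prod>h\<in>B. f' h)"
proof -
  have inj: "inj_on (\<lambda>h. k \<otimes> h) B"
    using subgroup.mem_carrier[OF assms(1)] assms(2) by (auto intro!: inj_onI)
  have "(\<lambda>h. k \<otimes> h) ` B \<subseteq> B" using assms by (auto intro: subgroup.m_closed)
  moreover have "finite B" using assms(1) finite_H subgroup.subset finite_subset by blast
  ultimately have "bij_betw (\<lambda>h. k \<otimes> h) B B" using inj by (simp add: bij_betw_def endo_inj_surj)
  then show "(\<Sum>h\<in>B. f (k \<otimes> h)) = (\<Sum>h\<in>B. f h)" "(\<Prod>h\<in>B. f' (k \<otimes> h)) = (\<Prod>h\<in>B. f' h)"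
    by (rule sum.reindex_bij_betw, rule prod.reindex_bij_betw)
qed

definition Fix :: "'h set \<Rightarrow> 'l set" where
  "Fix B = {u. \<forall>h\<in>B. \<rho> h u = u}"

lemma is_subfield_Fix:
  assumes "B \<subseteq> carrier H" shows "is_subfield (Fix B)"
proof -
  have "Fix B = \<Inter>((\<lambda>h. {u. \<rho> h u = u}) ` B)" by (auto simp: Fix_def)
  then show ?thesis using assms is_subfield_fixed[OF \<rho>_hom] by (auto intro!: is_subfield_Inter)
qed

text \<open>Averaging shows that an invariant of \<open>D\<close> lies in \<open>F\<close>. The norm
  of an element is such an invariant and a multiple of the element in \<open>D\<close>, which gives
  inverses. This takes the place of the Galois correspondence, first for \<open>A\<close> and then
  for the whole group.\<close>

lemma descent:
  assumes B: "subgroup B H" and char: "of_nat (card B) \<noteq> (0::'l)"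
    and D: "is_subring D" and F: "is_subfield F" "F \<subseteq> D" "F \<subseteq> Fix B"
    and stable: "\<And>h d. h \<in> B \<Longrightarrow> d \<in> D \<Longrightarrow> \<rho> h d \<in> D"
    and avg: "\<And>d. d \<in> D \<Longrightarrow> (\<Sum>h\<in>B. \<rho> h d) \<in> F"
  shows "is_subfield D" "D \<inter> Fix B \<subseteq> F"
proof -
  note BH = subgroup.mem_carrier[OF B]
  have finB: "finite B" using B finite_H subgroup.subset finite_subset by blast
  show fixD: "D \<inter> Fix B \<subseteq> F"
  proof
    fix d assume d: "d \<in> D \<inter> Fix B"
    then have "of_nat (card B) * d \<in> F" using avg[of d] by (simp add: Fix_def)
    then have "of_nat (card B) * d / of_nat (card B) \<in> F"
      by (intro is_subfield_divide[OF F(1)] is_subfield_of_nat[OF F(1)])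
    then show "d \<in> F" using char by simp
  qed
  have "inverse d \<in> D" if d: "d \<in> D" for d
  proof (cases "d = 0")
    case False
    define N where "N = (\<Prod>h\<in>B. \<rho> h d)"
    define N' where "N' = (\<Prod>h\<in>B - {\<one>}. \<rho> h d)"
    have one: "\<one> \<in> B" using B by (rule subgroup.one_closed)
    have "N = d * N'" using finB one by (simp add: N_def N'_def prod.remove \<rho>_one)
    have "N \<noteq> 0" unfolding N_def using finB False BH by (simp add: field_hom_eq_0[OF \<rho>_hom])
    have N': "N' \<in> D" unfolding N'_def using stable d by (intro is_subring_prod[OF D]) auto
    have "\<rho> k N = N" if "k \<in> B" for k
    proof -
      have "\<rho> k N = (\<Prod>h\<in>B. \<rho> (k \<otimes> h) d)"
        using that BH by (simp add: N_def field_hom_prod[OF \<rho>_hom] \<rho>_mult)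
      then show ?thesis using subgroup_sum_translate(2)[OF B that] by (simp add: N_def)
    qed
    then have "N \<in> Fix B" by (simp add: Fix_def)
    moreover have "N \<in> D" unfolding \<open>N = d * N'\<close> by (rule is_subring_mult[OF D d N'])
    ultimately have "inverse N \<in> D" using fixD F is_subfield_inverse[OF F(1)] by blast
    then have "inverse N * N' \<in> D" by (rule is_subring_mult[OF D _ N'])
    moreover have "inverse N * N' = inverse d" using \<open>N = d * N'\<close> \<open>N \<noteq> 0\<close> False by (simp add: field_simps)
    ultimately show ?thesis by simp
  qed (use is_subring_zero[OF D] in simp)
  then show "is_subfield D" using D by (auto simp: is_subfield_def is_subring_def)
qed

lemma map_poly_field_hom_mult:
  assumes f: "field_hom f" shows "map_poly f (q * r) = map_poly f q * map_poly f r"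
  by (rule poly_eqI)
    (simp add: coeff_map_poly field_hom_zero[OF f] Polynomial.coeff_mult field_hom_sum[OF f] field_hom_mult[OF f])

text \<open>The product of the factors X - \<open>\<rho> h u\<close> over the group has invariant
  coefficients and the root \<open>u\<close>.\<close>

lemma algebraic_over_Fix: "algebraic_over (Fix (carrier H)) u"
proof -
  define P where "P = (\<Prod>h\<in>carrier H. [:- \<rho> h u, 1:])"
  have map: "map_poly f (\<Prod>h\<in>S. [:- \<rho> h u, 1:]) = (\<Prod>h\<in>S. [:- f (\<rho> h u), 1:])"
    if "field_hom f" "finite S" for f S
    using that(2)
    by (induction S rule: finite_induct)
      (simp_all add: map_poly_field_hom_mult[OF that(1)] map_poly_pCons field_hom_simps[OF that(1)] map_poly_1'
        del: mult_pCons_left)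
  have "Polynomial.coeff P i \<in> Fix (carrier H)" for i
    unfolding Fix_def
  proof safe
    fix k assume k: "k \<in> carrier H"
    have "map_poly (\<rho> k) P = (\<Prod>h\<in>carrier H. [:- \<rho> (k \<otimes> h) u, 1:])"
      unfolding P_def map[OF \<rho>_hom[OF k] finite_H] using k by (simp add: \<rho>_mult)
    also have "\<dots> = P"
      unfolding P_def by (rule subgroup_sum_translate(2)[OF subgroup_self k])
    finally show "\<rho> k (Polynomial.coeff P i) = Polynomial.coeff P i"
      by (metis coeff_map_poly field_hom_zero[OF \<rho>_hom[OF k]])
  qed
  moreover have "P \<noteq> 0" using finite_H by (simp add: P_def)
  moreover have "poly P u = 0"
    unfolding P_def poly_prod using finite_H by (auto intro!: prod_zero bexI[of _ \<one>] simp: \<rho>_one)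
  ultimately show ?thesis by (auto simp: algebraic_over_def)
qed

lemma rational_Fix:
  assumes "Fix (carrier H) = field_adjoin K Y" "finite Y" "card Y \<le> card (carrier H)"
  shows "rational_over K (Fix (carrier H))"
  unfolding assms(1)
  by (rule rational_if_generated_by_few[OF K finite_H x_indep assms(2,3)])
    (use algebraic_over_Fix in \<open>simp add: assms(1)\<close>)

end

text \<open>The powers of \<open>z\<close> are already \<open>M\<close> different roots of X^M -
  1.\<close>

lemma roots_of_unity_powers:
  fixes z :: "'l::field"
  assumes z: "primitive_root_of_unity M z" and w: "w ^ M = 1" and M: "0 < M"
  shows "\<exists>i<M. w = z ^ i"
proof -
  define P :: "'l poly" where "P = Polynomial.monom 1 M - 1"
  have co: "Polynomial.coeff P M = 1" using M by (simp add: P_def)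
  then have P0: "P \<noteq> 0" by auto
  have "Polynomial.degree P \<le> M" unfolding P_def by (intro degree_diff_le degree_monom_le) auto
  moreover have "card {y. poly P y = 0} \<le> Polynomial.degree P" by (rule card_poly_roots_bound[OF P0])
  moreover have eq: "{y. poly P y = 0} = {y. y ^ M = 1}" by (auto simp: P_def poly_monom)
  ultimately have card: "card {y::'l. y ^ M = 1} \<le> M" by simp
  have fin: "finite {y::'l. y ^ M = 1}" using poly_roots_finite[OF P0] eq by simp
  have zM: "z ^ M = 1" "\<And>j. 0 < j \<Longrightarrow> j < M \<Longrightarrow> z ^ j \<noteq> 1"
    using z by (auto simp: primitive_root_of_unity_def)
  have z0: "z \<noteq> 0" using zM(1) M by (auto simp: power_0_left)
  have inj: "inj_on (\<lambda>i. z ^ i) {..<M}"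
  proof (rule linorder_inj_onI')
    fix a b assume ab: "a \<in> {..<M}" "b \<in> {..<M}" "a < b"
    show "z ^ a \<noteq> z ^ b"
    proof
      assume eq: "z ^ a = z ^ b"
      have "z ^ b = z ^ a * z ^ (b - a)" using ab(3) by (simp flip: power_add)
      with eq z0 have "z ^ (b - a) = 1" by simp
      moreover have "b - a < M" "0 < b - a" using ab by auto
      ultimately show False using zM(2) by blast
    qed
  qed
  have "(z ^ i) ^ M = 1" for i
    using zM(1) by (metis mult.commute power_mult power_one)
  then have sub: "(\<lambda>i. z ^ i) ` {..<M} \<subseteq> {y. y ^ M = 1}" by blast
  have "card ((\<lambda>i. z ^ i) ` {..<M}) = M" using inj by (simp add: card_image)
  then have "(\<lambda>i. z ^ i) ` {..<M} = {y. y ^ M = 1}" using card by (intro card_seteq[OF fin sub]) simp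
  with w show ?thesis by blast
qed

section \<open>Joint eigenfunctions\<close>

text \<open>\<open>\<tau> [^] (p ^ n)\<close> lies in \<open>A\<close> but need not be 1, so
  eigenvalues of \<open>\<tau>\<close> are roots of order p^n of character values of
  \<open>A\<close>. Powers of \<open>z\<close> supply both the character values and these
  roots.\<close>

locale abelian_by_cyclic = regular_field H K x \<rho>
  for H :: "('h, 'm) monoid_scheme" (structure) and K :: "'l::field set" and x \<rho> +
  fixes A :: "'h set" and \<tau> :: 'h and p n m r :: nat and z :: 'l
  assumes A: "subgroup A H" and A_comm: "\<And>a b. a \<in> A \<Longrightarrow> b \<in> A \<Longrightarrow> a \<otimes> b = b \<otimes> a"
    and \<tau>: "\<tau> \<in> carrier H" and A_conj: "\<And>a. a \<in> A \<Longrightarrow> inv \<tau> \<otimes> a \<otimes> \<tau> \<in> A"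
    and p: "Factorial_Ring.prime p" and n: "1 \<le> n" and \<tau>_pow: "\<tau> [^] (p ^ n) \<in> A"
    and decomp: "bij_betw (\<lambda>(a, l). a \<otimes> \<tau> [^] l) (A \<times> {..<p ^ n}) (carrier H)"
    and order_H: "card (carrier H) = p ^ r"
    and exponent: "\<And>g. g \<in> carrier H \<Longrightarrow> g [^] (p ^ m) = \<one>"
    and z: "z \<in> K" "primitive_root_of_unity (p ^ m) z" and p_nz: "of_nat p \<noteq> (0::'l)"
begin

abbreviation N where "N \<equiv> p ^ n"

lemma N2: "2 \<le> N"
proof -
  have "2 \<le> p" using p by (rule prime_ge_2_nat)
  also have "p \<le> p ^ n" using n \<open>2 \<le> p\<close> by (simp add: self_le_power)
  finally show ?thesis .
qed

lemma A_carrier: "a \<in> A \<Longrightarrow> a \<in> carrier H"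
  using subgroup.mem_carrier[OF A] .

lemma decomp_ex: "g \<in> carrier H \<Longrightarrow> \<exists>a\<in>A. \<exists>l<N. g = a \<otimes> \<tau> [^] l"
  using decomp by (force simp: bij_betw_def)

lemma decomp_unique:
  assumes "a \<in> A" "l < N" "a' \<in> A" "l' < N" "a \<otimes> \<tau> [^] l = a' \<otimes> \<tau> [^] l'"
  shows "a = a' \<and> l = l'"
proof -
  have "inj_on (\<lambda>(a, l). a \<otimes> \<tau> [^] l) (A \<times> {..<N})" using decomp by (simp add: bij_betw_def)
  from inj_onD[OF this, of "(a, l)" "(a', l')"] assms show ?thesis by auto
qed

definition ops :: "('h \<Rightarrow> 'h) set" where
  "ops = insert (\<lambda>g. g \<otimes> \<tau>) ((\<lambda>a g. a \<otimes> g) ` A)"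

lemma finite_A: "finite A"
  using finite_H A subgroup.subset finite_subset by blast

lemma finite_ops: "finite ops"
  by (simp add: ops_def finite_A)

lemma ops_closed: "\<sigma> \<in> ops \<Longrightarrow> g \<in> carrier H \<Longrightarrow> \<sigma> g \<in> carrier H"
  using A_carrier \<tau> by (auto simp: ops_def)

lemma ops_commute:
  assumes "\<sigma> \<in> ops" "\<sigma>' \<in> ops" "g \<in> carrier H" shows "\<sigma> (\<sigma>' g) = \<sigma>' (\<sigma> g)"
proof -
  have aa: "a \<otimes> (b \<otimes> g) = b \<otimes> (a \<otimes> g)" if "a \<in> A" "b \<in> A" for a b
    using A_comm[OF that] that A_carrier assms(3) by (simp flip: m_assoc)
  have at: "a \<otimes> (g \<otimes> \<tau>) = (a \<otimes> g) \<otimes> \<tau>" if "a \<in> A" for a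
    using that A_carrier assms(3) \<tau> by (simp add: m_assoc)
  from assms(1,2) show ?thesis unfolding ops_def
    by (elim insertE imageE; hypsubst) (rule refl, rule at[symmetric], assumption, rule at, assumption, rule aa)
qed

lemma ops_pow_closed: "\<sigma> \<in> ops \<Longrightarrow> g \<in> carrier H \<Longrightarrow> (\<sigma> ^^ l) g \<in> carrier H"
  by (induction l) (auto simp: ops_closed)

lemma ops_pow_commute: "\<sigma> \<in> ops \<Longrightarrow> \<sigma>' \<in> ops \<Longrightarrow> g \<in> carrier H \<Longrightarrow> (\<sigma> ^^ l) (\<sigma>' g) = \<sigma>' ((\<sigma> ^^ l) g)"
  by (induction l) (auto simp: ops_commute ops_pow_closed)

lemma ops_order:
  assumes "\<sigma> \<in> ops" "g \<in> carrier H" shows "(\<sigma> ^^ (p ^ m)) g = g"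
proof -
  have a: "((\<lambda>g. a \<otimes> g) ^^ l) g = a [^] l \<otimes> g" if "a \<in> A" for a l
  proof (induction l)
    case (Suc l)
    have "a \<otimes> (a [^] l \<otimes> g) = a [^] Suc l \<otimes> g"
      using A_carrier[OF that] assms(2) nat_pow_Suc2[OF A_carrier[OF that], of l] by (simp add: m_assoc[symmetric])
    with Suc show ?case by simp
  qed (use assms in simp)
  have t: "((\<lambda>g. g \<otimes> \<tau>) ^^ l) g = g \<otimes> \<tau> [^] l" for l
    by (induction l) (use assms \<tau> in \<open>simp_all add: m_assoc\<close>)
  from assms(1) show ?thesis
    unfolding ops_def
  proof (elim insertE imageE)
    assume "\<sigma> = (\<lambda>g. g \<otimes> \<tau>)"
    then show ?thesis using t[of "p ^ m"] exponent[OF \<tau>] assms(2) by simp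
  next
    fix b assume "b \<in> A" "\<sigma> = (\<lambda>g. b \<otimes> g)"
    then show ?thesis using a[of b "p ^ m"] exponent[OF A_carrier[of b]] assms(2) by simp
  qed
qed

text \<open>Left translations by \<open>A\<close> commute with right translation by \<open>\<tau>\<close>, so every function on \<open>H\<close>
  is a sum of joint eigenfunctions, and these are determined up to a factor by their eigenvalues.\<close>

definition \<Theta> :: "('h \<Rightarrow> 'l) set" where
  "\<Theta> = {\<theta>. (\<forall>g. g \<notin> carrier H \<longrightarrow> \<theta> g = 0) \<and> \<theta> \<one> = 1 \<and>
    (\<forall>\<sigma>\<in>ops. \<forall>g\<in>carrier H. \<theta> (\<sigma> g) = \<theta> (\<sigma> \<one>) * \<theta> g)}"

context
  fixes \<theta>
  assumes \<theta>: "\<theta> \<in> \<Theta>"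
begin

lemma \<Theta>_one: "\<theta> \<one> = 1" and \<Theta>_off: "g \<notin> carrier H \<Longrightarrow> \<theta> g = 0"
  and \<Theta>_ops: "\<sigma> \<in> ops \<Longrightarrow> g \<in> carrier H \<Longrightarrow> \<theta> (\<sigma> g) = \<theta> (\<sigma> \<one>) * \<theta> g"
  using \<theta> unfolding \<Theta>_def by blast+

lemma \<Theta>_mult: "a \<in> A \<Longrightarrow> g \<in> carrier H \<Longrightarrow> \<theta> (a \<otimes> g) = \<theta> a * \<theta> g"
  using \<Theta>_ops[of "\<lambda>g. a \<otimes> g" g] A_carrier by (simp add: ops_def)

lemma \<Theta>_\<tau>: "g \<in> carrier H \<Longrightarrow> \<theta> (g \<otimes> \<tau>) = \<theta> g * \<theta> \<tau>"
  using \<Theta>_ops[of "\<lambda>g. g \<otimes> \<tau>" g] \<tau> by (simp add: ops_def)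

lemma \<Theta>_\<tau>_pow: "g \<in> carrier H \<Longrightarrow> \<theta> (g \<otimes> \<tau> [^] (l::nat)) = \<theta> g * \<theta> \<tau> ^ l"
proof (induction l)
  case (Suc l)
  have "g \<otimes> \<tau> [^] Suc l = (g \<otimes> \<tau> [^] l) \<otimes> \<tau>" using Suc.prems \<tau> by (simp add: m_assoc)
  then show ?case using Suc \<tau> by (simp add: \<Theta>_\<tau>)
qed simp

lemma \<Theta>_\<tau>_pow': "\<theta> (\<tau> [^] (l::nat)) = \<theta> \<tau> ^ l"
  using \<Theta>_\<tau>_pow[of \<one> l] \<tau> by (simp add: \<Theta>_one)

lemma \<Theta>_A_pow: "a \<in> A \<Longrightarrow> \<theta> (a [^] (l::nat)) = \<theta> a ^ l"
proof (induction l)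
  case (Suc l)
  have "\<theta> (a [^] Suc l) = \<theta> (a \<otimes> a [^] l)" using nat_pow_Suc2[OF A_carrier[OF Suc.prems]] by simp
  then show ?case using Suc A_carrier by (simp add: \<Theta>_mult)
qed (simp add: \<Theta>_one)

lemma \<Theta>_root:
  assumes "g \<in> carrier H" shows "\<theta> g ^ (p ^ m) = 1"
proof -
  obtain a l where al: "a \<in> A" "g = a \<otimes> \<tau> [^] (l::nat)" using decomp_ex[OF assms] by blast
  have "\<theta> a ^ (p ^ m) = 1" using \<Theta>_A_pow[OF al(1), of "p ^ m"] exponent A_carrier al by (simp add: \<Theta>_one)
  moreover have "\<theta> \<tau> ^ (p ^ m) = 1" using \<Theta>_\<tau>_pow'[of "p ^ m"] exponent \<tau> by (simp add: \<Theta>_one)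
  then have "(\<theta> \<tau> ^ l) ^ (p ^ m) = 1" by (metis mult.commute power_mult power_one)
  ultimately show ?thesis using al A_carrier by (simp add: \<Theta>_\<tau>_pow power_mult_distrib)
qed

lemma \<Theta>_nz: "g \<in> carrier H \<Longrightarrow> \<theta> g \<noteq> 0"
  using \<Theta>_root p by (metis power_0_left power_not_zero prime_gt_0_nat zero_less_power less_irrefl zero_neq_one)

lemma \<Theta>_K: "\<theta> g \<in> K"
proof (cases "g \<in> carrier H")
  case True
  from roots_of_unity_powers[OF z(2) \<Theta>_root[OF True]] p obtain i where "\<theta> g = z ^ i"
    by (auto simp: prime_gt_0_nat)
  then show ?thesis using is_subfield_power[OF K z(1)] by simp
qed (simp add: \<Theta>_off is_subfield_zero[OF K])

lemma \<Theta>_inv_A: "a \<in> A \<Longrightarrow> \<theta> (inv a) = inverse (\<theta> a)"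
  using \<Theta>_mult[of "inv a" a] A_carrier subgroup.m_inv_closed[OF A, of a] \<Theta>_nz[of a]
  by (simp add: \<Theta>_one field_simps)

lemma \<Theta>_inv_\<tau>: "\<theta> (inv \<tau>) * \<theta> \<tau> = 1"
  using \<Theta>_\<tau>[of "inv \<tau>"] \<tau> by (simp add: \<Theta>_one)

end

lemma \<Theta>_eqI:
  assumes "\<theta> \<in> \<Theta>" "\<theta>' \<in> \<Theta>" "\<And>a. a \<in> A \<Longrightarrow> \<theta> a = \<theta>' a" "\<theta> \<tau> = \<theta>' \<tau>" shows "\<theta> = \<theta>'"
proof
  fix g show "\<theta> g = \<theta>' g"
  proof (cases "g \<in> carrier H")
    case True
    obtain a l where "a \<in> A" "g = a \<otimes> \<tau> [^] (l::nat)" using decomp_ex[OF True] by blast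
    then show ?thesis using assms A_carrier by (simp add: \<Theta>_\<tau>_pow)
  qed (use assms in \<open>simp add: \<Theta>_off\<close>)
qed

lemma \<Theta>I:
  assumes "\<And>g. g \<notin> carrier H \<Longrightarrow> \<theta> g = 0" "\<theta> \<one> = 1"
    "\<And>a g. a \<in> A \<Longrightarrow> g \<in> carrier H \<Longrightarrow> \<theta> (a \<otimes> g) = \<theta> a * \<theta> g"
    "\<And>g. g \<in> carrier H \<Longrightarrow> \<theta> (g \<otimes> \<tau>) = \<theta> g * \<theta> \<tau>"
  shows "\<theta> \<in> \<Theta>"
  unfolding \<Theta>_def ops_def
proof (intro CollectI conjI allI impI ballI)
  fix \<sigma> g assume "\<sigma> \<in> insert (\<lambda>g. g \<otimes> \<tau>) ((\<lambda>a g. a \<otimes> g) ` A)" and g: "g \<in> carrier H"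
  then show "\<theta> (\<sigma> g) = \<theta> (\<sigma> \<one>) * \<theta> g"
  proof (elim insertE imageE)
    assume "\<sigma> = (\<lambda>g. g \<otimes> \<tau>)"
    then show ?thesis using assms(4)[OF g] \<tau> by simp
  next
    fix a assume "a \<in> A" "\<sigma> = (\<lambda>g. a \<otimes> g)"
    then show ?thesis using assms(3)[OF _ g, of a] A_carrier by simp
  qed
qed (use assms in auto)

text \<open>Dedekind's argument: the relation moved by \<open>\<sigma>\<close>, minus
  \<open>\<theta>0 (\<sigma> \<one>)\<close> times the relation, no longer contains
  \<open>\<theta>0\<close>.\<close>

lemma \<Theta>_independent:
  assumes "finite S" "S \<subseteq> \<Theta>" "\<And>g. g \<in> carrier H \<Longrightarrow> (\<Sum>\<theta>\<in>S. c \<theta> * \<theta> g) = 0"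
  shows "\<forall>\<theta>\<in>S. c \<theta> = 0"
  using assms
proof (induction S arbitrary: c rule: finite_induct)
  case (insert \<theta>0 S)
  have rel: "c \<theta>0 * \<theta>0 g + (\<Sum>\<theta>\<in>S. c \<theta> * \<theta> g) = 0" if "g \<in> carrier H" for g
    using insert.prems(2)[OF that] insert.hyps by simp
  have op: "c \<theta> * (\<theta> (\<sigma> \<one>) - \<theta>0 (\<sigma> \<one>)) = 0" if \<sigma>: "\<sigma> \<in> ops" and \<theta>S: "\<theta> \<in> S" for \<sigma> \<theta>
  proof -
    have "(\<Sum>\<theta>\<in>S. c \<theta> * (\<theta> (\<sigma> \<one>) - \<theta>0 (\<sigma> \<one>)) * \<theta> g) = 0" if g: "g \<in> carrier H" for g
    proof -
      have "c \<theta>0 * \<theta>0 (\<sigma> g) + (\<Sum>\<theta>\<in>S. c \<theta> * \<theta> (\<sigma> g)) = 0" using rel ops_closed[OF \<sigma> g] by simp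
      moreover have "\<theta> (\<sigma> g) = \<theta> (\<sigma> \<one>) * \<theta> g" if "\<theta> \<in> insert \<theta>0 S" for \<theta>
        using \<Theta>_ops[OF _ \<sigma> g] insert.prems(1) that by blast
      ultimately have e1: "c \<theta>0 * (\<theta>0 (\<sigma> \<one>) * \<theta>0 g) + (\<Sum>\<theta>\<in>S. c \<theta> * (\<theta> (\<sigma> \<one>) * \<theta> g)) = 0"
        by simp
      have e2: "\<theta>0 (\<sigma> \<one>) * (c \<theta>0 * \<theta>0 g + (\<Sum>\<theta>\<in>S. c \<theta> * \<theta> g)) = 0" using rel[OF g] by simp
      have "(\<Sum>\<theta>\<in>S. c \<theta> * (\<theta> (\<sigma> \<one>) - \<theta>0 (\<sigma> \<one>)) * \<theta> g) =
          (\<Sum>\<theta>\<in>S. c \<theta> * (\<theta> (\<sigma> \<one>) * \<theta> g)) - \<theta>0 (\<sigma> \<one>) * (\<Sum>\<theta>\<in>S. c \<theta> * \<theta> g)"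
        by (simp add: sum_subtractf sum_distrib_left algebra_simps)
      also have "\<dots> = - (c \<theta>0 * (\<theta>0 (\<sigma> \<one>) * \<theta>0 g)) - (- (\<theta>0 (\<sigma> \<one>) * (c \<theta>0 * \<theta>0 g)))"
      proof (intro arg_cong2[of _ _ _ _ "(-)"])
        show "(\<Sum>\<theta>\<in>S. c \<theta> * (\<theta> (\<sigma> \<one>) * \<theta> g)) = - (c \<theta>0 * (\<theta>0 (\<sigma> \<one>) * \<theta>0 g))"
          using e1 by (simp add: eq_neg_iff_add_eq_0 add.commute)
        show "\<theta>0 (\<sigma> \<one>) * (\<Sum>\<theta>\<in>S. c \<theta> * \<theta> g) = - (\<theta>0 (\<sigma> \<one>) * (c \<theta>0 * \<theta>0 g))"
          using e2 unfolding distrib_left by (simp only: eq_neg_iff_add_eq_0 add.commute)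
      qed
      finally show ?thesis by (simp add: mult_ac)
    qed
    from insert.IH[OF _ this] insert.prems(1) \<theta>S show ?thesis by auto
  qed
  have cS: "c \<theta> = 0" if \<theta>S: "\<theta> \<in> S" for \<theta>
  proof (rule ccontr)
    assume "c \<theta> \<noteq> 0"
    with op \<theta>S have "\<theta> (\<sigma> \<one>) = \<theta>0 (\<sigma> \<one>)" if "\<sigma> \<in> ops" for \<sigma> using that by fastforce
    then have eq: "\<theta> (\<sigma> \<one>) = \<theta>0 (\<sigma> \<one>)" if "\<sigma> \<in> ops" for \<sigma> using that by blast
    have "\<theta> a = \<theta>0 a" if "a \<in> A" for a
      using eq[of "\<lambda>g. a \<otimes> g"] that A_carrier by (simp add: ops_def)
    moreover have "\<theta> \<tau> = \<theta>0 \<tau>" using eq[of "\<lambda>g. g \<otimes> \<tau>"] \<tau> by (simp add: ops_def)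
    ultimately have "\<theta> = \<theta>0" using insert.prems(1) \<theta>S by (intro \<Theta>_eqI) auto
    with insert.hyps \<theta>S show False by simp
  qed
  moreover have "c \<theta>0 = 0" using rel[of \<one>] cS insert.prems(1) \<Theta>_one[of \<theta>0] by simp
  ultimately show ?case by simp
qed simp

lemma \<Theta>_card: "finite \<Theta>" "card \<Theta> \<le> card (carrier H)"
proof -
  have small: "card S \<le> card (carrier H)" if S: "finite S" "S \<subseteq> \<Theta>" for S
  proof (rule ccontr)
    assume "\<not> card S \<le> card (carrier H)"
    then have "card (carrier H) < card S" by simp
    from homogeneous_system_nontrivial[OF _ finite_H S(1) this, of UNIV "\<lambda>\<theta> g. \<theta> g"]
    obtain c where "\<exists>\<theta>\<in>S. c \<theta> \<noteq> 0" "\<forall>g\<in>carrier H. (\<Sum>\<theta>\<in>S. c \<theta> * \<theta> g) = 0"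
      by (auto simp: is_subfield_def)
    with \<Theta>_independent[OF S, of c] show False by auto
  qed
  show fin: "finite \<Theta>"
  proof (rule ccontr)
    assume "infinite \<Theta>"
    then obtain S where "S \<subseteq> \<Theta>" "finite S" "card S = Suc (card (carrier H))"
      using infinite_arbitrarily_large by blast
    with small[of S] show False by simp
  qed
  show "card \<Theta> \<le> card (carrier H)" using small[OF fin] by simp
qed

text \<open>A list and not a set, because the projections that produce the summands may coincide.
  Zero summands are allowed.\<close>

definition eigen_list :: "('h \<Rightarrow> 'h) set \<Rightarrow> ('h \<Rightarrow> 'l) \<Rightarrow> ('h \<Rightarrow> 'l) list \<Rightarrow> bool" where
  "eigen_list S f fs \<longleftrightarrow>
    (\<forall>h\<in>set fs. (\<forall>g\<in>carrier H. h g \<in> K) \<and> (\<forall>\<sigma>\<in>S. \<exists>c. \<forall>g\<in>carrier H. h (\<sigma> g) = c * h g)) \<and>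
    (\<forall>g\<in>carrier H. f g = (\<Sum>h\<leftarrow>fs. h g))"

lemma eigen_listD:
  assumes "eigen_list S f fs"
  shows "h \<in> set fs \<Longrightarrow> g \<in> carrier H \<Longrightarrow> h g \<in> K"
    and "h \<in> set fs \<Longrightarrow> \<sigma> \<in> S \<Longrightarrow> \<exists>c. \<forall>g\<in>carrier H. h (\<sigma> g) = c * h g"
    and "g \<in> carrier H \<Longrightarrow> f g = (\<Sum>h\<leftarrow>fs. h g)"
  using assms unfolding eigen_list_def by blast+

text \<open>The operators are treated one after another. As \<open>\<sigma> ^^ (p ^ m)\<close> is
  the identity, the averages \<open>pr h i\<close> against powers of \<open>z\<close> project to
  eigenspaces of the new operator; as the operators commute, they preserve the eigenspaces of the
  earlier ones.\<close>

lemma eigenfunction_decomposition: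
  assumes "finite S" "S \<subseteq> ops" "\<And>g. g \<in> carrier H \<Longrightarrow> f g \<in> K"
  shows "\<exists>fs. eigen_list S f fs"
  using assms
proof (induction S arbitrary: f rule: finite_induct)
  case empty
  then show ?case by (intro exI[of _ "[f]"]) (simp add: eigen_list_def)
next
  case (insert \<sigma> S)
  define M where "M = p ^ m"
  have M0: "of_nat M \<noteq> (0::'l)" using p_nz by (simp add: M_def)
  have zM: "z ^ M = 1" "\<And>j. 0 < j \<Longrightarrow> j < M \<Longrightarrow> z ^ j \<noteq> 1"
    using z by (auto simp: primitive_root_of_unity_def M_def)
  have Mpos: "0 < M" using p by (simp add: M_def prime_gt_0_nat)
  have z0: "z \<noteq> 0" using zM(1) Mpos by (auto simp: power_0_left)
  note cK = is_subfield_closed[OF K]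
  have "S \<subseteq> ops" using insert.prems(1) by simp
  then obtain fs where "eigen_list S f fs" using insert.IH[of f] insert.prems(2) by metis
  note fs = eigen_listD[OF this]
  have \<sigma>: "\<sigma> \<in> ops" using insert.prems by simp
  define pr where "pr h i g = (\<Sum>l<M. (z ^ i) ^ l * h ((\<sigma> ^^ l) g)) / of_nat M" for h :: "'h \<Rightarrow> 'l" and i g
  define gs where "gs = concat (map (\<lambda>h. map (pr h) [0..<M]) fs)"
  have sum_pr: "(\<Sum>i<M. pr h i g) = h g" if g: "g \<in> carrier H" for h g
  proof -
    have "(\<Sum>i<M. pr h i g) = (\<Sum>l<M. (\<Sum>i<M. (z ^ l) ^ i) * h ((\<sigma> ^^ l) g)) / of_nat M"
      unfolding pr_def sum_divide_distrib[symmetric] sum_distrib_right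
      by (subst sum.swap) (simp add: mult.commute flip: power_mult)
    also have "\<dots> = (\<Sum>l<M. if l = 0 then of_nat M * h g else 0) / of_nat M"
    proof (intro arg_cong2[of _ _ _ _ "(/)"] sum.cong refl)
      fix l assume "l \<in> {..<M}"
      moreover have "(z ^ l) ^ M = 1" using zM(1) by (metis mult.commute power_mult power_one)
      ultimately have "(\<Sum>i<M. (z ^ l) ^ i) = 0" if "l \<noteq> 0"
        using that zM(2)[of l] by (intro sum_powers_root_of_unity) auto
      then show "(\<Sum>i<M. (z ^ l) ^ i) * h ((\<sigma> ^^ l) g) = (if l = 0 then of_nat M * h g else 0)" by auto
    qed
    also have "\<dots> = h g" using Mpos M0 by simp
    finally show ?thesis .
  qed
  have "(\<forall>g\<in>carrier H. h' g \<in> K) \<and> (\<forall>\<sigma>'\<in>insert \<sigma> S. \<exists>c. \<forall>g\<in>carrier H. h' (\<sigma>' g) = c * h' g)"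
    if h': "h' \<in> set gs" for h'
  proof -
    from h' obtain h i where h: "h \<in> set fs" "h' = pr h i" by (auto simp: gs_def)
    have "h' g \<in> K" if "g \<in> carrier H" for g
      unfolding h(2) pr_def using fs(1)[OF h(1)] ops_pow_closed[OF \<sigma> that] z(1) by (intro cK) auto
    moreover have "h' (\<sigma> g) = inverse (z ^ i) * h' g" if g: "g \<in> carrier H" for g
    proof -
      have "z ^ i * (\<Sum>l<M. (z ^ i) ^ l * h ((\<sigma> ^^ l) (\<sigma> g))) = (\<Sum>l<M. (z ^ i) ^ Suc l * h ((\<sigma> ^^ Suc l) g))"
        by (simp add: sum_distrib_left mult_ac funpow_swap1)
      also have "\<dots> = (\<Sum>l<M. (z ^ i) ^ l * h ((\<sigma> ^^ l) g))"
      proof (rule sum_lessThan_rotate)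
        have "(z ^ i) ^ M = 1" using zM(1) by (metis mult.commute power_mult power_one)
        then show "(z ^ i) ^ M * h ((\<sigma> ^^ M) g) = (z ^ i) ^ 0 * h ((\<sigma> ^^ 0) g)"
          using ops_order[OF \<sigma> g] by (simp add: M_def)
      qed
      finally have "(\<Sum>l<M. (z ^ i) ^ l * h ((\<sigma> ^^ l) (\<sigma> g))) =
          inverse (z ^ i) * (\<Sum>l<M. (z ^ i) ^ l * h ((\<sigma> ^^ l) g))"
        using z0 by (metis (no_types, lifting) left_inverse mult.assoc mult_1 power_not_zero)
      then show ?thesis by (simp add: h(2) pr_def)
    qed
    moreover have "\<exists>c. \<forall>g\<in>carrier H. h' (\<sigma>' g) = c * h' g" if \<sigma>': "\<sigma>' \<in> S" for \<sigma>'
    proof -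
      from fs(2)[OF h(1) \<sigma>'] obtain c where c: "\<forall>g\<in>carrier H. h (\<sigma>' g) = c * h g" by blast
      have "h' (\<sigma>' g) = c * h' g" if g: "g \<in> carrier H" for g
      proof -
        have "(\<sigma> ^^ l) (\<sigma>' g) = \<sigma>' ((\<sigma> ^^ l) g)" for l
          using ops_pow_commute[OF \<sigma> _ g] \<sigma>' insert.prems(1) by blast
        then have "h ((\<sigma> ^^ l) (\<sigma>' g)) = c * h ((\<sigma> ^^ l) g)" for l
          using c ops_pow_closed[OF \<sigma> g] by simp
        then show ?thesis by (simp add: h(2) pr_def sum_distrib_left mult_ac)
      qed
      then show ?thesis by blast
    qed
    ultimately show ?thesis by blast
  qed
  moreover have "f g = (\<Sum>h\<leftarrow>gs. h g)" if g: "g \<in> carrier H" for g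
  proof -
    have "(\<Sum>h\<leftarrow>gs. h g) = (\<Sum>h\<leftarrow>fs. \<Sum>h'\<leftarrow>map (pr h) [0..<M]. h' g)"
      unfolding gs_def by (induction fs) simp_all
    also have "\<dots> = (\<Sum>h\<leftarrow>fs. h g)"
      using sum_pr[OF g] by (simp add: comp_def interv_sum_list_conv_sum_set_nat atLeast0LessThan)
    finally show ?thesis using fs(3)[OF g] by simp
  qed
  ultimately have "eigen_list (insert \<sigma> S) f gs" unfolding eigen_list_def by blast
  then show ?case by blast
qed

text \<open>The linear form with coefficient function \<open>\<theta>\<close>. The group acts on the
  variables from the left, so \<open>A\<close> multiplies this form by inverse character values.
  Left translation by \<open>\<tau>\<close> is not among \<open>ops\<close>; it permutes these forms
  up to constants.\<close>

definition ev :: "('h \<Rightarrow> 'l) \<Rightarrow> 'l" where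
  "ev \<theta> = (\<Sum>h\<in>carrier H. \<theta> h * x h)"

lemma ev_nz: "\<theta> \<in> \<Theta> \<Longrightarrow> ev \<theta> \<noteq> 0"
  using x_linear_independent[of \<theta> \<one>] \<Theta>_K[of \<theta>] \<Theta>_one[of \<theta>] unfolding ev_def
  by (metis one_closed zero_neq_one)

lemma x_in_span_ev:
  assumes D: "is_subring D" "K \<subseteq> D" "ev ` \<Theta> \<subseteq> D" and g: "g \<in> carrier H"
  shows "x g \<in> D"
proof -
  define f where "f h = (if h = g then 1 else 0 :: 'l)" for h
  have "f h \<in> K" for h by (auto simp: f_def is_subfield_closed[OF K])
  then obtain fs where "eigen_list ops f fs"
    using eigenfunction_decomposition[OF finite_ops order_refl, of f] by metis
  note fs = eigen_listD[OF this]
  have "(\<Sum>g\<in>carrier H. h g * x g) \<in> D" if h: "h \<in> set fs" for h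
  \<comment> \<open>An eigenfunction that is 0 at the identity is 0 on all of \<open>A\<close> and
    on all its cosets; any other can be scaled to a member of \<open>\<Theta>\<close>.\<close>
  proof (cases "h \<one> = 0")
    case True
    have "h g = 0" if g: "g \<in> carrier H" for g
    proof -
      obtain a l where al: "a \<in> A" "g = a \<otimes> \<tau> [^] (l::nat)" using decomp_ex[OF g] by blast
      have "h (\<tau> [^] l) = 0" for l :: nat
      proof (induction l)
        case (Suc l)
        obtain c where "\<forall>g\<in>carrier H. h (g \<otimes> \<tau>) = c * h g"
          using fs(2)[OF h, of "\<lambda>g. g \<otimes> \<tau>"] by (auto simp: ops_def)
        then show ?case using Suc \<tau> by simp
      qed (use True in simp)
      moreover obtain c where "\<forall>g\<in>carrier H. h (a \<otimes> g) = c * h g"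
        using fs(2)[OF h, of "\<lambda>g. a \<otimes> g"] al by (auto simp: ops_def)
      ultimately show ?thesis using al \<tau> by simp
    qed
    then show ?thesis using is_subring_zero[OF D(1)] by simp
  next
    case False
    define \<theta> where "\<theta> g = (if g \<in> carrier H then h g / h \<one> else 0)" for g
    have "\<theta> \<in> \<Theta>"
    proof -
      have "\<theta> (\<sigma> g) = \<theta> (\<sigma> \<one>) * \<theta> g" if \<sigma>: "\<sigma> \<in> ops" and g: "g \<in> carrier H" for \<sigma> g
      proof -
        obtain c where "\<forall>g\<in>carrier H. h (\<sigma> g) = c * h g" using fs(2)[OF h \<sigma>] by blast
        then show ?thesis using \<sigma> g ops_closed False by (simp add: \<theta>_def)
      qed
      moreover have "\<theta> \<one> = 1" "\<And>g. g \<notin> carrier H \<Longrightarrow> \<theta> g = 0" using False by (simp_all add: \<theta>_def)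
      ultimately show ?thesis unfolding \<Theta>_def by blast
    qed
    have "(\<Sum>g\<in>carrier H. h g * x g) = h \<one> * ev \<theta>"
      unfolding ev_def sum_distrib_left using False by (intro sum.cong refl) (simp add: \<theta>_def)
    moreover have "h \<one> \<in> D" using fs(1)[OF h] D(2) by auto
    moreover have "ev \<theta> \<in> D" using \<open>\<theta> \<in> \<Theta>\<close> D(3) by auto
    ultimately show ?thesis using is_subring_mult[OF D(1)] by simp
  qed
  then have "(\<Sum>h\<leftarrow>fs. \<Sum>g\<in>carrier H. h g * x g) \<in> D"
    by (induction fs) (auto intro: is_subring_zero[OF D(1)] is_subring_add[OF D(1)])
  moreover have "(\<Sum>h\<leftarrow>fs. \<Sum>g\<in>carrier H. h g * x g) = (\<Sum>g\<in>carrier H. (\<Sum>h\<leftarrow>fs. h g) * x g)"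
    by (induction fs) (simp_all add: sum.distrib distrib_right)
  moreover have "\<dots> = (\<Sum>h\<in>carrier H. f h * x h)" using fs(3) by (intro sum.cong refl) simp
  moreover have "\<dots> = x g"
    unfolding f_def using finite_H g by (simp add: if_distrib[of "\<lambda>u. u * _"] cong: if_cong)
  ultimately show ?thesis by simp
qed

end

section \<open>Linear spans over a subfield\<close>

definition lin_span :: "'l::field set \<Rightarrow> 'j set \<Rightarrow> ('j \<Rightarrow> 'l) \<Rightarrow> 'l set" where
  "lin_span F J w = {u. \<exists>e. (\<forall>j\<in>J. e j \<in> F) \<and> u = (\<Sum>j\<in>J. e j * w j)}"

lemma lin_spanI: "(\<And>j. j \<in> J \<Longrightarrow> e j \<in> F) \<Longrightarrow> (\<Sum>j\<in>J. e j * w j) \<in> lin_span F J w"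
  unfolding lin_span_def by blast

lemma lin_spanE:
  assumes "u \<in> lin_span F J w"
  obtains e where "\<And>j. j \<in> J \<Longrightarrow> e j \<in> F" "u = (\<Sum>j\<in>J. e j * w j)"
  using assms unfolding lin_span_def by blast

context
  fixes F :: "'l::field set" and J :: "'j set" and w :: "'j \<Rightarrow> 'l"
  assumes F: "is_subfield F" and J: "finite J"
begin

lemma lin_span_scale: assumes "u \<in> lin_span F J w" "c \<in> F" shows "c * u \<in> lin_span F J w"
proof -
  from assms(1) obtain e where e: "\<And>j. j \<in> J \<Longrightarrow> e j \<in> F" "u = (\<Sum>j\<in>J. e j * w j)" by (rule lin_spanE) blast
  have "c * u = (\<Sum>j\<in>J. (c * e j) * w j)" by (simp add: e(2) sum_distrib_left mult.assoc)
  also have "\<dots> \<in> lin_span F J w"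
    by (rule lin_spanI) (use e(1) assms(2) is_subfield_mult[OF F] in auto)
  finally show ?thesis .
qed

lemma lin_span_diff:
  assumes "u \<in> lin_span F J w" "u' \<in> lin_span F J w" shows "u - u' \<in> lin_span F J w"
proof -
  from assms(1) obtain e where e: "\<And>j. j \<in> J \<Longrightarrow> e j \<in> F" "u = (\<Sum>j\<in>J. e j * w j)" by (rule lin_spanE) blast
  from assms(2) obtain e' where e': "\<And>j. j \<in> J \<Longrightarrow> e' j \<in> F" "u' = (\<Sum>j\<in>J. e' j * w j)" by (rule lin_spanE) blast
  have "u - u' = (\<Sum>j\<in>J. (e j - e' j) * w j)" by (simp add: e(2) e'(2) sum_subtractf left_diff_distrib)
  also have "\<dots> \<in> lin_span F J w"
    by (rule lin_spanI) (use e(1) e'(1) is_subfield_diff[OF F] in auto)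
  finally show ?thesis .
qed

lemma lin_span_zero: "0 \<in> lin_span F J w"
  using lin_spanI[of J "\<lambda>_. 0" F w] is_subfield_zero[OF F] by simp

lemma lin_span_add: "u \<in> lin_span F J w \<Longrightarrow> u' \<in> lin_span F J w \<Longrightarrow> u + u' \<in> lin_span F J w"
  using lin_span_diff[of u "0 - u'"] lin_span_diff[OF lin_span_zero, of u'] by simp

lemma lin_span_sum: "(\<And>i. i \<in> I \<Longrightarrow> f i \<in> lin_span F J w) \<Longrightarrow> sum f I \<in> lin_span F J w"
  by (induction I rule: infinite_finite_induct) (auto intro: lin_span_zero lin_span_add)

lemma lin_span_base: assumes "j \<in> J" shows "w j \<in> lin_span F J w"
proof -
  have "(\<Sum>i\<in>J. (if i = j then 1 else 0) * w i) \<in> lin_span F J w"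
    by (rule lin_spanI) (auto simp: is_subfield_one[OF F] is_subfield_zero[OF F])
  moreover have "(\<Sum>i\<in>J. (if i = j then 1 else 0) * w i) = w j"
    using J assms by (simp add: if_distrib[of "\<lambda>u. u * _"] cong: if_cong)
  ultimately show ?thesis by simp
qed

lemma is_subring_lin_span:
  assumes one: "1 \<in> lin_span F J w"
    and mult: "\<And>i j. i \<in> J \<Longrightarrow> j \<in> J \<Longrightarrow> w i * w j \<in> lin_span F J w"
  shows "is_subring (lin_span F J w)"
  unfolding is_subring_def
proof (intro conjI ballI one lin_span_diff)
  fix u u' assume uu': "u \<in> lin_span F J w" "u' \<in> lin_span F J w"
  from uu'(1) obtain e where e: "\<And>j. j \<in> J \<Longrightarrow> e j \<in> F" "u = (\<Sum>j\<in>J. e j * w j)" by (rule lin_spanE) blast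
  from uu'(2) obtain e' where e': "\<And>j. j \<in> J \<Longrightarrow> e' j \<in> F" "u' = (\<Sum>j\<in>J. e' j * w j)" by (rule lin_spanE) blast
  have "u * u' = (\<Sum>i\<in>J. \<Sum>j\<in>J. (e i * e' j) * (w i * w j))"
    unfolding e(2) e'(2) sum_product by (intro sum.cong refl) (simp add: mult_ac)
  also have "\<dots> \<in> lin_span F J w"
    by (intro lin_span_sum lin_span_scale mult is_subfield_mult[OF F] e(1) e'(1))
  finally show "u * u' \<in> lin_span F J w" .
qed

end

text \<open>The default \<open>d\<close> fills up the family, so that the index set keeps its
  prescribed size when \<open>S\<close> is smaller.\<close>

lemma enumerate_with_default:
  assumes "finite S" "finite J" "card S \<le> card J"
  shows "\<exists>t. S \<subseteq> t ` J \<and> t ` J \<subseteq> insert d S"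
proof -
  obtain f where f: "f ` S \<subseteq> J" "inj_on f S" using card_le_inj[OF assms] by blast
  define t where "t j = (if j \<in> f ` S then inv_into S f j else d)" for j
  have "t (f s) = s" if "s \<in> S" for s using that f(2) by (simp add: t_def)
  then have "S \<subseteq> t ` J" using f(1) by (metis image_eqI image_subset_iff subsetI)
  moreover have "t ` J \<subseteq> insert d S" by (auto simp: t_def inv_into_into)
  ultimately show ?thesis by blast
qed

section \<open>Characters of \<open>A\<close>, their extensions to eigenfunctions, and conjugation
  by \<open>\<tau>\<close>\<close>

context abelian_by_cyclic
begin

lemma N_pos: "0 < N"
  by (rule less_le_trans[OF _ N2]) simp

lemma \<tau>_cancel: "g \<in> carrier H \<Longrightarrow> \<tau> \<otimes> (inv \<tau> \<otimes> g) = g" "g \<in> carrier H \<Longrightarrow> inv \<tau> \<otimes> (\<tau> \<otimes> g) = g"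
  using \<tau> by (simp_all flip: m_assoc)

definition tau_exp :: "'h \<Rightarrow> nat" where
  "tau_exp g = (THE l. l < N \<and> (\<exists>a\<in>A. g = a \<otimes> \<tau> [^] l))"

lemma tau_exp_eq: "a \<in> A \<Longrightarrow> l < N \<Longrightarrow> tau_exp (a \<otimes> \<tau> [^] l) = l"
  unfolding tau_exp_def by (rule the_equality) (use decomp_unique in blast)+

lemma tau_exp_A: "a \<in> A \<Longrightarrow> tau_exp a = 0"
  using tau_exp_eq[of a 0] N_pos A_carrier by simp

lemma tau_exp_mult: assumes "a \<in> A" "g \<in> carrier H" shows "tau_exp (a \<otimes> g) = tau_exp g"
proof -
  obtain b l where bl: "b \<in> A" "l < N" "g = b \<otimes> \<tau> [^] l" using decomp_ex[OF assms(2)] by blast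
  have "a \<otimes> g = (a \<otimes> b) \<otimes> \<tau> [^] l" using bl assms A_carrier \<tau> by (simp add: m_assoc)
  then show ?thesis using bl tau_exp_eq subgroup.m_closed[OF A assms(1) bl(1)] by simp
qed

lemma tau_exp_\<tau>: assumes "g \<in> carrier H" shows "tau_exp (g \<otimes> \<tau>) = (if Suc (tau_exp g) < N then Suc (tau_exp g) else 0)"
  and "tau_exp g < N"
proof -
  obtain b l where bl: "b \<in> A" "l < N" "g = b \<otimes> \<tau> [^] l" using decomp_ex[OF assms] by blast
  have tau_exp: "tau_exp g = l" using bl tau_exp_eq by simp
  then show "tau_exp g < N" using bl by simp
  have g\<tau>: "g \<otimes> \<tau> = b \<otimes> \<tau> [^] Suc l" using bl A_carrier \<tau> by (simp add: m_assoc)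
  show "tau_exp (g \<otimes> \<tau>) = (if Suc (tau_exp g) < N then Suc (tau_exp g) else 0)"
  proof (cases "Suc l < N")
    case True
    then show ?thesis using tau_exp_eq[OF bl(1) True] g\<tau> tau_exp by simp
  next
    case False
    then have "Suc l = N" using bl by simp
    then have "b \<otimes> \<tau> [^] Suc l \<in> A" using \<tau>_pow subgroup.m_closed[OF A bl(1)] by metis
    then show ?thesis using tau_exp_A g\<tau> tau_exp False by simp
  qed
qed

text \<open>For \<open>\<omega> ^ N = 1\<close> this is the character of the cyclic quotient by
  \<open>A\<close> with value \<open>\<omega>\<close> at \<open>\<tau>\<close>. Products with these
  characters run through all eigenfunctions with a given restriction to \<open>A\<close>.\<close>

definition tau_char :: "'l \<Rightarrow> 'h \<Rightarrow> 'l" where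
  "tau_char \<omega> g = (if g \<in> carrier H then \<omega> ^ tau_exp g else 0)"

lemma tau_exp_of_\<tau>: "tau_exp \<tau> = 1"
  using tau_exp_eq[OF subgroup.one_closed[OF A], of 1] N2 \<tau> by simp

lemma tau_char_A: "a \<in> A \<Longrightarrow> tau_char \<omega> a = 1"
  by (simp add: tau_char_def tau_exp_A A_carrier)

lemma tau_char_\<tau>: "tau_char \<omega> \<tau> = \<omega>"
  by (simp add: tau_char_def tau_exp_of_\<tau> \<tau>)

lemma tau_char_\<Theta>: assumes \<omega>: "\<omega> ^ N = 1" shows "tau_char \<omega> \<in> \<Theta>"
proof (rule \<Theta>I)
  show "tau_char \<omega> \<one> = 1" by (rule tau_char_A) (rule subgroup.one_closed[OF A])
  show "tau_char \<omega> (a \<otimes> g) = tau_char \<omega> a * tau_char \<omega> g" if "a \<in> A" "g \<in> carrier H" for a g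
    using that A_carrier by (simp add: tau_char_A) (simp add: tau_char_def tau_exp_mult)
  show "tau_char \<omega> (g \<otimes> \<tau>) = tau_char \<omega> g * tau_char \<omega> \<tau>" if g: "g \<in> carrier H" for g
  proof (cases "Suc (tau_exp g) < N")
    case True
    then show ?thesis using g \<tau> by (simp add: tau_char_\<tau>) (simp add: tau_char_def tau_exp_\<tau>)
  next
    case False
    then have "Suc (tau_exp g) = N" using tau_exp_\<tau>(2)[OF g] by simp
    then have "\<omega> ^ tau_exp g * \<omega> = 1" using \<omega> by (metis power_Suc2)
    then show ?thesis using g \<tau> False by (simp add: tau_char_\<tau>) (simp add: tau_char_def tau_exp_\<tau>)
  qed
qed (simp add: tau_char_def)

lemma \<Theta>_times: "\<theta> \<in> \<Theta> \<Longrightarrow> \<theta>' \<in> \<Theta> \<Longrightarrow> (\<lambda>g. \<theta> g * \<theta>' g) \<in> \<Theta>"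
  by (rule \<Theta>I) (simp_all add: \<Theta>_off \<Theta>_one \<Theta>_mult \<Theta>_\<tau>)

lemma \<Theta>_monomial:
  assumes "I \<subseteq> \<Theta>"
  shows "(\<lambda>g. if g \<in> carrier H then \<Prod>i\<in>I. i g powi (f i :: int) else 0) \<in> \<Theta>"
proof (rule \<Theta>I)
  show "(if \<one> \<in> carrier H then \<Prod>i\<in>I. i \<one> powi f i else 0) = 1"
    using assms by (auto intro!: prod.neutral simp: \<Theta>_one subset_iff)
  show "(if a \<otimes> g \<in> carrier H then \<Prod>i\<in>I. i (a \<otimes> g) powi f i else 0) =
      (if a \<in> carrier H then \<Prod>i\<in>I. i a powi f i else 0) * (if g \<in> carrier H then \<Prod>i\<in>I. i g powi f i else 0)"
    if "a \<in> A" "g \<in> carrier H" for a g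
    using that A_carrier assms
    by (auto simp: \<Theta>_mult subset_iff power_int_mult_distrib simp flip: prod.distrib intro!: prod.cong)
  show "(if g \<otimes> \<tau> \<in> carrier H then \<Prod>i\<in>I. i (g \<otimes> \<tau>) powi f i else 0) =
      (if g \<in> carrier H then \<Prod>i\<in>I. i g powi f i else 0) * (if \<tau> \<in> carrier H then \<Prod>i\<in>I. i \<tau> powi f i else 0)"
    if "g \<in> carrier H" for g
    using that \<tau> assms
    by (auto simp: \<Theta>_\<tau> subset_iff power_int_mult_distrib simp flip: prod.distrib intro!: prod.cong)
qed simp

text \<open>The root depends on \<open>\<theta> (\<tau> [^] N)\<close> only, so that characters of \<open>A\<close> conjugate under \<open>\<tau>\<close>
  get the same root.\<close>

definition tau_root :: "('h \<Rightarrow> 'l) \<Rightarrow> 'l" where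
  "tau_root \<theta> = (SOME c. c ^ N = \<theta> (\<tau> [^] N))"

lemma tau_root_pow: "\<theta> \<in> \<Theta> \<Longrightarrow> tau_root \<theta> ^ N = \<theta> (\<tau> [^] N)"
  unfolding tau_root_def by (rule someI[of _ "\<theta> \<tau>"]) (simp add: \<Theta>_\<tau>_pow')

lemma tau_root_ratio: "\<theta> \<in> \<Theta> \<Longrightarrow> (tau_root \<theta> / \<theta> \<tau>) ^ N = 1"
  using tau_root_pow[of \<theta>] \<Theta>_\<tau>_pow'[of \<theta> N] \<Theta>_nz[of \<theta> \<tau>] \<tau> by (simp add: power_divide)

lemma tau_root_cong: "\<theta> (\<tau> [^] N) = \<theta>' (\<tau> [^] N) \<Longrightarrow> tau_root \<theta> = tau_root \<theta>'"
  by (simp add: tau_root_def)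

text \<open>The factor moves the value at \<open>\<tau>\<close> to the chosen root and leaves the
  restriction to \<open>A\<close> alone.\<close>

definition base :: "('h \<Rightarrow> 'l) \<Rightarrow> 'h \<Rightarrow> 'l" where
  "base \<theta> g = \<theta> g * tau_char (tau_root \<theta> / \<theta> \<tau>) g"

lemma base_\<Theta>: "\<theta> \<in> \<Theta> \<Longrightarrow> base \<theta> \<in> \<Theta>"
  unfolding base_def[abs_def] by (intro \<Theta>_times tau_char_\<Theta> tau_root_ratio)

lemma base_A: "a \<in> A \<Longrightarrow> base \<theta> a = \<theta> a"
  by (simp add: base_def tau_char_A)

lemma base_\<tau>: "\<theta> \<in> \<Theta> \<Longrightarrow> base \<theta> \<tau> = tau_root \<theta>"
  using \<Theta>_nz[of \<theta> \<tau>] \<tau> by (simp add: base_def tau_char_\<tau>)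

lemma tau_root_base: "tau_root (base \<theta>) = tau_root \<theta>"
  by (rule tau_root_cong) (rule base_A[OF \<tau>_pow])

text \<open>One eigenfunction for each character of \<open>A\<close> that occurs. Every other member
  of \<open>\<Theta>\<close> is one of these times a \<open>tau_char\<close>.\<close>

definition I where "I = {\<theta> \<in> \<Theta>. \<theta> \<tau> = tau_root \<theta>}"

lemma I_\<Theta>: "i \<in> I \<Longrightarrow> i \<in> \<Theta>" and I_\<tau>: "i \<in> I \<Longrightarrow> i \<tau> = tau_root i"
  by (auto simp: I_def)

lemma base_I: "\<theta> \<in> \<Theta> \<Longrightarrow> base \<theta> \<in> I"
  by (simp add: I_def base_\<Theta> base_\<tau> tau_root_base)

lemma I_eqI: "i \<in> I \<Longrightarrow> j \<in> I \<Longrightarrow> (\<And>a. a \<in> A \<Longrightarrow> i a = j a) \<Longrightarrow> i = j"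
  using tau_root_cong[of i j] \<tau>_pow by (intro \<Theta>_eqI) (auto simp: I_def)

lemma finite_I: "finite I"
  using \<Theta>_card by (simp add: I_def)

lemma conj_surj: assumes "a \<in> A" shows "\<exists>b\<in>A. a = inv \<tau> \<otimes> b \<otimes> \<tau>"
proof -
  have "inj_on (\<lambda>b. inv \<tau> \<otimes> b \<otimes> \<tau>) A"
    using A_carrier \<tau> by (intro inj_onI) simp
  moreover have "(\<lambda>b. inv \<tau> \<otimes> b \<otimes> \<tau>) ` A \<subseteq> A" using A_conj by blast
  ultimately have "(\<lambda>b. inv \<tau> \<otimes> b \<otimes> \<tau>) ` A = A" using finite_A by (simp add: endo_inj_surj)
  with assms show ?thesis by blast
qed

text \<open>The factor \<open>\<theta> \<tau>\<close> restores the value 1 at the identity. On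
  \<open>A\<close> the result is the character conjugated by \<open>\<tau>\<close>, and the value at
  \<open>\<tau>\<close> does not change.\<close>

definition sh :: "('h \<Rightarrow> 'l) \<Rightarrow> 'h \<Rightarrow> 'l" where
  "sh \<theta> g = (if g \<in> carrier H then \<theta> (inv \<tau> \<otimes> g) * \<theta> \<tau> else 0)"

lemma inv_\<tau>_A: "a \<in> A \<Longrightarrow> g \<in> carrier H \<Longrightarrow> inv \<tau> \<otimes> (a \<otimes> g) = (inv \<tau> \<otimes> a \<otimes> \<tau>) \<otimes> (inv \<tau> \<otimes> g)"
  using A_carrier[of a] \<tau> by (simp add: m_assoc \<tau>_cancel)

lemma sh_A: assumes "\<theta> \<in> \<Theta>" "a \<in> A" shows "sh \<theta> a = \<theta> (inv \<tau> \<otimes> a \<otimes> \<tau>)"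
proof -
  have "sh \<theta> a = \<theta> (inv \<tau> \<otimes> (a \<otimes> \<one>)) * \<theta> \<tau>" using A_carrier[OF assms(2)] by (simp add: sh_def)
  also have "\<dots> = \<theta> (inv \<tau> \<otimes> a \<otimes> \<tau>) * (\<theta> (inv \<tau>) * \<theta> \<tau>)"
    using \<Theta>_mult[OF assms(1) A_conj[OF assms(2)], of "inv \<tau>"] assms \<tau> inv_\<tau>_A[OF assms(2) one_closed]
    by simp
  finally show ?thesis using \<Theta>_inv_\<tau>[OF assms(1)] by simp
qed

lemma sh_\<tau>: "\<theta> \<in> \<Theta> \<Longrightarrow> sh \<theta> \<tau> = \<theta> \<tau>"
  using \<tau> by (simp add: sh_def \<Theta>_one)

lemma sh_\<Theta>: assumes \<theta>: "\<theta> \<in> \<Theta>" shows "sh \<theta> \<in> \<Theta>"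
proof (rule \<Theta>I)
  show "sh \<theta> \<one> = 1" using \<Theta>_inv_\<tau>[OF \<theta>] \<tau> by (simp add: sh_def)
  show "sh \<theta> (a \<otimes> g) = sh \<theta> a * sh \<theta> g" if "a \<in> A" "g \<in> carrier H" for a g
    unfolding sh_A[OF \<theta> that(1)]
    using that A_carrier \<tau> \<Theta>_mult[OF \<theta> A_conj[OF that(1)], of "inv \<tau> \<otimes> g"] inv_\<tau>_A[OF that]
    by (simp add: sh_def)
  show "sh \<theta> (g \<otimes> \<tau>) = sh \<theta> g * sh \<theta> \<tau>" if "g \<in> carrier H" for g
    unfolding sh_\<tau>[OF \<theta>] using that \<tau> \<Theta>_\<tau>[OF \<theta>, of "inv \<tau> \<otimes> g"] by (simp add: sh_def m_assoc)
qed (simp add: sh_def)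

text \<open>Conjugation by \<open>\<tau>\<close> fixes \<open>\<tau> [^] N\<close>, the only
  argument on which the chosen root depends. This keeps \<open>I\<close> stable under
  \<open>sh\<close>.\<close>

lemma sh_tau_root: "\<theta> \<in> \<Theta> \<Longrightarrow> tau_root (sh \<theta>) = tau_root \<theta>"
proof (rule tau_root_cong)
  assume \<theta>: "\<theta> \<in> \<Theta>"
  have "inv \<tau> \<otimes> \<tau> [^] N \<otimes> \<tau> = \<tau> [^] N"
    using \<tau> nat_pow_Suc2[OF \<tau>, of N] by (simp add: m_assoc inv_solve_left')
  then show "sh \<theta> (\<tau> [^] N) = \<theta> (\<tau> [^] N)" using sh_A[OF \<theta> \<tau>_pow] by simp
qed

lemma sh_I: "i \<in> I \<Longrightarrow> sh i \<in> I"
  by (simp add: I_def sh_\<Theta> sh_\<tau> sh_tau_root)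

lemma base_sh: "\<theta> \<in> \<Theta> \<Longrightarrow> base (sh \<theta>) = sh (base \<theta>)"
  by (rule I_eqI) (simp_all add: base_I sh_I sh_\<Theta> base_A sh_A base_\<Theta> A_conj)

lemma sh_inj: "inj_on sh \<Theta>"
proof (rule inj_onI)
  fix \<theta> \<theta>' assume *: "\<theta> \<in> \<Theta>" "\<theta>' \<in> \<Theta>" "sh \<theta> = sh \<theta>'"
  show "\<theta> = \<theta>'"
  proof (rule \<Theta>_eqI[OF *(1,2)])
    show "\<theta> \<tau> = \<theta>' \<tau>" using sh_\<tau>[OF *(1)] sh_\<tau>[OF *(2)] *(3) by simp
    fix a assume "a \<in> A"
    then obtain b where "b \<in> A" "a = inv \<tau> \<otimes> b \<otimes> \<tau>" using conj_surj by blast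
    then show "\<theta> a = \<theta>' a" using sh_A[OF *(1), of b] sh_A[OF *(2), of b] *(3) by simp
  qed
qed

lemma sh_bij_I: "bij_betw sh I I"
proof -
  have "inj_on sh I" using sh_inj I_\<Theta> by (meson inj_on_subset subsetI)
  moreover have "sh ` I \<subseteq> I" using sh_I by blast
  ultimately show ?thesis using finite_I by (simp add: bij_betw_def endo_inj_surj)
qed

lemma sh_pow_\<Theta>: "\<theta> \<in> \<Theta> \<Longrightarrow> (sh ^^ l) \<theta> \<in> \<Theta>" and sh_pow_I: "i \<in> I \<Longrightarrow> (sh ^^ l) i \<in> I"
  by (induction l) (auto simp: sh_\<Theta> sh_I)

lemma sh_pow_A: "\<theta> \<in> \<Theta> \<Longrightarrow> a \<in> A \<Longrightarrow>
  inv (\<tau> [^] l) \<otimes> a \<otimes> \<tau> [^] l \<in> A \<and> (sh ^^ l) \<theta> a = \<theta> (inv (\<tau> [^] l) \<otimes> a \<otimes> \<tau> [^] l)" for l :: nat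
proof (induction l arbitrary: a)
  case (Suc l)
  define b where "b = inv \<tau> \<otimes> a \<otimes> \<tau>"
  have b: "b \<in> A" using A_conj Suc.prems by (simp add: b_def)
  have "inv (\<tau> [^] l) \<otimes> b \<otimes> \<tau> [^] l = inv (\<tau> [^] Suc l) \<otimes> a \<otimes> \<tau> [^] Suc l"
    using \<tau> A_carrier[OF Suc.prems(2)] nat_pow_Suc2[OF \<tau>, of l]
    unfolding b_def by (simp add: inv_mult_group m_assoc del: nat_pow_Suc)
  then show ?case using Suc.IH[OF Suc.prems(1) b] sh_A[OF sh_pow_\<Theta>[OF Suc.prems(1)] Suc.prems(2)]
    by (simp add: b_def)
qed (use A_carrier in simp)

lemma sh_order: assumes "i \<in> I" shows "(sh ^^ N) i = i"
proof (rule I_eqI[OF sh_pow_I[OF assms] assms])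
  fix a assume a: "a \<in> A"
  have "inv (\<tau> [^] N) \<otimes> a \<otimes> \<tau> [^] N = a"
    using A_comm[OF a \<tau>_pow] A_carrier[OF a] A_carrier[OF \<tau>_pow] by (simp add: m_assoc inv_solve_left')
  then show "(sh ^^ N) i a = i a" using sh_pow_A[OF I_\<Theta>[OF assms] a, of N] by simp
qed

lemma \<rho>_A_ev: assumes "a \<in> A" "\<theta> \<in> \<Theta>" shows "\<rho> a (ev \<theta>) = inverse (\<theta> a) * ev \<theta>"
proof -
  have a: "a \<in> carrier H" "inv a \<in> A" using A_carrier assms subgroup.m_inv_closed[OF A] by auto
  have "\<rho> a (ev \<theta>) = (\<Sum>h\<in>carrier H. \<theta> (inv a \<otimes> (a \<otimes> h)) * x (a \<otimes> h))"
    unfolding ev_def using a \<Theta>_K[OF assms(2)]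
    by (simp add: field_hom_sum[OF \<rho>_hom] field_hom_mult[OF \<rho>_hom] \<rho>_x \<rho>_K m_assoc[symmetric])
  also have "\<dots> = (\<Sum>h\<in>carrier H. \<theta> (inv a \<otimes> h) * x h)"
    by (rule subgroup_sum_translate(1)[OF subgroup_self a(1)])
  also have "\<dots> = inverse (\<theta> a) * ev \<theta>"
    unfolding ev_def sum_distrib_left
    by (intro sum.cong refl) (simp add: \<Theta>_mult[OF assms(2) a(2)] \<Theta>_inv_A[OF assms(2,1)])
  finally show ?thesis .
qed

lemma \<rho>_\<tau>_ev: assumes "\<theta> \<in> \<Theta>" shows "\<rho> \<tau> (ev \<theta>) = inverse (\<theta> \<tau>) * ev (sh \<theta>)"
proof -
  have "\<rho> \<tau> (ev \<theta>) = (\<Sum>h\<in>carrier H. \<theta> (inv \<tau> \<otimes> (\<tau> \<otimes> h)) * x (\<tau> \<otimes> h))"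
    unfolding ev_def using \<tau> \<Theta>_K[OF assms]
    by (simp add: field_hom_sum[OF \<rho>_hom] field_hom_mult[OF \<rho>_hom] \<rho>_x \<rho>_K m_assoc[symmetric])
  also have "\<dots> = (\<Sum>h\<in>carrier H. \<theta> (inv \<tau> \<otimes> h) * x h)"
    by (rule subgroup_sum_translate(1)[OF subgroup_self \<tau>])
  also have "\<dots> = inverse (\<theta> \<tau>) * ev (sh \<theta>)"
    unfolding ev_def sum_distrib_left
    by (intro sum.cong refl) (use \<Theta>_nz[OF assms \<tau>] in \<open>simp add: sh_def\<close>)
  finally show ?thesis .
qed

lemma character_sum:
  assumes "\<theta> \<in> \<Theta>" "b \<in> A" "\<theta> b \<noteq> 1" shows "(\<Sum>a\<in>A. inverse (\<theta> a)) = 0"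
proof -
  have "(\<Sum>a\<in>A. inverse (\<theta> a)) = (\<Sum>a\<in>A. inverse (\<theta> (b \<otimes> a)))"
    by (rule subgroup_sum_translate(1)[OF A assms(2), symmetric])
  also have "\<dots> = inverse (\<theta> b) * (\<Sum>a\<in>A. inverse (\<theta> a))"
    unfolding sum_distrib_left using A_carrier by (intro sum.cong refl) (simp add: \<Theta>_mult[OF assms(1,2)])
  finally have "(1 - inverse (\<theta> b)) * (\<Sum>a\<in>A. inverse (\<theta> a)) = 0" by (simp add: left_diff_distrib)
  then show ?thesis using assms(3) by auto
qed

lemma Fix_A_\<tau>: assumes "u \<in> Fix A" shows "\<rho> \<tau> u \<in> Fix A"
  unfolding Fix_def
proof safe
  fix a assume a: "a \<in> A"
  define b where "b = inv \<tau> \<otimes> a \<otimes> \<tau>"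
  have b: "b \<in> A" using A_conj[OF a] by (simp add: b_def)
  have "a \<otimes> \<tau> = \<tau> \<otimes> b" using A_carrier[OF a] \<tau> by (simp add: b_def m_assoc \<tau>_cancel)
  then have "\<rho> a (\<rho> \<tau> u) = \<rho> \<tau> (\<rho> b u)" using A_carrier a b \<tau> by (simp flip: \<rho>_mult)
  also have "\<rho> b u = u" using assms b by (simp add: Fix_def)
  finally show "\<rho> a (\<rho> \<tau> u) = \<rho> \<tau> u" .
qed

lemma \<rho>_\<tau>_pow: "(\<rho> \<tau> ^^ l) u = \<rho> (\<tau> [^] l) u" for l :: nat
proof (induction l)
  case (Suc l)
  then show ?case using \<tau> nat_pow_Suc2[OF \<tau>, of l] by (simp add: \<rho>_mult del: nat_pow_Suc)
qed (simp add: \<rho>_one)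

lemma Fix_H_iff: "u \<in> Fix (carrier H) \<longleftrightarrow> u \<in> Fix A \<and> \<rho> \<tau> u = u"
proof
  show "u \<in> Fix A \<and> \<rho> \<tau> u = u" if "u \<in> Fix (carrier H)"
    using that A_carrier \<tau> by (auto simp: Fix_def)
  assume u: "u \<in> Fix A \<and> \<rho> \<tau> u = u"
  show "u \<in> Fix (carrier H)"
    unfolding Fix_def
  proof safe
    fix g assume "g \<in> carrier H"
    then obtain a l where al: "a \<in> A" "g = a \<otimes> \<tau> [^] (l::nat)" using decomp_ex by blast
    have "(\<rho> \<tau> ^^ l) u = u" by (induction l) (use u in auto)
    then show "\<rho> g u = u" using al A_carrier \<tau> u by (simp add: \<rho>_mult Fix_def flip: \<rho>_\<tau>_pow)
  qed
qed

text \<open>The order \<open>N\<close> of \<open>\<tau>\<close> modulo \<open>A\<close> divides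
  every exponent that kills \<open>\<tau>\<close>.\<close>

lemma n_le_m: "n \<le> m"
proof -
  define q s where "q = p ^ m div N" and "s = p ^ m mod N"
  have qs: "p ^ m = N * q + s" by (simp add: q_def s_def)
  have "s < N" using N_pos by (simp add: s_def)
  have "(\<tau> [^] N) [^] q \<in> A"
    by (induction q) (use \<tau>_pow A_carrier subgroup.m_closed[OF A] subgroup.one_closed[OF A] in auto)
  moreover have "\<one> = (\<tau> [^] N) [^] q \<otimes> \<tau> [^] s"
    using exponent[OF \<tau>] \<tau> unfolding qs by (simp add: nat_pow_mult nat_pow_pow)
  then have "\<one> \<otimes> \<tau> [^] (0::nat) = (\<tau> [^] N) [^] q \<otimes> \<tau> [^] s"
    by (metis l_one nat_pow_0 one_closed)
  ultimately have "0 = s"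
    using decomp_unique[OF subgroup.one_closed[OF A] N_pos _ \<open>s < N\<close>] by blast
  then have "p ^ n dvd p ^ m" using qs by simp
  then show ?thesis using p by (metis power_dvd_imp_le prime_gt_1_nat)
qed

end

section \<open>The Kummer generator and the monomials invariant under \<open>A\<close>\<close>

context abelian_by_cyclic
begin

definition \<zeta> :: 'l where "\<zeta> = z ^ (p ^ (m - n))"

lemma \<zeta>_K: "\<zeta> \<in> K"
  by (simp add: \<zeta>_def z is_subfield_power[OF K])

lemma \<zeta>_primitive: "\<zeta> ^ N = 1" "0 < l \<Longrightarrow> l < N \<Longrightarrow> \<zeta> ^ l \<noteq> 1"
proof -
  have zM: "z ^ (p ^ m) = 1" "\<And>j. 0 < j \<Longrightarrow> j < p ^ m \<Longrightarrow> z ^ j \<noteq> 1"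
    using z by (auto simp: primitive_root_of_unity_def)
  have M: "p ^ (m - n) * N = p ^ m" using n_le_m by (simp flip: power_add)
  show "\<zeta> ^ N = 1" using zM(1) M by (simp add: \<zeta>_def flip: power_mult)
  have pos: "0 < p ^ (m - n)" using p by (simp add: prime_gt_0_nat)
  show "\<zeta> ^ l \<noteq> 1" if "0 < l" "l < N"
    using zM(2)[of "p ^ (m - n) * l"] that pos mult_strict_left_mono[OF that(2) pos] M
    by (simp add: \<zeta>_def flip: power_mult)
qed

lemma \<zeta>_nz: "\<zeta> \<noteq> 0"
  using \<zeta>_primitive(1) N_pos by (auto simp: power_0_left)

lemma \<zeta>_inv: "inverse \<zeta> ^ N = 1"
  by (simp add: power_inverse \<zeta>_primitive)

definition i1 where "i1 = base (tau_char 1)"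

text \<open>Another eigenfunction over the trivial character of \<open>A\<close>, besides
  \<open>i1\<close>. It is twisted by the inverse of \<open>\<zeta>\<close> because eigenvalues
  enter the action inverted: this makes \<open>\<tau>\<close> multiply the quotient \<open>v\<close>
  by \<open>\<zeta>\<close>.\<close>

definition \<theta>v where "\<theta>v = (\<lambda>g. i1 g * tau_char (inverse \<zeta>) g)"

definition v where "v = ev \<theta>v / ev i1"

lemma i1_I: "i1 \<in> I"
  unfolding i1_def by (intro base_I tau_char_\<Theta>) simp

lemma i1_A: "a \<in> A \<Longrightarrow> i1 a = 1"
  by (simp add: i1_def base_A tau_char_A)

lemma \<theta>v_\<Theta>: "\<theta>v \<in> \<Theta>"
  unfolding \<theta>v_def by (intro \<Theta>_times I_\<Theta> i1_I tau_char_\<Theta> \<zeta>_inv)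

lemma \<theta>v_A: "a \<in> A \<Longrightarrow> \<theta>v a = 1"
  by (simp add: \<theta>v_def i1_A tau_char_A)

lemma \<theta>v_\<tau>: "\<theta>v \<tau> = i1 \<tau> * inverse \<zeta>"
  by (simp add: \<theta>v_def tau_char_\<tau>)

lemma sh_\<theta>v: "sh \<theta>v = \<theta>v"
  by (rule \<Theta>_eqI) (simp_all add: \<theta>v_\<Theta> sh_\<Theta> sh_A sh_\<tau> \<theta>v_A A_conj)

lemma \<theta>v_not_I: "\<theta>v \<notin> I"
proof
  assume "\<theta>v \<in> I"
  then have "\<theta>v = i1" by (rule I_eqI[OF _ i1_I]) (simp add: \<theta>v_A i1_A)
  then have "inverse \<zeta> = 1" using \<theta>v_\<tau> \<Theta>_nz[OF I_\<Theta>[OF i1_I] \<tau>] by simp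
  then have "\<zeta> ^ 1 = 1" by simp
  with \<zeta>_primitive(2)[of 1] N2 show False by simp
qed

lemma base_\<theta>v: "base \<theta>v = i1"
  by (rule I_eqI) (simp_all add: base_I \<theta>v_\<Theta> i1_I base_A \<theta>v_A i1_A)

lemma ratio_Fix_A:
  assumes "\<theta> \<in> \<Theta>" shows "ev \<theta> / ev (base \<theta>) \<in> Fix A"
  unfolding Fix_def
proof safe
  fix a assume a: "a \<in> A"
  have "\<theta> a \<noteq> 0" using \<Theta>_nz[OF assms A_carrier[OF a]] .
  then show "\<rho> a (ev \<theta> / ev (base \<theta>)) = ev \<theta> / ev (base \<theta>)"
    using a assms by (simp add: field_hom_divide[OF \<rho>_hom] A_carrier \<rho>_A_ev base_\<Theta> base_A)
qed

lemma \<rho>_\<tau>_ratio: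
  assumes "\<theta> \<in> \<Theta>"
  shows "\<rho> \<tau> (ev \<theta> / ev (base \<theta>)) = (tau_root \<theta> / \<theta> \<tau>) * (ev (sh \<theta>) / ev (base (sh \<theta>)))"
  using assms by (simp add: field_hom_divide[OF \<rho>_hom[OF \<tau>]] \<rho>_\<tau>_ev base_\<Theta> base_\<tau> base_sh field_simps)

sublocale KS: kummer_setup K "Fix A" "\<rho> \<tau>" p n \<zeta> v
proof unfold_locales
  have AH: "A \<subseteq> carrier H" using A_carrier by blast
  show "is_subfield K" by (rule K)
  show "is_subfield (Fix A)" by (rule is_subfield_Fix[OF AH])
  show "K \<subseteq> Fix A" using \<rho>_K A_carrier by (auto simp: Fix_def)
  show "field_hom (\<rho> \<tau>)" by (rule \<rho>_hom[OF \<tau>])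
  show "\<rho> \<tau> u = u" if "u \<in> K" for u using \<rho>_K[OF \<tau> that] .
  show "\<rho> \<tau> u \<in> Fix A" if "u \<in> Fix A" for u by (rule Fix_A_\<tau>[OF that])
  show "(\<rho> \<tau> ^^ (p ^ n)) u = u" if "u \<in> Fix A" for u
    using that \<tau>_pow by (simp add: \<rho>_\<tau>_pow Fix_def)
  show "Factorial_Ring.prime p" by (rule p)
  show "of_nat p \<noteq> (0::'l)" by (rule p_nz)
  show "\<zeta> \<in> K" by (rule \<zeta>_K)
  show "\<zeta> ^ p ^ n = 1" by (rule \<zeta>_primitive)
  show "\<zeta> ^ l \<noteq> 1" if "0 < l" "l < p ^ n" for l by (rule \<zeta>_primitive(2)[OF that])
  show "v \<in> Fix A" using ratio_Fix_A[OF \<theta>v_\<Theta>] by (simp add: v_def base_\<theta>v)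
  show "v \<noteq> 0" by (simp add: v_def ev_nz \<theta>v_\<Theta> I_\<Theta> i1_I)
  show "\<rho> \<tau> v = \<zeta> * v"
  proof -
    have "i1 \<tau> \<noteq> 0" by (rule \<Theta>_nz[OF I_\<Theta>[OF i1_I] \<tau>])
    then have "tau_root \<theta>v / \<theta>v \<tau> = \<zeta>"
      using base_\<tau>[OF \<theta>v_\<Theta>] \<zeta>_nz by (simp add: base_\<theta>v \<theta>v_\<tau> divide_inverse)
    then show ?thesis using \<rho>_\<tau>_ratio[OF \<theta>v_\<Theta>] by (simp add: v_def base_\<theta>v sh_\<theta>v)
  qed
qed

definition log_ratio :: "('h \<Rightarrow> 'l) \<Rightarrow> nat" where
  "log_ratio \<theta> = (SOME k. tau_root \<theta> / \<theta> \<tau> = \<zeta> ^ k)"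

lemma log_ratio: "\<theta> \<in> \<Theta> \<Longrightarrow> tau_root \<theta> / \<theta> \<tau> = \<zeta> ^ log_ratio \<theta>"
  unfolding log_ratio_def
proof (rule someI_ex)
  assume "\<theta> \<in> \<Theta>"
  have "primitive_root_of_unity N \<zeta>" using \<zeta>_primitive by (auto simp: primitive_root_of_unity_def)
  from roots_of_unity_powers[OF this tau_root_ratio[OF \<open>\<theta> \<in> \<Theta>\<close>] N_pos]
  show "\<exists>k. tau_root \<theta> / \<theta> \<tau> = \<zeta> ^ k" by blast
qed

text \<open>The quotients \<open>ev \<theta> / ev (base \<theta>)\<close> are permuted by
  \<open>\<tau>\<close> only up to a power of \<open>\<zeta>\<close>. The power of \<open>v\<close>
  takes up this constant, so that the corrected quotients are permuted exactly.\<close>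

definition tau_quot :: "('h \<Rightarrow> 'l) \<Rightarrow> 'l" where
  "tau_quot \<theta> = ev \<theta> / ev (base \<theta>) / v ^ log_ratio \<theta>"

lemma tau_quot_Fix_A: "\<theta> \<in> \<Theta> \<Longrightarrow> tau_quot \<theta> \<in> Fix A"
  unfolding tau_quot_def by (intro is_subfield_divide[OF KS.E] is_subfield_power[OF KS.E] ratio_Fix_A KS.v)

lemma \<rho>_\<tau>_tau_quot: assumes "\<theta> \<in> \<Theta>" shows "\<rho> \<tau> (tau_quot \<theta>) = tau_quot (sh \<theta>)"
proof -
  \<comment> \<open>The choice made in \<open>log_ratio\<close> depends on
    \<open>tau_root \<theta> / \<theta> \<tau>\<close> only, and \<open>sh\<close> changes neither
    of the two.\<close>
  have "log_ratio (sh \<theta>) = log_ratio \<theta>"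
    by (simp add: log_ratio_def sh_tau_root sh_\<tau> assms)
  moreover have "\<rho> \<tau> (tau_quot \<theta>) = (\<zeta> ^ log_ratio \<theta> * (ev (sh \<theta>) / ev (base (sh \<theta>)))) / (\<zeta> * v) ^ log_ratio \<theta>"
    unfolding tau_quot_def field_hom_divide[OF KS.T, of _ "v ^ _"] \<rho>_\<tau>_ratio[OF assms] log_ratio[OF assms]
      field_hom_power[OF KS.T] KS.v(3) ..
  ultimately show ?thesis using \<zeta>_nz by (simp add: tau_quot_def power_mult_distrib)
qed

text \<open>Twisting by \<open>tau_char \<zeta>\<close> embeds \<open>I\<close> into
  \<open>\<Theta>\<close> and away from \<open>I\<close>, since \<open>N\<close> is at least 2.
  Besides the monomials this leaves room for at least \<open>card I\<close> generators, from which
  the tower takes the invariants to absorb.\<close>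

lemma card_I: "2 * card I \<le> card (carrier H)" "1 \<le> card I"
proof -
  define f where "f = (\<lambda>i g. i g * tau_char \<zeta> g)"
  have f\<Theta>: "f i \<in> \<Theta>" if "i \<in> I" for i
    unfolding f_def by (intro \<Theta>_times I_\<Theta> that tau_char_\<Theta> \<zeta>_primitive)
  have f_A: "f i a = i a" if "a \<in> A" for i a using that by (simp add: f_def tau_char_A)
  have "inj_on f I" by (intro inj_onI I_eqI) (auto, metis f_A)
  then have "card (f ` I) = card I" by (rule card_image)
  moreover have "f ` I \<inter> I = {}"
  proof safe
    fix i assume i: "i \<in> I" "f i \<in> I"
    then have "f i = i" by (intro I_eqI) (auto simp: f_A)
    then have "f i \<tau> = i \<tau>" by (rule fun_cong)
    then have "i \<tau> * \<zeta> = i \<tau>" by (simp only: f_def tau_char_\<tau>)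
    then have "\<zeta> ^ 1 = 1" using \<Theta>_nz[OF I_\<Theta>[OF i(1)] \<tau>] by simp
    with \<zeta>_primitive(2)[of 1] N2 show "f i \<in> {}" by simp
  qed
  moreover have "card (f ` I \<union> I) \<le> card \<Theta>"
    using f\<Theta> I_\<Theta> by (intro card_mono \<Theta>_card) auto
  ultimately show "2 * card I \<le> card (carrier H)"
    using finite_I \<Theta>_card(2) by (simp add: card_Un_disjoint)
  show "1 \<le> card I" using i1_I finite_I by (metis One_nat_def Suc_leI card_gt_0_iff empty_iff)
qed

text \<open>The inverse of \<open>sh\<close> on \<open>I\<close>, because the tower requires
  \<open>\<tau>\<close> to send the variable at \<open>g i\<close> to a multiple of the one at
  \<open>i\<close>. The identity outside \<open>I\<close> makes it a permutation in the sense of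
  \<open>permutes\<close>.\<close>

definition g :: "('h \<Rightarrow> 'l) \<Rightarrow> 'h \<Rightarrow> 'l" where
  "g i = (if i \<in> I then the_inv_into I sh i else i)"

lemma g_I: "i \<in> I \<Longrightarrow> g i \<in> I" and sh_g: "i \<in> I \<Longrightarrow> sh (g i) = i" and g_sh: "i \<in> I \<Longrightarrow> g (sh i) = i"
  using sh_bij_I sh_I unfolding g_def bij_betw_def
  by (auto simp: f_the_inv_into_f the_inv_into_f_f intro: the_inv_into_into)

lemma g_permutes: "g permutes I"
proof (rule bij_imp_permutes)
  show "bij_betw g I I"
    by (rule bij_betw_byWitness[of _ sh]) (use g_I sh_g g_sh sh_I in auto)
qed (simp add: g_def)

lemma g_pow_sh_pow: "i \<in> I \<Longrightarrow> (g ^^ l) ((sh ^^ l) i) = i"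
proof (induction l)
  case (Suc l)
  have "(g ^^ Suc l) ((sh ^^ Suc l) i) = (g ^^ l) (g (sh ((sh ^^ l) i)))" by (simp add: funpow_swap1)
  then show ?case using Suc g_sh[OF sh_pow_I[OF Suc.prems]] by simp
qed simp

sublocale PL: perm_lattice I g p n
proof unfold_locales
  show "(g ^^ (p ^ n)) i = i" if "i \<in> I" for i
    using g_pow_sh_pow[OF that, of N] sh_order[OF that] by simp
qed (use finite_I g_permutes p in auto)

definition chi :: "(('h \<Rightarrow> 'l) \<Rightarrow> int) \<Rightarrow> 'h \<Rightarrow> 'l" where
  "chi f a = (\<Prod>i\<in>I. i a powi f i)"

text \<open>The kernel of the map from the permutation lattice to the characters of
  \<open>A\<close>, in other words the exponents of the invariant monomials.\<close>

definition M where "M = {f \<in> PL.lattice. \<forall>a\<in>A. chi f a = 1}"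

lemma I_nz: "i \<in> I \<Longrightarrow> a \<in> A \<Longrightarrow> i a \<noteq> 0"
  using \<Theta>_nz[OF I_\<Theta> A_carrier] .

lemma chi_diff: "a \<in> A \<Longrightarrow> chi (f - h) a = chi f a / chi h a"
  unfolding chi_def prod_dividef[symmetric] by (intro prod.cong refl) (simp add: power_int_diff I_nz)

lemma chi_nz: "a \<in> A \<Longrightarrow> chi f a \<noteq> 0"
  by (simp add: chi_def finite_I I_nz power_int_not_zero)

lemma chi_shift:
  assumes "a \<in> A" shows "chi (\<lambda>i. f ((g ^^ l) i)) a = chi f (inv (\<tau> [^] l) \<otimes> a \<otimes> \<tau> [^] l)"
proof -
  have bij: "bij_betw (sh ^^ l) I I" by (rule bij_betw_funpow[OF sh_bij_I])
  have "chi (\<lambda>i. f ((g ^^ l) i)) a = (\<Prod>j\<in>I. ((sh ^^ l) j) a powi f ((g ^^ l) ((sh ^^ l) j)))"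
    unfolding chi_def by (rule prod.reindex_bij_betw[OF bij, symmetric])
  also have "\<dots> = chi f (inv (\<tau> [^] l) \<otimes> a \<otimes> \<tau> [^] l)"
    unfolding chi_def using assms by (intro prod.cong refl) (simp add: g_pow_sh_pow sh_pow_A I_\<Theta>)
  finally show ?thesis .
qed

lemma unit_vector_lattice: "i \<in> I \<Longrightarrow> PL.unit_vector i \<in> PL.lattice"
  by (auto simp: PL.unit_vector_def PL.lattice_def)

lemma chi_unit_vector: "i \<in> I \<Longrightarrow> chi (PL.unit_vector i) a = i a"
  unfolding chi_def PL.unit_vector_def using finite_I
  by (simp add: if_distrib[of "\<lambda>e. _ powi e"] cong: if_cong)

lemma submodule_M: "PL.L.submodule M"
  unfolding PL.L.submodule_def
proof (intro conjI ballI)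
  show "0 \<in> M" using PL.L.submodule_zero[OF PL.submodule_lattice] by (simp add: M_def chi_def)
  show "f - h \<in> M" if "f \<in> M" "h \<in> M" for f h
    using that PL.L.submodule_diff[OF PL.submodule_lattice] by (simp add: M_def chi_diff)
  show "coboundary g f \<in> M" if f: "f \<in> M" for f
  proof -
    have "coboundary g f = (\<lambda>i. f ((g ^^ 1) i)) - f" by (auto simp: coboundary_def fun_eq_iff)
    moreover have "chi ((\<lambda>i. f ((g ^^ 1) i)) - f) a = 1" if a: "a \<in> A" for a
    proof -
      have "inv (\<tau> [^] (1::nat)) \<otimes> a \<otimes> \<tau> [^] (1::nat) \<in> A" using A_conj[OF a] \<tau> by simp
      then show ?thesis using f a unfolding chi_diff[OF a] chi_shift[OF a] by (simp add: M_def)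
    qed
    ultimately show ?thesis
      using f PL.L.submodule_lam[OF PL.submodule_lattice, of f] by (simp add: M_def)
  qed
qed

text \<open>The character of the monomial with exponent vector \<open>f\<close> also occurs among the eigenvectors
  \<open>ev i\<close>, and it is fixed by as large a power of \<open>\<tau>\<close>.\<close>

lemma M_coflasque:
  assumes f: "f \<in> PL.lattice" and fM: "shift_diff g q f \<in> M"
  shows "\<exists>h\<in>M. shift_diff g q h = shift_diff g q f"
proof -
  define \<eta> where "\<eta> = (\<lambda>x. if x \<in> carrier H then \<Prod>i\<in>I. i x powi f i else 0)"
  have \<eta>: "\<eta> \<in> \<Theta>" unfolding \<eta>_def using I_\<Theta> by (intro \<Theta>_monomial) auto
  define i0 where "i0 = base \<eta>"
  have i0: "i0 \<in> I" unfolding i0_def by (rule base_I[OF \<eta>])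
  have i0_A: "i0 a = chi f a" if "a \<in> A" for a
    using that A_carrier by (simp add: i0_def base_A \<eta>_def chi_def)
  \<comment> \<open>That \<open>shift_diff g q f\<close> lies in \<open>M\<close> means that the
    character of \<open>f\<close> is unchanged by conjugation with
    \<open>\<tau> [^] q\<close>.\<close>
  have "(sh ^^ q) i0 = i0"
  proof (rule I_eqI[OF sh_pow_I[OF i0] i0])
    fix a assume a: "a \<in> A"
    define b where "b = inv (\<tau> [^] q) \<otimes> a \<otimes> \<tau> [^] q"
    have b: "b \<in> A" "(sh ^^ q) i0 a = i0 b" using sh_pow_A[OF I_\<Theta>[OF i0] a, of q] by (auto simp: b_def)
    have "shift_diff g q f = (\<lambda>i. f ((g ^^ q) i)) - f" by (auto simp: shift_diff_def fun_eq_iff)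
    then have "chi f b / chi f a = 1"
      using fM a chi_diff[OF a, of "\<lambda>i. f ((g ^^ q) i)" f] chi_shift[OF a, of f q] by (simp add: M_def b_def)
    then show "(sh ^^ q) i0 a = i0 a" using b i0_A a chi_nz[OF a] by simp
  qed
  then have gi0: "(g ^^ q) i0 = i0" using g_pow_sh_pow[OF i0, of q] by simp
  define h where "h = f - PL.unit_vector i0"
  have "h \<in> M"
    using PL.L.submodule_diff[OF PL.submodule_lattice f unit_vector_lattice[OF i0]]
    by (simp add: M_def h_def chi_diff chi_unit_vector[OF i0] i0_A chi_nz)
  moreover have "shift_diff g q (PL.unit_vector i0) = 0"
  proof -
    have "(g ^^ q) y = i0 \<longleftrightarrow> y = i0" for y
      using gi0 permutes_inj[OF PL.funpow_permutes[of q]] by (metis injD)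
    then show ?thesis by (auto simp: shift_diff_def PL.unit_vector_def fun_eq_iff)
  qed
  then have "shift_diff g q h = shift_diff g q f" by (simp only: h_def PL.shift_diff_diff diff_zero)
  ultimately show ?thesis by blast
qed

lemma M_index: "f \<in> PL.lattice \<Longrightarrow> (\<lambda>i. int (p ^ m) * f i) \<in> M"
proof -
  assume f: "f \<in> PL.lattice"
  have "chi (\<lambda>i. int (p ^ m) * f i) a = 1" if "a \<in> A" for a
    unfolding chi_def using \<Theta>_root[OF I_\<Theta> A_carrier[OF that]]
    by (intro prod.neutral) (simp add: power_int_mult del: of_nat_power)
  then show ?thesis using f by (auto simp: M_def PL.lattice_def)
qed

sublocale CL: coflasque_sublattice I g p n M m
  by unfold_locales (use submodule_M M_index M_coflasque in \<open>auto simp: M_def\<close>)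

lemma mon_Fix_A: assumes "f \<in> M" shows "(\<Prod>i\<in>I. ev i powi f i) \<in> Fix A"
  unfolding Fix_def
proof safe
  fix a assume a: "a \<in> A"
  have "\<rho> a (\<Prod>i\<in>I. ev i powi f i) = (\<Prod>i\<in>I. inverse (i a) powi f i * ev i powi f i)"
    using a by (simp add: field_hom_prod[OF \<rho>_hom] field_hom_power_int[OF \<rho>_hom] A_carrier \<rho>_A_ev I_\<Theta> power_int_mult_distrib)
  also have "\<dots> = (\<Prod>i\<in>I. ev i powi f i) / chi f a"
    unfolding chi_def prod.distrib by (simp add: power_int_inverse prod_inversef[symmetric] divide_inverse mult.commute comp_def)
  finally show "\<rho> a (\<Prod>i\<in>I. ev i powi f i) = (\<Prod>i\<in>I. ev i powi f i)"
    using assms a by (simp add: M_def)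
qed

lemma card_A_nz: "of_nat (card A) \<noteq> (0::'l)" and card_H_nz: "of_nat (card (carrier H)) \<noteq> (0::'l)"
  and card_A_N: "card (carrier H) = card A * N"
proof -
  show AN: "card (carrier H) = card A * N"
    using bij_betw_same_card[OF decomp] by (simp add: card_cartesian_product)
  show H: "of_nat (card (carrier H)) \<noteq> (0::'l)" using p_nz by (simp add: order_H)
  then show "of_nat (card A) \<noteq> (0::'l)" by (auto simp: AN)
qed

end

section \<open>Generators of the invariants of \<open>A\<close> and of \<open>H\<close>\<close>

context abelian_by_cyclic
begin

text \<open>The length of the family is what remains of \<open>card (carrier H)\<close> after
  \<open>card I\<close> generators are set aside for the monomials and one for the power of
  \<open>v\<close>. Padding with 1 makes this length exact even if fewer invariants occur.\<close>

lemma permutation_part: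
  "\<exists>t :: nat \<Rightarrow> 'l. (\<forall>j < card (carrier H) - card I - 1. t j \<in> KS.T_fixed \<and> t j \<noteq> 0) \<and>
    (\<forall>L. is_subfield L \<and> K \<subseteq> L \<and> v \<in> L \<and> t ` {..<card (carrier H) - card I - 1} \<subseteq> L \<longrightarrow>
      tau_quot ` (\<Theta> - I - {\<theta>v}) \<subseteq> L)"
proof -
  define R where "R = \<Theta> - I - {\<theta>v}"
  define s where "s = card (carrier H) - card I - 1"
  have finR: "finite R" using \<Theta>_card by (simp add: R_def)
  have "I \<subseteq> \<Theta>" using I_\<Theta> by blast
  then have "card R = card \<Theta> - card I - 1"
    using \<theta>v_\<Theta> \<theta>v_not_I finite_I by (simp add: R_def card_Diff_subset)
  then have cardR: "card R \<le> s" using \<Theta>_card(2) by (simp add: s_def)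
  have shR: "sh \<theta> \<in> R" if \<theta>: "\<theta> \<in> R" for \<theta>
  proof -
    have \<theta>\<Theta>: "\<theta> \<in> \<Theta>" using \<theta> by (simp add: R_def)
    have "sh \<theta> \<notin> I"
    proof
      assume "sh \<theta> \<in> I"
      then have "g (sh \<theta>) \<in> I" "sh (g (sh \<theta>)) = sh \<theta>" by (auto simp: g_I sh_g)
      then have "g (sh \<theta>) = \<theta>" using inj_onD[OF sh_inj _ I_\<Theta> \<theta>\<Theta>] by blast
      then show False using \<open>g (sh \<theta>) \<in> I\<close> \<theta> by (simp add: R_def)
    qed
    moreover have "sh \<theta> \<noteq> \<theta>v"
      using inj_onD[OF sh_inj _ \<theta>\<Theta> \<theta>v_\<Theta>] sh_\<theta>v \<theta> by (auto simp: R_def)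
    ultimately show ?thesis using sh_\<Theta>[OF \<theta>\<Theta>] by (simp add: R_def)
  qed
  have "finite (tau_quot ` R)" "tau_quot ` R \<subseteq> Fix A" using finR tau_quot_Fix_A by (auto simp: R_def)
  moreover have "\<rho> \<tau> ` tau_quot ` R \<subseteq> tau_quot ` R"
    using shR \<rho>_\<tau>_tau_quot by (fastforce simp: R_def)
  ultimately obtain Y where Y: "finite Y" "card Y \<le> card (tau_quot ` R)" "Y \<subseteq> KS.T_fixed"
    "tau_quot ` R \<subseteq> field_adjoin (field_adjoin K {v}) Y"
    using KS.permuted_set_invariant_generators[OF KS.T_stable_base] by blast
  \<comment> \<open>0 is dropped because the tower works with nonzero invariants; every subfield
    contains it anyway.\<close>
  have "card (Y - {0}) \<le> card Y" using Y(1) by (intro card_mono) auto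
  also have "\<dots> \<le> s" using Y(2) card_image_le[OF finR, of tau_quot] cardR by simp
  finally have "card (Y - {0}) \<le> card {..<s}" by simp
  then obtain t where t: "Y - {0} \<subseteq> t ` {..<s}" "t ` {..<s} \<subseteq> insert 1 (Y - {0})"
    using enumerate_with_default[of "Y - {0}" "{..<s}" 1] Y(1) by auto
  have one: "1 \<in> KS.T_fixed"
    using is_subfield_one[OF KS.E] field_hom_one[OF KS.T] by (simp add: KS.T_fixed_def)
  show ?thesis
  proof (intro exI[of _ t] conjI allI impI)
    fix j assume "j < card (carrier H) - card I - 1"
    then have "t j \<in> insert 1 (Y - {0})" using t(2) by (auto simp: s_def)
    then show "t j \<in> KS.T_fixed" "t j \<noteq> 0" using Y(3) one by auto
  next
    fix L assume L: "is_subfield L \<and> K \<subseteq> L \<and> v \<in> L \<and> t ` {..<card (carrier H) - card I - 1} \<subseteq> L"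
    then have "Y \<subseteq> L" using t(1) is_subfield_zero[of L] by (auto simp: s_def)
    moreover have "field_adjoin K {v} \<subseteq> L" using L by (intro field_adjoin_least) auto
    ultimately have "field_adjoin (field_adjoin K {v}) Y \<subseteq> L" using L by (intro field_adjoin_least) auto
    then show "tau_quot ` (\<Theta> - I - {\<theta>v}) \<subseteq> L" using Y(4) by (simp add: R_def)
  qed
qed

text \<open>The \<open>L\<close>-span of the \<open>ev i\<close> is a ring:
  \<open>ev i * ev j\<close> has the same character as some \<open>ev k\<close>, and the quotient is
  an invariant monomial. Summation over \<open>A\<close> kills the terms with nontrivial character
  and leaves elements of \<open>L\<close>. The span contains all \<open>ev \<theta>\<close>, hence
  all variables, so \<open>descent\<close> gives the invariants.\<close>

lemma Fix_A_generated:
  assumes L: "is_subfield L" "K \<subseteq> L" "v \<in> L" "L \<subseteq> Fix A"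
    and tqL: "tau_quot ` (\<Theta> - I - {\<theta>v}) \<subseteq> L"
    and monL: "\<And>f. f \<in> M \<Longrightarrow> (\<Prod>i\<in>I. ev i powi f i) \<in> L"
  shows "Fix A \<subseteq> L"
proof -
  define D where "D = lin_span L I ev"
  note sp = L(1) finite_I
  have ev_L: "ev i \<in> L" if i: "i \<in> I" and triv: "\<And>a. a \<in> A \<Longrightarrow> i a = 1" for i
  proof -
    have "PL.unit_vector i \<in> M"
      using unit_vector_lattice[OF i] triv by (simp add: M_def chi_unit_vector[OF i])
    from monL[OF this] show ?thesis
      using finite_I i by (simp add: PL.unit_vector_def if_distrib[of "\<lambda>e. _ powi e"] cong: if_cong)
  qed
  have one: "1 \<in> D"
  proof -
    have "inverse (ev i1) * ev i1 \<in> D" unfolding D_def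
      by (intro lin_span_scale[OF sp] lin_span_base[OF sp] i1_I is_subfield_inverse[OF L(1)] ev_L i1_A)
    then show ?thesis using ev_nz[OF I_\<Theta>[OF i1_I]] by simp
  qed
  have mult: "ev i * ev j \<in> D" if ij: "i \<in> I" "j \<in> I" for i j
  proof -
    define k where "k = base (\<lambda>g. i g * j g)"
    have k: "k \<in> I" unfolding k_def by (intro base_I \<Theta>_times I_\<Theta> ij)
    have k_A: "k a = i a * j a" if "a \<in> A" for a using that by (simp add: k_def base_A)
    define f where "f = PL.unit_vector i + PL.unit_vector j - PL.unit_vector k"
    have "f \<in> PL.lattice" unfolding f_def
      by (intro PL.L.submodule_diff[OF PL.submodule_lattice] PL.L.submodule_add[OF PL.submodule_lattice]
          unit_vector_lattice ij k)
    moreover have "chi f a = 1" if a: "a \<in> A" for a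
    proof -
      have "chi (PL.unit_vector i + PL.unit_vector j) a = i a * j a"
        using chi_unit_vector[OF ij(1), of a] chi_unit_vector[OF ij(2), of a] I_nz a
        by (simp add: chi_def power_int_add prod.distrib)
      then show ?thesis using k_A[OF a] I_nz[OF k a]
        by (simp add: f_def chi_diff[OF a] chi_unit_vector[OF k])
    qed
    ultimately have "f \<in> M" by (simp add: M_def)
    have pu: "(\<Prod>i\<in>I. ev i powi PL.unit_vector k i) = ev k" if "k \<in> I" for k
      using finite_I that by (simp add: PL.unit_vector_def if_distrib[of "\<lambda>e. _ powi e"] cong: if_cong)
    have "(\<Prod>l\<in>I. ev l powi f l) = (\<Prod>l\<in>I. ev l powi PL.unit_vector i l * ev l powi PL.unit_vector j l / ev l powi PL.unit_vector k l)"
      by (intro prod.cong refl) (simp add: f_def power_int_diff power_int_add ev_nz I_\<Theta>)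
    also have "\<dots> = ev i * ev j / ev k"
      unfolding prod_dividef prod.distrib pu[OF ij(1)] pu[OF ij(2)] pu[OF k] ..
    finally have "ev i * ev j = (\<Prod>l\<in>I. ev l powi f l) * ev k" using ev_nz[OF I_\<Theta>[OF k]] by simp
    then show ?thesis
      unfolding D_def using lin_span_scale[OF sp lin_span_base[OF sp k] monL[OF \<open>f \<in> M\<close>]] by simp
  qed
  have D: "is_subring D"
    unfolding D_def by (rule is_subring_lin_span[OF sp]) (use one mult in \<open>auto simp: D_def\<close>)
  have LD: "L \<subseteq> D"
    using lin_span_scale[OF sp, of 1] one by (auto simp: D_def)
  have \<rho>_lin: "\<rho> a (\<Sum>i\<in>I. e i * ev i) = (\<Sum>i\<in>I. (e i * inverse (i a)) * ev i)"
    if a: "a \<in> A" and e: "\<And>i. i \<in> I \<Longrightarrow> e i \<in> L" for a e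
  proof -
    have "\<rho> a (e i) = e i" if "i \<in> I" for i using e[OF that] L(4) a by (auto simp: Fix_def)
    then show ?thesis
      using a A_carrier by (simp add: field_hom_sum[OF \<rho>_hom] field_hom_mult[OF \<rho>_hom] \<rho>_A_ev I_\<Theta> mult.assoc)
  qed
  have stable: "\<rho> a d \<in> D" if a: "a \<in> A" and d: "d \<in> D" for a d
  proof -
    from d obtain e where e: "\<And>i. i \<in> I \<Longrightarrow> e i \<in> L" "d = (\<Sum>i\<in>I. e i * ev i)"
      unfolding D_def by (rule lin_spanE) blast
    have "\<rho> a d = (\<Sum>i\<in>I. (e i * inverse (i a)) * ev i)"
      unfolding e(2) by (rule \<rho>_lin[OF a]) (rule e(1))
    also have "\<dots> \<in> D" unfolding D_def
      using e(1) \<Theta>_K[OF I_\<Theta>] L(2)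
      by (intro lin_spanI is_subfield_mult[OF L(1)] is_subfield_inverse[OF L(1)]) auto
    finally show ?thesis .
  qed
  have avg: "(\<Sum>a\<in>A. \<rho> a d) \<in> L" if d: "d \<in> D" for d
  proof -
    from d obtain e where e: "\<And>i. i \<in> I \<Longrightarrow> e i \<in> L" "d = (\<Sum>i\<in>I. e i * ev i)"
      unfolding D_def by (rule lin_spanE) blast
    have "(\<Sum>a\<in>A. \<rho> a d) = (\<Sum>a\<in>A. \<Sum>i\<in>I. (e i * ev i) * inverse (i a))"
      unfolding e(2) by (intro sum.cong refl) (simp add: \<rho>_lin e(1) mult_ac)
    also have "\<dots> = (\<Sum>i\<in>I. (e i * ev i) * (\<Sum>a\<in>A. inverse (i a)))"
      by (subst sum.swap) (simp add: sum_distrib_left)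
    also have "\<dots> \<in> L"
    proof (rule is_subfield_sum[OF L(1)])
      fix i assume i: "i \<in> I"
      show "(e i * ev i) * (\<Sum>a\<in>A. inverse (i a)) \<in> L"
      proof (cases "\<exists>b\<in>A. i b \<noteq> 1")
        case True
        then show ?thesis using character_sum[OF I_\<Theta>[OF i]] is_subfield_zero[OF L(1)] by auto
      next
        case False
        then show ?thesis
          using e(1)[OF i] ev_L[OF i] is_subfield_of_nat[OF L(1)] by (auto intro!: is_subfield_mult[OF L(1)])
      qed
    qed
    finally show ?thesis .
  qed
  note desc = descent[OF A card_A_nz D L(1) LD L(4) stable avg]
  have ev_D: "ev \<theta> \<in> D" if \<theta>: "\<theta> \<in> \<Theta>" for \<theta>
  proof (cases "\<theta> \<in> I")
    case True
    then show ?thesis unfolding D_def by (rule lin_span_base[OF sp])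
  next
    case False
    have "ev \<theta> / ev (base \<theta>) \<in> L"
    proof (cases "\<theta> = \<theta>v")
      case True
      then show ?thesis using L(3) by (simp add: v_def base_\<theta>v)
    next
      case neq: False
      have "tau_quot \<theta> \<in> L" using tqL \<theta> False neq by auto
      moreover have "ev \<theta> / ev (base \<theta>) = tau_quot \<theta> * v ^ log_ratio \<theta>" using KS.v by (simp add: tau_quot_def)
      ultimately show ?thesis using L(1,3) by (simp add: is_subfield_mult is_subfield_power)
    qed
    then have "ev \<theta> / ev (base \<theta>) * ev (base \<theta>) \<in> D"
      unfolding D_def by (intro lin_span_scale[OF sp] lin_span_base[OF sp] base_I \<theta>)
    then show ?thesis using ev_nz[OF base_\<Theta>[OF \<theta>]] by simp
  qed
  have "K \<subseteq> D" using L(2) LD by blast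
  then have "x ` carrier H \<subseteq> D" using x_in_span_ev[OF D] ev_D by blast
  then have "field_adjoin K (x ` carrier H) \<subseteq> D" using \<open>K \<subseteq> D\<close> by (intro field_adjoin_least desc(1))
  then have "D = UNIV" unfolding x_gen by blast
  then show ?thesis using desc(2) by simp
qed

lemma \<rho>_v: "h \<in> carrier H \<Longrightarrow> \<rho> h v = \<zeta> ^ tau_exp h * v"
proof -
  assume "h \<in> carrier H"
  then obtain a l where al: "a \<in> A" "l < N" "h = a \<otimes> \<tau> [^] l" using decomp_ex by blast
  have "\<rho> h v = \<rho> a ((\<rho> \<tau> ^^ l) v)" using al A_carrier \<tau> by (simp add: \<rho>_mult \<rho>_\<tau>_pow)
  also have "(\<rho> \<tau> ^^ l) v = \<zeta> ^ l * v" by (rule KS.T_pow_v)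
  also have "\<rho> a (\<zeta> ^ l * v) = \<zeta> ^ l * v"
  proof -
    have "\<zeta> ^ l * v \<in> Fix A" using KS.KE KS.E KS.v \<zeta>_K by (auto intro!: is_subfield_mult is_subfield_power)
    then show ?thesis using al by (simp add: Fix_def)
  qed
  finally show ?thesis using al tau_exp_eq by simp
qed

lemma sum_tau_exp: "(\<Sum>h\<in>carrier H. f (tau_exp h)) = of_nat (card A) * (\<Sum>l<N. f l)" for f :: "nat \<Rightarrow> 'l"
proof -
  have "(\<Sum>h\<in>carrier H. f (tau_exp h)) = (\<Sum>(a, l)\<in>A \<times> {..<N}. f (tau_exp (a \<otimes> \<tau> [^] l)))"
    using sum.reindex_bij_betw[OF decomp, of "\<lambda>h. f (tau_exp h)"] by (simp add: split_def)
  also have "\<dots> = (\<Sum>a\<in>A. \<Sum>l<N. f (tau_exp (a \<otimes> \<tau> [^] l)))" by (simp add: sum.cartesian_product)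
  also have "\<dots> = (\<Sum>a\<in>A. \<Sum>l<N. f l)" by (intro sum.cong refl) (simp add: tau_exp_eq)
  finally show ?thesis by simp
qed

text \<open>Over \<open>F\<close> the powers of \<open>v\<close> below \<open>N\<close> span a ring
  that contains \<open>v\<close> and \<open>Y\<close>. Summation over the group keeps only the term
  at \<open>v ^ 0\<close>, because the other powers of \<open>\<zeta>\<close> sum to 0. So the
  passage from \<open>A\<close> to \<open>H\<close> only replaces \<open>v\<close> by
  \<open>v ^ N\<close>.\<close>

lemma Fix_H_generated:
  assumes Y: "Y \<subseteq> KS.T_fixed" and gen: "Fix A \<subseteq> field_adjoin (field_adjoin K {v}) Y"
  shows "Fix (carrier H) = field_adjoin K (insert (v ^ N) Y)"
proof -
  define F where "F = field_adjoin K (insert (v ^ N) Y)"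
  have F: "is_subfield F" unfolding F_def by (rule field_adjoin_subfield)
  have gens: "K \<subseteq> F" "v ^ N \<in> F" "Y \<subseteq> F" unfolding F_def by (auto intro: field_adjoin_base field_adjoin_gen)
  have FH: "F \<subseteq> Fix (carrier H)"
    unfolding F_def
  proof (rule field_adjoin_least[OF is_subfield_Fix])
    have "\<rho> \<tau> (v ^ N) = v ^ N"
      by (simp add: field_hom_power[OF KS.T] KS.v power_mult_distrib \<zeta>_primitive)
    then show "insert (v ^ N) Y \<subseteq> Fix (carrier H)"
      using Y KS.v is_subfield_power[OF KS.E] by (auto simp: Fix_H_iff KS.T_fixed_def)
    show "K \<subseteq> Fix (carrier H)" using \<rho>_K by (auto simp: Fix_def)
  qed simp
  define w where "w k = v ^ k" for k :: nat
  define D where "D = lin_span F {..<N} w"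
  have fin: "finite {..<N}" by simp
  note sp = F fin
  have pow: "v ^ k \<in> D" for k
  proof -
    have "v ^ k = (v ^ N) ^ (k div N) * w (k mod N)"
      by (simp add: w_def flip: power_mult power_add)
    also have "\<dots> \<in> D" unfolding D_def using N_pos
      by (intro lin_span_scale[OF sp] lin_span_base[OF sp] is_subfield_power[OF F] gens) auto
    finally show ?thesis .
  qed
  have D: "is_subring D"
    unfolding D_def by (rule is_subring_lin_span[OF sp])
      (use pow[of 0] pow in \<open>auto simp: D_def w_def simp flip: power_add\<close>)
  have FD: "F \<subseteq> D"
    using lin_span_scale[OF sp, of 1 w] pow[of 0] by (auto simp: D_def)
  have \<rho>_lin: "\<rho> h (\<Sum>k<N. e k * w k) = (\<Sum>k<N. (e k * (\<zeta> ^ tau_exp h) ^ k) * w k)"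
    if h: "h \<in> carrier H" and e: "\<And>k. k < N \<Longrightarrow> e k \<in> F" for h e
  proof -
    have "\<rho> h (e k) = e k" if "k < N" for k using e[OF that] FH h by (auto simp: Fix_def)
    then show ?thesis
      by (simp add: field_hom_sum[OF \<rho>_hom[OF h]] field_hom_mult[OF \<rho>_hom[OF h]] w_def
          field_hom_power[OF \<rho>_hom[OF h]] \<rho>_v[OF h] power_mult_distrib mult.assoc)
  qed
  have stable: "\<rho> h d \<in> D" if h: "h \<in> carrier H" and d: "d \<in> D" for h d
  proof -
    from d obtain e where e: "\<And>k. k \<in> {..<N} \<Longrightarrow> e k \<in> F" "d = (\<Sum>k<N. e k * w k)"
      unfolding D_def by (rule lin_spanE) blast
    have "\<rho> h d = (\<Sum>k<N. (e k * (\<zeta> ^ tau_exp h) ^ k) * w k)" unfolding e(2) by (rule \<rho>_lin[OF h]) (use e(1) in simp)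
    also have "\<dots> \<in> D" unfolding D_def
      using e(1) \<zeta>_K gens by (intro lin_spanI is_subfield_mult[OF F] is_subfield_power[OF F]) auto
    finally show ?thesis .
  qed
  have avg: "(\<Sum>h\<in>carrier H. \<rho> h d) \<in> F" if d: "d \<in> D" for d
  proof -
    from d obtain e where e: "\<And>k. k \<in> {..<N} \<Longrightarrow> e k \<in> F" "d = (\<Sum>k<N. e k * w k)"
      unfolding D_def by (rule lin_spanE) blast
    have "(\<Sum>h\<in>carrier H. \<rho> h d) = (\<Sum>h\<in>carrier H. \<Sum>k<N. (e k * w k) * (\<zeta> ^ tau_exp h) ^ k)"
      unfolding e(2) by (intro sum.cong refl) (simp add: \<rho>_lin e(1) mult_ac)
    also have "\<dots> = (\<Sum>k<N. (e k * w k) * (\<Sum>h\<in>carrier H. (\<zeta> ^ tau_exp h) ^ k))"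
      by (subst sum.swap) (simp add: sum_distrib_left)
    also have "\<dots> \<in> F"
    proof (rule is_subfield_sum[OF F])
      fix k assume k: "k \<in> {..<N}"
      show "(e k * w k) * (\<Sum>h\<in>carrier H. (\<zeta> ^ tau_exp h) ^ k) \<in> F"
      proof (cases "k = 0")
        case True
        then show ?thesis using e(1)[OF k] is_subfield_of_nat[OF F] by (auto simp: w_def intro!: is_subfield_mult[OF F])
      next
        case False
        have "(\<Sum>h\<in>carrier H. (\<zeta> ^ tau_exp h) ^ k) = of_nat (card A) * (\<Sum>l<N. (\<zeta> ^ k) ^ l)"
          using sum_tau_exp[of "\<lambda>l. (\<zeta> ^ l) ^ k"] by (simp add: mult.commute flip: power_mult)
        also have "(\<Sum>l<N. (\<zeta> ^ k) ^ l) = 0"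
        proof (rule sum_powers_root_of_unity)
          show "(\<zeta> ^ k) ^ N = 1" using \<zeta>_primitive(1) by (metis mult.commute power_mult power_one)
          show "\<zeta> ^ k \<noteq> 1" using \<zeta>_primitive(2)[of k] k False by simp
        qed
        finally show ?thesis using is_subfield_zero[OF F] by simp
      qed
    qed
    finally show ?thesis .
  qed
  note desc = descent[OF subgroup_self card_H_nz D F FD FH stable avg]
  have "field_adjoin K {v} \<subseteq> D" using pow[of 1] gens FD by (intro field_adjoin_least desc(1)) auto
  then have "field_adjoin (field_adjoin K {v}) Y \<subseteq> D"
    using field_adjoin_least[OF desc(1), of "field_adjoin K {v}" Y] gens FD by blast
  moreover have "Fix (carrier H) \<subseteq> Fix A" by (auto simp: Fix_H_iff)
  ultimately have "Fix (carrier H) \<subseteq> D" using gen by blast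
  then have "Fix (carrier H) \<subseteq> F" using desc(2) by blast
  then show ?thesis using FH by (simp add: F_def)
qed

theorem rational_fixed_field_semisimple: "rational_over K (Fix (carrier H))"
proof -
  define s where "s = card (carrier H) - card I - 1"
  obtain t :: "nat \<Rightarrow> 'l" where
    t0: "(\<forall>j < s. t j \<in> KS.T_fixed \<and> t j \<noteq> 0) \<and>
      (\<forall>L. is_subfield L \<and> K \<subseteq> L \<and> v \<in> L \<and> t ` {..<s} \<subseteq> L \<longrightarrow> tau_quot ` (\<Theta> - I - {\<theta>v}) \<subseteq> L)"
    using permutation_part unfolding s_def by (rule exE)
  have t: "\<And>j. j < s \<Longrightarrow> t j \<in> KS.T_fixed" "\<And>j. j < s \<Longrightarrow> t j \<noteq> 0"
    and tL: "\<And>L. is_subfield L \<Longrightarrow> K \<subseteq> L \<Longrightarrow> v \<in> L \<Longrightarrow> t ` {..<s} \<subseteq> L \<Longrightarrow> tau_quot ` (\<Theta> - I - {\<theta>v}) \<subseteq> L"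
    using t0 by simp_all
  interpret MT: monomial_tower K "Fix A" "\<rho> \<tau>" p n \<zeta> v I g M m ev "\<lambda>i. inverse (g i \<tau>)" "{..<s}" t
  proof unfold_locales
    show "ev i \<noteq> 0" if "i \<in> I" for i by (rule ev_nz[OF I_\<Theta>[OF that]])
    show "inverse (g i \<tau>) \<in> K" "inverse (g i \<tau>) \<noteq> 0" if "i \<in> I" for i
      using \<Theta>_K[OF I_\<Theta>[OF g_I[OF that]]] \<Theta>_nz[OF I_\<Theta>[OF g_I[OF that]] \<tau>] is_subfield_inverse[OF K] by auto
    show "\<rho> \<tau> (ev (g i)) = inverse (g i \<tau>) * ev i" if "i \<in> I" for i
      using \<rho>_\<tau>_ev[OF I_\<Theta>[OF g_I[OF that]]] sh_g[OF that] by simp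
    show "(\<Prod>i\<in>I. ev i powi f i) \<in> Fix A" if "f \<in> M" for f by (rule mon_Fix_A[OF that])
  qed (use t in auto)
  \<comment> \<open>As \<open>p\<close> is at least 2, the number absorbed at each level is at most
    the net number of generators there. The total is therefore at most \<open>card I\<close> minus
    the number of orbits, and there is at least one orbit.\<close>
  have "MT.budget 0 \<le> (\<Sum>i\<in>{1..n}. card (PL.moved i) * (p ^ i - p ^ (i - 1)))"
    unfolding MT.budget_def atLeastSucAtMost_greaterThanAtMost[symmetric]
  proof (simp only: One_nat_def, rule sum_mono)
    fix i assume "i \<in> {Suc 0..n}"
    then have "p ^ i = p * p ^ (i - Suc 0)" by (cases i) auto
    moreover have "2 * p ^ (i - Suc 0) \<le> p * p ^ (i - Suc 0)" using prime_ge_2_nat[OF p] by simp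
    ultimately have "p ^ (i - Suc 0) \<le> p ^ i - p ^ (i - Suc 0)" by linarith
    then show "card (PL.moved i) * p ^ (i - Suc 0) \<le> card (PL.moved i) * (p ^ i - p ^ (i - Suc 0))"
      by (rule mult_le_mono2)
  qed
  also have "\<dots> = card I - card PL.reps" using PL.card_moved_sum by simp
  also have "card PL.reps \<ge> 1"
    using i1_I PL.reps_meet PL.finite_reps by (metis One_nat_def Suc_leI card_gt_0_iff empty_iff)
  then have "card I - card PL.reps \<le> s" using card_I by (simp add: s_def)
  finally have "MT.budget 0 \<le> card {..<s}" by simp
  from MT.monomial_tower_generators[OF this] obtain Y where
    Y: "finite Y" "Y \<subseteq> KS.T_fixed" "card Y \<le> card I + s"
    "MT.mon ` M \<union> t ` {..<s} \<subseteq> field_adjoin (field_adjoin K {v}) Y" by auto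
  define L where "L = field_adjoin (field_adjoin K {v}) Y"
  have L: "KS.T_stable L" unfolding L_def by (rule KS.T_stable_adjoin[OF KS.T_stable_base Y(2)])
  then have L': "is_subfield L" "K \<subseteq> L" "v \<in> L" "L \<subseteq> Fix A" by (auto simp: KS.T_stable_def)
  have "Fix A \<subseteq> L"
  proof (rule Fix_A_generated[OF L'])
    show "tau_quot ` (\<Theta> - I - {\<theta>v}) \<subseteq> L" by (rule tL[OF L'(1-3)]) (use Y(4) in \<open>simp add: L_def\<close>)
    show "(\<Prod>i\<in>I. ev i powi f i) \<in> L" if "f \<in> M" for f
      using Y(4) that by (auto simp: L_def MT.mon_def)
  qed
  then have "Fix (carrier H) = field_adjoin K (insert (v ^ N) Y)"
    unfolding L_def by (rule Fix_H_generated[OF Y(2)])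
  moreover have "card (insert (v ^ N) Y) \<le> card (carrier H)"
  proof -
    have "card (insert (v ^ N) Y) \<le> Suc (card Y)" using Y(1) by (simp add: card_insert_if)
    also have "\<dots> \<le> card (carrier H)" using Y(3) card_I by (simp add: s_def)
    finally show ?thesis .
  qed
  ultimately show ?thesis using rational_Fix Y(1) by simp
qed

end

section \<open>The modular case\<close>

definition poly_over :: "'l::field set \<Rightarrow> 'l poly \<Rightarrow> bool" where
  "poly_over F P \<longleftrightarrow> (\<forall>i. Polynomial.coeff P i \<in> F)"

context
  fixes F :: "'l::field set"
  assumes F: "is_subfield F"
begin

lemma poly_over_diff: "poly_over F P \<Longrightarrow> poly_over F Q \<Longrightarrow> poly_over F (P - Q)"
  and poly_over_add: "poly_over F P \<Longrightarrow> poly_over F Q \<Longrightarrow> poly_over F (P + Q)"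
  and poly_over_mult: "poly_over F P \<Longrightarrow> poly_over F Q \<Longrightarrow> poly_over F (P * Q)"
  and poly_over_monom: "c \<in> F \<Longrightarrow> poly_over F (Polynomial.monom c n)"
  and poly_over_const: "c \<in> F \<Longrightarrow> poly_over F [:c:]"
  and poly_over_linear: "b \<in> F \<Longrightarrow> poly_over F [:b, 1:]"
  by (auto simp: poly_over_def Polynomial.coeff_mult coeff_pCons split: nat.splits
      intro!: is_subfield_closed[OF F])

lemma poly_over_prod: "(\<And>i. i \<in> I \<Longrightarrow> poly_over F (f i)) \<Longrightarrow> poly_over F (prod f I)"
  using poly_over_const[OF is_subfield_one[OF F]]
  by (induction I rule: infinite_finite_induct) (auto simp: one_pCons intro: poly_over_mult)

lemma poly_over_pcompose:
  assumes "poly_over F P" "poly_over F Q" shows "poly_over F (pcompose P Q)"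
  using assms(1)
proof (induction P)
  case (pCons a P)
  have "a \<in> F" "poly_over F P"
    using pCons.prems by (auto simp: poly_over_def coeff_pCons split: nat.splits)
  then show ?case
    using pCons.IH assms(2) by (simp add: pcompose_pCons poly_over_add poly_over_mult poly_over_const)
qed (simp add: poly_over_def is_subfield_zero[OF F])

lemma poly_over_division:
  assumes P: "poly_over F P" "lead_coeff P = 1" "0 < Polynomial.degree P" and Q: "poly_over F Q"
  shows "\<exists>q r. poly_over F q \<and> poly_over F r \<and> Q = q * P + r \<and> Polynomial.degree r < Polynomial.degree P"
  using Q
proof (induction "Polynomial.degree Q" arbitrary: Q rule: less_induct)
  case less
  show ?case
  proof (cases "Polynomial.degree Q < Polynomial.degree P")
    case True
    then show ?thesis using less.prems
      by (intro exI[of _ 0] exI[of _ Q]) (auto simp: poly_over_def is_subfield_zero[OF F])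
  next
    case False
    define d where "d = Polynomial.degree Q - Polynomial.degree P"
    define M where "M = Polynomial.monom (lead_coeff Q) d"
    have Q0: "Q \<noteq> 0" using False P(3) by auto
    have "lead_coeff Q \<in> F" using less.prems by (simp add: poly_over_def)
    then have M: "poly_over F M" unfolding M_def by (rule poly_over_monom)
    have degM: "Polynomial.degree (M * P) = Polynomial.degree Q"
      using Q0 P False by (subst degree_mult_eq) (auto simp: M_def d_def degree_monom_eq monom_eq_0_iff)
    have lcM: "Polynomial.coeff (M * P) (Polynomial.degree Q) = lead_coeff Q"
    proof -
      have "lead_coeff (M * P) = lead_coeff Q"
        unfolding lead_coeff_mult using P by (simp add: M_def degree_monom_eq Q0)
      then show ?thesis by (simp add: degM)
    qed
    define Q' where "Q' = Q - M * P"
    have "Polynomial.degree Q' < Polynomial.degree Q"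
    proof (rule degree_lessI)
      show "Q' \<noteq> 0 \<or> 0 < Polynomial.degree Q" using False P(3) by simp
      show "\<forall>k\<ge>Polynomial.degree Q. Polynomial.coeff Q' k = 0"
      proof safe
        fix k assume "Polynomial.degree Q \<le> k"
        then show "Polynomial.coeff Q' k = 0"
          using lcM degM by (cases "k = Polynomial.degree Q") (auto simp: Q'_def coeff_eq_0)
      qed
    qed
    from less.hyps[OF this] obtain q r where qr: "poly_over F q" "poly_over F r" "Q' = q * P + r"
      "Polynomial.degree r < Polynomial.degree P"
      using less.prems M P(1) by (auto simp: Q'_def poly_over_diff poly_over_mult)
    have "Q = (q + M) * P + r" using qr(3) by (simp add: Q'_def algebra_simps)
    then show ?thesis using qr M poly_over_add by blast
  qed
qed

end

section \<open>Invariants in one variable on which the group acts by translations\<close>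

context regular_field
begin

text \<open>The action of \<open>h\<close> on P(y), written on the polynomial \<open>P\<close>, when
  \<open>h\<close> sends y to y + \<open>b h\<close>. It preserves degrees, and this makes the
  division argument below work.\<close>

definition twist :: "('h \<Rightarrow> 'l) \<Rightarrow> 'h \<Rightarrow> 'l poly \<Rightarrow> 'l poly" where
  "twist b h P = pcompose (map_poly (\<rho> h) P) [:b h, 1:]"

context
  fixes F :: "'l set" and y :: 'l and b :: "'h \<Rightarrow> 'l"
  assumes F: "is_subfield F" and F_stable: "\<And>h u. h \<in> carrier H \<Longrightarrow> u \<in> F \<Longrightarrow> \<rho> h u \<in> F"
    and y: "\<not> algebraic_over F y" and b: "\<And>h. h \<in> carrier H \<Longrightarrow> b h \<in> F"
    and \<rho>_y: "\<And>h. h \<in> carrier H \<Longrightarrow> \<rho> h y = b h + y"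
begin

lemma poly_map_field_hom: "field_hom f \<Longrightarrow> poly (map_poly f P) (f u) = f (poly P u)"
  by (induction P) (simp_all add: map_poly_pCons field_hom_simps)

lemma twist_value: "h \<in> carrier H \<Longrightarrow> poly (twist b h P) y = \<rho> h (poly P y)"
  using poly_map_field_hom[OF \<rho>_hom, of h P y] by (simp add: twist_def poly_pcompose \<rho>_y)

lemma twist_over: "h \<in> carrier H \<Longrightarrow> poly_over F P \<Longrightarrow> poly_over F (twist b h P)"
  unfolding twist_def
  by (intro poly_over_pcompose[OF F] poly_over_linear[OF F] b)
    (auto simp: poly_over_def coeff_map_poly field_hom_zero[OF \<rho>_hom] F_stable)

lemma twist_degree: "h \<in> carrier H \<Longrightarrow> Polynomial.degree (twist b h P) = Polynomial.degree P"
  unfolding twist_def using degree_map_poly[of "\<rho> h" P] by (simp add: degree_pcompose field_hom_eq_0[OF \<rho>_hom])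

lemma twist_lead_coeff: "h \<in> carrier H \<Longrightarrow> lead_coeff (twist b h P) = \<rho> h (lead_coeff P)"
  unfolding twist_def using degree_map_poly[of "\<rho> h" P]
  by (subst lead_coeff_comp) (simp_all add: coeff_map_poly field_hom_zero[OF \<rho>_hom] field_hom_eq_0[OF \<rho>_hom])

lemma poly_eq_if_value_eq: "poly_over F P \<Longrightarrow> poly_over F Q \<Longrightarrow> poly P y = poly Q y \<Longrightarrow> P = Q"
  using y poly_over_diff[OF F, of P Q] unfolding algebraic_over_def poly_over_def[symmetric]
  by (metis eq_iff_diff_eq_0 poly_diff)

lemma invariant_iff_twist:
  assumes "poly_over F P"
  shows "poly P y \<in> Fix (carrier H) \<longleftrightarrow> (\<forall>h\<in>carrier H. twist b h P = P)"
proof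
  assume fixed: "poly P y \<in> Fix (carrier H)"
  show "\<forall>h\<in>carrier H. twist b h P = P"
  proof
    fix h assume h: "h \<in> carrier H"
    have "poly (twist b h P) y = poly P y" using fixed h by (simp add: twist_value Fix_def)
    then show "twist b h P = P" by (rule poly_eq_if_value_eq[OF twist_over[OF h assms] assms])
  qed
next
  assume "\<forall>h\<in>carrier H. twist b h P = P"
  then show "poly P y \<in> Fix (carrier H)" by (simp add: Fix_def flip: twist_value)
qed

text \<open>When an invariant polynomial is divided by the monic invariant \<open>P\<close> of least
  positive degree, uniqueness makes quotient and remainder invariant, and minimality makes the
  remainder constant. Invariant fractions are reduced to this case by multiplying with the other
  conjugates of the denominator.\<close>

lemma invariant_fixed_generator:
  "\<exists>f\<in>Fix (carrier H). field_adjoin F {y} \<inter> Fix (carrier H) \<subseteq> field_adjoin (F \<inter> Fix (carrier H)) {f}"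
proof -
  define invar where "invar P \<longleftrightarrow> poly_over F P \<and> poly P y \<in> Fix (carrier H)" for P
  have FixH: "is_subfield (Fix (carrier H))" by (rule is_subfield_Fix) simp
  \<comment> \<open>The product of the conjugates of \<open>y\<close> shows that invariants of
    positive degree exist.\<close>
  define P0 where "P0 = (\<Prod>h\<in>carrier H. [:b h, 1:])"
  have "poly_over F P0" unfolding P0_def by (intro poly_over_prod[OF F] poly_over_linear[OF F] b)
  moreover have P0y: "poly P0 y = (\<Prod>h\<in>carrier H. \<rho> h y)"
    unfolding P0_def poly_prod by (intro prod.cong refl) (simp add: \<rho>_y)
  have "\<rho> k (\<Prod>h\<in>carrier H. \<rho> h y) = (\<Prod>h\<in>carrier H. \<rho> h y)" if "k \<in> carrier H" for k
    using that subgroup_sum_translate(2)[OF subgroup_self that, of "\<lambda>h. \<rho> h y"]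
    by (simp add: field_hom_prod[OF \<rho>_hom] flip: \<rho>_mult)
  then have "poly P0 y \<in> Fix (carrier H)" by (simp add: P0y Fix_def)
  moreover have "Polynomial.degree P0 = card (carrier H)"
    unfolding P0_def by (subst degree_prod_sum_eq) auto
  then have "0 < Polynomial.degree P0" using finite_H by (metis card_gt_0_iff empty_iff one_closed)
  ultimately have "invar P0 \<and> 0 < Polynomial.degree P0" by (simp add: invar_def)
  then obtain P1 where P1: "invar P1" "0 < Polynomial.degree P1"
    "\<And>Q. invar Q \<Longrightarrow> 0 < Polynomial.degree Q \<Longrightarrow> Polynomial.degree P1 \<le> Polynomial.degree Q"
    using ex_has_least_nat[of "\<lambda>P. invar P \<and> 0 < Polynomial.degree P" P0 Polynomial.degree] by auto
  define c where "c = lead_coeff P1"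
  have c0: "c \<noteq> 0" using P1(2) by (auto simp: c_def)
  have cF: "c \<in> F" using P1(1) by (simp add: c_def invar_def poly_over_def)
  \<comment> \<open>A translation does not alter the leading coefficient, so \<open>c\<close> is
    invariant and \<open>P1\<close> can be made monic among the invariants.\<close>
  have "\<rho> h c = c" if "h \<in> carrier H" for h
    using twist_lead_coeff[OF that, of P1] P1(1) invariant_iff_twist[of P1] that by (simp add: c_def invar_def)
  then have cFix: "c \<in> Fix (carrier H)" by (simp add: Fix_def)
  define P where "P = [:inverse c:] * P1"
  have P: "invar P" "lead_coeff P = 1" "Polynomial.degree P = Polynomial.degree P1"
    using P1(1) c0 cF cFix is_subfield_inverse[OF F cF] poly_over_mult[OF F poly_over_const[OF F], of "inverse c" P1]
      is_subfield_mult[OF FixH is_subfield_inverse[OF FixH cFix]]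
    by (auto simp: P_def invar_def c_def)
  define f where "f = poly P y"
  define L where "L = field_adjoin (F \<inter> Fix (carrier H)) {f}"
  have L: "is_subfield L" unfolding L_def by (rule field_adjoin_subfield)
  have fL: "f \<in> L" by (simp add: L_def field_adjoin_gen)
  have const: "poly Q y \<in> L" if "invar Q" "Polynomial.degree Q = 0" for Q
  proof -
    from that(2) obtain a where "Q = [:a:]" by (rule degree_eq_zeroE)
    then have "a \<in> F \<inter> Fix (carrier H)"
      using that(1) by (auto simp: invar_def poly_over_def coeff_pCons split: nat.splits)
    then show ?thesis by (simp add: \<open>Q = [:a:]\<close> L_def field_adjoin_base)
  qed
  have all: "poly Q y \<in> L" if "invar Q" for Q
    using that
  proof (induction "Polynomial.degree Q" arbitrary: Q rule: less_induct)
    case less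
    show ?case
    proof (cases "Polynomial.degree Q = 0")
      case False
      have Po: "poly_over F P" "poly_over F Q" using P(1) less.prems by (auto simp: invar_def)
      have degP: "0 < Polynomial.degree P" using P(3) P1(2) by simp
      from poly_over_division[OF F Po(1) P(2) degP Po(2)] obtain q r where
        qr: "poly_over F q" "poly_over F r" "Q = q * P + r" "Polynomial.degree r < Polynomial.degree P" by blast
      have tau_char: "twist b h q = q \<and> twist b h r = r" if h: "h \<in> carrier H" for h
      proof -
        have "poly (twist b h q * P + twist b h r) y = \<rho> h (poly q y * poly P y + poly r y)"
          using twist_value[OF h] P(1) h by (simp add: field_hom_simps[OF \<rho>_hom[OF h]] invar_def Fix_def)
        also have "\<dots> = poly Q y" using less.prems h by (simp add: qr(3) invar_def Fix_def)
        finally have eq: "twist b h q * P + twist b h r = q * P + r"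
          using twist_over[OF h] qr Po by (intro poly_eq_if_value_eq poly_over_add[OF F] poly_over_mult[OF F]) auto
        then have e: "(twist b h q - q) * P = r - twist b h r" by (simp add: algebra_simps)
        have "twist b h q - q = 0"
        proof (rule ccontr)
          assume "twist b h q - q \<noteq> 0"
          then have "Polynomial.degree P \<le> Polynomial.degree ((twist b h q - q) * P)"
            using degP by (subst degree_mult_eq) auto
          also have "\<dots> < Polynomial.degree P"
            unfolding e using degree_diff_less qr(4) twist_degree[OF h, of r] by metis
          finally show False by simp
        qed
        then show ?thesis using eq by simp
      qed
      have "invar q" "invar r" using qr tau_char invariant_iff_twist by (auto simp: invar_def)
      have "Polynomial.degree r = 0"
        using P1(3)[OF \<open>invar r\<close>] qr(4) P(3) by (cases "Polynomial.degree r = 0") auto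
      then have "poly r y \<in> L" using const \<open>invar r\<close> by blast
      moreover have "poly q y \<in> L"
      proof (cases "q = 0")
        case True
        then show ?thesis using is_subfield_zero[OF L] by simp
      next
        case q0: False
        have "Polynomial.degree (q * P) = Polynomial.degree q + Polynomial.degree P"
          using q0 degP by (intro degree_mult_eq) auto
        then have "Polynomial.degree q < Polynomial.degree Q"
          unfolding qr(3) using qr(4) degP by (subst degree_add_eq_left) auto
        then show ?thesis using less.hyps \<open>invar q\<close> by blast
      qed
      ultimately show ?thesis
        unfolding qr(3) using fL by (simp add: f_def is_subfield_add[OF L] is_subfield_mult[OF L])
    qed (use const less.prems in blast)
  qed
  define R where "R = {poly P y |P. \<forall>i. Polynomial.coeff P i \<in> F}"
  have R: "is_subring R" unfolding R_def by (rule is_subring_poly_values[OF F])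
  have RL: "u \<in> L" if u: "u \<in> R" "u \<in> Fix (carrier H)" for u
  proof -
    from u(1) obtain Q where "u = poly Q y" "poly_over F Q" unfolding R_def poly_over_def by blast
    then show ?thesis using all[of Q] u(2) by (simp add: invar_def)
  qed
  have FR: "F \<subseteq> R"
  proof
    fix a assume "a \<in> F"
    then have "a = poly [:a:] y \<and> (\<forall>i. Polynomial.coeff [:a:] i \<in> F)"
      using poly_over_const[OF F] by (simp add: poly_over_def)
    then show "a \<in> R" unfolding R_def by blast
  qed
  have yR: "{y} \<subseteq> R"
  proof -
    have "y = poly [:0, 1:] y \<and> (\<forall>i. Polynomial.coeff [:0, 1:] i \<in> F)"
      using poly_over_linear[OF F is_subfield_zero[OF F]] by (simp add: poly_over_def)
    then show ?thesis unfolding R_def by blast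
  qed
  have R_stable: "\<rho> h u \<in> R" if h: "h \<in> carrier H" and u: "u \<in> R" for h u
  proof -
    from u obtain Q where "u = poly Q y" "poly_over F Q" unfolding R_def poly_over_def by blast
    then have "\<rho> h u = poly (twist b h Q) y" "poly_over F (twist b h Q)"
      using twist_value[OF h] twist_over[OF h] by auto
    then show ?thesis unfolding R_def poly_over_def by blast
  qed
  have "e \<in> L" if e: "e \<in> field_adjoin F {y} \<inter> Fix (carrier H)" for e
  proof -
    from e field_adjoin_fractions[OF R FR yR] obtain u w where uw: "e = u / w" "u \<in> R" "w \<in> R" by blast
    show ?thesis
    proof (cases "w = 0")
      case True
      then show ?thesis using uw is_subfield_zero[OF L] by simp
    next
      case False
      define W where "W = (\<Prod>h\<in>carrier H. \<rho> h w)"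
      define W' where "W' = (\<Prod>h\<in>carrier H - {\<one>}. \<rho> h w)"
      have WW': "W = w * W'" using finite_H by (simp add: W_def W'_def prod.remove[of _ \<one>] \<rho>_one)
      have W0: "W \<noteq> 0" unfolding W_def using finite_H False by (simp add: field_hom_eq_0[OF \<rho>_hom])
      have "\<rho> k W = W" if "k \<in> carrier H" for k
        using that subgroup_sum_translate(2)[OF subgroup_self that, of "\<lambda>h. \<rho> h w"]
        by (simp add: W_def field_hom_prod[OF \<rho>_hom] flip: \<rho>_mult)
      then have WFix: "W \<in> Fix (carrier H)" by (simp add: Fix_def)
      have W'R: "W' \<in> R" unfolding W'_def using R_stable uw by (intro is_subring_prod[OF R]) auto
      have "W \<in> L" using RL[OF _ WFix] is_subring_mult[OF R uw(3) W'R] WW' by simp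
      moreover have "e * W = u * W'" using uw False WW' by simp
      then have "e * W \<in> R" using is_subring_mult[OF R uw(2) W'R] by simp
      then have "e * W \<in> L" using RL is_subfield_mult[OF FixH _ WFix] e by blast
      ultimately show ?thesis using is_subfield_cancel_right[OF L] W0 by blast
    qed
  qed
  then have "field_adjoin F {y} \<inter> Fix (carrier H) \<subseteq> L" by (rule subsetI)
  moreover have "f \<in> Fix (carrier H)" using P(1) by (simp add: f_def invar_def)
  ultimately show ?thesis unfolding L_def by (rule bexI[of _ f])
qed

end

text \<open>Each step of the flag contributes one invariant. That \<open>y i\<close> is
  transcendental over its predecessors follows by counting: without it, fewer than
  \<open>card (carrier H)\<close> elements would carry the full transcendence degree.\<close>

lemma rational_if_unipotent_flag:
  fixes y :: "nat \<Rightarrow> 'l"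
  assumes flag: "\<And>i h. i < card (carrier H) \<Longrightarrow> h \<in> carrier H \<Longrightarrow> \<rho> h (y i) - y i \<in> field_adjoin K (y ` {..<i})"
    and gen: "field_adjoin K (y ` {..<card (carrier H)}) = UNIV"
  shows "rational_over K (Fix (carrier H))"
proof -
  define s where "s = card (carrier H)"
  define L where "L i = field_adjoin K (y ` {..<i})" for i
  have FixH: "is_subfield (Fix (carrier H))" by (rule is_subfield_Fix) simp
  have LS: "L (Suc i) = field_adjoin (L i) {y i}" for i
  proof -
    have "y ` {..<Suc i} = y ` {..<i} \<union> {y i}" by (auto simp: lessThan_Suc)
    then show ?thesis unfolding L_def by (simp only: field_adjoin_Un)
  qed
  have L_stable: "\<rho> h u \<in> L i" if "i \<le> s" "h \<in> carrier H" "u \<in> L i" for i h u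
    unfolding L_def
  proof (rule field_hom_field_adjoin[OF \<rho>_hom[OF that(2)] field_adjoin_subfield _ _ that(3)[unfolded L_def]])
    fix u assume "u \<in> K"
    then show "\<rho> h u \<in> field_adjoin K (y ` {..<i})"
      using \<rho>_K[OF that(2)] by (simp add: field_adjoin_base)
  next
    fix u assume "u \<in> y ` {..<i}"
    then obtain j where j: "j < i" "u = y j" by auto
    have "\<rho> h (y j) - y j \<in> field_adjoin K (y ` {..<j})"
      using flag[of j h] j that(1,2) by (simp add: s_def)
    moreover have "field_adjoin K (y ` {..<j}) \<subseteq> field_adjoin K (y ` {..<i})"
      using j(1) by (intro field_adjoin_mono image_mono) auto
    ultimately have "\<rho> h (y j) - y j \<in> field_adjoin K (y ` {..<i})" by blast
    moreover have "y j \<in> field_adjoin K (y ` {..<i})" using j by (auto intro: field_adjoin_gen)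
    ultimately have "(\<rho> h (y j) - y j) + y j \<in> field_adjoin K (y ` {..<i})"
      by (rule is_subfield_add[OF field_adjoin_subfield])
    then show "\<rho> h u \<in> field_adjoin K (y ` {..<i})" using j by simp
  qed
  have trans: "\<not> algebraic_over (L i) (y i)" if i: "i < s" for i
  proof
    assume alg: "algebraic_over (L i) (y i)"
    define Y where "Y = y ` ({..<s} - {i})"
    have alg': "algebraic_over (field_adjoin K Y) (y i)"
    proof (rule algebraic_over_mono[OF alg])
      show "L i \<subseteq> field_adjoin K Y" unfolding L_def Y_def
        by (rule field_adjoin_mono) (use i in auto)
    qed
    have "algebraic_over (field_adjoin K Y) u" for u
    proof (rule algebraic_over_trans[OF field_adjoin_subfield alg'])
      have "field_adjoin K (y ` {..<s}) \<subseteq> field_adjoin K (Y \<union> {y i})"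
        by (intro field_adjoin_mono) (auto simp: Y_def)
      then have "field_adjoin (field_adjoin K Y) {y i} = UNIV"
        using gen unfolding s_def field_adjoin_Un by blast
      then show "algebraic_over (field_adjoin (field_adjoin K Y) {y i}) u"
        by (intro algebraic_over_self field_adjoin_subfield) auto
    qed
    from transcendence_degree_le[OF K finite_H x_indep, of Y, OF _ this] have "s \<le> card Y"
      by (simp add: s_def Y_def)
    also have "card Y \<le> card ({..<s} - {i})" unfolding Y_def by (rule card_image_le) simp
    also have "\<dots> < s" using i by simp
    finally show False by simp
  qed
  have "\<exists>Y\<subseteq>Fix (carrier H). finite Y \<and> card Y \<le> i \<and> L i \<inter> Fix (carrier H) \<subseteq> field_adjoin K Y" if "i \<le> s" for i
    using that
  proof (induction i)
    case 0
    have "L 0 \<subseteq> K" unfolding L_def by (rule field_adjoin_least[OF K]) auto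
    then show ?case by (intro exI[of _ "{}"]) (auto intro: field_adjoin_base)
  next
    case (Suc i)
    then obtain Y where Y: "Y \<subseteq> Fix (carrier H)" "finite Y" "card Y \<le> i"
      "L i \<inter> Fix (carrier H) \<subseteq> field_adjoin K Y" by auto
    have "\<exists>f\<in>Fix (carrier H). field_adjoin (L i) {y i} \<inter> Fix (carrier H)
        \<subseteq> field_adjoin (L i \<inter> Fix (carrier H)) {f}"
    proof (rule invariant_fixed_generator[where b = "\<lambda>h. \<rho> h (y i) - y i"])
      show "is_subfield (L i)" unfolding L_def by (rule field_adjoin_subfield)
      show "\<rho> h u \<in> L i" if "h \<in> carrier H" "u \<in> L i" for h u using L_stable that Suc.prems by simp
      show "\<not> algebraic_over (L i) (y i)" using trans Suc.prems by simp
      show "\<rho> h (y i) - y i \<in> L i" if "h \<in> carrier H" for h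
        unfolding L_def using flag that Suc.prems by (simp add: s_def)
    qed simp
    then obtain f where f: "f \<in> Fix (carrier H)"
      "L (Suc i) \<inter> Fix (carrier H) \<subseteq> field_adjoin (L i \<inter> Fix (carrier H)) {f}" unfolding LS by blast
    have "field_adjoin (L i \<inter> Fix (carrier H)) {f} \<subseteq> field_adjoin (field_adjoin K Y) {f}"
      by (rule field_adjoin_mono[OF Y(4)]) simp
    also have "\<dots> = field_adjoin K (insert f Y)" unfolding field_adjoin_Un[symmetric] by simp
    finally show ?case
      using f Y by (intro exI[of _ "insert f Y"]) (auto simp: card_insert_if)
  qed
  from this[of s] obtain Y where Y: "Y \<subseteq> Fix (carrier H)" "finite Y" "card Y \<le> s"
    "L s \<inter> Fix (carrier H) \<subseteq> field_adjoin K Y" by blast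
  have "L s = UNIV" using gen by (simp add: L_def s_def)
  moreover have "field_adjoin K Y \<subseteq> Fix (carrier H)"
    using \<rho>_K by (intro field_adjoin_least[OF FixH] Y) (auto simp: Fix_def)
  ultimately have "Fix (carrier H) = field_adjoin K Y" using Y(4) by auto
  then show ?thesis using rational_Fix Y by (simp add: s_def)
qed

end

text \<open>In characteristic \<open>p\<close> the power (f - 1)^(p^m) is f^(p^m) - 1. The
  congruence for functions applies to the sequence of iterates \<open>(f ^^ i) w\<close>, on which
  \<open>f\<close> acts as the shift by \<open>Suc\<close>.\<close>

lemma unipotent_nilpotent:
  fixes f :: "'l::field \<Rightarrow> 'l"
  assumes f: "field_hom f" and p: "Factorial_Ring.prime p" "of_nat p = (0::'l)" and w: "(f ^^ (p ^ m)) w = w"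
  shows "((\<lambda>u. f u - u) ^^ (p ^ m)) w = 0"
proof -
  define \<delta> where "\<delta> = (\<lambda>u. f u - u)"
  have \<delta>_diff: "(\<delta> ^^ k) (u - u') = (\<delta> ^^ k) u - (\<delta> ^^ k) u'" for k u u'
    by (induction k) (simp_all add: \<delta>_def field_hom_diff[OF f])
  have cob: "(coboundary Suc ^^ k) (\<lambda>i. (f ^^ i) w) i = (\<delta> ^^ k) ((f ^^ i) w)" for k i
  proof (induction k arbitrary: i)
    case (Suc k)
    have "(coboundary Suc ^^ Suc k) (\<lambda>i. (f ^^ i) w) i = (\<delta> ^^ k) ((f ^^ Suc i) w) - (\<delta> ^^ k) ((f ^^ i) w)"
      unfolding funpow.simps(2) o_apply by (subst coboundary_apply) (simp only: Suc o_apply funpow.simps(2))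
    also have "\<dots> = (\<delta> ^^ k) (\<delta> ((f ^^ i) w))" by (simp add: \<delta>_diff[symmetric]) (simp add: \<delta>_def)
    finally show ?case by (simp add: funpow_swap1)
  qed simp
  \<comment> \<open>Since \<open>of_nat p\<close> is 0 here, this divisibility is an
    equation.\<close>
  have "(of_nat p :: 'l) dvd (coboundary Suc ^^ (p ^ m)) (\<lambda>i. (f ^^ i) w) 0 - shift_diff Suc (p ^ m) (\<lambda>i. (f ^^ i) w) 0"
    by (rule shift_diff_prime_power_cong[OF p(1)])
  moreover have "(Suc ^^ k) 0 = k" for k by (induction k) auto
  ultimately show ?thesis using w p(2) by (simp add: cob shift_diff_apply \<delta>_def)
qed

lemma last_outside:
  assumes "w \<notin> U" "(\<delta> ^^ k) w \<in> U"
  shows "\<exists>j. (\<delta> ^^ j) w \<notin> U \<and> \<delta> ((\<delta> ^^ j) w) \<in> U"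
  using assms(2)
proof (induction k)
  case (Suc k)
  then show ?case by (cases "(\<delta> ^^ k) w \<in> U") auto
qed (use assms(1) in simp)

section \<open>A flag of linear forms in characteristic \<open>p\<close>\<close>

locale unipotent_regular_field = regular_field H K x \<rho>
  for H :: "('h, 'm) monoid_scheme" (structure) and K :: "'l::field set" and x \<rho> +
  fixes A :: "'h set" and \<tau> :: 'h and p m :: nat
  assumes A: "subgroup A H" and A_comm: "\<And>a b. a \<in> A \<Longrightarrow> b \<in> A \<Longrightarrow> a \<otimes> b = b \<otimes> a"
    and \<tau>: "\<tau> \<in> carrier H" and A_conj: "\<And>a. a \<in> A \<Longrightarrow> inv \<tau> \<otimes> a \<otimes> \<tau> \<in> A"
    and decomp: "\<And>g. g \<in> carrier H \<Longrightarrow> \<exists>a\<in>A. \<exists>l::nat. g = a \<otimes> \<tau> [^] l"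
    and exponent: "\<And>g. g \<in> carrier H \<Longrightarrow> g [^] (p ^ m) = \<one>"
    and p: "Factorial_Ring.prime p" and char_p: "of_nat p = (0::'l)"
begin

definition V where "V = lin_span K (carrier H) x"

lemma V_diff: "u \<in> V \<Longrightarrow> w \<in> V \<Longrightarrow> u - w \<in> V"
  unfolding V_def by (rule lin_span_diff[OF K finite_H])

lemma V_stable: assumes "h \<in> carrier H" "w \<in> V" shows "\<rho> h w \<in> V"
proof -
  from assms(2) obtain e where e: "\<And>g. g \<in> carrier H \<Longrightarrow> e g \<in> K" "w = (\<Sum>g\<in>carrier H. e g * x g)"
    unfolding V_def by (rule lin_spanE) blast
  have "\<rho> h w = (\<Sum>g\<in>carrier H. e g * x (h \<otimes> g))"
    unfolding e(2) using assms(1) e(1) by (simp add: field_hom_sum[OF \<rho>_hom] field_hom_mult[OF \<rho>_hom] \<rho>_K \<rho>_x)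
  also have "\<dots> \<in> V" unfolding V_def
    using assms(1) e(1) by (intro lin_span_sum[OF K finite_H] lin_span_scale[OF K finite_H] lin_span_base[OF K finite_H]) auto
  finally show ?thesis .
qed

lemma \<rho>_pow: "h \<in> carrier H \<Longrightarrow> (\<rho> h ^^ l) u = \<rho> (h [^] l) u" for l :: nat
proof (induction l)
  case (Suc l)
  then show ?case using nat_pow_Suc2[OF Suc.prems, of l] by (simp add: \<rho>_mult del: nat_pow_Suc)
qed (simp add: \<rho>_one)

lemma nilpotent: "h \<in> carrier H \<Longrightarrow> ((\<lambda>u. \<rho> h u - u) ^^ (p ^ m)) w = 0"
  by (rule unipotent_nilpotent[OF \<rho>_hom p char_p]) (simp_all add: \<rho>_pow exponent \<rho>_one)

lemma A_carrier: "a \<in> A \<Longrightarrow> a \<in> carrier H"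
  using subgroup.mem_carrier[OF A] .

context
  fixes U :: "'l set"
  assumes U0: "0 \<in> U" and U_diff: "\<And>u w. u \<in> U \<Longrightarrow> w \<in> U \<Longrightarrow> u - w \<in> U"
    and U_stable: "\<And>h u. h \<in> carrier H \<Longrightarrow> u \<in> U \<Longrightarrow> \<rho> h u \<in> U"
begin

lemma U_add: "u \<in> U \<Longrightarrow> w \<in> U \<Longrightarrow> u + w \<in> U"
  using U_diff[of u "0 - w"] U_diff[OF U0, of w] by simp

text \<open>Iterating \<open>\<rho> b\<close> - 1 on \<open>w\<close> ends in \<open>U\<close>. The
  last vector outside \<open>U\<close> is fixed by \<open>b\<close> modulo \<open>U\<close>, and
  still by the elements treated before, because \<open>A\<close> is commutative.\<close>

lemma fixed_mod_A:
  assumes "finite B" "B \<subseteq> A" "\<exists>w\<in>V. w \<notin> U"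
  shows "\<exists>w\<in>V. w \<notin> U \<and> (\<forall>b\<in>B. \<rho> b w - w \<in> U)"
  using assms
proof (induction B rule: finite_induct)
  case (insert b B)
  then obtain w where w: "w \<in> V" "w \<notin> U" "\<And>c. c \<in> B \<Longrightarrow> \<rho> c w - w \<in> U" by auto
  define \<delta> where "\<delta> = (\<lambda>u. \<rho> b u - u)"
  have b: "b \<in> A" "b \<in> carrier H" using insert.prems A_carrier by auto
  from last_outside[OF w(2), of "p ^ m" \<delta>] nilpotent[OF b(2)] U0 obtain j where
    j: "(\<delta> ^^ j) w \<notin> U" "\<delta> ((\<delta> ^^ j) w) \<in> U" by (auto simp: \<delta>_def)
  have \<delta>V: "(\<delta> ^^ i) w \<in> V" for i
    by (induction i) (auto simp: w \<delta>_def intro: V_diff V_stable[OF b(2)])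
  have \<delta>U: "(\<delta> ^^ i) u \<in> U" if "u \<in> U" for i u
    using that by (induction i) (auto simp: \<delta>_def intro: U_diff U_stable[OF b(2)])
  have "\<rho> c ((\<delta> ^^ i) w) - (\<delta> ^^ i) w = (\<delta> ^^ i) (\<rho> c w - w)" if c: "c \<in> B" for c i
  proof (induction i)
    case (Suc i)
    have cA: "c \<in> A" "c \<in> carrier H" using c insert.prems A_carrier by auto
    have comm: "\<rho> c (\<rho> b u) = \<rho> b (\<rho> c u)" for u
      using A_comm[OF cA(1) b(1)] cA b by (simp flip: \<rho>_mult)
    have "\<rho> c ((\<delta> ^^ Suc i) w) - (\<delta> ^^ Suc i) w = \<delta> (\<rho> c ((\<delta> ^^ i) w) - (\<delta> ^^ i) w)"
      by (simp add: \<delta>_def field_hom_diff[OF \<rho>_hom[OF cA(2)]] field_hom_diff[OF \<rho>_hom[OF b(2)]] comm)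
    then show ?case using Suc by simp
  qed simp
  then have "\<rho> c ((\<delta> ^^ j) w) - (\<delta> ^^ j) w \<in> U" if "c \<in> B" for c
    using \<delta>U w(3) that by simp
  moreover have "\<rho> b ((\<delta> ^^ j) w) - (\<delta> ^^ j) w \<in> U" using j(2) by (simp add: \<delta>_def)
  ultimately show ?case using j(1) \<delta>V by blast
qed auto

text \<open>The same argument for \<open>\<tau>\<close>, which only normalizes \<open>A\<close>.
  Therefore the vectors fixed modulo \<open>U\<close> by all of \<open>A\<close> at once are
  considered: they are stable under \<open>\<rho> \<tau>\<close> - 1.\<close>

lemma fixed_mod:
  assumes "\<exists>w\<in>V. w \<notin> U"
  shows "\<exists>w\<in>V. w \<notin> U \<and> (\<forall>h\<in>carrier H. \<rho> h w - w \<in> U)"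
proof -
  have "finite A" using finite_H A subgroup.subset finite_subset by blast
  from fixed_mod_A[OF this order_refl assms] obtain w where
    w: "w \<in> V" "w \<notin> U" "\<And>a. a \<in> A \<Longrightarrow> \<rho> a w - w \<in> U" by blast
  define \<delta> where "\<delta> = (\<lambda>u. \<rho> \<tau> u - u)"
  from last_outside[OF w(2), of "p ^ m" \<delta>] nilpotent[OF \<tau>] U0 obtain j where
    j: "(\<delta> ^^ j) w \<notin> U" "\<delta> ((\<delta> ^^ j) w) \<in> U" by (auto simp: \<delta>_def)
  define y where "y = (\<delta> ^^ j) w"
  have yV: "(\<delta> ^^ i) w \<in> V" for i
    by (induction i) (auto simp: w \<delta>_def intro: V_diff V_stable[OF \<tau>])
  have yA: "\<rho> a ((\<delta> ^^ i) w) - (\<delta> ^^ i) w \<in> U" if "a \<in> A" for a i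
    using that
  proof (induction i arbitrary: a)
    case (Suc i)
    define u where "u = (\<delta> ^^ i) w"
    define b where "b = inv \<tau> \<otimes> a \<otimes> \<tau>"
    have b: "b \<in> A" "b \<in> carrier H" using A_conj[OF Suc.prems] A_carrier by (auto simp: b_def)
    have a: "a \<in> carrier H" using A_carrier Suc.prems by simp
    have "\<tau> \<otimes> b = (\<tau> \<otimes> inv \<tau>) \<otimes> (a \<otimes> \<tau>)" using a \<tau> inv_closed[OF \<tau>] unfolding b_def by (metis m_assoc m_closed)
    then have "a \<otimes> \<tau> = \<tau> \<otimes> b" using a \<tau> by simp
    then have "\<rho> a (\<rho> \<tau> u) = \<rho> \<tau> (\<rho> b u)" using a b \<tau> by (simp flip: \<rho>_mult)
    then have "\<rho> a (\<delta> u) - \<delta> u = \<rho> \<tau> (\<rho> b u - u) - (\<rho> a u - u)"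
      by (simp add: \<delta>_def field_hom_diff[OF \<rho>_hom[OF a]] field_hom_diff[OF \<rho>_hom[OF \<tau>]])
    also have "\<dots> \<in> U" using Suc.IH[OF b(1)] Suc.IH[OF Suc.prems] U_stable[OF \<tau>] U_diff by (simp add: u_def)
    finally show ?case by (simp add: u_def)
  qed (use w in simp)
  have prod: "\<rho> (h \<otimes> k) y - y \<in> U" if "h \<in> carrier H" "k \<in> carrier H" "\<rho> h y - y \<in> U" "\<rho> k y - y \<in> U" for h k
  proof -
    have "\<rho> (h \<otimes> k) y - y = \<rho> h (\<rho> k y - y) + (\<rho> h y - y)"
      using that by (simp add: \<rho>_mult field_hom_diff[OF \<rho>_hom])
    also have "\<dots> \<in> U" by (intro U_add U_stable that)
    finally show ?thesis .
  qed
  have y\<tau>: "\<rho> \<tau> y - y \<in> U" using j(2) by (simp add: \<delta>_def y_def)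
  have "\<rho> (\<tau> [^] l) y - y \<in> U" for l :: nat
    by (induction l) (auto simp: \<rho>_one U0 \<tau> intro: prod y\<tau>)
  then have "\<rho> h y - y \<in> U" if "h \<in> carrier H" for h
    using decomp[OF that] prod yA[of _ j] A_carrier \<tau> by (auto simp: y_def)
  then show ?thesis using j(1) yV by (auto simp: y_def)
qed

end

text \<open>\<open>R\<close> contains the variables not yet exchanged for vectors
  \<open>y i\<close>. Its size is part of the definition, so that the process exhausts the variables
  after \<open>card (carrier H)\<close> steps without a notion of dimension.\<close>

definition flag :: "nat \<Rightarrow> (nat \<Rightarrow> 'l) \<Rightarrow> 'h set \<Rightarrow> bool" where
  "flag k y R \<longleftrightarrow> R \<subseteq> carrier H \<and> card R + k = card (carrier H) \<and>
    (\<forall>i<k. \<forall>h\<in>carrier H. \<rho> h (y i) - y i \<in> lin_span K {..<i} y) \<and>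
    (\<forall>g\<in>carrier H. \<exists>u\<in>lin_span K {..<k} y. \<exists>w\<in>lin_span K R x. x g = u + w)"

lemma lin_span_cong: "(\<And>i. i \<in> I \<Longrightarrow> y i = y' i) \<Longrightarrow> lin_span K I y = lin_span K I y'"
  unfolding lin_span_def by (simp cong: sum.cong)

lemma lin_span_mono:
  assumes "finite J" "I \<subseteq> J" shows "lin_span K I y \<subseteq> lin_span K J y"
proof
  fix u assume "u \<in> lin_span K I y"
  then obtain e where e: "\<And>i. i \<in> I \<Longrightarrow> e i \<in> K" "u = (\<Sum>i\<in>I. e i * y i)" by (rule lin_spanE) blast
  have fI: "finite I" using assms finite_subset by blast
  show "u \<in> lin_span K J y" unfolding e(2)
    using e(1) assms by (intro lin_span_sum[OF K assms(1)] lin_span_scale[OF K assms(1)] lin_span_base[OF K assms(1)]) auto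
qed

lemma flag_stable:
  assumes fl: "flag k y R" and h: "h \<in> carrier H" and u: "u \<in> lin_span K {..<k} y"
  shows "\<rho> h u \<in> lin_span K {..<k} y"
proof -
  from u obtain e where e: "\<And>i. i \<in> {..<k} \<Longrightarrow> e i \<in> K" "u = (\<Sum>i<k. e i * y i)" by (rule lin_spanE) blast
  have fin: "finite {..<k}" by simp
  have "\<rho> h (y i) \<in> lin_span K {..<k} y" if i: "i < k" for i
  proof -
    have "\<rho> h (y i) - y i \<in> lin_span K {..<i} y" using fl h i by (simp add: flag_def)
    also have "\<dots> \<subseteq> lin_span K {..<k} y" using i by (intro lin_span_mono) auto
    finally have "(\<rho> h (y i) - y i) + y i \<in> lin_span K {..<k} y"
      using i by (intro lin_span_add[OF K fin] lin_span_base[OF K fin]) auto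
    then show ?thesis by simp
  qed
  then have "(\<Sum>i<k. e i * \<rho> h (y i)) \<in> lin_span K {..<k} y"
    using e(1) by (intro lin_span_sum[OF K fin] lin_span_scale[OF K fin]) auto
  moreover have "\<rho> h u = (\<Sum>i<k. e i * \<rho> h (y i))"
    unfolding e(2) using e(1) h by (simp add: field_hom_sum[OF \<rho>_hom] field_hom_mult[OF \<rho>_hom] \<rho>_K)
  ultimately show ?thesis by simp
qed

lemma flag_decompose:
  assumes fl: "flag k y R" and w: "w \<in> V"
  shows "\<exists>u\<in>lin_span K {..<k} y. \<exists>r\<in>lin_span K R x. w = u + r"
proof -
  have fin: "finite {..<k}" "finite R" using fl finite_H finite_subset by (auto simp: flag_def)
  from w obtain e where e: "\<And>g. g \<in> carrier H \<Longrightarrow> e g \<in> K" "w = (\<Sum>g\<in>carrier H. e g * x g)"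
    unfolding V_def by (rule lin_spanE) blast
  have "\<forall>g\<in>carrier H. \<exists>u r. u \<in> lin_span K {..<k} y \<and> r \<in> lin_span K R x \<and> x g = u + r"
    using fl unfolding flag_def by blast
  then obtain u r where ur: "\<And>g. g \<in> carrier H \<Longrightarrow> u g \<in> lin_span K {..<k} y"
    "\<And>g. g \<in> carrier H \<Longrightarrow> r g \<in> lin_span K R x" "\<And>g. g \<in> carrier H \<Longrightarrow> x g = u g + r g" by metis
  have "w = (\<Sum>g\<in>carrier H. e g * u g) + (\<Sum>g\<in>carrier H. e g * r g)"
    unfolding e(2) sum.distrib[symmetric] by (intro sum.cong refl) (simp add: ur(3) distrib_left)
  moreover have "(\<Sum>g\<in>carrier H. e g * u g) \<in> lin_span K {..<k} y"
    using e(1) ur(1) by (intro lin_span_sum[OF K fin(1)] lin_span_scale[OF K fin(1)])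
  moreover have "(\<Sum>g\<in>carrier H. e g * r g) \<in> lin_span K R x"
    using e(1) ur(2) by (intro lin_span_sum[OF K fin(2)] lin_span_scale[OF K fin(2)])
  ultimately show ?thesis by blast
qed

lemma flag_step:
  assumes fl: "flag k y R" and k: "k < card (carrier H)"
  shows "\<exists>y' R'. flag (Suc k) y' R'"
proof -
  have fin: "finite {..<k}" "finite {..<Suc k}" and finR: "finite R"
    using fl finite_H finite_subset by (auto simp: flag_def)
  have R: "R \<subseteq> carrier H" "card R + k = card (carrier H)" using fl by (auto simp: flag_def)
  define U where "U = lin_span K {..<k} y"
  have "\<exists>w g. g \<in> R \<and> (\<forall>h\<in>carrier H. \<rho> h w - w \<in> U) \<and>
    (\<exists>u\<in>U. \<exists>c\<in>K. \<exists>r\<in>lin_span K (R - {g}) x. x g = u + c * w + r)"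
  \<comment> \<open>If no linear form lies outside \<open>U\<close>, the vector 0 is added and any
    remaining variable is given up; this saves a dimension count.\<close>
  proof (cases "V \<subseteq> U")
    case True
    obtain g where g: "g \<in> R" using R k by (metis add_0 card.empty ex_in_conv less_irrefl)
    have "x g \<in> V" unfolding V_def using g R by (intro lin_span_base[OF K finite_H]) auto
    then have "x g \<in> U" using True by blast
    have z: "0 \<in> lin_span K (R - {g}) x" "0 \<in> U" unfolding U_def
      using finR by (auto intro: lin_span_zero[OF K])
    have xg: "x g = x g + 0 * 0 + 0" by simp
    have "\<forall>h\<in>carrier H. \<rho> h 0 - 0 \<in> U" using z(2) by (simp add: field_hom_zero[OF \<rho>_hom])
    moreover have "\<exists>u\<in>U. \<exists>c\<in>K. \<exists>r\<in>lin_span K (R - {g}) x. x g = u + c * 0 + r"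
      by (intro bexI, rule xg) (use z \<open>x g \<in> U\<close> is_subfield_zero[OF K] in auto)
    ultimately show ?thesis using g by blast
  next
    case False
    then have "\<exists>w\<in>V. w \<notin> U" by blast
    then have "\<exists>w\<in>V. w \<notin> U \<and> (\<forall>h\<in>carrier H. \<rho> h w - w \<in> U)"
      unfolding U_def
      by (intro fixed_mod lin_span_zero[OF K fin(1)] lin_span_diff[OF K fin(1)] flag_stable[OF fl])
    then obtain w where w: "w \<in> V" "w \<notin> U" "\<forall>h\<in>carrier H. \<rho> h w - w \<in> U" by blast
    from flag_decompose[OF fl w(1)] obtain u r where ur: "u \<in> U" "r \<in> lin_span K R x" "w = u + r"
      unfolding U_def by blast
    from ur(2) obtain e where e: "\<And>g. g \<in> R \<Longrightarrow> e g \<in> K" "r = (\<Sum>g\<in>R. e g * x g)" by (rule lin_spanE) blast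
    have "\<exists>g\<in>R. e g \<noteq> 0"
    proof (rule ccontr)
      assume "\<not> ?thesis"
      then have "r = 0" by (simp add: e(2))
      with ur w show False by simp
    qed
    \<comment> \<open>A variable that occurs in \<open>w\<close> modulo \<open>U\<close> is
      exchanged for \<open>w\<close>.\<close>
    then obtain g where g: "g \<in> R" "e g \<noteq> 0" by blast
    define r' where "r' = (\<Sum>h\<in>R - {g}. e h * x h)"
    have "r = e g * x g + r'" unfolding e(2) r'_def using finR g(1) by (rule sum.remove)
    then have "x g = (w - u - r') / e g" using ur(3) g(2) by (simp add: field_simps)
    then have xg: "x g = inverse (e g) * (0 - u) + inverse (e g) * w + inverse (e g) * (0 - r')"
      by (simp add: divide_inverse algebra_simps)
    have r': "r' \<in> lin_span K (R - {g}) x" unfolding r'_def using e(1) by (intro lin_spanI) auto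
    have finR': "finite (R - {g})" using finR by simp
    have ig: "inverse (e g) \<in> K" using e(1)[OF g(1)] by (rule is_subfield_inverse[OF K])
    have u: "inverse (e g) * (0 - u) \<in> U" unfolding U_def
      by (intro lin_span_scale[OF K fin(1) _ ig] lin_span_diff[OF K fin(1)] lin_span_zero[OF K fin(1)] ur(1)[unfolded U_def])
    have r: "inverse (e g) * (0 - r') \<in> lin_span K (R - {g}) x"
      by (intro lin_span_scale[OF K finR' _ ig] lin_span_diff[OF K finR'] lin_span_zero[OF K finR'] r')
    have "\<exists>u\<in>U. \<exists>c\<in>K. \<exists>r\<in>lin_span K (R - {g}) x. x g = u + c * w + r"
      by (intro bexI, rule xg) (rule u r ig)+
    then show ?thesis using g(1) w(3) by blast
  qed
  then obtain w g u c r where wg: "g \<in> R" "\<forall>h\<in>carrier H. \<rho> h w - w \<in> U"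
    "u \<in> U" "c \<in> K" "r \<in> lin_span K (R - {g}) x" "x g = u + c * w + r" by blast
  define y' where "y' = y(k := w)"
  define R' where "R' = R - {g}"
  have finR': "finite R'" using finR by (simp add: R'_def)
  have same: "lin_span K {..<i} y' = lin_span K {..<i} y" if "i \<le> k" for i
    by (rule lin_span_cong) (use that in \<open>auto simp: y'_def\<close>)
  have U': "U \<subseteq> lin_span K {..<Suc k} y'"
    unfolding U_def same[OF order_refl, symmetric] by (rule lin_span_mono) auto
  have w': "w \<in> lin_span K {..<Suc k} y'"
    using lin_span_base[OF K fin(2), of k y'] by (simp add: y'_def)
  have "flag (Suc k) y' R'"
    unfolding flag_def
  proof (intro conjI allI impI ballI)
    show "R' \<subseteq> carrier H" using R by (auto simp: R'_def)
    show "card R' + Suc k = card (carrier H)"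
      using R(2) card_Suc_Diff1[OF finR wg(1)] by (simp add: R'_def)
    show "\<rho> h (y' i) - y' i \<in> lin_span K {..<i} y'" if "i < Suc k" "h \<in> carrier H" for i h
    proof (cases "i = k")
      case True
      then show ?thesis using wg(2) that same[of k] by (simp add: y'_def U_def)
    next
      case False
      then show ?thesis using fl that same[of i] by (simp add: y'_def flag_def)
    qed
    fix h assume "h \<in> carrier H"
    then obtain u1 r1 where ur1: "u1 \<in> U" "r1 \<in> lin_span K R x" "x h = u1 + r1"
      using fl unfolding flag_def U_def by blast
    from ur1(2) obtain e where e: "\<And>g. g \<in> R \<Longrightarrow> e g \<in> K" "r1 = (\<Sum>g\<in>R. e g * x g)" by (rule lin_spanE) blast
    define r2 where "r2 = (\<Sum>h\<in>R - {g}. e h * x h)"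
    have r1: "r1 = e g * x g + r2" unfolding e(2) r2_def using finR wg(1) by (rule sum.remove)
    have "r2 \<in> lin_span K R' x" unfolding r2_def R'_def using e(1) by (intro lin_spanI) auto
    then have "e g * r + r2 \<in> lin_span K R' x"
      using wg(5) e(1)[OF wg(1)] by (intro lin_span_add[OF K finR'] lin_span_scale[OF K finR']) (simp_all add: R'_def)
    moreover have "u1 + e g * (u + c * w) \<in> lin_span K {..<Suc k} y'"
      using ur1(1) wg(3,4) U' w' e(1)[OF wg(1)]
      by (intro lin_span_add[OF K fin(2)] lin_span_scale[OF K fin(2)]) auto
    moreover have "x h = (u1 + e g * (u + c * w)) + (e g * r + r2)"
      unfolding ur1(3) r1 wg(6) by (simp add: algebra_simps)
    ultimately show "\<exists>u\<in>lin_span K {..<Suc k} y'. \<exists>w\<in>lin_span K R' x. x h = u + w" by blast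
  qed
  then show ?thesis by blast
qed

theorem rational_fixed_field_modular: "rational_over K (Fix (carrier H))"
proof -
  have "\<exists>y R. flag k y R" if "k \<le> card (carrier H)" for k
    using that
  proof (induction k)
    case 0
    have "flag 0 (\<lambda>_. 0) (carrier H)"
      unfolding flag_def
    proof (intro conjI ballI)
      fix h assume "h \<in> carrier H"
      then have "x h \<in> lin_span K (carrier H) x" by (rule lin_span_base[OF K finite_H])
      moreover have "0 \<in> lin_span K {..<0::nat} (\<lambda>_. 0 :: 'l)" by (rule lin_span_zero[OF K finite_lessThan])
      ultimately show "\<exists>u\<in>lin_span K {..<0::nat} (\<lambda>_. 0). \<exists>w\<in>lin_span K (carrier H) x. x h = u + w"
        by - (intro bexI, rule add_0[symmetric], assumption+)
    qed auto
    then show ?case by blast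
  next
    case (Suc k)
    then show ?case using flag_step[of k] by auto
  qed
  then obtain y R where fl: "flag (card (carrier H)) y R" by blast
  then have "R = {}" using finite_H by (auto simp: flag_def finite_subset)
  have sp: "lin_span K {..<k} y \<subseteq> field_adjoin K (y ` {..<k})" for k
  proof
    fix u assume "u \<in> lin_span K {..<k} y"
    then obtain e where e: "\<And>i. i \<in> {..<k} \<Longrightarrow> e i \<in> K" "u = (\<Sum>i<k. e i * y i)" by (rule lin_spanE) blast
    show "u \<in> field_adjoin K (y ` {..<k})" unfolding e(2)
      using e(1) by (intro is_subfield_sum[OF field_adjoin_subfield] is_subfield_mult[OF field_adjoin_subfield])
        (auto intro: field_adjoin_base field_adjoin_gen)
  qed
  show ?thesis
  proof (rule rational_if_unipotent_flag)
    show "\<rho> h (y i) - y i \<in> field_adjoin K (y ` {..<i})" if "i < card (carrier H)" "h \<in> carrier H" for i h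
      using fl that sp[of i] unfolding flag_def by blast
    have "x g \<in> field_adjoin K (y ` {..<card (carrier H)})" if g: "g \<in> carrier H" for g
    proof -
      obtain u w where "u \<in> lin_span K {..<card (carrier H)} y" "w \<in> lin_span K R x" "x g = u + w"
        using fl g unfolding flag_def by blast
      moreover have "w = 0" using \<open>w \<in> lin_span K R x\<close> \<open>R = {}\<close> by (auto simp: lin_span_def)
      ultimately show ?thesis using sp by auto
    qed
    then have "field_adjoin K (x ` carrier H) \<subseteq> field_adjoin K (y ` {..<card (carrier H)})"
      by (intro field_adjoin_least field_adjoin_subfield) (auto intro: field_adjoin_base)
    then show "field_adjoin K (y ` {..<card (carrier H)}) = UNIV" unfolding x_gen by blast
  qed
qed

end

section \<open>Cyclic extensions of abelian normal subgroups\<close>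

context group
begin

text \<open>Conjugation maps \<open>A\<close> into itself, hence onto itself by finiteness. So it
  can also be undone, and elements of \<open>A\<close> move across powers of \<open>\<tau>\<close>
  to the left.\<close>

lemma conj_push_right:
  assumes fin: "finite (carrier G)" and A: "subgroup A G" and \<tau>: "\<tau> \<in> carrier G"
    and conj: "\<And>a. a \<in> A \<Longrightarrow> inv \<tau> \<otimes> a \<otimes> \<tau> \<in> A" and a: "a \<in> A"
  shows "\<exists>a'\<in>A. \<tau> [^] (l::nat) \<otimes> a = a' \<otimes> \<tau> [^] l"
proof -
  note Ac = subgroup.mem_carrier[OF A]
  have "finite A" using fin A subgroup.subset finite_subset by blast
  moreover have "inj_on (\<lambda>a. inv \<tau> \<otimes> a \<otimes> \<tau>) A"
    using \<tau> Ac by (auto intro!: inj_onI)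
  ultimately have surj: "(\<lambda>a. inv \<tau> \<otimes> a \<otimes> \<tau>) ` A = A"
    using conj by (intro endo_inj_surj) auto
  have step: "\<exists>a'\<in>A. \<tau> \<otimes> a = a' \<otimes> \<tau>" if "a \<in> A" for a
  proof -
    from that have "a \<in> (\<lambda>a. inv \<tau> \<otimes> a \<otimes> \<tau>) ` A" unfolding surj .
    then obtain a' where a': "a' \<in> A" "a = inv \<tau> \<otimes> a' \<otimes> \<tau>" by (rule imageE)
    have "\<tau> \<otimes> a = a' \<otimes> \<tau>"
      unfolding a'(2) using \<tau> Ac[OF a'(1)] by (simp flip: m_assoc)
    then show ?thesis using a'(1) by blast
  qed
  show ?thesis
  proof (induction l)
    case 0
    then show ?case using a Ac by (intro bexI[of _ a]) auto
  next
    case (Suc l)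
    then obtain a' where a': "a' \<in> A" "\<tau> [^] l \<otimes> a = a' \<otimes> \<tau> [^] l" by blast
    obtain b where b: "b \<in> A" "\<tau> \<otimes> a' = b \<otimes> \<tau>" using step[OF a'(1)] by blast
    have "\<tau> [^] Suc l \<otimes> a = \<tau> \<otimes> (\<tau> [^] l \<otimes> a)"
      using \<tau> Ac[OF a] nat_pow_Suc2[OF \<tau>, of l] by (simp add: m_assoc del: nat_pow_Suc)
    also have "\<dots> = (\<tau> \<otimes> a') \<otimes> \<tau> [^] l" unfolding a'(2) using \<tau> Ac[OF a'(1)] by (simp add: m_assoc)
    also have "\<dots> = b \<otimes> \<tau> [^] Suc l"
      unfolding b(2) using \<tau> Ac[OF b(1)] nat_pow_Suc2[OF \<tau>, of l] by (simp add: m_assoc del: nat_pow_Suc)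
    finally show ?case using b(1) by blast
  qed
qed

text \<open>The least positive \<open>N\<close> with \<open>\<tau> [^] N\<close> in \<open>A\<close>
  divides the order of the group, so it is a power of \<open>p\<close>. It is not 1, because
  \<open>A\<close> is a proper subgroup.\<close>

lemma cyclic_coset_decomposition:
  assumes fin: "finite (carrier G)" and A: "subgroup A G" and \<tau>: "\<tau> \<in> carrier G"
    and card: "card (carrier G) = p ^ s" and p: "Factorial_Ring.prime (p::nat)"
    and decomp: "\<And>g. g \<in> carrier G \<Longrightarrow> \<exists>a\<in>A. \<exists>l::nat. g = a \<otimes> \<tau> [^] l"
    and A_ne: "A \<noteq> carrier G"
  shows "\<exists>n\<ge>1. \<tau> [^] (p ^ n) \<in> A \<and>
    bij_betw (\<lambda>(a, l). a \<otimes> \<tau> [^] l) (A \<times> {..<p ^ n}) (carrier G)"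
proof -
  note Ac = subgroup.mem_carrier[OF A] and Am = subgroup.m_closed[OF A] and Ai = subgroup.m_inv_closed[OF A]
  define N where "N = (LEAST l::nat. 0 < l \<and> \<tau> [^] l \<in> A)"
  have "0 < p ^ s \<and> \<tau> [^] (p ^ s) \<in> A"
    using pow_order_eq_1[OF \<tau>] card p subgroup.one_closed[OF A] by (simp add: Coset.order_def prime_gt_0_nat)
  from LeastI[of "\<lambda>l. 0 < l \<and> \<tau> [^] l \<in> A", OF this] have N: "0 < N" "\<tau> [^] N \<in> A"
    unfolding N_def by auto
  have least: "N \<le> l" if "0 < l" "\<tau> [^] l \<in> A" for l
    unfolding N_def using that by (intro Least_le) auto
  have multiple: "\<tau> [^] (N * q) \<in> A" for q
  proof (induction q)
    case (Suc q)
    have "\<tau> [^] (N * Suc q) = \<tau> [^] N \<otimes> \<tau> [^] (N * q)"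
      using \<tau> by (simp add: nat_pow_mult)
    then show ?case using Am[OF N(2) Suc] by simp
  qed (simp add: subgroup.one_closed[OF A])
  have split: "\<tau> [^] l = \<tau> [^] (N * (l div N)) \<otimes> \<tau> [^] (l mod N)" for l
    using \<tau> by (simp add: nat_pow_mult)
  have dvd: "N dvd l" if "\<tau> [^] l \<in> A" for l
  proof -
    have "\<tau> [^] (l mod N) = inv (\<tau> [^] (N * (l div N))) \<otimes> \<tau> [^] l"
      using \<tau> split[of l] by (simp add: inv_solve_left)
    then have "\<tau> [^] (l mod N) \<in> A" using Am[OF Ai[OF multiple] that] by simp
    then have "l mod N = 0" using least[of "l mod N"] N(1) by (metis mod_less_divisor not_gr_zero not_le)
    then show ?thesis by (simp add: dvd_eq_mod_eq_0)
  qed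
  have "N dvd p ^ s" using \<open>0 < p ^ s \<and> \<tau> [^] (p ^ s) \<in> A\<close> dvd by blast
  then obtain n where n: "N = p ^ n" using p by (auto simp: divides_primepow_nat)
  have "n \<noteq> 0"
  proof
    assume "n = 0"
    then have "\<tau> \<in> A" using N(2) n \<tau> by simp
    have "\<tau> [^] l \<in> A" for l :: nat
      by (induction l) (auto intro: Am subgroup.one_closed[OF A] \<open>\<tau> \<in> A\<close>)
    then have "carrier G \<subseteq> A" using decomp Am by blast
    then show False using A_ne subgroup.subset[OF A] by blast
  qed
  have coset_eq: "l' \<le> l" if "a \<in> A" "a' \<in> A" "l < N" "l' < N" "a \<otimes> \<tau> [^] l = a' \<otimes> \<tau> [^] l'" for a a' l l'
  proof (rule ccontr)
    assume "\<not> l' \<le> l"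
    then have l: "l' = (l' - l) + l" by simp
    have "a \<otimes> \<tau> [^] l = (a' \<otimes> \<tau> [^] (l' - l)) \<otimes> \<tau> [^] l"
      unfolding that(5) using \<tau> Ac[OF that(2)] l by (metis m_assoc nat_pow_closed nat_pow_mult)
    then have "a = a' \<otimes> \<tau> [^] (l' - l)" using \<tau> Ac that by simp
    then have "\<tau> [^] (l' - l) = inv a' \<otimes> a" using \<tau> Ac that by (simp add: inv_solve_left)
    then have "\<tau> [^] (l' - l) \<in> A" using Am Ai that by simp
    then show False using least[of "l' - l"] \<open>\<not> l' \<le> l\<close> that(4) by simp
  qed
  have "bij_betw (\<lambda>(a, l). a \<otimes> \<tau> [^] l) (A \<times> {..<N}) (carrier G)"
    unfolding bij_betw_def
  proof
    show "inj_on (\<lambda>(a, l). a \<otimes> \<tau> [^] l) (A \<times> {..<N})"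
    proof (rule inj_onI, clarsimp)
      fix a l a' l'
      assume *: "a \<in> A" "l < N" "a' \<in> A" "l' < N" "a \<otimes> \<tau> [^] l = a' \<otimes> \<tau> [^] l'"
      have "l = l'" using coset_eq[of a a' l l'] coset_eq[of a' a l' l] * by simp
      then show "a = a' \<and> l = l'" using * Ac \<tau> by simp
    qed
    have "g \<in> (\<lambda>(a, l). a \<otimes> \<tau> [^] l) ` (A \<times> {..<N})" if g: "g \<in> carrier G" for g
    proof -
      from decomp[OF g] obtain a l where al: "a \<in> A" "g = a \<otimes> \<tau> [^] (l::nat)" by blast
      have "g = (a \<otimes> \<tau> [^] (N * (l div N))) \<otimes> \<tau> [^] (l mod N)"
        unfolding al(2) split[of l] using \<tau> Ac[OF al(1)] by (simp add: m_assoc)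
      then show ?thesis using Am[OF al(1) multiple] N(1)
        by (intro image_eqI[of _ _ "(a \<otimes> \<tau> [^] (N * (l div N)), l mod N)"]) auto
    qed
    then show "(\<lambda>(a, l). a \<otimes> \<tau> [^] l) ` (A \<times> {..<N}) = carrier G" using Ac \<tau> by auto
  qed
  then show ?thesis using \<open>n \<noteq> 0\<close> N(2) n by (intro exI[of _ n]) auto
qed

lemma group_exponent_pow:
  assumes "finite (carrier G)" "g \<in> carrier G"
  shows "g [^] group_exponent G = \<one>"
proof -
  have "0 < Coset.order G \<and> (\<forall>g\<in>carrier G. g [^] Coset.order G = \<one>)"
    using assms(1) order_gt_0_iff_finite pow_order_eq_1 by blast
  from LeastI[of "\<lambda>n. 0 < n \<and> (\<forall>g\<in>carrier G. g [^] n = \<one>)", OF this] show ?thesis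
    using assms(2) unfolding group_exponent_def by blast
qed

end

section \<open>Central extensions\<close>

locale central_group_extension =
  fixes C :: "('c, 'd) monoid_scheme" and E :: "('e, 'f) monoid_scheme" and G :: "('a, 'b) monoid_scheme"
    and \<iota> :: "'c \<Rightarrow> 'e" and \<pi> :: "'e \<Rightarrow> 'a"
  assumes ext: "central_extension C E G \<iota> \<pi>"
begin

sublocale E: group E using ext by (simp add: central_extension_def)
sublocale G: group G using ext by (simp add: central_extension_def)
sublocale group_hom E G \<pi>
  using ext by unfold_locales (auto simp: central_extension_def epi_def)

lemma surj: "\<pi> ` carrier E = carrier G"
  using ext by (auto simp: central_extension_def epi_def)

lemma preimage_exists: "g \<in> carrier G \<Longrightarrow> \<exists>e\<in>carrier E. \<pi> e = g"
  using surj by (metis imageE)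

lemma kernel_central: "e \<in> kernel E G \<pi> \<Longrightarrow> g \<in> carrier E \<Longrightarrow> e \<otimes>\<^bsub>E\<^esub> g = g \<otimes>\<^bsub>E\<^esub> e"
  using ext by (auto simp: central_extension_def group_center_def)

lemma kernelI: "e \<in> carrier E \<Longrightarrow> \<pi> e = \<one>\<^bsub>G\<^esub> \<Longrightarrow> e \<in> kernel E G \<pi>"
  by (simp add: kernel_def)

lemma card_kernel: "card (kernel E G \<pi>) = card (carrier C)"
proof -
  have "inj_on \<iota> (carrier C)" "kernel E G \<pi> = \<iota> ` carrier C"
    using ext by (auto simp: central_extension_def mon_def)
  then show ?thesis by (simp add: card_image)
qed

lemma finite_card_extension:
  assumes "finite (carrier C)" "finite (carrier G)"
  shows "finite (carrier E)" "card (carrier E) = card (carrier G) * card (carrier C)"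
proof -
  obtain s where s: "\<And>g. g \<in> carrier G \<Longrightarrow> s g \<in> carrier E" "\<And>g. g \<in> carrier G \<Longrightarrow> \<pi> (s g) = g"
    using preimage_exists by metis
  have ker: "e \<in> carrier E" "\<pi> e = \<one>\<^bsub>G\<^esub>" if "e \<in> kernel E G \<pi>" for e
    using that by (auto simp: kernel_def)
  have "bij_betw (\<lambda>(g, e). s g \<otimes>\<^bsub>E\<^esub> e) (carrier G \<times> kernel E G \<pi>) (carrier E)"
    unfolding bij_betw_def
  proof
    show "inj_on (\<lambda>(g, e). s g \<otimes>\<^bsub>E\<^esub> e) (carrier G \<times> kernel E G \<pi>)"
    proof (rule inj_onI, clarsimp)
      fix g e g' e'
      assume *: "g \<in> carrier G" "e \<in> kernel E G \<pi>" "g' \<in> carrier G" "e' \<in> kernel E G \<pi>"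
        "s g \<otimes>\<^bsub>E\<^esub> e = s g' \<otimes>\<^bsub>E\<^esub> e'"
      have "\<pi> (s g \<otimes>\<^bsub>E\<^esub> e) = \<pi> (s g' \<otimes>\<^bsub>E\<^esub> e')" using *(5) by simp
      then have "g = g'" using *(1-4) s ker by simp
      then show "g = g' \<and> e = e'" using * s ker by simp
    qed
    have "u \<in> (\<lambda>(g, e). s g \<otimes>\<^bsub>E\<^esub> e) ` (carrier G \<times> kernel E G \<pi>)" if u: "u \<in> carrier E" for u
    proof -
      have "inv\<^bsub>E\<^esub> s (\<pi> u) \<otimes>\<^bsub>E\<^esub> u \<in> kernel E G \<pi>" using u s by (intro kernelI) auto
      moreover have "u = s (\<pi> u) \<otimes>\<^bsub>E\<^esub> (inv\<^bsub>E\<^esub> s (\<pi> u) \<otimes>\<^bsub>E\<^esub> u)"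
        using u s by (simp flip: E.m_assoc)
      ultimately show ?thesis using u by (intro image_eqI[of _ _ "(\<pi> u, inv\<^bsub>E\<^esub> s (\<pi> u) \<otimes>\<^bsub>E\<^esub> u)"]) auto
    qed
    then show "(\<lambda>(g, e). s g \<otimes>\<^bsub>E\<^esub> e) ` (carrier G \<times> kernel E G \<pi>) = carrier E"
      using s ker by auto
  qed
  moreover have "finite (kernel E G \<pi>)"
    using ext assms(1) by (auto simp: central_extension_def)
  ultimately show "finite (carrier E)" "card (carrier E) = card (carrier G) * card (carrier C)"
    using assms(2) bij_betw_finite bij_betw_same_card card_kernel by (fastforce simp: card_cartesian_product)+
qed

lemma abelian_preimage:
  assumes "\<sigma> \<in> carrier E" "a \<in> carrier E" "b \<in> carrier E"
    and "\<pi> a \<in> generate G {\<pi> \<sigma>}" "\<pi> b \<in> generate G {\<pi> \<sigma>}"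
  shows "a \<otimes>\<^bsub>E\<^esub> b = b \<otimes>\<^bsub>E\<^esub> a"
proof -
  have split: "\<exists>(i::int) c. c \<in> kernel E G \<pi> \<and> e = c \<otimes>\<^bsub>E\<^esub> \<sigma> [^]\<^bsub>E\<^esub> i"
    if e: "e \<in> carrier E" "\<pi> e \<in> generate G {\<pi> \<sigma>}" for e
  proof -
    obtain i :: int where i: "\<pi> e = \<pi> \<sigma> [^]\<^bsub>G\<^esub> i"
      using e(2) assms(1) G.generate_pow[of "\<pi> \<sigma>"] by auto
    have "e \<otimes>\<^bsub>E\<^esub> inv\<^bsub>E\<^esub> (\<sigma> [^]\<^bsub>E\<^esub> i) \<in> kernel E G \<pi>"
      using e assms(1) i by (intro kernelI) (auto simp: hom_int_pow)
    moreover have "e = (e \<otimes>\<^bsub>E\<^esub> inv\<^bsub>E\<^esub> (\<sigma> [^]\<^bsub>E\<^esub> i)) \<otimes>\<^bsub>E\<^esub> \<sigma> [^]\<^bsub>E\<^esub> i"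
      using e assms(1) by (simp add: E.m_assoc)
    ultimately show ?thesis by blast
  qed
  obtain i :: int and c where a: "c \<in> kernel E G \<pi>" "a = c \<otimes>\<^bsub>E\<^esub> \<sigma> [^]\<^bsub>E\<^esub> i" using split assms by blast
  obtain j :: int and d where b: "d \<in> kernel E G \<pi>" "b = d \<otimes>\<^bsub>E\<^esub> \<sigma> [^]\<^bsub>E\<^esub> j" using split assms by blast
  have car: "c \<in> carrier E" "d \<in> carrier E" using a b by (auto simp: kernel_def)
  define u v where "u = \<sigma> [^]\<^bsub>E\<^esub> i" and "v = \<sigma> [^]\<^bsub>E\<^esub> j"
  have uv: "u \<in> carrier E" "v \<in> carrier E" using assms(1) by (auto simp: u_def v_def)
  have "u \<otimes>\<^bsub>E\<^esub> v = v \<otimes>\<^bsub>E\<^esub> u" using assms(1) by (simp add: u_def v_def E.int_pow_mult[symmetric] add.commute)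
  have "(c \<otimes>\<^bsub>E\<^esub> u) \<otimes>\<^bsub>E\<^esub> (d \<otimes>\<^bsub>E\<^esub> v) = c \<otimes>\<^bsub>E\<^esub> (u \<otimes>\<^bsub>E\<^esub> d) \<otimes>\<^bsub>E\<^esub> v"
    using car uv by (simp add: E.m_assoc)
  also have "\<dots> = (c \<otimes>\<^bsub>E\<^esub> d) \<otimes>\<^bsub>E\<^esub> (u \<otimes>\<^bsub>E\<^esub> v)"
    unfolding kernel_central[OF b(1) uv(1), symmetric] using car uv by (simp add: E.m_assoc)
  also have "\<dots> = (d \<otimes>\<^bsub>E\<^esub> c) \<otimes>\<^bsub>E\<^esub> (v \<otimes>\<^bsub>E\<^esub> u)"
    using kernel_central[OF a(1) car(2)] \<open>u \<otimes>\<^bsub>E\<^esub> v = v \<otimes>\<^bsub>E\<^esub> u\<close> by simp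
  also have "\<dots> = d \<otimes>\<^bsub>E\<^esub> (c \<otimes>\<^bsub>E\<^esub> v) \<otimes>\<^bsub>E\<^esub> u" using car uv by (simp add: E.m_assoc)
  also have "\<dots> = (d \<otimes>\<^bsub>E\<^esub> v) \<otimes>\<^bsub>E\<^esub> (c \<otimes>\<^bsub>E\<^esub> u)"
    unfolding kernel_central[OF a(1) uv(2)] using car uv by (simp add: E.m_assoc)
  finally show ?thesis using a(2) b(2) by (simp add: u_def v_def)
qed

text \<open>The elements of the required form are closed under products, and \<open>A\<close>
  contains the kernel, so membership of \<open>e\<close> depends on \<open>\<pi> e\<close> only.
  This allows an induction over how \<open>\<pi> e\<close> is generated in \<open>G\<close>; the
  inverse of \<open>\<tau>\<close> is a natural power of it, since the group is finite.\<close>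

lemma preimage_decomposition:
  assumes fin: "finite (carrier E)" and \<sigma>: "\<sigma> \<in> carrier E" and \<tau>: "\<tau> \<in> carrier E"
    and gen: "generate G {\<pi> \<sigma>, \<pi> \<tau>} = carrier G"
    and A: "subgroup A E" "kernel E G \<pi> \<subseteq> A" "\<sigma> \<in> A"
    and conj: "\<And>a. a \<in> A \<Longrightarrow> inv\<^bsub>E\<^esub> \<tau> \<otimes>\<^bsub>E\<^esub> a \<otimes>\<^bsub>E\<^esub> \<tau> \<in> A" and e: "e \<in> carrier E"
  shows "\<exists>a\<in>A. \<exists>l::nat. e = a \<otimes>\<^bsub>E\<^esub> \<tau> [^]\<^bsub>E\<^esub> l"
proof -
  define T where "T e \<longleftrightarrow> (\<exists>a\<in>A. \<exists>l::nat. e = a \<otimes>\<^bsub>E\<^esub> \<tau> [^]\<^bsub>E\<^esub> l)" for e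
  note Ac = subgroup.mem_carrier[OF A(1)]
  have TI: "T (a \<otimes>\<^bsub>E\<^esub> \<tau> [^]\<^bsub>E\<^esub> l)" if "a \<in> A" for a and l :: nat using that by (auto simp: T_def)
  have TA: "T a" if "a \<in> A" for a using TI[OF that, of 0] Ac that by simp
  have T_mult: "T (e \<otimes>\<^bsub>E\<^esub> f)" if "T e" "T f" for e f
  proof -
    from that obtain a l b k where e: "a \<in> A" "e = a \<otimes>\<^bsub>E\<^esub> \<tau> [^]\<^bsub>E\<^esub> (l::nat)"
      and f: "b \<in> A" "f = b \<otimes>\<^bsub>E\<^esub> \<tau> [^]\<^bsub>E\<^esub> (k::nat)" unfolding T_def by blast
    from E.conj_push_right[OF fin A(1) \<tau> conj f(1), of l] obtain b' where
      b': "b' \<in> A" "\<tau> [^]\<^bsub>E\<^esub> l \<otimes>\<^bsub>E\<^esub> b = b' \<otimes>\<^bsub>E\<^esub> \<tau> [^]\<^bsub>E\<^esub> l" by blast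
    have "e \<otimes>\<^bsub>E\<^esub> f = a \<otimes>\<^bsub>E\<^esub> (\<tau> [^]\<^bsub>E\<^esub> l \<otimes>\<^bsub>E\<^esub> b) \<otimes>\<^bsub>E\<^esub> \<tau> [^]\<^bsub>E\<^esub> k"
      using e f Ac \<tau> by (simp add: E.m_assoc)
    also have "\<dots> = (a \<otimes>\<^bsub>E\<^esub> b') \<otimes>\<^bsub>E\<^esub> \<tau> [^]\<^bsub>E\<^esub> (l + k)"
      unfolding b'(2) using e b'(1) Ac \<tau> by (simp add: E.m_assoc E.nat_pow_mult[symmetric])
    finally show ?thesis using TI[OF subgroup.m_closed[OF A(1) e(1) b'(1)]] by simp
  qed
  have T_ker: "T e" if "e \<in> carrier E" "f \<in> carrier E" "T f" "\<pi> e = \<pi> f" for e f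
  proof -
    have "e \<otimes>\<^bsub>E\<^esub> inv\<^bsub>E\<^esub> f \<in> kernel E G \<pi>" using that by (intro kernelI) auto
    then have "T (e \<otimes>\<^bsub>E\<^esub> inv\<^bsub>E\<^esub> f)" using A(2) TA by blast
    from T_mult[OF this that(3)] show ?thesis using that(1,2) by (simp add: E.m_assoc)
  qed
  have T\<tau>: "T (\<tau> [^]\<^bsub>E\<^esub> l)" for l :: nat
    using TI[OF subgroup.one_closed[OF A(1)], of l] \<tau> by simp
  have "inv\<^bsub>E\<^esub> \<tau> = \<tau> [^]\<^bsub>E\<^esub> (Coset.order E - 1)"
  proof (rule E.inv_equality)
    have "0 < Coset.order E" using fin E.order_gt_0_iff_finite by simp
    then have "\<tau> [^]\<^bsub>E\<^esub> (Coset.order E - 1) \<otimes>\<^bsub>E\<^esub> \<tau> = \<tau> [^]\<^bsub>E\<^esub> Coset.order E"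
      by (metis E.nat_pow_Suc Suc_diff_1)
    then show "\<tau> [^]\<^bsub>E\<^esub> (Coset.order E - 1) \<otimes>\<^bsub>E\<^esub> \<tau> = \<one>\<^bsub>E\<^esub>" using E.pow_order_eq_1[OF \<tau>] by simp
  qed (use \<tau> in auto)
  then have T_inv: "T (inv\<^bsub>E\<^esub> \<tau>)" using T\<tau> by simp
  have "\<forall>e\<in>carrier E. \<pi> e = g \<longrightarrow> T e" if "g \<in> generate G {\<pi> \<sigma>, \<pi> \<tau>}" for g
    using that
  proof (induction rule: generate.induct)
    case one
    then show ?case using A(2) TA kernelI by blast
  next
    case (incl g)
    then obtain f where f: "f = \<sigma> \<or> f = \<tau>" "g = \<pi> f" by auto
    then have "T f" "f \<in> carrier E" using TA[OF A(3)] T\<tau>[of 1] \<sigma> \<tau> by auto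
    then show ?case using T_ker f(2) by auto
  next
    case (inv g)
    then obtain f where f: "f = \<sigma> \<or> f = \<tau>" "g = \<pi> f" by auto
    then have "T (inv\<^bsub>E\<^esub> f)" "f \<in> carrier E"
      using TA[OF subgroup.m_inv_closed[OF A(1,3)]] T_inv \<sigma> \<tau> by auto
    then show ?case using T_ker[of _ "inv\<^bsub>E\<^esub> f"] f(2) by auto
  next
    case (eng g h)
    show ?case
    proof (intro ballI impI)
      fix u assume u: "u \<in> carrier E" "\<pi> u = g \<otimes>\<^bsub>G\<^esub> h"
      have gh: "g \<in> carrier G" "h \<in> carrier G" using eng.hyps unfolding gen by simp_all
      then obtain v where v: "v \<in> carrier E" "\<pi> v = g" using preimage_exists by blast
      have "\<pi> (inv\<^bsub>E\<^esub> v \<otimes>\<^bsub>E\<^esub> u) = h" using u v gh by (simp flip: G.m_assoc)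
      then have "T (inv\<^bsub>E\<^esub> v \<otimes>\<^bsub>E\<^esub> u)" "T v" using eng.IH u v by auto
      then have "T (v \<otimes>\<^bsub>E\<^esub> (inv\<^bsub>E\<^esub> v \<otimes>\<^bsub>E\<^esub> u))" using T_mult by blast
      then show "T u" using u v by (simp flip: E.m_assoc)
    qed
  qed
  from this[of "\<pi> e"] have "T e" using e unfolding gen by simp
  then show ?thesis by (simp add: T_def)
qed

end

section \<open>Application to central extensions of metacyclic groups\<close>

lemma of_nat_prime_eq_0_iff:
  assumes "Factorial_Ring.prime p"
  shows "of_nat p = (0::'l::field) \<longleftrightarrow> CHAR('l) = p"
proof
  assume "of_nat p = (0::'l)"
  then have "CHAR('l) dvd p" by (simp add: of_nat_eq_0_iff_char_dvd)
  moreover have "CHAR('l) \<noteq> 1" by simp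
  ultimately show "CHAR('l) = p" using assms by (auto simp: prime_nat_iff)
next
  assume "CHAR('l) = p"
  then show "of_nat p = (0::'l)" using of_nat_CHAR[where 'a = 'l] by simp
qed

lemma regular_field_intro:
  assumes E: "group E" "finite (carrier E)"
    and x: "rational_function_field K E x" and \<rho>: "regular_action K E x \<rho>"
  shows "regular_field E K x \<rho>"
proof -
  interpret E: group E by fact
  have act: "group_action E UNIV \<rho>" and aut: "\<And>h. h \<in> carrier E \<Longrightarrow> automorphism_over K (\<rho> h)"
    and \<rho>x: "\<And>h g. h \<in> carrier E \<Longrightarrow> g \<in> carrier E \<Longrightarrow> \<rho> h (x g) = x (h \<otimes>\<^bsub>E\<^esub> g)"
    using \<rho> by (auto simp: regular_action_def)
  show ?thesis
  proof
    show "finite (carrier E)" by fact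
    show "is_subfield K" "algebraically_independent K (carrier E) x" "field_adjoin K (x ` carrier E) = UNIV"
      using x by (auto simp: rational_function_field_def subfield_iff_is_subfield)
    show "field_hom (\<rho> h)" "u \<in> K \<Longrightarrow> \<rho> h u = u" if "h \<in> carrier E" for h u
      using aut[OF that] by (auto simp: automorphism_over_def field_hom_def)
    show "\<rho> \<one>\<^bsub>E\<^esub> u = u" for u using group_action.id_eq_one[OF act] by (metis restrict_UNIV)
    show "\<rho> (h \<otimes>\<^bsub>E\<^esub> k) u = \<rho> h (\<rho> k u)" if "h \<in> carrier E" "k \<in> carrier E" for h k u
      using group_action.composition_rule[OF act, of u h k] that by simp
    show "\<rho> h (x k) = x (h \<otimes>\<^bsub>E\<^esub> k)" if "h \<in> carrier E" "k \<in> carrier E" for h k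
      using \<rho>x that by simp
  qed
qed

theorem theorem1p7:
  fixes p a b c r t m :: nat
    and \<epsilon> k :: int
    and G :: "('a, 'b) monoid_scheme" and \<sigma> \<tau> :: 'a
    and E :: "('e, 'f) monoid_scheme" and \<sigma>' \<tau>' :: 'e
    and \<iota> :: "int \<Rightarrow> 'e" and \<pi> :: "'e \<Rightarrow> 'a"
    and K :: "'l::field set" and x :: "'e \<Rightarrow> 'l" and \<rho> :: "'e \<Rightarrow> 'l \<Rightarrow> 'l"
  assumes "Factorial_Ring.prime p"
    and "group G" and "\<not> comm_group G" and "metacyclic G"
    and "\<sigma> \<in> carrier G" and "\<tau> \<in> carrier G" and "generate G {\<sigma>, \<tau>} = carrier G"
    and "\<sigma> [^]\<^bsub>G\<^esub> (p ^ a) = \<one>\<^bsub>G\<^esub>"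
    and "\<tau> [^]\<^bsub>G\<^esub> (p ^ b) = \<sigma> [^]\<^bsub>G\<^esub> (p ^ c)"
    and "inv\<^bsub>G\<^esub> \<tau> \<otimes>\<^bsub>G\<^esub> \<sigma> \<otimes>\<^bsub>G\<^esub> \<tau> = \<sigma> [^]\<^bsub>G\<^esub> k"
    and "group.ord G \<sigma> = p ^ a" and "Coset.order G = p ^ (a + b)"
    and "k = \<epsilon> + int p ^ r"
    and "1 \<le> c" and "c \<le> a" and "r \<le> min b c"
    and "odd p \<longrightarrow> \<epsilon> = 1" and "p = 2 \<longrightarrow> \<epsilon> = 1 \<or> \<epsilon> = -1"
    and "central_extension (integer_mod_group (p ^ t)) E G \<iota> \<pi>"
    and "t \<le> r"
    and "\<sigma>' \<in> carrier E" and "\<pi> \<sigma>' = \<sigma>" and "\<tau>' \<in> carrier E" and "\<pi> \<tau>' = \<tau>"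
    and "group.ord E (\<sigma>' [^]\<^bsub>E\<^esub> (- k) \<otimes>\<^bsub>E\<^esub> inv\<^bsub>E\<^esub> \<tau>' \<otimes>\<^bsub>E\<^esub> \<sigma>' \<otimes>\<^bsub>E\<^esub> \<tau>') = p ^ t"
    and "p ^ m = group_exponent E"
    and "rational_function_field K E x" and "regular_action K E x \<rho>"
    and "CHAR('l) = p \<or>
         CHAR('l) \<noteq> p \<and> infinite K \<and> (\<exists>z\<in>K. primitive_root_of_unity (p ^ m) z)"
  shows "rational_over K (fixed_field E \<rho>)"
proof -
  note p = assms(1) and gen = assms(7) and conj = assms(10) and ext = assms(19)
    and \<sigma>' = assms(21,22) and \<tau>' = assms(23,24) and field = assms(27,28,29)
  interpret central_group_extension "integer_mod_group (p ^ t)" E G \<iota> \<pi>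
    using ext by unfold_locales
  have p0: "0 < p ^ i" for i using p by (simp add: prime_gt_0_nat)
  have C: "carrier (integer_mod_group (p ^ t)) = {0..<int (p ^ t)}"
    using p0[of t] by (simp add: carrier_integer_mod_group del: of_nat_power)
  have "finite (carrier G)" using assms(12) p0[of "a + b"] by (metis Coset.order_def card.infinite less_irrefl)
  then have fin: "finite (carrier E)" and "card (carrier E) = card (carrier G) * p ^ t"
    using finite_card_extension C by (auto simp del: of_nat_power)
  then have card: "card (carrier E) = p ^ (a + b + t)"
    using assms(12) by (simp add: Coset.order_def power_add)
  define S where "S = generate G {\<sigma>}"
  have S: "subgroup S G" unfolding S_def by (rule G.generate_is_subgroup) (use assms(5) in simp)
  note Sc = subgroup.mem_carrier[OF S]
  have \<sigma>S: "\<sigma> \<in> S" unfolding S_def by (rule generate.incl) simp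
  have conj_mult: "inv\<^bsub>G\<^esub> \<tau> \<otimes>\<^bsub>G\<^esub> (g \<otimes>\<^bsub>G\<^esub> h) \<otimes>\<^bsub>G\<^esub> \<tau> = (inv\<^bsub>G\<^esub> \<tau> \<otimes>\<^bsub>G\<^esub> g \<otimes>\<^bsub>G\<^esub> \<tau>) \<otimes>\<^bsub>G\<^esub> (inv\<^bsub>G\<^esub> \<tau> \<otimes>\<^bsub>G\<^esub> h \<otimes>\<^bsub>G\<^esub> \<tau>)"
    if "g \<in> carrier G" "h \<in> carrier G" for g h
  proof -
    have "\<tau> \<otimes>\<^bsub>G\<^esub> (inv\<^bsub>G\<^esub> \<tau> \<otimes>\<^bsub>G\<^esub> (h \<otimes>\<^bsub>G\<^esub> \<tau>)) = h \<otimes>\<^bsub>G\<^esub> \<tau>"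
      using that assms(6) by (simp flip: G.m_assoc)
    then show ?thesis using that assms(6) by (simp add: G.m_assoc)
  qed
  have \<sigma>k: "inv\<^bsub>G\<^esub> \<tau> \<otimes>\<^bsub>G\<^esub> \<sigma> \<otimes>\<^bsub>G\<^esub> \<tau> \<in> S"
    unfolding conj S_def using G.generate_pow[OF assms(5)] by auto
  have S_conj: "inv\<^bsub>G\<^esub> \<tau> \<otimes>\<^bsub>G\<^esub> s \<otimes>\<^bsub>G\<^esub> \<tau> \<in> S" if "s \<in> S" for s
    using that unfolding S_def[of]
  proof (induction rule: generate.induct)
    case one
    then show ?case using assms(6) generate.one by simp
  next
    case (incl h)
    then show ?case using \<sigma>k by (simp add: S_def)
  next
    case (inv h)
    then have "inv\<^bsub>G\<^esub> \<tau> \<otimes>\<^bsub>G\<^esub> inv\<^bsub>G\<^esub> h \<otimes>\<^bsub>G\<^esub> \<tau> = inv\<^bsub>G\<^esub> (inv\<^bsub>G\<^esub> \<tau> \<otimes>\<^bsub>G\<^esub> \<sigma> \<otimes>\<^bsub>G\<^esub> \<tau>)"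
      using assms(5,6) by (simp add: G.inv_mult_group G.m_assoc)
    then show ?case using subgroup.m_inv_closed[OF S \<sigma>k] by (simp add: S_def)
  next
    case (eng g h)
    then have "g \<in> carrier G" "h \<in> carrier G" using Sc by (auto simp: S_def)
    then show ?case using conj_mult eng.IH by (simp add: generate.eng)
  qed
  define A where "A = {e \<in> carrier E. \<pi> e \<in> S}"
  have A: "subgroup A E"
    by (rule E.subgroupI) (auto simp: A_def subgroup.m_closed[OF S] subgroup.m_inv_closed[OF S]
      intro!: exI[of _ "\<one>\<^bsub>E\<^esub>"] subgroup.one_closed[OF S])
  have A_comm: "u \<otimes>\<^bsub>E\<^esub> v = v \<otimes>\<^bsub>E\<^esub> u" if "u \<in> A" "v \<in> A" for u v
    using abelian_preimage[of \<sigma>' u v] that \<sigma>' by (auto simp: A_def S_def)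
  have A_conj: "inv\<^bsub>E\<^esub> \<tau>' \<otimes>\<^bsub>E\<^esub> u \<otimes>\<^bsub>E\<^esub> \<tau>' \<in> A" if "u \<in> A" for u
    using that S_conj \<tau>' by (auto simp: A_def)
  have decomp: "\<exists>u\<in>A. \<exists>l::nat. e = u \<otimes>\<^bsub>E\<^esub> \<tau>' [^]\<^bsub>E\<^esub> l" if "e \<in> carrier E" for e
  proof (rule preimage_decomposition[OF fin \<sigma>'(1) \<tau>'(1) _ A _ _ A_conj that])
    show "generate G {\<pi> \<sigma>', \<pi> \<tau>'} = carrier G" using gen \<sigma>' \<tau>' by simp
    show "kernel E G \<pi> \<subseteq> A" using subgroup.one_closed[OF S] by (auto simp: A_def kernel_def)
    show "\<sigma>' \<in> A" using \<sigma>' \<sigma>S by (simp add: A_def)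
  qed
  \<comment> \<open>If \<open>A\<close> were everything, the commutative group \<open>A\<close>
    would map onto \<open>G\<close>, which is nonabelian. Properness of \<open>A\<close> gives
    \<open>n\<close> at least 1, hence the second eigenfunction over each character.\<close>
  have A_ne: "A \<noteq> carrier E"
  proof
    assume "A = carrier E"
    then have "g \<otimes>\<^bsub>G\<^esub> h = h \<otimes>\<^bsub>G\<^esub> g" if "g \<in> carrier G" "h \<in> carrier G" for g h
      using that A_comm unfolding surj[symmetric] by (auto simp flip: hom_mult)
    then have "comm_group G" by (rule G.group_comm_groupI)
    with assms(3) show False by simp
  qed
  have exponent: "g [^]\<^bsub>E\<^esub> (p ^ m) = \<one>\<^bsub>E\<^esub>" if "g \<in> carrier E" for g
    using E.group_exponent_pow[OF fin that] assms(26) by simp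
  interpret regular_field E K x \<rho>
    by (rule regular_field_intro[OF E.group_axioms fin field(1,2)])
  have "rational_over K (Fix (carrier E))"
  proof (cases "CHAR('l) = p")
    case True
    interpret unipotent_regular_field E K x \<rho> A \<tau>' p m
      by (intro unipotent_regular_field.intro regular_field_axioms unipotent_regular_field_axioms.intro)
        (use A A_comm \<tau>'(1) A_conj decomp exponent p True in \<open>auto simp: of_nat_prime_eq_0_iff[OF p]\<close>)
    show ?thesis by (rule rational_fixed_field_modular)
  next
    case False
    then obtain z where z: "z \<in> K" "primitive_root_of_unity (p ^ m) z" using field(3) by blast
    obtain n where n: "1 \<le> n" "\<tau>' [^]\<^bsub>E\<^esub> (p ^ n) \<in> A"
      "bij_betw (\<lambda>(a, l). a \<otimes>\<^bsub>E\<^esub> \<tau>' [^]\<^bsub>E\<^esub> l) (A \<times> {..<p ^ n}) (carrier E)"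
      using E.cyclic_coset_decomposition[OF fin A \<tau>'(1) card p decomp A_ne] by blast
    interpret abelian_by_cyclic E K x \<rho> A \<tau>' p n m "a + b + t" z
      by (intro abelian_by_cyclic.intro regular_field_axioms abelian_by_cyclic_axioms.intro)
        (use A A_comm \<tau>'(1) A_conj p n card exponent z False in \<open>auto simp: of_nat_prime_eq_0_iff[OF p]\<close>)
    show ?thesis by (rule rational_fixed_field_semisimple)
  qed
  moreover have "fixed_field E \<rho> = Fix (carrier E)" by (simp add: fixed_field_def Fix_def)
  ultimately show ?thesis by simp
qed

end
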